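(* Let $D \ge 2$ and $d \in \{1,\ldots,D\}$. Then: (a) for any $\lambda < \lambda^{\mathrm{face}}_d$, $$\limsup_{r\to\infty} \frac{1}{r}\log \theta_{d,r}(\lambda) < 0;$$ (b) $$\liminf_{\lambda \searrow \lambda^{\mathrm{face}}_d} \frac{\theta_{d,\infty}(\lambda)}{\lambda - \lambda^{\mathrm{face}}_d} > 0.$$
   Context: Let $X$ be a homogeneous Poisson point process on $\mathbb{R}^D$ of intensity $\lambda>0$ under $\mathbb{P}_\lambda$; $o$ denotes the origin, $B_r(o)$ the closed Euclidean ball of radius $r$. For a discrete set $\Lambda\subset\mathbb{R}^D$ (a.s. in general position), $\mathscr{S}_d(\Lambda)$ is the set of $d$-simplices $\mathrm{ConvexHull}(\{x_1,\dots,x_{d+1}\})$ with $x_1,\dots,x_{d+1}\in\Lambda$ distinct and $|x_i-x_j|\le 1$ for all $i,j$ (the $d$-simplices of the Vietoris–Rips complex with parameter 1). A face of a $d$-simplex is the convex hull of $d$ of its $d+1$ vertices. Two $d$-simplices are adjacent if they share a face. There is face percolation of $d$-simplices if $\mathscr{S}_d(X)$ contains an infinite path of adjacent $d$-simplices, and $\lambda^{\mathrm{face}}_d := \inf\{\lambda>0: \mathbb{P}_\lambda(\text{face percolation of } d\text{-simplices})>0\}$. For $r>0$, $\theta_{d,r}(\lambda)$ is the probability that there is a sequence $\sigma_1,\dots,\sigma_n$ of $d$-simplices in $\mathscr{S}_d(X\cup\{o\})$ with $o\in\sigma_1$ (as a vertex), $\sigma_n$ intersecting the complement of $B_r(o)$,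 and $\sigma_i,\sigma_{i+1}$ adjacent for every $i$; $\theta_{d,\infty}(\lambda):=\lim_{r\to\infty}\theta_{d,r}(\lambda)$. *)

theory Defs
  imports "HOL-Probability.Probability"
begin

definition is_PPP :: "'a measure \<Rightarrow> ('a \<Rightarrow> (real^'n) set) \<Rightarrow> real \<Rightarrow> bool" where
  "is_PPP M X l \<longleftrightarrow> prob_space M \<and>
     (\<forall>\<omega>\<in>space M. \<forall>B. bounded B \<longrightarrow> finite (X \<omega> \<inter> B)) \<and>
     (\<forall>B \<in> sets lborel. bounded B \<longrightarrow>
        (\<lambda>\<omega>. card (X \<omega> \<inter> B)) \<in> measurable M (count_space UNIV) \<and>
        (\<forall>k. measure M {\<omega>\<in>space M. card (X \<omega> \<inter> B) = k}
              = exp (- l * measure lborel B) * (l * measure lborel B) ^ k / fact k)) \<and>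
     (\<forall>(F :: nat \<Rightarrow> (real^'n) set) n.
        (\<forall>i<n. F i \<in> sets lborel \<and> bounded (F i)) \<and> disjoint_family_on F {..<n} \<longrightarrow>
        prob_space.indep_vars M (\<lambda>_. count_space UNIV) (\<lambda>i \<omega>. card (X \<omega> \<inter> F i)) {..<n})"

text \<open>Vertex sets of the d-simplices of the Vietoris-Rips complex with parameter 1;
  the simplex itself is the convex hull of its vertex set.\<close>
definition simplices :: "nat \<Rightarrow> (real^'n) set \<Rightarrow> (real^'n) set set" where
  "simplices d \<Lambda> = {S. S \<subseteq> \<Lambda> \<and> finite S \<and> card S = d + 1 \<and> (\<forall>x\<in>S. \<forall>y\<in>S. dist x y \<le> 1)}"

definition adjacent :: "nat \<Rightarrow> (real^'n) set \<Rightarrow> (real^'n) set \<Rightarrow> bool" where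
  "adjacent d S T \<longleftrightarrow> (\<exists>F G. F \<subseteq> S \<and> G \<subseteq> T \<and> card F = d \<and> card G = d \<and>
       convex hull F = convex hull G)"

definition face_perc :: "nat \<Rightarrow> (real^'n) set \<Rightarrow> bool" where
  "face_perc d \<Lambda> \<longleftrightarrow> (\<exists>\<sigma> :: nat \<Rightarrow> (real^'n) set.
      (\<forall>i. \<sigma> i \<in> simplices d \<Lambda>) \<and> inj (\<lambda>i. convex hull (\<sigma> i)) \<and>
      (\<forall>i. adjacent d (\<sigma> i) (\<sigma> (Suc i))))"

definition reach :: "nat \<Rightarrow> real \<Rightarrow> (real^'n) set \<Rightarrow> bool" where
  "reach d r \<Lambda> \<longleftrightarrow> (\<exists>(\<sigma> :: nat \<Rightarrow> (real^'n) set) n.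
      (\<forall>i\<le>n. \<sigma> i \<in> simplices d (insert 0 \<Lambda>)) \<and> 0 \<in> \<sigma> 0 \<and>
      (\<forall>i<n. adjacent d (\<sigma> i) (\<sigma> (Suc i))) \<and>
      (convex hull (\<sigma> n)) - cball 0 r \<noteq> {})"

definition theta :: "'a measure \<Rightarrow> ('a \<Rightarrow> (real^'n) set) \<Rightarrow> nat \<Rightarrow> real \<Rightarrow> real" where
  "theta M X d r = measure M {\<omega>\<in>space M. reach d r (X \<omega>)}"

definition theta_inf :: "(real \<Rightarrow> 'a measure) \<Rightarrow> (real \<Rightarrow> 'a \<Rightarrow> (real^'n) set) \<Rightarrow> nat \<Rightarrow> real \<Rightarrow> real" where
  "theta_inf M X d l = Lim at_top (\<lambda>r. theta (M l) (X l) d r)"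

definition lambda_face :: "(real \<Rightarrow> 'a measure) \<Rightarrow> (real \<Rightarrow> 'a \<Rightarrow> (real^'n) set) \<Rightarrow> nat \<Rightarrow> real" where
  "lambda_face M X d = Inf {l. l > 0 \<and> measure (M l) {\<omega>\<in>space (M l). face_perc d (X l \<omega>)} > 0}"

end

theory Submission
  imports Defs "HOL-Real_Asymp.Real_Asymp"
begin

text \<open>Tile space by cubes of side \<open>s\<close> and keep only the counts of the Poisson process, cut off at \<open>d + 1\<close>. On
  these finitely-valued independent counts, declare points close if their cells are within
  distance \<open>\<rho>\<close>, where \<open>s\<close> is either \<open>1 / (\<rho> - \<surd>D)\<close> or \<open>1 / (\<rho> + \<surd>D)\<close>: the first choice contains the
  Vietoris-Rips complex, the second is contained in it, and the two agree as \<open>\<rho> \<rightarrow> \<infinity>\<close>.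

  On the lattice let \<open>\<theta>\<^sub>n\<close> be the probability that a chain of simplices leads from a ball of radius \<open>2 \<rho>\<close>
  to distance \<open>n \<rho>\<close>. Exploring the chains that start at a sphere of random radius reveals a given cell
  with probability of order \<open>(\<theta>\<^sub>0 + \<dots> + \<theta>\<^sub>n\<^sub>-\<^sub>1) / n\<close>, so the inequality of O'Donnell, Saks, Schramm and Servedio
  and the Margulis-Russo formula yield \<open>\<theta>\<^sub>n' \<ge> c n \<theta>\<^sub>n / (\<theta>\<^sub>0 + \<dots> + \<theta>\<^sub>n\<^sub>-\<^sub>1)\<close>. As observed by Duminil-Copin,
  Raoufi and Tassion, this forces a threshold below which \<open>\<theta>\<^sub>n\<close> decays exponentially and above which it is
  bounded below linearly. The constant \<open>c\<close> depends on \<open>\<rho>\<close> only through the intensity per unit volume, so both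
  statements survive the limit \<open>\<rho> \<rightarrow> \<infinity>\<close> and identify the thresholds with the critical intensity.
  In the supercritical regime the origin is joined to the infinite cluster by filling all small cells
  near the origin, at the price of a constant factor by the Harris inequality. Percolation at some finite
  intensity is shown by renormalisation in a plane of such cells.\<close>

subsection \<open>Chains of simplices\<close>

text \<open>Intensities are compared only through the product law of the cell counts
  (\<open>PPP_law\<close>). With x = \<mu> \<rho>^D as parameter of the lattice model, where \<mu>
  is the mean count per cell, the threshold \<beta> of each \<rho> is caught between two facts: a
  percolating l satisfies \<beta> \<le> l (\<rho> / (\<rho> - \<surd>D))^D, and l percolates if l
  (\<rho> / (\<rho> + \<surd>D))^D lies above \<beta> within the range considered.

  Two features of the definitions cost most of the remaining effort. An infinite path must consist
  of simplices with distinct convex hulls, so general position has to be derived although the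
  hypotheses speak of counts only. And percolation and \<open>reach\<close> must be shown to be
  events, again from counts in bounded Borel sets; for this, points are indexed by the cells that
  isolate them, and infinite paths are replaced by finite ones of every length.\<close>

definition csimp :: "nat \<Rightarrow> ('v \<Rightarrow> 'v \<Rightarrow> bool) \<Rightarrow> 'v set \<Rightarrow> 'v set set" where
  "csimp d N L = {S. S \<subseteq> L \<and> finite S \<and> card S = d + 1 \<and> (\<forall>x\<in>S. \<forall>y\<in>S. N x y)}"

text \<open>Adjacency through \<open>d\<close> common vertices instead of equal hulls of faces makes
  sense for any vertex type: points of space (\<open>N\<close> is \<open>close\<close>) and labelled
  cells (\<open>near\<close>). In space both notions generate the same connections
  (\<open>adjacent_conn\<close>, \<open>cadj_adjacent\<close>).\<close>

definition cadj :: "nat \<Rightarrow> ('v \<Rightarrow> 'v \<Rightarrow> bool) \<Rightarrow> 'v set \<Rightarrow> 'v set \<Rightarrow> 'v set \<Rightarrow> bool" where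
  "cadj d N L S T \<longleftrightarrow> S \<in> csimp d N L \<and> T \<in> csimp d N L \<and> d \<le> card (S \<inter> T)"

abbreviation conn :: "nat \<Rightarrow> ('v \<Rightarrow> 'v \<Rightarrow> bool) \<Rightarrow> 'v set \<Rightarrow> 'v set \<Rightarrow> 'v set \<Rightarrow> bool" where
  "conn d N L \<equiv> (cadj d N L)\<^sup>*\<^sup>*"

text \<open>\<open>conn\<close> is reflexive on arbitrary sets, so both ends are required to be
  simplices.\<close>

definition clink :: "nat \<Rightarrow> ('v \<Rightarrow> 'v \<Rightarrow> bool) \<Rightarrow> 'v set \<Rightarrow> 'v set \<Rightarrow> 'v set \<Rightarrow> bool" where
  "clink d N L A B \<longleftrightarrow> (\<exists>S T. S \<in> csimp d N L \<and> T \<in> csimp d N L \<and> S \<inter> A \<noteq> {} \<and> T \<inter> B \<noteq> {} \<and> conn d N L S T)"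

lemma csimp_mono: "L \<subseteq> L' \<Longrightarrow> S \<in> csimp d N L \<Longrightarrow> S \<in> csimp d N L'"
  unfolding csimp_def by auto

lemma csimp_restrict: "S \<in> csimp d N L \<Longrightarrow> S \<subseteq> L' \<Longrightarrow> S \<in> csimp d N L'"
  unfolding csimp_def by auto

lemma csimpD:
  assumes "S \<in> csimp d N L"
  shows "S \<subseteq> L" "finite S" "card S = d + 1" "\<And>x y. x \<in> S \<Longrightarrow> y \<in> S \<Longrightarrow> N x y" "S \<noteq> {}"
  using assms unfolding csimp_def by auto

lemma conn_mono: "L \<subseteq> L' \<Longrightarrow> conn d N L S T \<Longrightarrow> conn d N L' S T"
  by (erule rtranclp_mono[THEN predicate2D, rotated]) (auto simp: cadj_def dest: csimp_mono)

lemma clink_mono: "L \<subseteq> L' \<Longrightarrow> A \<subseteq> A' \<Longrightarrow> B \<subseteq> B' \<Longrightarrow> clink d N L A B \<Longrightarrow> clink d N L' A' B'"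
  unfolding clink_def using conn_mono[of L L'] csimp_mono[of L L']
  by (metis Int_mono order_refl subset_empty)

lemma cadj_sym: "cadj d N L S T \<Longrightarrow> cadj d N L T S"
  unfolding cadj_def by (auto simp: Int_commute)

lemma conn_sym: "conn d N L S T \<Longrightarrow> conn d N L T S"
  by (rule sympD[OF symp_rtranclp]) (auto intro: sympI cadj_sym)

lemma conn_csimp: "conn d N L S T \<Longrightarrow> S \<in> csimp d N L \<Longrightarrow> T \<in> csimp d N L"
  by (induction rule: rtranclp_induct) (auto simp: cadj_def)

lemma cadj_common:
  assumes "cadj d N L S T" "1 \<le> d"
  obtains w where "w \<in> S" "w \<in> T"
proof -
  have "S \<inter> T \<noteq> {}" using assms unfolding cadj_def by (metis card.empty not_one_le_zero order_trans)
  then show ?thesis using that by auto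
qed

lemma csimp_image:
  assumes "inj_on f L" "f ` L \<subseteq> L'" "\<And>x y. x \<in> L \<Longrightarrow> y \<in> L \<Longrightarrow> N x y \<Longrightarrow> N' (f x) (f y)" "S \<in> csimp d N L"
  shows "f ` S \<in> csimp d N' L'"
proof -
  note S = csimpD[OF assms(4)]
  have "card (f ` S) = card S" using S assms(1) by (intro card_image) (auto intro: inj_on_subset)
  then show ?thesis using S assms(2,3) unfolding csimp_def by (auto simp: subset_iff)
qed

lemma conn_image:
  assumes f: "inj_on f L" "f ` L \<subseteq> L'" "\<And>x y. x \<in> L \<Longrightarrow> y \<in> L \<Longrightarrow> N x y \<Longrightarrow> N' (f x) (f y)"
    and "conn d N L S T"
  shows "conn d N' L' (f ` S) (f ` T)"
  using assms(4)
proof (induction rule: rtranclp_induct)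
  case (step U T)
  have UT: "U \<in> csimp d N L" "T \<in> csimp d N L" "d \<le> card (U \<inter> T)" using step.hyps(2) by (auto simp: cadj_def)
  have "f ` U \<inter> f ` T = f ` (U \<inter> T)"
    using inj_on_image_Int[OF f(1)] csimpD(1)[OF UT(1)] csimpD(1)[OF UT(2)] by metis
  moreover have "card (f ` (U \<inter> T)) = card (U \<inter> T)"
    using csimpD(1)[OF UT(1)] f(1) by (intro card_image) (auto intro: inj_on_subset)
  ultimately have "cadj d N' L' (f ` U) (f ` T)"
    unfolding cadj_def using UT(3) csimp_image[of f L L' N N', OF f UT(1)] csimp_image[of f L L' N N', OF f UT(2)] by simp
  then show ?case using step.IH by auto
qed auto

lemma clink_image:
  assumes f: "inj_on f L" "f ` L \<subseteq> L'" "\<And>x y. x \<in> L \<Longrightarrow> y \<in> L \<Longrightarrow> N x y \<Longrightarrow> N' (f x) (f y)"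
    and "f ` (L \<inter> A) \<subseteq> A'" "f ` (L \<inter> B) \<subseteq> B'" "clink d N L A B"
  shows "clink d N' L' A' B'"
proof -
  obtain S T where ST: "S \<in> csimp d N L" "T \<in> csimp d N L" "S \<inter> A \<noteq> {}" "T \<inter> B \<noteq> {}" "conn d N L S T"
    using assms(6) unfolding clink_def by auto
  have "f ` S \<inter> A' \<noteq> {}" "f ` T \<inter> B' \<noteq> {}"
    using ST(3,4) assms(4,5) csimpD(1)[OF ST(1)] csimpD(1)[OF ST(2)] by blast+
  then show ?thesis unfolding clink_def
    using csimp_image[of f L L' N N', OF f ST(1)] csimp_image[of f L L' N N', OF f ST(2)]
      conn_image[of f L L' N N', OF f ST(5)] by blast
qed

text \<open>Within a clique one exchanges the vertices of a simplex one at a time.\<close>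
lemma conn_in_clique:
  assumes "U \<subseteq> L" "\<And>x y. x \<in> U \<Longrightarrow> y \<in> U \<Longrightarrow> N x y"
    and "S \<subseteq> U" "finite S" "card S = d + 1" "T \<subseteq> U" "finite T" "card T = d + 1"
  shows "conn d N L S T"
  using assms(3-8)
proof (induction "card (S - T)" arbitrary: S)
  case 0
  then have "S \<subseteq> T" by auto
  then have "S = T" using 0 by (metis card_subset_eq)
  then show ?case by auto
next
  case (Suc k)
  then obtain y where y: "y \<in> S" "y \<notin> T" by (metis Diff_iff card_gt_0_iff equals0I zero_less_Suc)
  have "\<not> T \<subseteq> S" using Suc.prems y by (metis card_subset_eq)
  then obtain x where x: "x \<in> T" "x \<notin> S" by auto
  define S' where "S' = insert x (S - {y})"
  have S': "S' \<subseteq> U" "finite S'" "card S' = d + 1" using Suc.prems x y unfolding S'_def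
    by (auto simp: card_insert_if)
  have "S' - T = (S - T) - {y}" unfolding S'_def using x y by auto
  then have "card (S' - T) = k" using Suc.hyps(2) y Suc.prems by (auto)
  then have IH: "conn d N L S' T" using Suc.hyps(1)[of S'] S' Suc.prems by auto
  have "S \<inter> S' = S - {y}" unfolding S'_def using x by auto
  then have "d \<le> card (S \<inter> S')" using y Suc.prems by auto
  then have "cadj d N L S S'" unfolding cadj_def csimp_def using S' Suc.prems assms(1,2)
    by (auto simp: subset_iff)
  then show ?case using IH by auto
qed

text \<open>Follow the chain to its first simplex that meets level \<open>t\<close>. Every earlier
  simplex lies below \<open>t\<close>, and the next one shares a vertex with it, so no vertex is
  higher than \<open>t + \<rho>\<close>. This is why crossing events depend on finitely many
  cells.\<close>

lemma conn_upto_level: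
  assumes h: "\<And>x y. N x y \<Longrightarrow> h y \<le> h x + \<rho>" and d: "1 \<le> d"
    and "conn d N L S T" "T \<inter> {x. t \<le> h x} \<noteq> {}" "\<forall>x\<in>S. h x \<le> t + \<rho>" "S \<in> csimp d N L"
  shows "\<exists>T'. T' \<inter> {x. t \<le> h x} \<noteq> {} \<and> conn d N (L \<inter> {x. h x \<le> t + (\<rho>::real)}) S T'"
  using assms(3,5,6)
proof (induction rule: converse_rtranclp_induct)
  case base
  then show ?case using assms(4) by auto
next
  case (step S S')
  show ?case
  proof (cases "S \<inter> {x. t \<le> h x} = {}")
    case False
    then show ?thesis by auto
  next
    case True
    obtain w where w: "w \<in> S" "w \<in> S'" using cadj_common[OF step.hyps(1) d] .
    have S': "S' \<in> csimp d N L" using step.hyps(1) by (auto simp: cadj_def)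
    have le: "\<forall>x\<in>S'. h x \<le> t + \<rho>"
    proof
      fix x assume "x \<in> S'"
      then have "h x \<le> h w + \<rho>" using h csimpD(4)[OF S'] w by blast
      then show "h x \<le> t + \<rho>" using True w by force
    qed
    then obtain T' where T': "T' \<inter> {x. t \<le> h x} \<noteq> {}" "conn d N (L \<inter> {x. h x \<le> t + \<rho>}) S' T'"
      using step.IH S' by auto
    have "cadj d N (L \<inter> {x. h x \<le> t + \<rho>}) S S'"
    proof -
      have "S \<in> csimp d N (L \<inter> {x. h x \<le> t + \<rho>})"
        using csimpD(1)[OF step.prems(2)] step.prems(1) by (intro csimp_restrict[OF step.prems(2)]) auto
      moreover have "S' \<in> csimp d N (L \<inter> {x. h x \<le> t + \<rho>})"
        using csimpD(1)[OF S'] le by (intro csimp_restrict[OF S']) auto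
      ultimately show ?thesis using step.hyps(1) unfolding cadj_def by simp
    qed
    then show ?thesis using T' converse_rtranclp_into_rtranclp[of _ S S' T'] by blast
  qed
qed

lemma clink_upto_level:
  assumes h: "\<And>x y. N x y \<Longrightarrow> h y \<le> h x + (\<rho>::real)" and d: "1 \<le> d"
    and A: "A \<subseteq> {x. h x \<le> t}"
    and "clink d N L A {x. t \<le> h x}"
  shows "clink d N (L \<inter> {x. h x \<le> t + \<rho>}) A {x. t \<le> h x}"
proof -
  obtain S T where ST: "S \<in> csimp d N L" "T \<in> csimp d N L" "S \<inter> A \<noteq> {}" "T \<inter> {x. t \<le> h x} \<noteq> {}" "conn d N L S T"
    using assms(4) unfolding clink_def by auto
  obtain a where a: "a \<in> S" "a \<in> A" using ST by auto
  have le: "\<forall>x\<in>S. h x \<le> t + \<rho>"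
  proof
    fix x assume "x \<in> S"
    then have "h x \<le> h a + \<rho>" using h csimpD(4)[OF ST(1)] a by blast
    then show "h x \<le> t + \<rho>" using A a by force
  qed
  obtain T' where T': "T' \<inter> {x. t \<le> h x} \<noteq> {}" "conn d N (L \<inter> {x. h x \<le> t + \<rho>}) S T'"
    using conn_upto_level[OF h d ST(5,4) le ST(1)] by auto
  have S: "S \<in> csimp d N (L \<inter> {x. h x \<le> t + \<rho>})" using le csimpD(1)[OF ST(1)] by (auto intro: csimp_restrict[OF ST(1)])
  show ?thesis unfolding clink_def using S T' conn_csimp[OF T'(2) S] ST(3) by blast
qed

text \<open>A discrete intermediate value theorem: heights vary by at most \<open>\<rho>\<close>
  within a simplex, so a chain from below \<open>t\<close> to above \<open>t\<close> has a vertex in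
  the layer of thickness \<open>\<rho>\<close> above \<open>t\<close>. Explorations can therefore
  start from such a layer.\<close>

lemma conn_crosses_level:
  assumes h: "\<And>x y. N x y \<Longrightarrow> h y \<le> h x + (\<rho>::real)" and d: "1 \<le> d"
    and "conn d N L S T" "T \<inter> {x. t \<le> h x} \<noteq> {}" "\<exists>x\<in>S. h x \<le> t" "S \<in> csimp d N L"
  shows "\<exists>U. U \<inter> {x. t \<le> h x \<and> h x \<le> t + \<rho>} \<noteq> {} \<and> conn d N L S U \<and> conn d N L U T"
  using assms(3,5,6)
proof (induction rule: converse_rtranclp_induct)
  case base
  then obtain x y where "x \<in> T" "h x \<le> t" "y \<in> T" "t \<le> h y" using assms(4) by auto
  moreover then have "h y \<le> t + \<rho>" using h[of x y] csimpD(4)[OF base(2), of x y] by auto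
  ultimately show ?case by auto
next
  case (step S S')
  show ?case
  proof (cases "S \<inter> {x. t \<le> h x} = {}")
    case False
    then obtain x y where "x \<in> S" "h x \<le> t" "y \<in> S" "t \<le> h y" using step.prems by auto
    moreover then have "h y \<le> t + \<rho>" using h[of x y] csimpD(4)[OF step.prems(2), of x y] by auto
    ultimately show ?thesis using step.hyps by (intro exI[of _ S]) auto
  next
    case True
    obtain w where w: "w \<in> S" "w \<in> S'" using cadj_common[OF step.hyps(1) d] .
    then have "\<exists>x\<in>S'. h x \<le> t" using True by force
    moreover have "S' \<in> csimp d N L" using step.hyps(1) by (simp add: cadj_def)
    ultimately obtain U where "U \<inter> {x. t \<le> h x \<and> h x \<le> t + \<rho>} \<noteq> {} \<and> conn d N L S' U \<and> conn d N L U T"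
      using step.IH by blast
    then show ?thesis using step.hyps(1) converse_rtranclp_into_rtranclp[of "cadj d N L" S S' U] by blast
  qed
qed

subsection \<open>Finite product measures\<close>

definition cfg :: "nat \<Rightarrow> 'v set \<Rightarrow> ('v \<Rightarrow> nat) set" where
  "cfg K V = {c. (\<forall>v\<in>V. c v \<le> K) \<and> (\<forall>v. v \<notin> V \<longrightarrow> c v = 0)}"

text \<open>Expectation of \<open>g\<close> when the coordinates in \<open>V\<close> are independent
  with law \<open>w\<close> on \<open>{..K}\<close> and all others are frozen at 0. Windows of all
  sizes thus share one type of configurations, and 0 is the least value, meaning an empty
  cell.\<close>

definition pexp :: "(nat \<Rightarrow> real) \<Rightarrow> nat \<Rightarrow> 'v set \<Rightarrow> (('v \<Rightarrow> nat) \<Rightarrow> real) \<Rightarrow> real" where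
  "pexp w K V g = (\<Sum>c\<in>cfg K V. (\<Prod>v\<in>V. w (c v)) * g c)"

lemma cfg_empty: "cfg K {} = {\<lambda>_. 0}"
  unfolding cfg_def by auto

lemma cfg_insert:
  assumes "v \<notin> V"
  shows "bij_betw (\<lambda>(k, c). c(v := k)) ({..K} \<times> cfg K V) (cfg K (insert v V))"
proof (rule bij_betwI[where g = "\<lambda>c. (c v, c(v := 0))"])
  show "(\<lambda>(k, c). c(v := k)) \<in> {..K} \<times> cfg K V \<rightarrow> cfg K (insert v V)"
    unfolding cfg_def by auto
  show "(\<lambda>c. (c v, c(v := 0))) \<in> cfg K (insert v V) \<rightarrow> {..K} \<times> cfg K V"
    using assms unfolding cfg_def by auto
qed (use assms in \<open>auto simp: cfg_def fun_eq_iff\<close>)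

lemma finite_cfg: "finite V \<Longrightarrow> finite (cfg K V)"
proof (induction rule: finite_induct)
  case (insert v V)
  then show ?case using bij_betw_finite[OF cfg_insert[of v V K]] by auto
qed (auto simp: cfg_empty)

lemma pexp_empty: "pexp w K {} g = g (\<lambda>_. 0)"
  unfolding pexp_def cfg_empty by simp

lemma pexp_insert:
  assumes "finite V" "v \<notin> V"
  shows "pexp w K (insert v V) g = (\<Sum>k\<le>K. w k * pexp w K V (\<lambda>c. g (c(v := k))))"
proof -
  have "pexp w K (insert v V) g = (\<Sum>(k,c)\<in>{..K} \<times> cfg K V. (\<Prod>u\<in>insert v V. w ((c(v := k)) u)) * g (c(v := k)))"
    unfolding pexp_def
    by (subst sum.reindex_bij_betw[OF cfg_insert[OF assms(2)], symmetric]) (auto simp: case_prod_unfold)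
  also have "\<dots> = (\<Sum>(k,c)\<in>{..K} \<times> cfg K V. w k * ((\<Prod>u\<in>V. w (c u)) * g (c(v := k))))"
    using assms by (intro sum.cong) (auto intro!: prod.cong)
  also have "\<dots> = (\<Sum>k\<le>K. w k * pexp w K V (\<lambda>c. g (c(v := k))))"
    unfolding pexp_def by (simp add: sum.cartesian_product[symmetric] sum_distrib_left)
  finally show ?thesis .
qed

lemma pexp_add: "pexp w K V (\<lambda>c. f c + g c) = pexp w K V f + pexp w K V g"
  unfolding pexp_def by (simp add: ring_distribs sum.distrib)

lemma pexp_diff: "pexp w K V (\<lambda>c. f c - g c) = pexp w K V f - pexp w K V g"
  unfolding pexp_def by (simp add: ring_distribs sum_subtractf)

lemma pexp_cmult: "pexp w K V (\<lambda>c. a * f c) = a * pexp w K V f"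
  unfolding pexp_def by (simp add: sum_distrib_left mult_ac)

lemma pexp_sum: "pexp w K V (\<lambda>c. \<Sum>i\<in>I. f i c) = (\<Sum>i\<in>I. pexp w K V (f i))"
  unfolding pexp_def by (subst sum.swap) (simp add: sum_distrib_left)

lemma pexp_cong: "(\<And>c. c \<in> cfg K V \<Longrightarrow> f c = g c) \<Longrightarrow> pexp w K V f = pexp w K V g"
  unfolding pexp_def by (intro sum.cong) auto

locale weights =
  fixes w :: "nat \<Rightarrow> real" and K :: nat
  assumes w_nonneg: "\<And>k. 0 \<le> w k" and w_sum: "(\<Sum>k\<le>K. w k) = 1"
begin

abbreviation E where "E \<equiv> pexp w K"

text \<open>Conditional expectation of \<open>g\<close> given all coordinates other than
  \<open>v\<close>.\<close>

definition avg :: "'v \<Rightarrow> (('v \<Rightarrow> nat) \<Rightarrow> real) \<Rightarrow> ('v \<Rightarrow> nat) \<Rightarrow> real" where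
  "avg v g c = (\<Sum>k\<le>K. w k * g (c(v := k)))"

lemma E_mono: "(\<And>c. c \<in> cfg K V \<Longrightarrow> f c \<le> g c) \<Longrightarrow> E V f \<le> E V g"
  unfolding pexp_def by (intro sum_mono mult_left_mono prod_nonneg) (auto simp: w_nonneg)

lemma E_const:
  assumes "finite V"
  shows "E V (\<lambda>_. a) = a"
  using assms
proof (induction rule: finite_induct)
  case (insert v V)
  then show ?case by (simp add: pexp_insert sum_distrib_right[symmetric] w_sum)
qed (auto simp: pexp_empty)

lemma E_nonneg: "(\<And>c. c \<in> cfg K V \<Longrightarrow> 0 \<le> g c) \<Longrightarrow> 0 \<le> E V g"
  unfolding pexp_def by (intro sum_nonneg mult_nonneg_nonneg prod_nonneg) (auto simp: w_nonneg)

lemma E_le_1: "finite V \<Longrightarrow> (\<And>c. c \<in> cfg K V \<Longrightarrow> g c \<le> 1) \<Longrightarrow> E V g \<le> 1"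
  using E_mono[of V g "\<lambda>_. 1"] E_const[of V 1] by simp

lemma E_insert_indep:
  assumes "finite V" "v \<notin> V" "\<And>c k. g (c(v := k)) = g c"
  shows "E (insert v V) g = E V g"
  using assms by (simp add: pexp_insert sum_distrib_right[symmetric] w_sum)

lemma E_superset:
  assumes "finite V'" "V \<subseteq> V'" "\<And>c v k. v \<in> V' - V \<Longrightarrow> g (c(v := k)) = g c"
  shows "E V' g = E V g"
proof -
  have "finite U \<Longrightarrow> U \<subseteq> V' - V \<Longrightarrow> E (V \<union> U) g = E V g" for U
  proof (induction rule: finite_induct)
    case (insert u U)
    have "finite (V \<union> U)" using insert assms finite_subset by auto
    then have "E (insert u (V \<union> U)) g = E (V \<union> U) g"
      using insert assms by (intro E_insert_indep) auto
    then show ?case using insert by simp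
  qed auto
  from this[of "V' - V"] show ?thesis using assms by (auto simp: Un_absorb1)
qed

text \<open>Outside \<open>V\<close> the left side uses 0, the least value; drawing those
  coordinates at random can only raise a monotone function.\<close>

lemma E_superset_mono:
  assumes "finite V'" "V \<subseteq> V'" "mono g"
  shows "E V g \<le> E V' g"
proof -
  have "finite U \<Longrightarrow> U \<subseteq> V' - V \<Longrightarrow> E V g \<le> E (V \<union> U) g" for U
  proof (induction rule: finite_induct)
    case (insert u U)
    have f: "finite (V \<union> U)" using insert assms finite_subset by auto
    have "E V g \<le> E (V \<union> U) g" using insert by auto
    also have "\<dots> = (\<Sum>k\<le>K. w k * E (V \<union> U) g)" by (simp add: sum_distrib_right[symmetric] w_sum)
    also have "\<dots> \<le> (\<Sum>k\<le>K. w k * E (V \<union> U) (\<lambda>c. g (c(u := k))))"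
      using insert by (intro sum_mono mult_left_mono E_mono monoD[OF assms(3)])
        (auto simp: le_fun_def cfg_def w_nonneg)
    also have "\<dots> = E (insert u (V \<union> U)) g" using insert f by (subst pexp_insert) auto
    finally show ?case by simp
  qed auto
  from this[of "V' - V"] show ?thesis using assms by (auto simp: Un_absorb1)
qed

lemma E_translate:
  fixes a :: "'v::ab_group_add"
  assumes "finite V"
  shows "E ((\<lambda>x. x + a) ` V) g = E V (\<lambda>c. g (\<lambda>x. c (x - a)))"
  using assms
proof (induction arbitrary: g rule: finite_induct)
  case (insert v V)
  have *: "(\<lambda>x. (c(v := k)) (x - a)) = (\<lambda>x. c (x - a))(v + a := k)" for c :: "'v \<Rightarrow> nat" and k
    by (auto simp: fun_eq_iff algebra_simps)
  have "v + a \<notin> (\<lambda>x. x + a) ` V" using insert by auto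
  then show ?case using insert by (simp add: pexp_insert * del: fun_upd_apply)
qed (auto simp: pexp_empty)

lemma E_avg:
  assumes "finite V" "v \<in> V"
  shows "E V g = E V (avg v g)"
proof -
  define U where "U = V - {v}"
  have V: "V = insert v U" "finite U" "v \<notin> U" using assms unfolding U_def by auto
  have "avg v g (c(v := k)) = avg v g c" for c k by (simp add: avg_def)
  then have "E V (avg v g) = (\<Sum>k\<le>K. w k * E U (avg v g))"
    unfolding V(1) by (simp add: pexp_insert V)
  also have "\<dots> = E U (avg v g)" by (simp add: sum_distrib_right[symmetric] w_sum)
  also have "\<dots> = (\<Sum>k\<le>K. w k * E U (\<lambda>c. g (c(v := k))))"
    unfolding avg_def by (simp add: pexp_sum pexp_cmult)
  also have "\<dots> = E V g" unfolding V(1) by (simp add: pexp_insert V)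
  finally show ?thesis by simp
qed

lemma cfg_irrelevant:
  assumes "finite W" "\<And>c v k. v \<in> W \<Longrightarrow> f (c(v := k)) = f c" "c \<in> cfg K W"
  shows "f c = f (\<lambda>_. 0)"
  using assms
proof (induction W arbitrary: c rule: finite_induct)
  case empty
  then show ?case by (simp add: cfg_empty)
next
  case (insert x W)
  have "c(x := 0) \<in> cfg K W" using insert.prems(2) insert.hyps by (simp add: cfg_def)
  then have "f (c(x := 0)) = f (\<lambda>_. 0)" by (rule insert.IH[rotated]) (rule insert.prems(1), simp)
  moreover have "f (c(x := 0)) = f c" by (rule insert.prems(1)) simp
  ultimately show ?case by (rule trans[OF sym, rotated])
qed

lemma E_Times_aux:
  assumes "finite U" "finite V'" "U \<inter> V' = {}"
    and "\<And>c v k. v \<in> V' \<Longrightarrow> f (c(v := k)) = f c" "\<And>c v k. v \<in> U \<Longrightarrow> g (c(v := k)) = g c"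
  shows "E (U \<union> V') (\<lambda>c. f c * g c) = E U f * E V' g"
  using assms
proof (induction U arbitrary: f rule: finite_induct)
  case empty
  have "E V' (\<lambda>c. f c * g c) = E V' (\<lambda>c. f (\<lambda>_. 0) * g c)"
    using cfg_irrelevant[of V' f] empty by (intro pexp_cong) simp
  then show ?case by (simp add: pexp_cmult pexp_empty)
next
  case (insert u U)
  have nu: "u \<notin> U \<union> V'" "finite (U \<union> V')" using insert by auto
  have IH: "E (U \<union> V') (\<lambda>c. f (c(u := k)) * g c) = E U (\<lambda>c. f (c(u := k))) * E V' g" for k
  proof (rule insert.IH)
    fix c v j assume v: "v \<in> V'"
    then have "v \<noteq> u" using insert.prems by auto
    then show "f (c(v := j, u := k)) = f (c(u := k))"
      using insert.prems(3)[OF v, of "c(u := k)" j] fun_upd_twist[of v u c j k] by (simp only: simp_thms)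
  qed (use insert.prems in auto)
  have g: "g (c(u := k)) = g c" for c k by (rule insert.prems(4)) simp
  have "E (insert u U \<union> V') (\<lambda>c. f c * g c) = (\<Sum>k\<le>K. w k * E (U \<union> V') (\<lambda>c. f (c(u := k)) * g c))"
    using pexp_insert[OF nu(2,1)] by (simp add: g)
  also have "\<dots> = (\<Sum>k\<le>K. w k * E U (\<lambda>c. f (c(u := k)))) * E V' g"
    by (simp add: IH sum_distrib_right mult.assoc)
  also have "\<dots> = E (insert u U) f * E V' g"
    using insert.hyps by (simp add: pexp_insert)
  finally show ?case .
qed

lemma E_Times:
  assumes "finite V" "finite V'" "V \<inter> V' = {}"
    and f: "\<And>c v k. v \<in> V' \<Longrightarrow> f (c(v := k)) = f c" and g: "\<And>c v k. v \<in> V \<Longrightarrow> g (c(v := k)) = g c"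
  shows "E (V \<union> V') (\<lambda>c. f c * g c) = E (V \<union> V') f * E (V \<union> V') g"
proof -
  have "E (V \<union> V') f = E V f" by (rule E_superset) (use assms in auto)
  moreover have "E (V \<union> V') g = E V' g" by (rule E_superset) (use assms in auto)
  ultimately show ?thesis using E_Times_aux[OF assms(1-3), of f g] f g by simp
qed

text \<open>Compare two independent copies: for monotone sequences the product of the differences of
  \<open>a\<close> and of \<open>b\<close> is nonnegative, and its expectation is twice the
  difference of the two sides.\<close>

lemma chebyshev:
  assumes "\<And>j k. j \<le> k \<Longrightarrow> a j \<le> a k" "\<And>j k. j \<le> k \<Longrightarrow> b j \<le> b k"
  shows "(\<Sum>k\<le>K. w k * a k) * (\<Sum>k\<le>K. w k * b k) \<le> (\<Sum>k\<le>K. w k * (a k * b k))"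
proof -
  have "0 \<le> (\<Sum>j\<le>K. \<Sum>k\<le>K. w j * w k * ((a j - a k) * (b j - b k)))"
  proof (intro sum_nonneg mult_nonneg_nonneg[OF mult_nonneg_nonneg[OF w_nonneg w_nonneg]])
    fix j k
    show "0 \<le> (a j - a k) * (b j - b k)"
      using assms[of j k] assms[of k j] linear[of j k]
      by (metis diff_ge_0_iff_ge le_iff_diff_le_0 mult_nonneg_nonneg mult_nonpos_nonpos)
  qed
  also have "\<dots> = (\<Sum>j\<le>K. \<Sum>k\<le>K. w k * (w j * (a j * b j)) + w j * (w k * (a k * b k))
      - (w j * a j) * (w k * b k) - (w k * a k) * (w j * b j))"
    by (simp add: algebra_simps)
  also have "\<dots> = (\<Sum>j\<le>K. \<Sum>k\<le>K. w k * (w j * (a j * b j))) + (\<Sum>j\<le>K. \<Sum>k\<le>K. w j * (w k * (a k * b k)))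
      - (\<Sum>j\<le>K. \<Sum>k\<le>K. (w j * a j) * (w k * b k)) - (\<Sum>j\<le>K. \<Sum>k\<le>K. (w k * a k) * (w j * b j))"
    by (simp only: sum.distrib sum_subtractf)
  also have "(\<Sum>j\<le>K. \<Sum>k\<le>K. w k * (w j * (a j * b j))) = (\<Sum>k\<le>K. w k * (a k * b k))"
    by (simp add: sum_distrib_right[symmetric] w_sum)
  also have "(\<Sum>j\<le>K. \<Sum>k\<le>K. w j * (w k * (a k * b k))) = (\<Sum>k\<le>K. w k * (a k * b k))"
    by (simp add: sum_distrib_left[symmetric] sum_distrib_right[symmetric] w_sum)
  also have "(\<Sum>j\<le>K. \<Sum>k\<le>K. (w j * a j) * (w k * b k)) = (\<Sum>k\<le>K. w k * a k) * (\<Sum>k\<le>K. w k * b k)"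
    by (simp only: sum_product)
  also have "(\<Sum>j\<le>K. \<Sum>k\<le>K. (w k * a k) * (w j * b j)) = (\<Sum>k\<le>K. w k * a k) * (\<Sum>k\<le>K. w k * b k)"
    by (subst sum.swap) (simp only: sum_product)
  finally show ?thesis by simp
qed

text \<open>The Harris inequality, one coordinate at a time: given the value at \<open>v\<close> the
  induction hypothesis applies, and both conditional expectations increase with that value, so
  \<open>chebyshev\<close> handles the last average.\<close>

lemma harris:
  assumes "finite V" "mono f" "mono g"
  shows "E V f * E V g \<le> E V (\<lambda>c. f c * g c)"
  using assms
proof (induction arbitrary: f g rule: finite_induct)
  case (insert v V)
  have m: "mono (\<lambda>c. h (c(v := k)))" if "mono h" for h :: "('a \<Rightarrow> nat) \<Rightarrow> real" and k
    using that unfolding mono_def le_fun_def by auto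
  have mk: "E V (\<lambda>c. h (c(v := j))) \<le> E V (\<lambda>c. h (c(v := k)))" if "mono h" "j \<le> k" for h j k
    using that by (intro E_mono) (auto simp: mono_def le_fun_def)
  have "E (insert v V) f * E (insert v V) g
      \<le> (\<Sum>k\<le>K. w k * (E V (\<lambda>c. f (c(v := k))) * E V (\<lambda>c. g (c(v := k)))))"
    unfolding pexp_insert[OF insert(1,2)] using insert.prems by (intro chebyshev mk) auto
  also have "\<dots> \<le> (\<Sum>k\<le>K. w k * E V (\<lambda>c. f (c(v := k)) * g (c(v := k))))"
    using insert by (intro sum_mono mult_left_mono insert.IH m) (auto simp: w_nonneg)
  also have "\<dots> = E (insert v V) (\<lambda>c. f c * g c)"
    using insert by (simp add: pexp_insert)
  finally show ?case .
qed (auto simp: pexp_empty)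

end

subsection \<open>Decision trees\<close>

datatype 'v dt = Leaf real | Node 'v "nat \<Rightarrow> 'v dt"

primrec val :: "'v dt \<Rightarrow> ('v \<Rightarrow> nat) \<Rightarrow> real" where
  "val (Leaf a) c = a"
| "val (Node v T) c = val (T (c v)) c"

primrec qry :: "'v dt \<Rightarrow> ('v \<Rightarrow> nat) \<Rightarrow> 'v set" where
  "qry (Leaf a) c = {}"
| "qry (Node v T) c = insert v (qry (T (c v)) c)"

primrec vars :: "'v dt \<Rightarrow> 'v set" where
  "vars (Leaf a) = {}"
| "vars (Node v T) = insert v (\<Union>k. vars (T k))"

text \<open>Guarantees that each subtree below a query of \<open>v\<close> is a function of the
  other coordinates.\<close>

primrec read_once :: "'v dt \<Rightarrow> bool" where
  "read_once (Leaf a) \<longleftrightarrow> True"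
| "read_once (Node v T) \<longleftrightarrow> (\<forall>k. v \<notin> vars (T k)) \<and> (\<forall>k. read_once (T k))"

lemma val_upd: "v \<notin> vars T \<Longrightarrow> val T (c(v := k)) = val T c"
  by (induction T) auto

lemma qry_upd: "v \<notin> vars T \<Longrightarrow> qry T (c(v := k)) = qry T c"
  by (induction T) auto

lemma qry_vars: "qry T c \<subseteq> vars T"
  by (induction T) auto

context weights
begin

lemma avg_ge:
  assumes "mono g"
  shows "g (c(v := 0)) \<le> avg v g c"
proof -
  have "g (c(v := 0)) = (\<Sum>k\<le>K. w k * g (c(v := 0)))" by (simp add: sum_distrib_right[symmetric] w_sum)
  also have "\<dots> \<le> avg v g c" unfolding avg_def
    by (intro sum_mono mult_left_mono monoD[OF assms] w_nonneg) (auto simp: le_fun_def)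
  finally show ?thesis .
qed

lemma mono_avg: "mono g \<Longrightarrow> mono (avg v g)"
  unfolding mono_def avg_def
  by (intro allI impI sum_mono mult_left_mono w_nonneg) (auto simp: le_fun_def)

lemma E_avg_sum:
  assumes "finite V" "v \<in> V"
  shows "E V g = (\<Sum>k\<le>K. w k * E V (\<lambda>c. g (c(v := k))))"
  unfolding E_avg[OF assms, of g] avg_def by (simp add: pexp_sum pexp_cmult)

text \<open>Averaging over \<open>v\<close> removes the influence of \<open>v\<close> and commutes
  with setting another coordinate to 0, so no influence grows.\<close>

lemma infl_avg_le:
  assumes "finite V" "v \<in> V" "mono g"
  shows "E V (\<lambda>c. avg v g c - avg v g (c(u := 0))) \<le> E V (\<lambda>c. g c - g (c(u := 0)))"
proof (cases "u = v")
  case True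
  have "avg v g (c(v := 0)) = avg v g c" for c by (simp add: avg_def)
  then have "E V (\<lambda>c. avg v g c - avg v g (c(u := 0))) = 0"
    using True pexp_cmult[of w K V 0 "\<lambda>_. 0"] by simp
  also have "0 \<le> E V (\<lambda>c. g c - g (c(u := 0)))"
    by (intro E_nonneg) (auto intro!: monoD[OF assms(3)] simp: le_fun_def)
  finally show ?thesis .
next
  case False
  have "avg v g c - avg v g (c(u := 0)) = avg v (\<lambda>c. g c - g (c(u := 0))) c" for c
    using False by (simp add: avg_def sum_subtractf[symmetric] right_diff_distrib fun_upd_twist)
  then show ?thesis using E_avg[OF assms(1,2), of "\<lambda>c. g c - g (c(u := 0))"] by simp
qed

text \<open>The two-function form of the OSSS inequality. Keeping the second function unrestricted and
  averaging it over the coordinates already queried is what makes an induction on the tree work.\<close>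
lemma osss:
  assumes "finite V" "read_once T" "vars T \<subseteq> V" "\<And>c. 0 \<le> val T c" "\<And>c. val T c \<le> 1" "mono g"
  shows "E V (\<lambda>c. val T c * g c) \<le> E V (val T) * E V g +
    (\<Sum>v\<in>V. E V (\<lambda>c. of_bool (v \<in> qry T c)) * E V (\<lambda>c. g c - g (c(v := 0))))"
  using assms(2-6)
proof (induction T arbitrary: g)
  case (Leaf a)
  have z: "E V (\<lambda>c. 0) = 0" by (simp add: E_const assms)
  show ?case using assms(1) by (simp add: pexp_cmult E_const z)
next
  case (Node v T)
  define f where "f = val (Node v T)"
  define h where "h = avg v g"
  define I where "I u = E V (\<lambda>c. g c - g (c(u := 0)))" for u
  define Q where "Q k u = E V (\<lambda>c. of_bool (u \<in> qry (T k) c))" for k u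
  define D where "D u = E V (\<lambda>c. of_bool (u \<in> qry (Node v T) c))" for u
  have vV: "v \<in> V" using Node.prems by auto
  have vT: "v \<notin> vars (T k)" for k using Node.prems by auto
  have fk: "f (c(v := k)) = val (T k) c" for c k unfolding f_def by (simp add: val_upd[OF vT])
  have qk: "qry (Node v T) (c(v := k)) = insert v (qry (T k) c)" for c k by (simp add: qry_upd[OF vT])
  have I0: "0 \<le> I u" for u
    unfolding I_def by (intro E_nonneg) (auto intro!: monoD[OF Node.prems(5)] simp: le_fun_def)
  have hv: "h (c(v := k)) = h c" for c k unfolding h_def avg_def by simp
  have Eh: "E V h = E V g" unfolding h_def using E_avg[OF assms(1) vV] by simp
  \<comment> \<open>Passing from \<open>g\<close> to its average over the queried coordinate costs
    at most the influence of \<open>v\<close>, because the average is at least the value with an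
    empty cell at \<open>v\<close>.\<close>
  have step1: "E V (\<lambda>c. f c * (g c - h c)) \<le> I v" unfolding I_def
  proof (rule E_mono)
    fix c
    have f: "0 \<le> f c" "f c \<le> 1" using Node.prems f_def by auto
    have "f c * (g c - h c) \<le> f c * (g c - g (c(v := 0)))"
      unfolding h_def by (intro mult_left_mono diff_left_mono avg_ge Node.prems(5) f)
    also have "\<dots> \<le> 1 * (g c - g (c(v := 0)))"
    proof (rule mult_right_mono[OF f(2)])
      have "c(v := 0) \<le> c" by (simp add: le_fun_def)
      from monoD[OF Node.prems(5) this] show "0 \<le> g c - g (c(v := 0))" by (rule diff_ge_0_iff_ge[THEN iffD2])
    qed
    finally show "f c * (g c - h c) \<le> g c - g (c(v := 0))" by simp
  qed
  \<comment> \<open>The induction hypothesis is used with \<open>h\<close> in place of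
    \<open>g\<close>: \<open>h\<close> does not depend on the coordinate just read, and its
    influences are bounded by those of \<open>g\<close>.\<close>
  have IH: "E V (\<lambda>c. val (T k) c * h c) \<le> E V (val (T k)) * E V g + (\<Sum>u\<in>V. Q k u * I u)" for k
  proof -
    have b: "0 \<le> val (T k) c \<and> val (T k) c \<le> 1" for c
      using Node.prems(3,4)[of "c(v := k)"] by (simp only: val.simps fun_upd_same val_upd[OF vT] simp_thms)
    have "E V (\<lambda>c. val (T k) c * h c) \<le> E V (val (T k)) * E V h +
      (\<Sum>u\<in>V. E V (\<lambda>c. of_bool (u \<in> qry (T k) c)) * E V (\<lambda>c. h c - h (c(u := 0))))"
    proof (rule Node.IH)
      show "read_once (T k)" "vars (T k) \<subseteq> V" using Node.prems(1,2) by (simp_all add: UN_subset_iff)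
      show "mono h" unfolding h_def by (rule mono_avg[OF Node.prems(5)])
    qed (use b in auto)
    also have "\<dots> \<le> E V (val (T k)) * E V g + (\<Sum>u\<in>V. Q k u * I u)"
      unfolding Eh unfolding Q_def I_def h_def
      by (intro add_left_mono sum_mono mult_left_mono infl_avg_le assms(1) vV Node.prems E_nonneg) auto
    finally show ?thesis .
  qed
  have Dv: "D v = 1" unfolding D_def using assms(1) by (simp add: E_const)
  have D: "D u = (\<Sum>k\<le>K. w k * Q k u)" if "u \<noteq> v" for u
    unfolding D_def Q_def
    by (subst E_avg_sum[OF assms(1) vV], subst qk) (use that in simp)
  \<comment> \<open>Subtrees never query \<open>v\<close> again, so their sums leave the summand of
    \<open>v\<close>, whose query probability is 1, to pay for \<open>step1\<close>.\<close>
  have Qv: "Q k v = 0" for k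
  proof -
    have "v \<notin> qry (T k) c" for c using vT[of k] qry_vars[of "T k" c] by blast
    then show ?thesis unfolding Q_def using assms(1) by (simp add: E_const)
  qed
  have "E V (\<lambda>c. f c * g c) = E V (\<lambda>c. f c * (g c - h c)) + E V (\<lambda>c. f c * h c)"
    unfolding pexp_add[symmetric] by (simp add: algebra_simps)
  also have "E V (\<lambda>c. f c * h c) = (\<Sum>k\<le>K. w k * E V (\<lambda>c. val (T k) c * h c))"
    by (subst E_avg_sum[OF assms(1) vV]) (simp only: fk hv)
  also have "\<dots> \<le> (\<Sum>k\<le>K. w k * (E V (val (T k)) * E V g + (\<Sum>u\<in>V. Q k u * I u)))"
    by (intro sum_mono mult_left_mono IH w_nonneg)
  also have "\<dots> = (\<Sum>k\<le>K. w k * E V (val (T k))) * E V g + (\<Sum>u\<in>V. (\<Sum>k\<le>K. w k * Q k u) * I u)"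
    by (simp add: distrib_left sum.distrib sum_distrib_left sum_distrib_right mult.assoc sum.swap[of _ V])
  also have "(\<Sum>k\<le>K. w k * E V (val (T k))) = E V f"
    by (subst E_avg_sum[OF assms(1) vV, of f]) (simp only: fk)
  also have "(\<Sum>u\<in>V. (\<Sum>k\<le>K. w k * Q k u) * I u) = (\<Sum>u\<in>V - {v}. D u * I u)"
    using assms(1) vV by (subst sum.remove[of V v]) (auto simp: Qv D intro!: sum.cong)
  also have "\<dots> = (\<Sum>u\<in>V. D u * I u) - I v"
    using assms(1) vV by (subst sum.remove[of V v]) (auto simp: Dv)
  finally have "E V (\<lambda>c. f c * g c) \<le> E V f * E V g + (\<Sum>u\<in>V. D u * I u)" using step1 by linarith
  then show ?case unfolding f_def D_def I_def .
qed

end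

section \<open>Explorations as decision trees\<close>

definition res :: "'v set \<Rightarrow> ('v \<Rightarrow> nat) \<Rightarrow> 'v \<Rightarrow> nat" where
  "res B c = (\<lambda>v. if v \<in> B then c v else 0)"

lemma res_le: "res B c \<le> c" by (simp add: res_def le_fun_def)

lemma res_insert: "res (insert v B) c = (res B c)(v := c v)"
  by (auto simp: res_def)

text \<open>\<open>B\<close> is the set of cells already read and \<open>c\<close> their content,
  with 0 elsewhere. \<open>Fr c\<close> lists the cells to be read according to this knowledge, and
  the search stops once all of them are in \<open>B\<close>. The counter \<open>n\<close> makes the
  recursion primitive; the number of unread cells is large enough for it.\<close>

primrec explore :: "(('v \<Rightarrow> nat) \<Rightarrow> 'v set) \<Rightarrow> (('v \<Rightarrow> nat) \<Rightarrow> real) \<Rightarrow> nat \<Rightarrow> 'v set \<Rightarrow> ('v \<Rightarrow> nat) \<Rightarrow> 'v dt" where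
  "explore Fr g 0 B c = Leaf (g c)"
| "explore Fr g (Suc n) B c = (if Fr c \<subseteq> B then Leaf (g c)
     else Node (SOME v. v \<in> Fr c - B) (\<lambda>k. explore Fr g n (insert (SOME v. v \<in> Fr c - B) B) (c(SOME v. v \<in> Fr c - B := k))))"

lemma explore_next: "\<not> F \<subseteq> B \<Longrightarrow> (SOME v. v \<in> F - B) \<in> F - B"
  by (rule someI_ex) auto

lemma explore_vars:
  assumes "\<And>c. Fr c \<subseteq> V"
  shows "vars (explore Fr g n B c) \<subseteq> V - B \<and> read_once (explore Fr g n B c)"
proof (induction n arbitrary: B c)
  case (Suc n)
  show ?case
  proof (cases "Fr c \<subseteq> B")
    case False
    define v where "v = (SOME v. v \<in> Fr c - B)"
    have v: "v \<in> Fr c - B" unfolding v_def by (rule explore_next[OF False])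
    have e: "explore Fr g (Suc n) B c = Node v (\<lambda>k. explore Fr g n (insert v B) (c(v := k)))"
      using False by (simp add: v_def)
    show ?thesis unfolding e using v assms Suc.IH[of "insert v B"] by (simp add: subset_iff) blast
  qed auto
qed auto

lemma explore_val:
  assumes "\<And>c. P (g c)"
  shows "P (val (explore Fr g n B c) c')"
  by (induction n arbitrary: B c) (auto simp: assms)

text \<open>The knowledge gathered so far is \<open>res B c\<close>, which lies below
  \<open>c\<close>. Monotonicity of \<open>Fr\<close> hence bounds the adaptive set of queries by a
  set defined directly from the full configuration.\<close>

lemma explore_qry:
  assumes "\<And>c c'. c \<le> c' \<Longrightarrow> Fr c \<subseteq> Fr c'"
  shows "qry (explore Fr g n B (res B c)) c \<subseteq> Fr c"
proof (induction n arbitrary: B)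
  case (Suc n)
  show ?case
  proof (cases "Fr (res B c) \<subseteq> B")
    case False
    define v where "v = (SOME v. v \<in> Fr (res B c) - B)"
    have v: "v \<in> Fr (res B c) - B" unfolding v_def by (rule explore_next[OF False])
    have e: "explore Fr g (Suc n) B (res B c) = Node v (\<lambda>k. explore Fr g n (insert v B) ((res B c)(v := k)))"
      using False by (simp add: v_def)
    have "qry (explore Fr g n (insert v B) ((res B c)(v := c v))) c \<subseteq> Fr c"
      using Suc.IH[of "insert v B"] unfolding res_insert .
    moreover have "v \<in> Fr c" using v assms[OF res_le, of B c] by blast
    ultimately show ?thesis unfolding e by (simp only: qry.simps insert_subset simp_thms)
  qed auto
qed auto

text \<open>Each query adds a new cell to \<open>B\<close>, so \<open>card (V - B)\<close> steps are
  enough to reach a state in which the whole frontier has been read.\<close>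

lemma explore_result:
  assumes V: "finite V" and "\<And>c. Fr c \<subseteq> V" and "B \<subseteq> V" "n = card (V - B)"
    and "\<And>B. B \<subseteq> V \<Longrightarrow> Fr (res B c) \<subseteq> B \<Longrightarrow> g (res B c) = a"
  shows "val (explore Fr g n B (res B c)) c = a"
  using assms(3,4)
proof (induction n arbitrary: B)
  case 0
  then have "B = V" using V by auto
  then show ?case using assms(2)[of "res V c"] assms(5)[of V] by simp
next
  case (Suc n)
  show ?case
  proof (cases "Fr (res B c) \<subseteq> B")
    case True
    then have "explore Fr g (Suc n) B (res B c) = Leaf (g (res B c))" by simp
    then show ?thesis using assms(5)[OF Suc.prems(1) True] by (simp only: val.simps)
  next
    case False
    define v where "v = (SOME v. v \<in> Fr (res B c) - B)"
    have v: "v \<in> Fr (res B c) - B" unfolding v_def by (rule explore_next[OF False])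
    have e: "explore Fr g (Suc n) B (res B c) = Node v (\<lambda>k. explore Fr g n (insert v B) ((res B c)(v := k)))"
      using False by (simp add: v_def)
    have vV: "v \<in> V - B" using v assms(2) by auto
    have "V - insert v B = (V - B) - {v}" by auto
    moreover have "card ((V - B) - {v}) = n" using Suc.prems(2) vV by (simp add: card_Diff_singleton)
    ultimately have "val (explore Fr g n (insert v B) (res (insert v B) c)) c = a"
      using Suc.prems(1) vV by (intro Suc.IH) auto
    then show ?thesis unfolding e res_insert by (simp only: val.simps)
  qed
qed

context weights
begin

text \<open>By \<open>det\<close> the exploration tree computes \<open>g\<close> itself, so the
  two-function inequality becomes a bound on the variance of \<open>g\<close>.\<close>

lemma osss_explore:
  assumes "finite V" and Fr: "\<And>c. Fr c \<subseteq> V" "\<And>c c'. c \<le> c' \<Longrightarrow> Fr c \<subseteq> Fr c'"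
    and g: "mono g" "\<And>c. 0 \<le> g c" "\<And>c. g c \<le> 1"
    and det: "\<And>B c. c \<in> cfg K V \<Longrightarrow> B \<subseteq> V \<Longrightarrow> Fr (res B c) \<subseteq> B \<Longrightarrow> g (res B c) = g c"
  shows "E V (\<lambda>c. g c * g c) - E V g * E V g \<le>
    (\<Sum>v\<in>V. E V (\<lambda>c. of_bool (v \<in> Fr c)) * E V (\<lambda>c. g c - g (c(v := 0))))"
proof -
  define T where "T = explore Fr g (card V) {} (\<lambda>_. 0)"
  have r0: "(\<lambda>_. 0) = res {} c" for c :: "'b \<Rightarrow> nat" by (simp add: res_def)
  have T: "read_once T" "vars T \<subseteq> V" using explore_vars[of Fr V g "card V" "{}", OF Fr(1)] unfolding T_def by auto
  have b: "0 \<le> val T c" "val T c \<le> 1" for c unfolding T_def by (rule explore_val, rule g)+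
  have eq: "val T c = g c" if "c \<in> cfg K V" for c
    unfolding T_def r0[of c] using assms(1) Fr(1) det[OF that] by (intro explore_result) auto
  have q: "qry T c \<subseteq> Fr c" for c unfolding T_def r0[of c] by (rule explore_qry[OF Fr(2)])
  have e1: "E V (\<lambda>c. val T c * g c) = E V (\<lambda>c. g c * g c)" using eq by (intro pexp_cong) simp
  have e2: "E V (val T) = E V g" using eq by (intro pexp_cong) simp
  have "(\<Sum>v\<in>V. E V (\<lambda>c. of_bool (v \<in> qry T c)) * E V (\<lambda>c. g c - g (c(v := 0))))
      \<le> (\<Sum>v\<in>V. E V (\<lambda>c. of_bool (v \<in> Fr c)) * E V (\<lambda>c. g c - g (c(v := 0))))"
    using q by (intro sum_mono mult_right_mono E_mono E_nonneg)
      (auto simp: le_fun_def of_bool_def intro!: monoD[OF g(1)])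
  then show ?thesis using osss[OF assms(1) T b g(1)] e1 e2 by simp
qed

end

subsection \<open>Truncated Poisson weights\<close>

text \<open>The Poisson weights with all mass from \<open>K\<close> on collected at \<open>K\<close>: for \<open>d\<close>-simplices more than
  \<open>d + 1\<close> points in one cell make no difference, so that finitely many values suffice.\<close>
definition tpw :: "nat \<Rightarrow> real \<Rightarrow> nat \<Rightarrow> real" where
  "tpw K \<mu> k = (if k < K then exp (- \<mu>) * \<mu> ^ k / fact k
     else if k = K then 1 - (\<Sum>j<K. exp (- \<mu>) * \<mu> ^ j / fact j) else 0)"

lemma poisson_sum_le_1:
  assumes "0 \<le> (\<mu>::real)"
  shows "(\<Sum>j<n. exp (- \<mu>) * \<mu> ^ j / fact j) \<le> 1"
proof -
  have "(\<Sum>j<n. \<mu> ^ j / fact j) \<le> exp \<mu>"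
    using sum_le_suminf[OF summable_exp[of \<mu>], of "{..<n}"] assms
    by (simp add: exp_def divide_inverse mult_ac scaleR_conv_of_real)
  then have "exp (- \<mu>) * (\<Sum>j<n. \<mu> ^ j / fact j) \<le> exp (-\<mu>) * exp \<mu>" by (intro mult_left_mono) auto
  then show ?thesis by (simp add: sum_distrib_left exp_minus)
qed

lemma weights_tpw: "0 \<le> \<mu> \<Longrightarrow> weights (tpw K \<mu>) K"
proof
  fix k assume "0 \<le> \<mu>"
  then show "0 \<le> tpw K \<mu> k" using poisson_sum_le_1[of \<mu> K] by (simp add: tpw_def)
next
  assume "0 \<le> \<mu>"
  have "{..K} = insert K {..<K}" by auto
  then show "(\<Sum>k\<le>K. tpw K \<mu> k) = 1" by (simp add: tpw_def)
qed

lemma poisson_pmf_deriv: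
  "((\<lambda>\<mu>::real. exp (- \<mu>) * \<mu> ^ k / fact k) has_real_derivative
     ((if k = 0 then 0 else exp (- \<mu>) * \<mu> ^ (k - 1) / fact (k - 1)) - exp (- \<mu>) * \<mu> ^ k / fact k)) (at \<mu>)"
proof (cases k)
  case 0
  then show ?thesis by (auto intro!: derivative_eq_intros)
next
  case (Suc n)
  have f: "real (Suc n) / fact (Suc n) = 1 / fact n" by (subst fact_Suc) (simp del: of_nat_Suc)
  have "((\<lambda>\<mu>::real. exp (- \<mu>) * \<mu> ^ Suc n / fact (Suc n)) has_real_derivative
      (real (Suc n) / fact (Suc n)) * (exp (- \<mu>) * \<mu> ^ n) - exp (- \<mu>) * \<mu> ^ Suc n / fact (Suc n)) (at \<mu>)"
    by (rule derivative_eq_intros refl | simp add: field_simps del: fact_Suc)+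
  then show ?thesis unfolding f using Suc by simp
qed

lemma poisson_tail_deriv:
  "((\<lambda>\<mu>::real. 1 - (\<Sum>j\<le>n. exp (- \<mu>) * \<mu> ^ j / fact j)) has_real_derivative exp (- \<mu>) * \<mu> ^ n / fact n) (at \<mu>)"
proof (induction n)
  case 0
  show ?case by (auto intro!: derivative_eq_intros)
next
  case (Suc n)
  have "((\<lambda>\<mu>::real. (1 - (\<Sum>j\<le>n. exp (- \<mu>) * \<mu> ^ j / fact j)) - exp (- \<mu>) * \<mu> ^ Suc n / fact (Suc n))
      has_real_derivative exp (- \<mu>) * \<mu> ^ n / fact n -
      (exp (- \<mu>) * \<mu> ^ n / fact n - exp (- \<mu>) * \<mu> ^ Suc n / fact (Suc n))) (at \<mu>)"
    using poisson_pmf_deriv[of "Suc n" \<mu>] by (intro DERIV_diff Suc) simp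
  then show ?case by (simp add: algebra_simps)
qed

text \<open>The tail P(N > n) has derivative exp(-x) x^n / n!, and
  \<open>(1 - exp (- x)) * x ^ n / fact n\<close> grows at least as fast from the same value 0,
  hence dominates it. The factor 2 comes from exp \<mu> - 1 \<le> 2 \<mu> on the unit
  interval.\<close>

lemma poisson_tail_le:
  assumes "0 \<le> (\<mu>::real)" "\<mu> \<le> 1"
  shows "1 - (\<Sum>j\<le>n. exp (- \<mu>) * \<mu> ^ j / fact j) \<le> 2 * \<mu> * (exp (- \<mu>) * \<mu> ^ n / fact n)"
proof -
  define H where "H x = (1 - exp (- x)) * x ^ n / fact n - (1 - (\<Sum>j\<le>n. exp (- x) * x ^ j / fact j))" for x :: real
  define H' where "H' x = (exp (- x) * x ^ n + (1 - exp (- x)) * (real n * x ^ (n - 1))) / fact n - exp (- x) * x ^ n / fact n" for x :: real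
  have "(H has_real_derivative H' x) (at x)" for x
    unfolding H_def H'_def by (intro DERIV_diff poisson_tail_deriv) (auto intro!: derivative_eq_intros simp: field_simps)
  moreover have "0 \<le> H' x" if "0 \<le> x" for x
    unfolding H'_def using that by (simp add: add_divide_distrib)
  ultimately have "H 0 \<le> H \<mu>"
    using assms by (intro DERIV_nonneg_imp_nondecreasing[of 0 \<mu> H]) auto
  moreover have "H 0 = 0"
  proof -
    have "(\<Sum>j\<le>n. (0::real) ^ j / fact j) = (\<Sum>j\<in>{0}. (0::real) ^ j / fact j)"
      by (intro sum.mono_neutral_right) auto
    then show ?thesis unfolding H_def by simp
  qed
  ultimately have *: "1 - (\<Sum>j\<le>n. exp (- \<mu>) * \<mu> ^ j / fact j) \<le> (1 - exp (- \<mu>)) * \<mu> ^ n / fact n"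
    unfolding H_def by simp
  have "exp \<mu> \<le> 1 + \<mu> + \<mu>\<^sup>2" using assms by (intro exp_bound) auto
  also have "\<dots> \<le> 1 + 2 * \<mu>" using assms by (simp add: power2_eq_square mult_left_le)
  finally have "exp (- \<mu>) * (exp \<mu> - 1) \<le> exp (-\<mu>) * (2 * \<mu>)" by simp
  then have "1 - exp (- \<mu>) \<le> 2 * \<mu> * exp (- \<mu>)" by (simp add: right_diff_distrib exp_minus mult_ac)
  then have "(1 - exp (- \<mu>)) * \<mu> ^ n / fact n \<le> 2 * \<mu> * exp (- \<mu>) * \<mu> ^ n / fact n"
    using assms by (intro divide_right_mono mult_right_mono) auto
  then show ?thesis using * by (simp add: mult_ac)
qed

text \<open>Derivatives of Poisson weights are differences of neighbouring weights; summation by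
  parts moves the difference onto \<open>F\<close> and yields the mean effect of one additional
  point. The cap fits in: the mass collected at \<open>K\<close> has the weight at
  \<open>K - 1\<close> as its derivative, which closes the sum at the upper end.\<close>

lemma tpw_deriv_sum:
  assumes "\<And>k. k \<le> K \<Longrightarrow> (F k has_real_derivative F' k) (at \<mu>)" "0 < K"
  shows "((\<lambda>\<mu>. \<Sum>k\<le>K. tpw K \<mu> k * F k \<mu>) has_real_derivative
    (\<Sum>k<K. tpw K \<mu> k * (F (Suc k) \<mu> - F k \<mu>)) + (\<Sum>k\<le>K. tpw K \<mu> k * F' k)) (at \<mu>)"
proof -
  define p where "p k \<mu> = exp (- \<mu>) * \<mu> ^ k / fact k" for k and \<mu> :: real
  have K: "{..K} = insert K {..<K}" by auto
  define w' where "w' k = (if k < K then (if k = 0 then 0 else p (k - 1) \<mu>) - p k \<mu> else p (K - 1) \<mu>)" for k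
  have tK: "tpw K x K = 1 - (\<Sum>j\<le>K - 1. p j x)" for x
    using assms(2) unfolding tpw_def p_def by (cases K) (auto simp: lessThan_Suc_atMost)
  have w: "((\<lambda>\<mu>. tpw K \<mu> k) has_real_derivative w' k) (at \<mu>)" if "k \<le> K" for k
  proof (cases "k < K")
    case True
    then have "(\<lambda>\<mu>. tpw K \<mu> k) = (\<lambda>\<mu>. exp (- \<mu>) * \<mu> ^ k / fact k)" by (simp add: tpw_def)
    moreover have "w' k = (if k = 0 then 0 else exp (- \<mu>) * \<mu> ^ (k - 1) / fact (k - 1)) - exp (- \<mu>) * \<mu> ^ k / fact k"
      using True by (simp only: w'_def p_def if_True)
    ultimately show ?thesis using poisson_pmf_deriv[of k \<mu>] by (simp only:)
  next
    case False
    then have "k = K" using that by auto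
    moreover have "(\<lambda>\<mu>. tpw K \<mu> K) = (\<lambda>\<mu>. 1 - (\<Sum>j\<le>K - 1. exp (- \<mu>) * \<mu> ^ j / fact j))"
      by (rule ext) (rule tK[unfolded p_def])
    moreover have "w' K = exp (- \<mu>) * \<mu> ^ (K - 1) / fact (K - 1)"
      unfolding w'_def p_def by simp
    ultimately show ?thesis using poisson_tail_deriv[of "K - 1" \<mu>] by (simp only:)
  qed
  have "((\<lambda>\<mu>. \<Sum>k\<le>K. tpw K \<mu> k * F k \<mu>) has_real_derivative (\<Sum>k\<le>K. w' k * F k \<mu> + F' k * tpw K \<mu> k)) (at \<mu>)"
    by (intro DERIV_sum DERIV_mult w assms(1)) auto
  moreover have "(\<Sum>k\<le>K. w' k * F k \<mu>) = (\<Sum>k<K. tpw K \<mu> k * (F (Suc k) \<mu> - F k \<mu>))"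
  proof -
    have *: "(\<Sum>k<m. ((if k = 0 then 0 else p (k - 1) \<mu>) - p k \<mu>) * F k \<mu>) + (if m = 0 then 0 else p (m - 1) \<mu> * F m \<mu>)
        = (\<Sum>k<m. p k \<mu> * (F (Suc k) \<mu> - F k \<mu>))" for m
      by (induction m) (auto simp: algebra_simps)
    have "(\<Sum>k\<le>K. w' k * F k \<mu>) = (\<Sum>k<K. w' k * F k \<mu>) + w' K * F K \<mu>" unfolding K by simp
    also have "\<dots> = (\<Sum>k<K. ((if k = 0 then 0 else p (k - 1) \<mu>) - p k \<mu>) * F k \<mu>) + p (K - 1) \<mu> * F K \<mu>"
      by (simp add: w'_def)
    also have "\<dots> = (\<Sum>k<K. p k \<mu> * (F (Suc k) \<mu> - F k \<mu>))" using *[of K] assms(2) by simp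
    also have "\<dots> = (\<Sum>k<K. tpw K \<mu> k * (F (Suc k) \<mu> - F k \<mu>))" by (simp add: tpw_def p_def)
    finally show ?thesis .
  qed
  ultimately show ?thesis by (simp add: sum.distrib mult.commute)
qed

text \<open>The Margulis-Russo formula for Poisson counts: each cell contributes the mean effect of
  adding one point to it. The inner sum redraws the count at \<open>v\<close>; a count at the cap
  \<open>K\<close> contributes nothing.\<close>

lemma pexp_tpw_deriv:
  assumes "finite V" "0 < K" "0 \<le> \<mu>"
  shows "((\<lambda>\<mu>. pexp (tpw K \<mu>) K V g) has_real_derivative
    (\<Sum>v\<in>V. pexp (tpw K \<mu>) K V (\<lambda>c. \<Sum>k<K. tpw K \<mu> k * (g (c(v := Suc k)) - g (c(v := k)))))) (at \<mu>)"
  using assms(1)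
proof (induction V arbitrary: g rule: finite_induct)
  case empty
  show ?case by (simp add: pexp_empty)
next
  case (insert u V)
  interpret weights "tpw K \<mu>" K by (rule weights_tpw[OF assms(3)])
  let ?w = "tpw K \<mu>"
  define der where "der v g c = (\<Sum>k<K. ?w k * (g (c(v := Suc k)) - g (c(v := k))))" for v :: 'a and g :: "('a \<Rightarrow> nat) \<Rightarrow> real" and c
  have IH: "((\<lambda>\<mu>. pexp (tpw K \<mu>) K V (\<lambda>c. g (c(u := k)))) has_real_derivative
      (\<Sum>v\<in>V. pexp ?w K V (der v (\<lambda>c. g (c(u := k)))))) (at \<mu>)" for k
    using insert.IH[of "\<lambda>c. g (c(u := k))"] unfolding der_def .
  have eq: "pexp (tpw K \<mu>) K (insert u V) g = (\<Sum>k\<le>K. tpw K \<mu> k * pexp (tpw K \<mu>) K V (\<lambda>c. g (c(u := k))))" for \<mu>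
    by (rule pexp_insert[OF insert.hyps])
  have A: "pexp ?w K (insert u V) (der u g) = (\<Sum>k<K. ?w k * (pexp ?w K V (\<lambda>c. g (c(u := Suc k))) - pexp ?w K V (\<lambda>c. g (c(u := k)))))"
  proof -
    have "pexp ?w K (insert u V) (der u g) = pexp ?w K V (der u g)"
      using insert.hyps by (intro E_insert_indep) (auto simp: der_def)
    also have "\<dots> = (\<Sum>k<K. ?w k * (pexp ?w K V (\<lambda>c. g (c(u := Suc k))) - pexp ?w K V (\<lambda>c. g (c(u := k)))))"
      unfolding der_def by (simp only: pexp_sum pexp_cmult pexp_diff)
    finally show ?thesis .
  qed
  have B: "pexp ?w K (insert u V) (der v g) = (\<Sum>k\<le>K. ?w k * pexp ?w K V (der v (\<lambda>c. g (c(u := k)))))" if "v \<in> V" for v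
  proof -
    have "v \<noteq> u" using that insert.hyps by auto
    then have "der v g (c(u := k)) = der v (\<lambda>c. g (c(u := k))) c" for c k
      unfolding der_def by (simp only: fun_upd_twist[OF \<open>v \<noteq> u\<close>])
    then show ?thesis unfolding pexp_insert[OF insert.hyps] by simp
  qed
  have "(\<Sum>v\<in>insert u V. pexp ?w K (insert u V) (der v g)) =
     (\<Sum>k<K. ?w k * (pexp ?w K V (\<lambda>c. g (c(u := Suc k))) - pexp ?w K V (\<lambda>c. g (c(u := k)))))
     + (\<Sum>k\<le>K. ?w k * (\<Sum>v\<in>V. pexp ?w K V (der v (\<lambda>c. g (c(u := k))))))"
  proof -
    have "(\<Sum>v\<in>V. pexp ?w K (insert u V) (der v g)) = (\<Sum>v\<in>V. \<Sum>k\<le>K. ?w k * pexp ?w K V (der v (\<lambda>c. g (c(u := k)))))"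
      by (intro sum.cong refl B)
    also have "\<dots> = (\<Sum>k\<le>K. ?w k * (\<Sum>v\<in>V. pexp ?w K V (der v (\<lambda>c. g (c(u := k))))))"
      by (subst sum.swap) (simp only: sum_distrib_left)
    finally show ?thesis by (subst sum.insert[OF insert.hyps]) (simp only: A)
  qed
  moreover have "((\<lambda>\<mu>. pexp (tpw K \<mu>) K (insert u V) g) has_real_derivative
     (\<Sum>k<K. ?w k * (pexp ?w K V (\<lambda>c. g (c(u := Suc k))) - pexp ?w K V (\<lambda>c. g (c(u := k)))))
     + (\<Sum>k\<le>K. ?w k * (\<Sum>v\<in>V. pexp ?w K V (der v (\<lambda>c. g (c(u := k))))))) (at \<mu>)"
    unfolding eq by (rule tpw_deriv_sum[OF IH assms(2)])
  ultimately have "((\<lambda>\<mu>. pexp (tpw K \<mu>) K (insert u V) g) has_real_derivative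
    (\<Sum>v\<in>insert u V. pexp ?w K (insert u V) (der v g))) (at \<mu>)" by (simp only:)
  then show ?case unfolding der_def .
qed

text \<open>Write \<open>g c - g (c(v := 0))\<close> as a sum over points added one by one. The j-th
  increment carries the weight P(N > j) here and P(N = j) in the derivative, and
  \<open>poisson_tail_le\<close> compares the two. The factor \<mu> gained is what keeps the
  constants bounded as the mesh is refined.\<close>

lemma infl_le_deriv:
  assumes "finite V" "v \<in> V" "mono g" "0 \<le> \<mu>" "\<mu> \<le> 1"
  shows "pexp (tpw K \<mu>) K V (\<lambda>c. g c - g (c(v := 0)))
    \<le> 2 * \<mu> * pexp (tpw K \<mu>) K V (\<lambda>c. \<Sum>k<K. tpw K \<mu> k * (g (c(v := Suc k)) - g (c(v := k))))"
proof -
  interpret weights "tpw K \<mu>" K by (rule weights_tpw[OF assms(4)])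
  let ?w = "tpw K \<mu>"
  have tail: "(\<Sum>k\<in>{j<..K}. ?w k) \<le> 2 * \<mu> * ?w j" if "j < K" for j
  proof -
    have "{..K} = {..j} \<union> {j<..K}" using that by auto
    then have "1 = (\<Sum>k\<le>j. ?w k) + (\<Sum>k\<in>{j<..K}. ?w k)"
      using w_sum by (metis finite_atMost finite_greaterThanAtMost ivl_disj_int_one(3) sum.union_disjoint)
    moreover have "(\<Sum>k\<le>j. ?w k) = (\<Sum>k\<le>j. exp (- \<mu>) * \<mu> ^ k / fact k)"
      using that by (intro sum.cong) (auto simp: tpw_def)
    ultimately show ?thesis using poisson_tail_le[OF assms(4,5), of j] that by (simp add: tpw_def)
  qed
  have "pexp ?w K V (\<lambda>c. g c - g (c(v := 0))) = pexp ?w K V (avg v (\<lambda>c. g c - g (c(v := 0))))"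
    by (rule E_avg[OF assms(1,2)])
  also have "\<dots> \<le> pexp ?w K V (\<lambda>c. 2 * \<mu> * (\<Sum>k<K. ?w k * (g (c(v := Suc k)) - g (c(v := k)))))"
  proof (rule E_mono)
    fix c
    define D where "D j = g (c(v := Suc j)) - g (c(v := j))" for j
    have D0: "0 \<le> D j" for j unfolding D_def using monoD[OF assms(3), of "c(v := j)" "c(v := Suc j)"] by (simp add: le_fun_def)
    have tel: "g (c(v := k)) - g (c(v := 0)) = (\<Sum>j<k. D j)" for k
      unfolding D_def using sum_lessThan_telescope[of "\<lambda>j. g (c(v := j))" k] by simp
    have "avg v (\<lambda>c. g c - g (c(v := 0))) c = (\<Sum>k\<le>K. ?w k * (\<Sum>j<k. D j))"
      unfolding avg_def by (simp only: fun_upd_upd tel)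
    also have "\<dots> = (\<Sum>k\<le>K. \<Sum>j<K. if j < k then ?w k * D j else 0)"
    proof (intro sum.cong refl)
      fix k assume "k \<in> {..K}"
      then have "{..<k} = {j\<in>{..<K}. j < k}" by auto
      then show "?w k * (\<Sum>j<k. D j) = (\<Sum>j<K. if j < k then ?w k * D j else 0)"
        by (simp only: sum_distrib_left sum.inter_filter[OF finite_lessThan, symmetric])
    qed
    also have "\<dots> = (\<Sum>j<K. \<Sum>k\<le>K. if j < k then ?w k * D j else 0)" by (rule sum.swap)
    also have "\<dots> = (\<Sum>j<K. (\<Sum>k\<in>{j<..K}. ?w k) * D j)"
    proof (intro sum.cong refl)
      fix j assume "j \<in> {..<K}"
      have "{j<..K} = {k\<in>{..K}. j < k}" by auto
      then show "(\<Sum>k\<le>K. if j < k then ?w k * D j else 0) = (\<Sum>k\<in>{j<..K}. ?w k) * D j"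
        by (simp only: sum_distrib_right sum.inter_filter[OF finite_atMost, symmetric])
    qed
    also have "\<dots> \<le> (\<Sum>j<K. (2 * \<mu> * ?w j) * D j)"
      by (intro sum_mono mult_right_mono tail D0) auto
    finally show "avg v (\<lambda>c. g c - g (c(v := 0))) c \<le> 2 * \<mu> * (\<Sum>k<K. ?w k * (g (c(v := Suc k)) - g (c(v := k))))"
      unfolding D_def sum_distrib_left by (simp only: mult.assoc)
  qed
  finally show ?thesis by (simp only: pexp_cmult)
qed

subsection \<open>The differential inequality\<close>

text \<open>The dichotomy of Duminil-Copin, Raoufi and Tassion for the differential inequality
  f' \<ge> c n f / S. The threshold is the supremum of the parameters at which the series converges.\<close>
locale dichotomy =
  fixes f f' :: "nat \<Rightarrow> real \<Rightarrow> real" and b c :: real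
  assumes b: "0 < b" and c: "0 < c"
    and f0: "\<And>x. f 0 x = 1"
    and fnn: "\<And>n x. 0 < x \<Longrightarrow> x \<le> b \<Longrightarrow> 0 \<le> f n x"
    and fdec: "\<And>n x. 0 < x \<Longrightarrow> x \<le> b \<Longrightarrow> f (Suc n) x \<le> f n x"
    and fder: "\<And>n x. 3 \<le> n \<Longrightarrow> 0 < x \<Longrightarrow> x \<le> b \<Longrightarrow> (f n has_real_derivative f' n x) (at x)"
    and fineq: "\<And>n x. 3 \<le> n \<Longrightarrow> 0 < x \<Longrightarrow> x \<le> b \<Longrightarrow> c * n * f n x \<le> (\<Sum>k<n. f k x) * f' n x"
begin

definition S where "S n x = (\<Sum>k<n. f k x)"

lemma fle: "0 < x \<Longrightarrow> x \<le> b \<Longrightarrow> m \<le> n \<Longrightarrow> f n x \<le> f m x"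
  by (rule lift_Suc_antimono_le[of "\<lambda>n. f n x"]) (auto intro: fdec)

lemma f1: "0 < x \<Longrightarrow> x \<le> b \<Longrightarrow> f n x \<le> 1"
  using fle[of x 0 n] f0 by simp

lemma S_ge1: "0 < x \<Longrightarrow> x \<le> b \<Longrightarrow> 1 \<le> n \<Longrightarrow> 1 \<le> S n x"
  unfolding S_def using sum_mono2[of "{..<n}" "{0}" "\<lambda>k. f k x"] fnn f0 by auto

lemma S_le: "0 < x \<Longrightarrow> x \<le> b \<Longrightarrow> S n x \<le> n"
  unfolding S_def using sum_bounded_above[of "{..<n}" "\<lambda>k. f k x" 1] f1 by simp

lemma f'_ge: "3 \<le> n \<Longrightarrow> 0 < x \<Longrightarrow> x \<le> b \<Longrightarrow> c * n * f n x / S n x \<le> f' n x"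
  using fineq[of n x] S_ge1[of x n] unfolding S_def[symmetric] by (simp add: field_simps)

lemma f'_nonneg: "3 \<le> n \<Longrightarrow> 0 < x \<Longrightarrow> x \<le> b \<Longrightarrow> 0 \<le> f' n x"
  by (rule order_trans[OF _ f'_ge]) (use S_ge1[of x n] fnn[of x n] c in auto)

lemma f_mono3:
  assumes "3 \<le> n" "0 < x" "x \<le> y" "y \<le> b"
  shows "f n x \<le> f n y"
proof (rule DERIV_nonneg_imp_nondecreasing[OF assms(3)])
  fix z assume "x \<le> z" "z \<le> y"
  then have "0 < z" "z \<le> b" using assms by auto
  then show "\<exists>D. (f n has_real_derivative D) (at z) \<and> 0 \<le> D"
    using fder[OF assms(1)] f'_nonneg[OF assms(1)] by blast
qed

text \<open>Monotonicity in the parameter is known from index 3 on; the first three terms lie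
  between 0 and 1 and cost at most 3.\<close>

lemma S_mono: "0 < x \<Longrightarrow> x \<le> y \<Longrightarrow> y \<le> b \<Longrightarrow> S n x \<le> S n y + 3"
proof -
  assume a: "0 < x" "x \<le> y" "y \<le> b"
  have "S n x \<le> (\<Sum>k<n. f k y + of_bool (k < 3))"
    unfolding S_def
  proof (rule sum_mono)
    fix k show "f k x \<le> f k y + of_bool (k < 3)"
      using f_mono3[of k x y] a f1[of x k] fnn[of y k] by (cases "k < 3") auto
  qed
  also have "\<dots> = S n y + (\<Sum>k<n. of_bool (k < 3))" by (simp add: S_def sum.distrib)
  also have "(\<Sum>k<n. of_bool (k < 3)) \<le> (\<Sum>k<n + 3. of_bool (k < 3) :: real)" by (intro sum_mono2) auto
  also have "\<dots> = (\<Sum>k<(3::nat). 1 :: real)" by (intro sum.mono_neutral_cong_right) auto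
  finally show ?thesis by simp
qed

text \<open>If \<open>S\<close> stays below \<open>B\<close>, the inequality reads f' \<ge> (c n /
  B) f; integrate from \<open>x\<close> to \<open>y\<close> and use f \<le> 1 at \<open>y\<close>.
  The integrating factor avoids dividing by f, which may vanish.\<close>

lemma gronwall:
  assumes "3 \<le> n" "0 < x" "x \<le> y" "y \<le> b" "\<And>z. x \<le> z \<Longrightarrow> z \<le> y \<Longrightarrow> S n z \<le> B"
  shows "f n x \<le> exp (- (c * n / B) * (y - x))"
proof -
  define a where "a = c * n / B"
  have B: "1 \<le> B" using S_ge1[of x n] assms by force
  define H where "H z = exp (- a * z) * f n z" for z
  have "(H has_real_derivative exp (- a * z) * (f' n z - a * f n z)) (at z)" if "x \<le> z" "z \<le> y" for z
    unfolding H_def using that assms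
    by (auto intro!: derivative_eq_intros fder simp: algebra_simps)
  moreover have "0 \<le> exp (- a * z) * (f' n z - a * f n z)" if z: "x \<le> z" "z \<le> y" for z
  proof -
    have "a * f n z = c * n * f n z / B" unfolding a_def by simp
    also have "\<dots> \<le> c * n * f n z / S n z"
      using assms z c fnn[of z n] S_ge1[of z n] B by (intro divide_left_mono) auto
    also have "\<dots> \<le> f' n z" using assms z by (intro f'_ge) auto
    finally show ?thesis by simp
  qed
  ultimately have "H x \<le> H y" using assms by (intro DERIV_nonneg_imp_nondecreasing[of x y H]) auto
  also have "\<dots> \<le> exp (- a * y)" unfolding H_def using f1[of y n] assms by (simp add: mult_left_le)
  finally have "exp (- a * x) * f n x \<le> exp (- a * y)" unfolding H_def .
  then have "f n x \<le> exp (- a * y) / exp (- a * x)" by (simp add: field_simps)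
  also have "\<dots> = exp (- a * (y - x))" unfolding exp_diff[symmetric] by (simp add: algebra_simps)
  finally show ?thesis unfolding a_def .
qed

lemma exp_decay_below:
  assumes "0 < x" "x < y" "y \<le> b" "summable (\<lambda>n. f n y)"
  shows "\<exists>\<alpha>>0. \<forall>n\<ge>3. f n x \<le> exp (- \<alpha> * n)"
proof -
  define B where "B = (\<Sum>n. f n y) + 3"
  have Sy: "S n y \<le> (\<Sum>n. f n y)" for n
    unfolding S_def using fnn assms by (intro sum_le_suminf) auto
  have S: "S n z \<le> B" if "x \<le> z" "z \<le> y" for n z
    using S_mono[of z y n] Sy[of n] that assms unfolding B_def by simp
  have B: "0 < B" using S[of x 1] S_ge1[of x 1] assms by simp
  show ?thesis
  proof (intro exI[of _ "c * (y - x) / B"] conjI allI impI)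
    show "0 < c * (y - x) / B" using assms c B by simp
    fix n :: nat assume "3 \<le> n"
    then have "f n x \<le> exp (- (c * n / B) * (y - x))" using assms S by (intro gronwall) auto
    then show "f n x \<le> exp (- (c * (y - x) / B) * n)" by (simp add: mult_ac)
  qed
qed

text \<open>On the interval \<open>S n\<close> is at most \<open>S n y + 3\<close>, hence at most 4
  times \<open>n powr (1 - a)\<close>, since \<open>S n y\<close> is at least 1. Then
  \<open>gronwall\<close> gives the stretched exponential exp(- \<kappa> n^a), which is
  summable.\<close>

lemma summable_below:
  assumes "0 < x" "x < y" "y \<le> b" "0 < a" "\<forall>n\<ge>N. S n y \<le> n powr (1 - a)"
  shows "summable (\<lambda>n. f n x)"
proof -
  define \<kappa> where "\<kappa> = c * (y - x) / 4"
  define g where "g n = exp (- \<kappa> * (real n powr a))" for n :: nat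
  have "summable g"
  proof (rule summable_comparison_test_bigo)
    show "summable (\<lambda>n. norm (real n powr (-2)))" by (simp add: summable_real_powr_iff)
    have "0 < \<kappa>" unfolding \<kappa>_def using c assms by simp
    then show "g \<in> O(\<lambda>n. real n powr (-2))" unfolding g_def using assms(4) by real_asymp
  qed
  then show ?thesis
  proof (rule summable_comparison_test_ev[rotated])
    have "norm (f n x) \<le> g n" if n: "N + 3 \<le> n" for n
    proof -
      have S1: "1 \<le> S n y" using S_ge1 n assms by auto
      have "S n z \<le> 4 * (n powr (1 - a))" if "x \<le> z" "z \<le> y" for z
      proof -
        have "S n z \<le> S n y + 3" using S_mono[of z y n] that assms by auto
        moreover have "S n y \<le> n powr (1 - a)" using assms n by auto
        ultimately show ?thesis using S1 by linarith
      qed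
      then have "f n x \<le> exp (- (c * n / (4 * (n powr (1 - a)))) * (y - x))"
        using n assms by (intro gronwall) auto
      also have "c * n / (4 * (n powr (1 - a))) = c / 4 * n powr a"
        using n by (simp add: powr_diff field_simps)
      finally show ?thesis using fnn[of x n] assms unfolding g_def \<kappa>_def by (simp add: mult_ac)
    qed
    then show "\<forall>\<^sub>F n in sequentially. norm (f n x) \<le> g n" unfolding eventually_sequentially by blast
  qed
qed

text \<open>Since f_i' / (c i) \<ge> f_i / S_i \<ge> ln S_(i+1) - ln S_i, the derivative of the
  weighted sum telescopes to c (ln S_n - ln S_3). The constants absorb the loss in
  \<open>S_mono\<close>, which costs ln 4, and ln S_3 \<le> 2.\<close>

lemma T_lower:
  assumes "0 < x" "x < y" "y \<le> b" "3 \<le> n"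
  shows "c * (y - x) * (ln (S n x) - ln 4 - 3) \<le> (\<Sum>i\<in>{3..<n}. f i y / i)"
proof -
  define L where "L = ln (S n x) - ln 4 - 3"
  define H where "H z = (\<Sum>i\<in>{3..<n}. f i z / i) - c * L * z" for z
  define H' where "H' z = (\<Sum>i\<in>{3..<n}. f' i z / i) - c * L" for z
  have "(H has_real_derivative H' z) (at z)" if "x \<le> z" "z \<le> y" for z
    unfolding H_def H'_def using that assms
    by (intro DERIV_diff DERIV_sum DERIV_cdivide fder) (auto intro!: derivative_eq_intros)
  moreover have "0 \<le> H' z" if z: "x \<le> z" "z \<le> y" for z
  proof -
    have zb: "0 < z" "z \<le> b" using z assms by auto
    have S1: "1 \<le> S i z" if "1 \<le> i" for i using S_ge1 zb that by auto
    have step: "ln (S (Suc i) z) - ln (S i z) \<le> f' i z / i / c" if i: "3 \<le> i" for i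
    proof -
      have p: "0 < S i z" using S1[of i] i by auto
      have S': "S (Suc i) z = S i z + f i z" unfolding S_def by simp
      have "ln (S (Suc i) z) - ln (S i z) = ln (1 + f i z / S i z)"
      proof -
        have "S i z + f i z = S i z * (1 + f i z / S i z)" using p by (simp add: field_simps)
        moreover have "ln (S i z * (1 + f i z / S i z)) = ln (S i z) + ln (1 + f i z / S i z)"
          using p fnn[OF zb, of i] by (intro ln_mult_pos) (auto intro!: add_pos_nonneg)
        ultimately show ?thesis unfolding S' by simp
      qed
      also have "\<dots> \<le> f i z / S i z" using p fnn[OF zb, of i] by (intro ln_add_one_self_le_self) auto
      also have "\<dots> = c * i * f i z / S i z / i / c" using i c by (simp add: field_simps)
      also have "\<dots> \<le> f' i z / i / c" using f'_ge[OF i zb] c by (intro divide_right_mono) auto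
      finally show ?thesis .
    qed
    have tel: "(\<Sum>i\<in>{3..<n}. ln (S (Suc i) z) - ln (S i z)) = ln (S n z) - ln (S 3 z)"
      using assms(4) by (rule sum_Suc_diff')
    have "L \<le> ln (S n z) - ln (S 3 z)"
    proof -
      have "S n x \<le> 4 * S n z" using S_mono[of x z n] z assms S1[of n] by auto
      then have "ln (S n x) \<le> ln (4 * S n z)" using S_ge1[of x n] assms S1[of n] by (subst ln_le_cancel_iff) auto
      also have "\<dots> = ln 4 + ln (S n z)" using S1[of n] assms(4) by (intro ln_mult_pos) auto
      finally have 1: "ln (S n x) - ln 4 \<le> ln (S n z)" by simp
      have "ln (S 3 z) \<le> ln 3" using S_le[OF zb, of 3] S1[of 3] by (subst ln_le_cancel_iff) auto
      also have "\<dots> \<le> 3 - 1" by (intro ln_le_minus_one) auto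
      finally show ?thesis unfolding L_def using 1 by simp
    qed
    also have "\<dots> \<le> (\<Sum>i\<in>{3..<n}. f' i z / i / c)" unfolding tel[symmetric] by (intro sum_mono step) auto
    also have "\<dots> = (\<Sum>i\<in>{3..<n}. f' i z / i) / c" by (simp add: sum_divide_distrib)
    finally show ?thesis unfolding H'_def using c by (simp add: field_simps)
  qed
  ultimately have "H x \<le> H y" using assms by (intro DERIV_nonneg_imp_nondecreasing[of x y H]) auto
  moreover have "0 \<le> (\<Sum>i\<in>{3..<n}. f i x / i)" using fnn assms by (intro sum_nonneg) auto
  ultimately show ?thesis unfolding H_def L_def[symmetric] by (simp add: algebra_simps)
qed

lemma harmonic_le_ln: "2 \<le> n \<Longrightarrow> (\<Sum>i\<in>{3..<Suc n}. 1 / real i) \<le> ln n"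
proof (induction n rule: nat_induct_at_least)
  case base
  then show ?case by simp
next
  case (Suc n)
  have "ln (real n / real (Suc n)) \<le> real n / real (Suc n) - 1" using Suc by (intro ln_le_minus_one) auto
  then have "1 / real (Suc n) \<le> ln (Suc n) - ln n"
    using Suc by (subst (asm) ln_div) (auto simp: field_simps)
  moreover have "(\<Sum>i\<in>{3..<Suc (Suc n)}. 1 / real i) = (\<Sum>i\<in>{3..<Suc n}. 1 / real i) + 1 / real (Suc n)"
    using Suc by (subst sum.atLeastLessThan_Suc) auto
  ultimately show ?case using Suc.IH by linarith
qed

text \<open>For infinitely many n the sum of f_i(y) / i is at least c (y - x) (1 - a) ln n up to a
  constant, by \<open>T_lower\<close>, while antitonicity in the index bounds it by f_m(y) ln n + m.
  Comparing the coefficients of ln n gives the claim.\<close>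

lemma above_aux:
  assumes "0 < x" "x < y" "y \<le> b" "0 < a" "\<forall>N. \<exists>n\<ge>N. n powr (1 - a) < S n x"
  shows "c * (y - x) * (1 - a) \<le> f m y"
proof (rule ccontr)
  assume neg: "\<not> c * (y - x) * (1 - a) \<le> f m y"
  define \<delta> where "\<delta> = c * (y - x) * (1 - a) - f m y"
  define C where "C = c * (y - x) * (ln 4 + 3) + m"
  have \<delta>: "0 < \<delta>" using neg unfolding \<delta>_def by simp
  \<comment> \<open>Beyond \<open>N\<close> the logarithm exceeds \<open>C / \<delta>\<close>, which
    contradicts the two estimates combined.\<close>
  define N where "N = nat \<lceil>exp (C / \<delta>)\<rceil> + m + 4"
  obtain n where n: "N \<le> n" "n powr (1 - a) < S n x" using assms(5) by blast
  have n4: "4 \<le> n" "m \<le> n" "exp (C / \<delta>) < n" using n(1) unfolding N_def by linarith+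
  have "(1 - a) * ln n = ln (n powr (1 - a))" using n4 by (simp add: ln_powr)
  also have "\<dots> \<le> ln (S n x)" using n n4 by (subst ln_le_cancel_iff) (auto intro: less_trans[OF _ n(2)])
  finally have 1: "(1 - a) * ln n \<le> ln (S n x)" .
  have "c * (y - x) * ((1 - a) * ln n - ln 4 - 3) \<le> c * (y - x) * (ln (S n x) - ln 4 - 3)"
    using 1 c assms by (intro mult_left_mono) auto
  also have "\<dots> \<le> (\<Sum>i\<in>{3..<n}. f i y / i)" using assms n4 by (intro T_lower) auto
  also have "\<dots> \<le> (\<Sum>i\<in>{3..<n}. f m y * (1 / i) + of_bool (i < m))"
  proof (rule sum_mono)
    fix i assume i: "i \<in> {3..<n}"
    have y: "0 < y" using assms by auto
    show "f i y / i \<le> f m y * (1 / i) + of_bool (i < m)"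
    proof (cases "i < m")
      case True
      have "f i y / i \<le> 1" using f1[OF y assms(3), of i] fnn[OF y assms(3), of i] i by (simp add: field_simps)
      then show ?thesis using True fnn[OF y assms(3), of m] by (simp add: add_increasing)
    next
      case False
      then show ?thesis using fle[OF y assms(3), of m i] by (simp add: divide_right_mono)
    qed
  qed
  also have "\<dots> = f m y * (\<Sum>i\<in>{3..<n}. 1 / i) + (\<Sum>i\<in>{3..<n}. of_bool (i < m))"
    by (simp add: sum.distrib sum_distrib_left)
  also have "\<dots> \<le> f m y * ln n + m"
  proof (intro add_mono mult_left_mono)
    have "(\<Sum>i\<in>{3..<n}. 1 / real i) \<le> (\<Sum>i\<in>{3..<Suc n}. 1 / real i)" by (intro sum_mono2) auto
    also have "\<dots> \<le> ln n" using n4 by (intro harmonic_le_ln) auto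
    finally show "(\<Sum>i\<in>{3..<n}. 1 / real i) \<le> ln n" .
    show "0 \<le> f m y" using fnn assms by auto
    have "(\<Sum>i\<in>{3..<n}. of_bool (i < m) :: real) \<le> (\<Sum>i<n. of_bool (i < m))" by (intro sum_mono2) auto
    also have "\<dots> = (\<Sum>i<m. 1)" using n4 by (intro sum.mono_neutral_cong_right) auto
    finally show "(\<Sum>i\<in>{3..<n}. of_bool (i < m) :: real) \<le> m" by simp
  qed
  finally have "\<delta> * ln n \<le> C" unfolding \<delta>_def C_def by (simp add: algebra_simps)
  then have "ln n \<le> C / \<delta>" using \<delta> by (simp add: field_simps)
  moreover have "C / \<delta> < ln n" using n4 by (metis exp_less_cancel_iff exp_ln exp_gt_zero less_trans)
  ultimately show False by simp
qed

text \<open>Divergence at a point just above \<open>x\<close> prevents \<open>S n\<close> from being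
  eventually below \<open>n powr (1 - t)\<close> slightly further up, by
  \<open>summable_below\<close>, and from there \<open>above_aux\<close> leads to \<open>y\<close>.
  Both the shift of the starting point and the factor \<open>1 - t\<close> disappear as t tends to
  0.\<close>

lemma above:
  assumes "0 \<le> x" "x < y" "y \<le> b" "\<And>z. x < z \<Longrightarrow> z \<le> b \<Longrightarrow> \<not> summable (\<lambda>n. f n z)"
  shows "c * (y - x) \<le> f m y"
proof -
  have *: "c * ((1 - t) * (y - x)) * (1 - t) \<le> f m y" if t: "0 < t" "t < 1" for t
  proof -
    define x' where "x' = x + t * (y - x)"
    define x'' where "x'' = x + t / 2 * (y - x)"
    have o: "x < x''" "x'' < x'" "x' < y"
    proof -
      have "0 < t * (y - x)" "t * (y - x) < 1 * (y - x)"
        using t assms by (auto intro!: mult_strict_right_mono)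
      then show "x < x''" "x'' < x'" "x' < y" unfolding x'_def x''_def by auto
    qed
    have "\<forall>N. \<exists>n\<ge>N. n powr (1 - t) < S n x'"
    proof (rule ccontr)
      assume "\<not> ?thesis"
      then obtain N where "\<forall>n\<ge>N. S n x' \<le> n powr (1 - t)" by (auto simp: not_less)
      then have "summable (\<lambda>n. f n x'')" using o assms t by (intro summable_below[of x'' x' t N]) auto
      then show False using assms(4)[of x''] o assms by auto
    qed
    then have "c * (y - x') * (1 - t) \<le> f m y" using o assms t by (intro above_aux) auto
    then show ?thesis unfolding x'_def by (simp add: algebra_simps)
  qed
  have "(\<lambda>n. c * ((1 - inverse (real n + 2)) * (y - x)) * (1 - inverse (real n + 2))) \<longlonglongrightarrow> c * ((1 - 0) * (y - x)) * (1 - 0)"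
    by (intro tendsto_intros) real_asymp+
  then have "c * ((1 - 0) * (y - x)) * (1 - 0) \<le> f m y"
  proof (rule LIMSEQ_le_const2, intro exI[of _ 0] allI impI)
    fix n show "c * ((1 - inverse (real n + 2)) * (y - x)) * (1 - inverse (real n + 2)) \<le> f m y"
      by (rule *) (auto simp: field_simps)
  qed
  then show ?thesis by simp
qed

lemma threshold:
  obtains \<beta> where "0 \<le> \<beta>" "\<beta> \<le> b"
    "\<And>x. 0 < x \<Longrightarrow> x < \<beta> \<Longrightarrow> \<exists>\<alpha>>0. \<forall>n\<ge>3. f n x \<le> exp (- \<alpha> * n)"
    "\<And>x m. \<beta> < x \<Longrightarrow> x \<le> b \<Longrightarrow> c * (x - \<beta>) \<le> f m x"
proof -
  \<comment> \<open>With 0 included the supremum is meaningful even when the series diverges for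
    every positive parameter; the threshold is 0 in that case.\<close>
  define A where "A = insert 0 {x. 0 < x \<and> x \<le> b \<and> summable (\<lambda>n. f n x)}"
  define \<beta> where "\<beta> = Sup A"
  have A: "bdd_above A" "A \<noteq> {}" unfolding A_def bdd_above_def using b by (auto intro!: exI[of _ b])
  have \<beta>0: "0 \<le> \<beta>" unfolding \<beta>_def using A by (intro cSup_upper) (auto simp: A_def)
  show ?thesis
  proof (rule that[of \<beta>])
    show "\<beta> \<le> b" unfolding \<beta>_def using A b by (intro cSup_least) (auto simp: A_def)
    show "\<exists>\<alpha>>0. \<forall>n\<ge>3. f n x \<le> exp (- \<alpha> * n)" if x: "0 < x" "x < \<beta>" for x
    proof -
      obtain y where "y \<in> A" "x < y" using x less_cSupE[of x A] A unfolding \<beta>_def by auto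
      then show ?thesis using x exp_decay_below[of x y] unfolding A_def by auto
    qed
    show "c * (x - \<beta>) \<le> f m x" if x: "\<beta> < x" "x \<le> b" for x m
    proof (rule above[OF \<beta>0 x])
      fix z assume z: "\<beta> < z" "z \<le> b"
      show "\<not> summable (\<lambda>n. f n z)"
      proof
        assume "summable (\<lambda>n. f n z)"
        then have "z \<in> A" using z \<beta>0 unfolding A_def by auto
        then have "z \<le> \<beta>" unfolding \<beta>_def using A by (intro cSup_upper)
        then show False using z by simp
      qed
    qed
  qed (rule \<beta>0)
qed

end

subsection \<open>Arm probabilities on the lattice\<close>

definition lat :: "(real^'n) set" where
  "lat = {x. \<forall>i. x $ i \<in> \<int>}"

text \<open>Labelled copies of the site \<open>u\<close>, one for each point in the cell of \<open>u\<close>.\<close>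
definition lab :: "('v \<Rightarrow> nat) \<Rightarrow> ('v \<times> nat) set" where
  "lab c = {(u, i). i < c u}"

definition near :: "real \<Rightarrow> ('v::metric_space \<times> nat) \<Rightarrow> ('v \<times> nat) \<Rightarrow> bool" where
  "near \<rho> p q \<longleftrightarrow> dist (fst p) (fst q) \<le> \<rho>"

definition dlink :: "nat \<Rightarrow> real \<Rightarrow> ('v::metric_space \<Rightarrow> nat) \<Rightarrow> 'v set \<Rightarrow> 'v set \<Rightarrow> bool" where
  "dlink d \<rho> c A B = clink d (near \<rho>) (lab c) (A \<times> UNIV) (B \<times> UNIV)"

definition far :: "'v::metric_space \<Rightarrow> real \<Rightarrow> 'v set" where
  "far v t = {x. t \<le> dist v x}"

lemma lab_mono: "c \<le> c' \<Longrightarrow> lab c \<subseteq> lab c'"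
  unfolding lab_def le_fun_def by (auto intro: less_le_trans)

lemma dlink_mono: "c \<le> c' \<Longrightarrow> A \<subseteq> A' \<Longrightarrow> B \<subseteq> B' \<Longrightarrow> dlink d \<rho> c A B \<Longrightarrow> dlink d \<rho> c' A' B'"
  unfolding dlink_def by (erule clink_mono[rotated 3]) (auto intro: lab_mono[THEN subsetD])

lemma near_dist: "near \<rho> p q \<Longrightarrow> dist v (fst q) \<le> dist v (fst p) + \<rho>"
  unfolding near_def using dist_triangle[of v "fst q" "fst p"] by simp

lemma dlink_local:
  assumes "1 \<le> d" "A \<subseteq> cball v t" "dlink d \<rho> c A (far v t)"
  shows "dlink d \<rho> (res (cball v (t + \<rho>)) c) A (far v t)"
proof -
  have "clink d (near \<rho>) (lab c \<inter> {p. dist v (fst p) \<le> t + \<rho>}) (A \<times> UNIV) {p. t \<le> dist v (fst p)}"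
  proof (rule clink_upto_level[OF near_dist assms(1)])
    have "far v t \<times> (UNIV :: nat set) = {p. t \<le> dist v (fst p)}" unfolding far_def by auto
    then show "clink d (near \<rho>) (lab c) (A \<times> UNIV) {p. t \<le> dist v (fst p)}"
      using assms(3) unfolding dlink_def by simp
  qed (use assms(2) in auto)
  then show ?thesis unfolding dlink_def
    by (rule clink_mono[rotated 3]) (auto simp: lab_def res_def far_def)
qed

lemma finite_lat_card:
  fixes r :: real
  assumes "0 \<le> r"
  shows "finite (lat \<inter> cball (0::real^'n) r)" "card (lat \<inter> cball (0::real^'n) r) \<le> (2 * r + 1) ^ CARD('n)"
proof -
  define m where "m = \<lfloor>r\<rfloor>"
  define P where "P = ((UNIV :: 'n set) \<rightarrow>\<^sub>E {- m..m})"
  have sub: "lat \<inter> cball (0::real^'n) r \<subseteq> (\<lambda>f. \<chi> i. of_int (f i)) ` P"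
  proof
    fix x :: "real^'n" assume x: "x \<in> lat \<inter> cball 0 r"
    define f where "f i = \<lfloor>x $ i\<rfloor>" for i
    have e: "x $ i = of_int (f i)" for i using x unfolding lat_def f_def by (auto elim!: Ints_cases)
    have "\<bar>of_int (f i)\<bar> \<le> r" for i
      using component_le_norm_cart[of x i] x e[of i] by simp
    then have "f i \<in> {- m..m}" for i unfolding m_def using le_floor_iff[of "f i" r] le_floor_iff[of "- f i" r]
      by (force simp: abs_le_iff)
    then have "f \<in> P" unfolding P_def by auto
    moreover have "x = (\<chi> i. of_int (f i))" by (simp add: vec_eq_iff e)
    ultimately show "x \<in> (\<lambda>f. \<chi> i. of_int (f i)) ` P" by auto
  qed
  have fP: "finite P" unfolding P_def by (intro finite_PiE) auto
  show "finite (lat \<inter> cball (0::real^'n) r)" using sub fP by (meson finite_imageI finite_subset)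
  have "card (lat \<inter> cball (0::real^'n) r) \<le> card ((\<lambda>f. (\<chi> i. of_int (f i)) :: real^'n) ` P)"
    using sub fP by (intro card_mono) auto
  also have "\<dots> \<le> card P" by (rule card_image_le[OF fP])
  also have "card P = nat (2 * m + 1) ^ CARD('n)" unfolding P_def by (simp add: card_PiE)
  finally have "real (card (lat \<inter> cball (0::real^'n) r)) \<le> real (nat (2 * m + 1)) ^ CARD('n)"
    by (metis of_nat_le_iff of_nat_power)
  also have "\<dots> \<le> (2 * r + 1) ^ CARD('n)"
  proof (rule power_mono)
    have "0 \<le> m" using assms unfolding m_def by simp
    then show "real (nat (2 * m + 1)) \<le> 2 * r + 1" unfolding m_def by simp
  qed auto
  finally show "card (lat \<inter> cball (0::real^'n) r) \<le> (2 * r + 1) ^ CARD('n)" .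
qed

lemma dlink_translate:
  fixes v :: "'v::real_normed_vector"
  assumes "dlink d \<rho> (\<lambda>x. c (x - v)) (cball v a) (far v t)"
  shows "dlink d \<rho> c (cball 0 a) (far 0 t)"
  unfolding dlink_def
  by (rule clink_image[where f = "\<lambda>(u, i). (u - v, i)", OF _ _ _ _ _ assms[unfolded dlink_def]])
    (auto simp: inj_on_def lab_def near_def far_def dist_norm norm_minus_commute)

definition hit :: "nat \<Rightarrow> real \<Rightarrow> nat \<Rightarrow> ('v::real_normed_vector \<Rightarrow> nat) \<Rightarrow> real" where
  "hit d \<rho> n c = of_bool (dlink d \<rho> c (cball 0 (2 * \<rho>)) (far 0 (n * \<rho>)))"

abbreviation win :: "real \<Rightarrow> nat \<Rightarrow> (real^'n) set" where
  "win \<rho> n \<equiv> lat \<inter> cball 0 (n * \<rho> + \<rho>)"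

text \<open>For \<open>n < 3\<close> the far region may meet the starting ball, and the value is set to the one required
  by the dichotomy.\<close>
definition arm :: "'n::finite itself \<Rightarrow> nat \<Rightarrow> real \<Rightarrow> nat \<Rightarrow> real \<Rightarrow> real" where
  "arm D d \<rho> n \<mu> = (if n < 3 then 1 else pexp (tpw (d + 1) \<mu>) (d + 1) (win \<rho> n :: (real^'n) set) (hit d \<rho> n))"

lemma mono_hit: "mono (hit d \<rho> n)"
  unfolding hit_def mono_def by (auto simp: of_bool_def intro: dlink_mono)

lemma dlink_far_cong:
  assumes "1 \<le> d" "A \<subseteq> cball v t" "x \<notin> cball v (t + \<rho>)"
  shows "dlink d \<rho> (c(x := k)) A (far v t) = dlink d \<rho> c A (far v t)"
proof -
  have 1: "dlink d \<rho> c A (far v t) \<longleftrightarrow> dlink d \<rho> (res (cball v (t + \<rho>)) c) A (far v t)" for c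
    using dlink_local[OF assms(1,2)] dlink_mono[OF res_le order_refl order_refl] by blast
  have "res (cball v (t + \<rho>)) (c(x := k)) = res (cball v (t + \<rho>)) c" using assms(3) by (auto simp: res_def)
  then show ?thesis using 1[of c] 1[of "c(x := k)"] by simp
qed

context
  fixes d :: nat and \<rho> \<mu> :: real
  assumes d: "1 \<le> d" and \<rho>: "1 \<le> \<rho>" and \<mu>: "0 \<le> \<mu>"
begin

interpretation weights "tpw (d + 1) \<mu>" "d + 1" by (rule weights_tpw[OF \<mu>])

text \<open>Adding the translated window to \<open>V\<close> can only raise the probability, and
  cells outside the translate do not affect the event (\<open>dlink_far_cong\<close>). An inequality
  is the right form for arbitrary \<open>V\<close>, which may cut off part of the neighbourhood of
  \<open>v\<close>.\<close>

lemma link_prob_le_arm: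
  assumes "finite V" "V \<subseteq> (lat :: (real^'n) set)" "v \<in> lat" "3 \<le> k"
  shows "E V (\<lambda>c. of_bool (dlink d \<rho> c (cball v (2 * \<rho>)) (far v (k * \<rho>)))) \<le> arm TYPE('n) d \<rho> k \<mu>"
proof -
  let ?g = "\<lambda>c. of_bool (dlink d \<rho> c (cball v (2 * \<rho>)) (far v (k * \<rho>))) :: real"
  let ?W = "(\<lambda>x. x + v) ` (win \<rho> k :: (real^'n) set)"
  have fin: "finite (win \<rho> k :: (real^'n) set)" using \<rho> by (intro finite_lat_card) auto
  have m: "mono ?g" unfolding mono_def by (auto simp: of_bool_def intro: dlink_mono)
  have sub: "cball v (2 * \<rho>) \<subseteq> cball v (k * \<rho>)" using assms(4) \<rho> by (intro subset_cball mult_right_mono) auto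
  have "E V ?g \<le> E (V \<union> ?W) ?g" using fin assms(1) by (intro E_superset_mono m) auto
  also have "\<dots> = E ?W ?g"
  proof (rule E_superset)
    fix c :: "real^'n \<Rightarrow> nat" and x j assume x: "x \<in> V \<union> ?W - ?W"
    have "x - v \<in> lat" using x assms(2,3) unfolding lat_def by auto
    moreover have "x - v \<notin> win \<rho> k" using x by (metis DiffD2 diff_add_cancel image_eqI)
    ultimately have "x \<notin> cball v (k * \<rho> + \<rho>)" by (auto simp: dist_norm norm_minus_commute)
    then show "?g (c(x := j)) = ?g c" using dlink_far_cong[OF d sub] by simp
  qed (use fin assms(1) in auto)
  also have "\<dots> = E (win \<rho> k) (\<lambda>c. ?g (\<lambda>x. c (x - v)))" by (rule E_translate[OF fin])
  also have "\<dots> \<le> E (win \<rho> k :: (real^'n) set) (hit d \<rho> k)"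
    unfolding hit_def by (intro E_mono) (auto simp: of_bool_def intro: dlink_translate)
  also have "\<dots> = arm TYPE('n) d \<rho> k \<mu>" using assms(4) by (simp add: arm_def)
  finally show ?thesis .
qed

lemma arm_bounds: "0 \<le> arm TYPE('n::finite) d \<rho> n \<mu>" "arm TYPE('n) d \<rho> n \<mu> \<le> 1"
proof -
  have fin: "finite (win \<rho> n :: (real^'n) set)" using \<rho> by (intro finite_lat_card) auto
  have "0 \<le> E (win \<rho> n :: (real^'n) set) (hit d \<rho> n)" by (rule E_nonneg) (simp add: hit_def)
  moreover have "E (win \<rho> n :: (real^'n) set) (hit d \<rho> n) \<le> 1" by (rule E_le_1[OF fin]) (simp add: hit_def)
  ultimately show "0 \<le> arm TYPE('n::finite) d \<rho> n \<mu>" "arm TYPE('n) d \<rho> n \<mu> \<le> 1"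
    by (simp_all add: arm_def)
qed

lemma arm_antimono_Suc: "arm TYPE('n::finite) d \<rho> (Suc n) \<mu> \<le> arm TYPE('n) d \<rho> n \<mu>"
proof (cases "n < 3")
  case True
  then show ?thesis using arm_bounds(2)[of "Suc n"] by (simp add: arm_def)
next
  case False
  have fin: "finite (win \<rho> (Suc n) :: (real^'n) set)" using \<rho> by (intro finite_lat_card) auto
  have "arm TYPE('n) d \<rho> (Suc n) \<mu> = E (win \<rho> (Suc n) :: (real^'n) set) (hit d \<rho> (Suc n))"
    using False by (simp add: arm_def)
  also have "\<dots> \<le> E (win \<rho> (Suc n) :: (real^'n) set) (hit d \<rho> n)"
  proof (rule E_mono)
    have "far 0 (real (Suc n) * \<rho>) \<subseteq> far (0::real^'n) (n * \<rho>)"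
      unfolding far_def using \<rho> by (auto simp: algebra_simps)
    then show "hit d \<rho> (Suc n) c \<le> hit d \<rho> n c" for c :: "real^'n \<Rightarrow> nat"
      unfolding hit_def by (auto simp: of_bool_def intro: dlink_mono)
  qed
  also have "\<dots> = E (win \<rho> (Suc n) :: (real^'n) set) (\<lambda>c. of_bool (dlink d \<rho> c (cball 0 (2 * \<rho>)) (far 0 (n * \<rho>))))"
    unfolding hit_def ..
  also have "\<dots> \<le> arm TYPE('n) d \<rho> n \<mu>"
    using False fin by (intro link_prob_le_arm) (auto simp: lat_def)
  finally show ?thesis .
qed

section \<open>Exploration from a shell and its revealment\<close>

definition shell :: "nat \<Rightarrow> (real^'n) set" where
  "shell s = {x. s * \<rho> \<le> norm x \<and> norm x \<le> s * \<rho> + \<rho>}"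

text \<open>The cells that have to be read to grow all chains meeting the shell: those within
  \<open>\<rho>\<close> of the shell or of a vertex already found. This set serves as the frontier
  \<open>Fr\<close> of \<open>explore\<close>.\<close>

definition reveal :: "(real^'n) set \<Rightarrow> nat \<Rightarrow> (real^'n \<Rightarrow> nat) \<Rightarrow> (real^'n) set" where
  "reveal V s c = {v\<in>V. (\<exists>x\<in>shell s. dist v x \<le> \<rho>) \<or>
     (\<exists>S T p. S \<in> csimp d (near \<rho>) (lab c) \<and> S \<inter> shell s \<times> UNIV \<noteq> {} \<and>
        conn d (near \<rho>) (lab c) S T \<and> p \<in> T \<and> dist v (fst p) \<le> \<rho>)}"

lemma reveal_mono: "c \<le> c' \<Longrightarrow> reveal V s c \<subseteq> reveal V s c'"
proof
  fix v assume le: "c \<le> c'" and v: "v \<in> reveal V s c"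
  show "v \<in> reveal V s c'"
  proof (cases "\<exists>x\<in>shell s. dist v x \<le> \<rho>")
    case False
    then obtain S T p where "S \<in> csimp d (near \<rho>) (lab c)" "S \<inter> shell s \<times> UNIV \<noteq> {}"
      "conn d (near \<rho>) (lab c) S T" "p \<in> T" "dist v (fst p) \<le> \<rho>"
      using v unfolding reveal_def by blast
    then show ?thesis using v csimp_mono[OF lab_mono[OF le]] conn_mono[OF lab_mono[OF le]]
      unfolding reveal_def by (intro CollectI conjI disjI2 exI[of _ S] exI[of _ T] exI[of _ p]) auto
  qed (use v in \<open>auto simp: reveal_def\<close>)
qed

text \<open>A chain to distance n \<rho> crosses shell \<open>s\<close>, because 2 \<le> s < n. From
  a simplex in the shell both halves are followed one simplex at a time: consecutive simplices share
  a vertex, so the next one lies in cells within \<open>\<rho>\<close> of a known vertex, and these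
  have been read. The whole chain is therefore visible in \<open>res B c\<close>.\<close>

lemma hit_reveal:
  assumes "c \<in> cfg K V" "reveal V s (res B c) \<subseteq> B" "2 \<le> s" "s < n"
  shows "hit d \<rho> n (res B c) = hit d \<rho> n c"
proof -
  let ?N = "near \<rho> :: (real^'n) \<times> nat \<Rightarrow> (real^'n) \<times> nat \<Rightarrow> bool"
  let ?L = "lab c" and ?M = "lab (res B c)"
  have LV: "fst p \<in> V" if "p \<in> ?L" for p using that assms(1) by (force simp: lab_def cfg_def)
  have inM: "p \<in> ?M" if "p \<in> ?L" "fst p \<in> reveal V s (res B c)" for p
    using that assms(2) by (auto simp: lab_def res_def)
  have N_dist: "dist (fst q) (fst p) \<le> \<rho>" if "?N p q" for p q using that by (simp add: near_def dist_commute)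
  have key: "conn d ?N ?M U W \<and> U \<in> csimp d ?N ?M \<and> W \<in> csimp d ?N ?M"
    if UW: "conn d ?N ?L U W" and U: "U \<in> csimp d ?N ?L" "U \<inter> shell s \<times> UNIV \<noteq> {}" for U W
    using UW
  proof (induction rule: rtranclp_induct)
    case base
    obtain p where p: "p \<in> U" "fst p \<in> shell s" using U(2) by auto
    have "U \<subseteq> ?M"
    proof
      fix q assume q: "q \<in> U"
      have "dist (fst q) (fst p) \<le> \<rho>" using N_dist csimpD(4)[OF U(1) p(1) q] .
      moreover have "q \<in> ?L" using csimpD(1)[OF U(1)] q by auto
      ultimately show "q \<in> ?M" using p(2) LV by (intro inM) (auto simp: reveal_def)
    qed
    then show ?case using csimp_restrict[OF U(1)] by auto
  next
    case (step W W')
    have W: "W \<in> csimp d ?N ?M" "conn d ?N ?M U W" "U \<in> csimp d ?N ?M" using step.IH by auto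
    have W': "W' \<in> csimp d ?N ?L" "d \<le> card (W \<inter> W')" using step.hyps(2) by (auto simp: cadj_def)
    obtain p where p: "p \<in> W" "p \<in> W'" using cadj_common[OF step.hyps(2) d] .
    have "W' \<subseteq> ?M"
    proof
      fix q assume q: "q \<in> W'"
      have "dist (fst q) (fst p) \<le> \<rho>" using N_dist csimpD(4)[OF W'(1) p(2) q] .
      moreover have "q \<in> ?L" using csimpD(1)[OF W'(1)] q by auto
      moreover have "fst q \<in> V" using LV calculation(2) .
      ultimately have "fst q \<in> reveal V s (res B c)" unfolding reveal_def using p(1) W U(2)
        by (intro CollectI conjI disjI2 exI[of _ U] exI[of _ W] exI[of _ p]) auto
      then show "q \<in> ?M" using \<open>q \<in> ?L\<close> by (intro inM)
    qed
    then have "W' \<in> csimp d ?N ?M" by (rule csimp_restrict[OF W'(1)])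
    moreover from this have "cadj d ?N ?M W W'" using W W' by (simp add: cadj_def)
    ultimately show ?case using W by (meson rtranclp.rtrancl_into_rtrancl)
  qed
  have "dlink d \<rho> (res B c) (cball 0 (2 * \<rho>)) (far 0 (n * \<rho>))"
    if dl: "dlink d \<rho> c (cball 0 (2 * \<rho>)) (far 0 (n * \<rho>))"
  proof -
    obtain S T where ST: "S \<in> csimp d ?N ?L" "T \<in> csimp d ?N ?L" "S \<inter> cball 0 (2 * \<rho>) \<times> UNIV \<noteq> {}"
      "T \<inter> far 0 (n * \<rho>) \<times> UNIV \<noteq> {}" "conn d ?N ?L S T"
      using dl unfolding dlink_def clink_def by auto
    have s2: "2 * \<rho> \<le> s * \<rho>" "s * \<rho> \<le> n * \<rho>" using assms(3,4) \<rho> by (auto intro!: mult_right_mono)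
    obtain U where U: "U \<inter> {p. s * \<rho> \<le> norm (fst p) \<and> norm (fst p) \<le> s * \<rho> + \<rho>} \<noteq> {}"
      "conn d ?N ?L S U" "conn d ?N ?L U T"
    proof -
      have "\<exists>U. U \<inter> {p. s * \<rho> \<le> norm (fst p) \<and> norm (fst p) \<le> s * \<rho> + \<rho>} \<noteq> {} \<and> conn d ?N ?L S U \<and> conn d ?N ?L U T"
      proof (rule conn_crosses_level[OF _ d ST(5) _ _ ST(1)])
        show "norm (fst q) \<le> norm (fst p) + \<rho>" if "?N p q" for p q
          using near_dist[OF that, of 0] by simp
        show "T \<inter> {p. s * \<rho> \<le> norm (fst p)} \<noteq> {}" using ST(4) s2 unfolding far_def by (auto simp: disjoint_iff)
        show "\<exists>p\<in>S. norm (fst p) \<le> s * \<rho>" using ST(3) s2 by (force simp: disjoint_iff)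
      qed
      then show ?thesis using that by blast
    qed
    have Us: "U \<inter> shell s \<times> UNIV \<noteq> {}" using U(1) unfolding shell_def by auto
    have UL: "U \<in> csimp d ?N ?L" by (rule conn_csimp[OF U(2) ST(1)])
    have 1: "conn d ?N ?M U T" "T \<in> csimp d ?N ?M" using key[OF U(3) UL Us] by auto
    have 2: "conn d ?N ?M U S" "S \<in> csimp d ?N ?M" using key[OF conn_sym[OF U(2)] UL Us] by auto
    have "conn d ?N ?M S T" using conn_sym[OF 2(1)] 1(1) by (rule rtranclp_trans)
    then show ?thesis unfolding dlink_def clink_def using 1 2 ST by blast
  qed
  then show ?thesis unfolding hit_def using dlink_mono[OF res_le order_refl order_refl] by fastforce
qed

text \<open>A chain from the shell to within \<open>\<rho>\<close> of \<open>v\<close> is, seen from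
  \<open>v\<close>, an arm about as long as the distance from \<open>v\<close> to the shell.
  Subtracting 2 leaves a margin for the thickness \<open>\<rho>\<close> of the shell; for
  \<open>k < 3\<close> the bound is the trivial value 1 of \<open>arm\<close>.\<close>

lemma reveal_prob:
  assumes "finite V" "V \<subseteq> (lat :: (real^'n) set)" "v \<in> V"
  shows "E V (\<lambda>c. of_bool (v \<in> reveal V s c)) \<le> arm TYPE('n) d \<rho> (nat \<lfloor>\<bar>norm v / \<rho> - s\<bar>\<rfloor> - 2) \<mu>"
proof -
  define k where "k = nat \<lfloor>\<bar>norm v / \<rho> - s\<bar>\<rfloor> - 2"
  show ?thesis unfolding k_def[symmetric]
  proof (cases "k < 3")
    case True
    then show "E V (\<lambda>c. of_bool (v \<in> reveal V s c)) \<le> arm TYPE('n) d \<rho> k \<mu>"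
      unfolding arm_def using E_le_1[OF assms(1), of "\<lambda>c. of_bool (v \<in> reveal V s c)"] by simp
  next
    case False
    have "real k + 2 \<le> \<bar>norm v / \<rho> - s\<bar>" using False unfolding k_def by linarith
    then have "(real k + 2) * \<rho> \<le> \<bar>norm v / \<rho> - s\<bar> * \<rho>" using \<rho> by (intro mult_right_mono) auto
    also have "\<dots> = \<bar>norm v - s * \<rho>\<bar>" using \<rho> by (simp add: abs_mult_pos left_diff_distrib)
    finally have far': "(real k + 2) * \<rho> \<le> \<bar>norm v - s * \<rho>\<bar>" .
    have d1: "(real k + 1) * \<rho> \<le> dist v x" if "x \<in> shell s" for x
      using that far' norm_triangle_ineq3[of v x] \<rho> unfolding shell_def dist_norm
      by (auto simp: algebra_simps abs_if split: if_splits)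
    have "dlink d \<rho> c (cball v (2 * \<rho>)) (far v (k * \<rho>))" if "v \<in> reveal V s c" for c
    proof -
      have "\<not> dist v x \<le> \<rho>" if "x \<in> shell s" for x
      proof -
        have "\<rho> < (real k + 1) * \<rho>" using False \<rho> by auto
        then show ?thesis using d1[OF that] by linarith
      qed
      then obtain S T p where S: "S \<in> csimp d (near \<rho>) (lab c)" "S \<inter> shell s \<times> UNIV \<noteq> {}"
        "conn d (near \<rho>) (lab c) S T" "p \<in> T" "dist v (fst p) \<le> \<rho>"
        using \<open>v \<in> reveal V s c\<close> unfolding reveal_def by blast
      have "S \<inter> far v (k * \<rho>) \<times> UNIV \<noteq> {}"
        using S(2) d1 \<rho> unfolding far_def by (force simp: disjoint_iff algebra_simps)
      moreover have "T \<inter> cball v (2 * \<rho>) \<times> UNIV \<noteq> {}"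
        using S(4,5) \<rho> by (cases p) (auto simp: disjoint_iff intro!: exI[of _ "fst p"])
      ultimately show ?thesis unfolding dlink_def clink_def
        using S conn_sym[OF S(3)] conn_csimp[OF S(3,1)] by blast
    qed
    then have "E V (\<lambda>c. of_bool (v \<in> reveal V s c))
        \<le> E V (\<lambda>c. of_bool (dlink d \<rho> c (cball v (2 * \<rho>)) (far v (k * \<rho>))))"
      by (intro E_mono) (auto simp: of_bool_def)
    also have "\<dots> \<le> arm TYPE('n) d \<rho> k \<mu>"
      using assms False by (intro link_prob_le_arm) auto
    finally show "E V (\<lambda>c. of_bool (v \<in> reveal V s c)) \<le> arm TYPE('n) d \<rho> k \<mu>" .
  qed
qed

end

text \<open>On each side of \<open>a\<close> the integer part of the distance takes every value at
  most once, which gives a factor 2. The shift by 2 repeats the term F 0 = 1 twice more and at most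
  triples the sum, which is at least 1.\<close>

lemma sum_shift_le:
  fixes F :: "nat \<Rightarrow> real"
  assumes "F 0 = 1" "\<And>k. 0 \<le> F k" "\<And>k. F k \<le> 1" "0 \<le> a" "a \<le> real n + 1" "1 \<le> n"
  shows "(\<Sum>s\<in>{2..<n}. F (nat \<lfloor>\<bar>a - real s\<bar>\<rfloor> - 2)) \<le> 6 * (\<Sum>k<n. F k)"
proof -
  define G where "G j = F (j - 2)" for j
  have G0: "0 \<le> G j" for j unfolding G_def using assms by auto
  have S1: "1 \<le> (\<Sum>k<n. F k)" using sum_mono2[of "{..<n}" "{0}" F] assms by auto
  have SG: "(\<Sum>j<n. G j) \<le> 3 * (\<Sum>k<n. F k)"
  proof -
    have "(\<Sum>j<m. G j) \<le> 2 + (\<Sum>k<m. F k)" for m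
    proof -
      have "(\<Sum>j<m + 2. G j) = 2 + (\<Sum>k<m. F k)"
        by (induction m) (auto simp: G_def assms numeral_2_eq_2)
      moreover have "(\<Sum>j<m. G j) \<le> (\<Sum>j<m + 2. G j)" using G0 by (intro sum_mono2) auto
      ultimately show ?thesis by simp
    qed
    from this[of n] show ?thesis using S1 by linarith
  qed
  define A where "A = {s\<in>{2..<n}. real s \<le> a}"
  define B where "B = {s\<in>{2..<n}. a < real s}"
  have AB: "{2..<n} = A \<union> B" "A \<inter> B = {}" "finite A" "finite B" unfolding A_def B_def by auto
  have "(\<Sum>s\<in>{2..<n}. G (nat \<lfloor>\<bar>a - real s\<bar>\<rfloor>)) =
      (\<Sum>s\<in>A. G (nat \<lfloor>\<bar>a - real s\<bar>\<rfloor>)) + (\<Sum>s\<in>B. G (nat \<lfloor>\<bar>a - real s\<bar>\<rfloor>))"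
    unfolding AB(1) by (rule sum.union_disjoint[OF AB(3,4,2)])
  moreover have "(\<Sum>s\<in>A. G (nat \<lfloor>\<bar>a - real s\<bar>\<rfloor>)) \<le> (\<Sum>j<n. G j)"
  proof -
    have e: "nat \<lfloor>\<bar>a - real s\<bar>\<rfloor> = nat \<lfloor>a\<rfloor> - s" if "s \<in> A" for s
    proof -
      have "\<bar>a - real s\<bar> = a - real s" using that unfolding A_def by auto
      then show ?thesis by (simp add: floor_diff_of_int[of a "int s", simplified] nat_diff_distrib')
    qed
    have "inj_on (\<lambda>s. nat \<lfloor>\<bar>a - real s\<bar>\<rfloor>) A"
    proof (rule inj_onI)
      fix s t assume st: "s \<in> A" "t \<in> A" "nat \<lfloor>\<bar>a - real s\<bar>\<rfloor> = nat \<lfloor>\<bar>a - real t\<bar>\<rfloor>"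
      have "s \<le> nat \<lfloor>a\<rfloor>" "t \<le> nat \<lfloor>a\<rfloor>" using st unfolding A_def by (auto simp: le_nat_floor)
      then show "s = t" using st e by simp
    qed
    then have "(\<Sum>s\<in>A. G (nat \<lfloor>\<bar>a - real s\<bar>\<rfloor>)) = (\<Sum>j\<in>(\<lambda>s. nat \<lfloor>\<bar>a - real s\<bar>\<rfloor>) ` A. G j)"
      by (simp add: sum.reindex)
    also have "\<dots> \<le> (\<Sum>j<n. G j)"
    proof (rule sum_mono2)
      show "(\<lambda>s. nat \<lfloor>\<bar>a - real s\<bar>\<rfloor>) ` A \<subseteq> {..<n}"
      proof
        fix j assume "j \<in> (\<lambda>s. nat \<lfloor>\<bar>a - real s\<bar>\<rfloor>) ` A"
        then obtain s where s: "s \<in> A" "j = nat \<lfloor>a\<rfloor> - s" using e by auto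
        have "nat \<lfloor>a\<rfloor> \<le> n + 1" using assms(4,5) by linarith
        then show "j \<in> {..<n}" using s assms(6) unfolding A_def by auto
      qed
    qed (auto simp: G0)
    finally show ?thesis .
  qed
  moreover have "(\<Sum>s\<in>B. G (nat \<lfloor>\<bar>a - real s\<bar>\<rfloor>)) \<le> (\<Sum>j<n. G j)"
  proof -
    have e: "nat \<lfloor>\<bar>a - real s\<bar>\<rfloor> = s - nat \<lceil>a\<rceil>" if "s \<in> B" for s
    proof -
      have "\<bar>a - real s\<bar> = real s - a" using that unfolding B_def by auto
      moreover have "\<lfloor>real s - a\<rfloor> = int s - \<lceil>a\<rceil>" by linarith
      ultimately show ?thesis using assms(4) by (simp add: nat_diff_distrib')
    qed
    have le: "nat \<lceil>a\<rceil> \<le> s" if "s \<in> B" for s using that unfolding B_def by (auto simp: ceiling_le_iff nat_le_iff)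
    have "inj_on (\<lambda>s. nat \<lfloor>\<bar>a - real s\<bar>\<rfloor>) B"
      using e le by (intro inj_onI) (metis diff_diff_cancel eq_diff_iff)
    then have "(\<Sum>s\<in>B. G (nat \<lfloor>\<bar>a - real s\<bar>\<rfloor>)) = (\<Sum>j\<in>(\<lambda>s. nat \<lfloor>\<bar>a - real s\<bar>\<rfloor>) ` B. G j)"
      by (simp add: sum.reindex)
    also have "\<dots> \<le> (\<Sum>j<n. G j)"
      using e by (intro sum_mono2) (auto simp: G0 B_def)
    finally show ?thesis .
  qed
  ultimately show ?thesis using SG unfolding G_def by linarith
qed

section \<open>The differential inequality for arm probabilities\<close>

definition arm_deriv :: "'n::finite itself \<Rightarrow> nat \<Rightarrow> real \<Rightarrow> nat \<Rightarrow> real \<Rightarrow> real" where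
  "arm_deriv D d \<rho> n \<mu> = (\<Sum>v\<in>(win \<rho> n :: (real^'n) set). pexp (tpw (d + 1) \<mu>) (d + 1) (win \<rho> n)
     (\<lambda>c. \<Sum>k<d + 1. tpw (d + 1) \<mu> k * (hit d \<rho> n (c(v := Suc k)) - hit d \<rho> n (c(v := k)))))"

lemma arm_has_deriv:
  assumes "1 \<le> \<rho>" "0 \<le> \<mu>" "3 \<le> n"
  shows "(arm TYPE('n::finite) d \<rho> n has_real_derivative arm_deriv TYPE('n) d \<rho> n \<mu>) (at \<mu>)"
proof -
  have fin: "finite (win \<rho> n :: (real^'n) set)" using assms by (intro finite_lat_card) auto
  have "arm TYPE('n::finite) d \<rho> n = (\<lambda>\<mu>. pexp (tpw (d + 1) \<mu>) (d + 1) (win \<rho> n :: (real^'n) set) (hit d \<rho> n))"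
    using assms(3) unfolding arm_def by (intro ext) simp
  then show ?thesis unfolding arm_deriv_def
    using pexp_tpw_deriv[OF fin _ assms(2), of "d + 1" "hit d \<rho> n"] by simp
qed

text \<open>Sum the exploration bound over the shells s = 2, ..., n - 1. The revealments of a fixed
  cell add up to at most 6 times the sum of the arms (\<open>sum_shift_le\<close>), and
  \<open>infl_le_deriv\<close> turns influences into derivatives with factor 2 \<mu>. Finally n
  \<le> 3 (n - 2) yields 36 = 3 * 6 * 2.\<close>

lemma arm_diff_ineq:
  assumes d: "1 \<le> d" and \<rho>: "1 \<le> \<rho>" and \<mu>: "0 \<le> \<mu>" "\<mu> \<le> 1" and n: "3 \<le> n"
  shows "n * (arm TYPE('n::finite) d \<rho> n \<mu> * (1 - arm TYPE('n) d \<rho> n \<mu>))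
    \<le> 36 * \<mu> * (\<Sum>k<n. arm TYPE('n) d \<rho> k \<mu>) * arm_deriv TYPE('n) d \<rho> n \<mu>"
proof -
  interpret weights "tpw (d + 1) \<mu>" "d + 1" by (rule weights_tpw[OF \<mu>(1)])
  define V where "V = (win \<rho> n :: (real^'n) set)"
  define a where "a k = arm TYPE('n) d \<rho> k \<mu>" for k
  define S where "S = (\<Sum>k<n. a k)"
  define I where "I v = E V (\<lambda>c. hit d \<rho> n c - hit d \<rho> n (c(v := 0)))" for v
  define J where "J v = E V (\<lambda>c. \<Sum>k<d + 1. tpw (d + 1) \<mu> k * (hit d \<rho> n (c(v := Suc k)) - hit d \<rho> n (c(v := k))))" for v
  define kk where "kk s v = nat \<lfloor>\<bar>norm v / \<rho> - real s\<bar>\<rfloor> - 2" for s and v :: "real^'n"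
  have fin: "finite V" unfolding V_def using \<rho> by (intro finite_lat_card) auto
  have lat: "V \<subseteq> lat" unfolding V_def by auto
  have mono: "mono (hit d \<rho> n :: (real^'n \<Rightarrow> nat) \<Rightarrow> real)" by (rule mono_hit)
  have h01: "0 \<le> hit d \<rho> n c" "hit d \<rho> n c \<le> 1" for c :: "real^'n \<Rightarrow> nat" by (simp_all add: hit_def)
  have I0: "0 \<le> I v" for v unfolding I_def
  proof (rule E_nonneg)
    fix c :: "real^'n \<Rightarrow> nat"
    have "c(v := 0) \<le> c" by (simp add: le_fun_def)
    from monoD[OF mono this] show "0 \<le> hit d \<rho> n c - hit d \<rho> n (c(v := 0))" by linarith
  qed
  have IJ: "I v \<le> 2 * \<mu> * J v" if "v \<in> V" for v
    unfolding I_def J_def by (rule infl_le_deriv[OF fin that mono \<mu>])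
  have an: "a n = E V (hit d \<rho> n)" using n unfolding a_def arm_def V_def by simp
  have sq: "E V (\<lambda>c. hit d \<rho> n c * hit d \<rho> n c) = a n" unfolding an by (intro pexp_cong) (simp add: hit_def)
  have one: "a n - a n * a n \<le> (\<Sum>v\<in>V. a (kk s v) * I v)" if s: "s \<in> {2..<n}" for s
  proof -
    have "E V (\<lambda>c. hit d \<rho> n c * hit d \<rho> n c) - E V (hit d \<rho> n) * E V (hit d \<rho> n)
        \<le> (\<Sum>v\<in>V. E V (\<lambda>c. of_bool (v \<in> reveal d \<rho> V s c)) * E V (\<lambda>c. hit d \<rho> n c - hit d \<rho> n (c(v := 0))))"
    proof (rule osss_explore[OF fin])
      show "reveal d \<rho> V s c \<subseteq> V" for c unfolding reveal_def[OF d \<rho> \<mu>(1)] by auto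
      show "c \<le> c' \<Longrightarrow> reveal d \<rho> V s c \<subseteq> reveal d \<rho> V s c'" for c c'
        by (rule reveal_mono[OF d \<rho> \<mu>(1)])
      show "hit d \<rho> n (res B c) = hit d \<rho> n c" if "c \<in> cfg (d + 1) V" "B \<subseteq> V" "reveal d \<rho> V s (res B c) \<subseteq> B" for B c
        using s by (intro hit_reveal[OF d \<rho> \<mu>(1) that(1,3)]) auto
    qed (rule mono h01)+
    also have "\<dots> \<le> (\<Sum>v\<in>V. a (kk s v) * I v)"
      unfolding I_def[symmetric] a_def kk_def
      by (intro sum_mono mult_right_mono I0 reveal_prob[OF d \<rho> \<mu>(1) fin lat]) auto
    finally show ?thesis unfolding sq an[symmetric] .
  qed
  have "real (n - 2) * (a n - a n * a n) = (\<Sum>s\<in>{2..<n}. a n - a n * a n)" by simp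
  also have "\<dots> \<le> (\<Sum>s\<in>{2..<n}. \<Sum>v\<in>V. a (kk s v) * I v)" by (intro sum_mono one)
  also have "\<dots> = (\<Sum>v\<in>V. (\<Sum>s\<in>{2..<n}. a (kk s v)) * I v)" by (subst sum.swap) (simp add: sum_distrib_right)
  also have "\<dots> \<le> (\<Sum>v\<in>V. (6 * S) * (2 * \<mu> * J v))"
  proof (intro sum_mono mult_mono IJ I0)
    fix v assume v: "v \<in> V"
    have "norm v / \<rho> \<le> real n + 1" using v \<rho> unfolding V_def by (auto simp: field_simps)
    then show "(\<Sum>s\<in>{2..<n}. a (kk s v)) \<le> 6 * S" unfolding S_def kk_def using n \<rho>
      by (intro sum_shift_le) (auto simp: a_def arm_bounds[OF d \<rho> \<mu>(1)] arm_def[of _ _ _ 0])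
    show "0 \<le> 6 * S" unfolding S_def a_def using arm_bounds[OF d \<rho> \<mu>(1)] by (auto intro!: sum_nonneg)
  qed
  also have "\<dots> = 12 * \<mu> * S * (\<Sum>v\<in>V. J v)" unfolding sum_distrib_left by (intro sum.cong) auto
  also have "(\<Sum>v\<in>V. J v) = arm_deriv TYPE('n) d \<rho> n \<mu>" unfolding J_def V_def arm_deriv_def ..
  finally have 1: "real (n - 2) * (a n - a n * a n) \<le> 12 * \<mu> * S * arm_deriv TYPE('n) d \<rho> n \<mu>" .
  have "0 \<le> a n" "a n \<le> 1" unfolding a_def by (rule arm_bounds[OF d \<rho> \<mu>(1)])+
  then have "0 \<le> a n - a n * a n" using mult_left_le[of "a n" "a n"] by simp
  then have "real n * (a n - a n * a n) \<le> (3 * real (n - 2)) * (a n - a n * a n)"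
    using n by (intro mult_right_mono) (auto simp: of_nat_diff)
  also have "\<dots> \<le> 36 * \<mu> * S * arm_deriv TYPE('n) d \<rho> n \<mu>" using mult_left_mono[OF 1, of 3] by (simp add: mult_ac)
  finally show ?thesis unfolding a_def[symmetric] S_def[symmetric] by (simp add: algebra_simps)
qed

lemma pexp_all_zero:
  assumes "finite W"
  shows "pexp w K W (\<lambda>c. of_bool (\<forall>u\<in>W. c u = 0)) = w 0 ^ card W"
proof -
  have "pexp w K W (\<lambda>c. of_bool (\<forall>u\<in>W. c u = 0)) = (\<Sum>c\<in>{\<lambda>_. 0}. (\<Prod>v\<in>W. w (c v)) * of_bool (\<forall>u\<in>W. c u = 0))"
    unfolding pexp_def
  proof (rule sum.mono_neutral_right[OF finite_cfg[OF assms]])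
    show "\<forall>c\<in>cfg K W - {\<lambda>_. 0}. (\<Prod>v\<in>W. w (c v)) * of_bool (\<forall>u\<in>W. c u = 0) = 0"
    proof
      fix c assume c: "c \<in> cfg K W - {\<lambda>_. 0}"
      then obtain x where "c x \<noteq> 0" by auto
      moreover from this have "x \<in> W" using c by (auto simp: cfg_def)
      ultimately show "(\<Prod>v\<in>W. w (c v)) * of_bool (\<forall>u\<in>W. c u = 0) = 0" by auto
    qed
  qed (auto simp: cfg_def)
  then show ?thesis by simp
qed

text \<open>An arm needs a point in the ball of radius 2 \<rho>, which holds at most (5 \<rho>)^D
  cells. This keeps the factor 1 - \<theta> of \<open>arm_diff_ineq\<close> away from 0, uniformly
  in n and in \<rho> while \<mu> \<rho>^D stays bounded.\<close>

lemma arm_le: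
  assumes d: "1 \<le> d" and \<rho>: "1 \<le> \<rho>" and \<mu>: "0 \<le> \<mu>" and n: "3 \<le> n"
  shows "arm TYPE('n::finite) d \<rho> n \<mu> \<le> 1 - exp (- (5 ^ CARD('n) * (\<mu> * \<rho> ^ CARD('n))))"
proof -
  interpret weights "tpw (d + 1) \<mu>" "d + 1" by (rule weights_tpw[OF \<mu>(1)])
  define V where "V = (win \<rho> n :: (real^'n) set)"
  define W where "W = (lat \<inter> cball 0 (2 * \<rho>) :: (real^'n) set)"
  have fin: "finite V" "finite W" unfolding V_def W_def using \<rho> by (auto intro!: finite_lat_card)
  have "2 * \<rho> \<le> n * \<rho> + \<rho>" using n \<rho> mult_right_mono[of 2 "real n" \<rho>] by auto
  then have WV: "W \<subseteq> V" unfolding W_def V_def by auto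
  have "arm TYPE('n) d \<rho> n \<mu> = E V (hit d \<rho> n)" using n unfolding arm_def V_def by simp
  also have "\<dots> \<le> E V (\<lambda>c. 1 - of_bool (\<forall>u\<in>W. c u = 0))"
  proof (rule E_mono)
    fix c assume c: "c \<in> cfg (d + 1) V"
    have "\<not> dlink d \<rho> c (cball 0 (2 * \<rho>)) (far 0 (n * \<rho>))" if z: "\<forall>u\<in>W. c u = 0"
    proof
      assume "dlink d \<rho> c (cball 0 (2 * \<rho>)) (far 0 (n * \<rho>))"
      then obtain S where S: "S \<in> csimp d (near \<rho>) (lab c)" "S \<inter> cball 0 (2 * \<rho>) \<times> UNIV \<noteq> {}"
        unfolding dlink_def clink_def by blast
      then obtain p where p: "p \<in> S" "fst p \<in> cball 0 (2 * \<rho>)" by auto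
      obtain u i where "p = (u, i)" by (cases p)
      then have ui: "(u, i) \<in> lab c" "u \<in> cball 0 (2 * \<rho>)" using csimpD(1)[OF S(1)] p by auto
      then have "c u \<noteq> 0" unfolding lab_def by auto
      moreover from this have "u \<in> V" using c unfolding cfg_def by auto
      then have "u \<in> W" using ui unfolding W_def V_def by auto
      ultimately show False using z by auto
    qed
    then show "hit d \<rho> n c \<le> 1 - of_bool (\<forall>u\<in>W. c u = 0)" unfolding hit_def by auto
  qed
  also have "\<dots> = 1 - E V (\<lambda>c. of_bool (\<forall>u\<in>W. c u = 0))" unfolding pexp_diff E_const[OF fin(1)] ..
  also have "E V (\<lambda>c. of_bool (\<forall>u\<in>W. c u = 0)) = E W (\<lambda>c. of_bool (\<forall>u\<in>W. c u = 0))"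
  proof (rule E_superset[OF fin(1) WV])
    fix c :: "real^'n \<Rightarrow> nat" and v k assume "v \<in> V - W"
    then have "\<forall>u\<in>W. (c(v := k)) u = c u" by auto
    then show "of_bool (\<forall>u\<in>W. (c(v := k)) u = 0) = (of_bool (\<forall>u\<in>W. c u = 0) :: real)" by auto
  qed
  also have "\<dots> = exp (- \<mu>) ^ card W" unfolding pexp_all_zero[OF fin(2)] by (simp add: tpw_def)
  also have "\<dots> = exp (- (card W * \<mu>))" by (simp add: exp_of_nat_mult[symmetric])
  also have "1 - \<dots> \<le> 1 - exp (- (5 ^ CARD('n) * (\<mu> * \<rho> ^ CARD('n))))"
  proof -
    have "card W \<le> (2 * (2 * \<rho>) + 1) ^ CARD('n)" unfolding W_def using \<rho> by (intro finite_lat_card) auto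
    also have "\<dots> \<le> (5 * \<rho>) ^ CARD('n)" using \<rho> by (intro power_mono) auto
    finally have "card W * \<mu> \<le> (5 * \<rho>) ^ CARD('n) * \<mu>" using \<mu> by (intro mult_right_mono)
    then show ?thesis by (simp add: power_mult_distrib mult_ac)
  qed
  finally show ?thesis .
qed

text \<open>The lower bound for 1 - \<theta> from \<open>arm_le\<close>, divided by the constant of
  \<open>arm_diff_ineq\<close> at the largest parameter \<open>b\<close>. It is free of
  \<rho>.\<close>

definition slope :: "'n::finite itself \<Rightarrow> real \<Rightarrow> real" where
  "slope D b = exp (- (5 ^ CARD('n) * b)) / (36 * b)"

text \<open>In the variable x = \<mu> \<rho>^D the factor \<mu> = x / \<rho>^D of
  \<open>arm_diff_ineq\<close> is absorbed by the factor 1 / \<rho>^D of the chain rule. The bound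
  on \<open>b\<close> keeps \<mu> \<le> 1, as \<open>infl_le_deriv\<close> requires.\<close>

lemma arm_threshold:
  assumes d: "1 \<le> d" and \<rho>: "1 \<le> \<rho>" and b: "0 < b" "b \<le> \<rho> ^ CARD('n::finite)"
  obtains \<beta> where "0 \<le> \<beta>" "\<beta> \<le> b"
    "\<And>x. 0 < x \<Longrightarrow> x < \<beta> \<Longrightarrow> \<exists>\<alpha>>0. \<forall>n\<ge>3. arm TYPE('n) d \<rho> n (x / \<rho> ^ CARD('n)) \<le> exp (- \<alpha> * n)"
    "\<And>x m. \<beta> < x \<Longrightarrow> x \<le> b \<Longrightarrow> slope TYPE('n) b * (x - \<beta>) \<le> arm TYPE('n) d \<rho> m (x / \<rho> ^ CARD('n))"
proof -
  define R where "R = \<rho> ^ CARD('n)"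
  have R: "0 < R" unfolding R_def using \<rho> by simp
  interpret dichotomy "\<lambda>n x. arm TYPE('n) d \<rho> n (x / R)" "\<lambda>n x. arm_deriv TYPE('n) d \<rho> n (x / R) / R" b "slope TYPE('n) b"
  proof
    show "0 < slope TYPE('n) b" unfolding slope_def using b by simp
    show "0 < b" by (rule b)
    show "arm TYPE('n) d \<rho> 0 (x / R) = 1" for x by (simp add: arm_def)
    fix n x assume x: "0 < x" "x \<le> b"
    have \<mu>: "0 \<le> x / R" "x / R \<le> 1" using x b R unfolding R_def by (auto simp: field_simps)
    show "0 \<le> arm TYPE('n) d \<rho> n (x / R)" by (rule arm_bounds[OF d \<rho> \<mu>(1)])
    show "arm TYPE('n) d \<rho> (Suc n) (x / R) \<le> arm TYPE('n) d \<rho> n (x / R)"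
      by (rule arm_antimono_Suc[OF d \<rho> \<mu>(1)])
    assume n: "3 \<le> n"
    show "((\<lambda>x. arm TYPE('n) d \<rho> n (x / R)) has_real_derivative arm_deriv TYPE('n) d \<rho> n (x / R) / R) (at x)"
      using DERIV_chain2[OF arm_has_deriv[OF \<rho> \<mu>(1) n] DERIV_cdivide[OF DERIV_ident, of R x]] by simp
    define a where "a = arm TYPE('n) d \<rho> n (x / R)"
    define S where "S = (\<Sum>k<n. arm TYPE('n) d \<rho> k (x / R))"
    define a' where "a' = arm_deriv TYPE('n) d \<rho> n (x / R)"
    define e where "e = exp (- (5 ^ CARD('n) * b))"
    have a0: "0 \<le> a" unfolding a_def by (rule arm_bounds[OF d \<rho> \<mu>(1)])
    have "a \<le> 1 - exp (- (5 ^ CARD('n) * (x / R * \<rho> ^ CARD('n))))"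
      unfolding a_def by (rule arm_le[OF d \<rho> \<mu>(1) n])
    also have "x / R * \<rho> ^ CARD('n) = x" unfolding R_def[symmetric] using R by simp
    also have "1 - exp (- (5 ^ CARD('n) * x)) \<le> 1 - e" unfolding e_def using x by simp
    finally have "e \<le> 1 - a" by simp
    then have "n * (a * e) \<le> n * (a * (1 - a))" using a0 by (intro mult_left_mono) auto
    also have "\<dots> \<le> 36 * (x / R) * S * a'" unfolding a_def S_def a'_def by (rule arm_diff_ineq[OF d \<rho> \<mu> n])
    finally have 1: "n * (a * e) \<le> 36 * x * (S * (a' / R))" by (simp add: mult_ac)
    \<comment> \<open>The sign of \<open>S * (a' / R)\<close> is settled first, so that
      \<open>x\<close> may be enlarged to \<open>b\<close>.\<close>
    have "0 \<le> n * (a * e)" using a0 unfolding e_def by simp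
    then have "0 \<le> S * (a' / R)" using 1 x by (smt (verit) mult_pos_neg)
    then have "36 * x * (S * (a' / R)) \<le> 36 * b * (S * (a' / R))" using x by (intro mult_right_mono) auto
    with 1 have "n * (a * e) \<le> 36 * b * (S * (a' / R))" by linarith
    then have "e / (36 * b) * n * a \<le> S * (a' / R)" using b by (simp add: field_simps)
    then show "slope TYPE('n) b * n * arm TYPE('n) d \<rho> n (x / R)
        \<le> (\<Sum>k<n. arm TYPE('n) d \<rho> k (x / R)) * (arm_deriv TYPE('n) d \<rho> n (x / R) / R)"
      unfolding slope_def e_def a_def S_def a'_def by simp
  qed
  show ?thesis using threshold that unfolding R_def by metis
qed

subsection \<open>Coarsening a point set to labelled cells\<close>

definition counts :: "nat \<Rightarrow> ('a \<Rightarrow> 'v) \<Rightarrow> 'a set \<Rightarrow> 'v \<Rightarrow> nat" where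
  "counts K \<kappa> L u = min (card {x\<in>L. \<kappa> x = u}) K"

lemma card_lab_fibres:
  assumes "finite S"
  shows "card (lab (\<lambda>u. card {x\<in>S. \<kappa> x = u})) = card S" "finite (lab (\<lambda>u. card {x\<in>S. \<kappa> x = u}))"
proof -
  have e: "lab (\<lambda>u. card {x\<in>S. \<kappa> x = u}) = (SIGMA u:\<kappa> ` S. {..<card {x\<in>S. \<kappa> x = u}})"
    using assms by (auto simp: lab_def card_gt_0_iff intro: ccontr)
      (metis (mono_tags, lifting) card.empty empty_Collect_eq image_eqI not_less_zero)
  show "finite (lab (\<lambda>u. card {x\<in>S. \<kappa> x = u}))" unfolding e using assms by auto
  have "card (lab (\<lambda>u. card {x\<in>S. \<kappa> x = u})) = (\<Sum>u\<in>\<kappa> ` S. card {x\<in>S. \<kappa> x = u})"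
    unfolding e using assms by (subst card_SigmaI) auto
  also have "\<dots> = (\<Sum>u\<in>\<kappa> ` S. \<Sum>x\<in>{x\<in>S. \<kappa> x = u}. 1)" by simp
  also have "\<dots> = (\<Sum>x\<in>S. 1)" by (rule sum.image_gen[OF assms, symmetric])
  finally show "card (lab (\<lambda>u. card {x\<in>S. \<kappa> x = u})) = card S" by simp
qed

text \<open>Counts are capped, so points cannot be mapped injectively to labels. Instead a simplex
  is replaced by the lowest labels of each cell, as many as it has points there
  (\<open>can\<close>); with d + 1 points it never exceeds the cap. If two simplices share d points,
  their replacements share at least the d labels of the common part.\<close>

lemma clink_coarsen:
  assumes fin: "\<And>u. finite {x\<in>L. \<kappa> x = u}"
    and N: "\<And>x y. x \<in> L \<Longrightarrow> y \<in> L \<Longrightarrow> N x y \<Longrightarrow> N' (\<kappa> x) (\<kappa> y)"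
    and AB: "\<And>x. x \<in> L \<inter> A \<Longrightarrow> \<kappa> x \<in> A'" "\<And>x. x \<in> L \<inter> B \<Longrightarrow> \<kappa> x \<in> B'"
    and cl: "clink d N L A B"
  shows "clink d (\<lambda>p q. N' (fst p) (fst q)) (lab (counts (d + 1) \<kappa> L)) (A' \<times> UNIV) (B' \<times> UNIV)"
proof -
  let ?M = "lab (counts (d + 1) \<kappa> L)" and ?N = "\<lambda>p q. N' (fst p) (fst q)"
  define can where "can S = lab (\<lambda>u. card {x\<in>S. \<kappa> x = u})" for S
  have can_fst: "fst p \<in> \<kappa> ` S" if "p \<in> can S" for p S
  proof -
    have "{x\<in>S. \<kappa> x = fst p} \<noteq> {}" using that unfolding can_def lab_def by (auto simp del: Collect_empty_eq)
    then obtain x where "x \<in> S" "\<kappa> x = fst p" by blast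
    then show ?thesis by (metis imageI)
  qed
  have can_simp: "can S \<in> csimp d ?N ?M" if S: "S \<in> csimp d N L" for S
  proof -
    note SD = csimpD[OF S]
    have "can S \<subseteq> ?M"
    proof -
      have "card {x\<in>S. \<kappa> x = u} \<le> counts (d + 1) \<kappa> L u" for u
      proof -
        have "card {x\<in>S. \<kappa> x = u} \<le> card {x\<in>L. \<kappa> x = u}" using SD(1) by (intro card_mono fin) auto
        moreover have "card {x\<in>S. \<kappa> x = u} \<le> card S" using SD(2) by (intro card_mono) auto
        ultimately show ?thesis using SD(3) unfolding counts_def by simp
      qed
      then show ?thesis unfolding can_def by (intro lab_mono) (simp add: le_fun_def)
    qed
    moreover have "?N p q" if pq: "p \<in> can S" "q \<in> can S" for p q
    proof -
      obtain x y where "x \<in> S" "fst p = \<kappa> x" "y \<in> S" "fst q = \<kappa> y" using can_fst[OF pq(1)] can_fst[OF pq(2)] by blast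
      then show ?thesis using N[of x y] SD by auto
    qed
    ultimately show ?thesis unfolding csimp_def can_def using card_lab_fibres[OF SD(2)] SD(3) by auto
  qed
  have can_conn: "conn d ?N ?M (can S) (can T)" if "conn d N L S T" for S T
    using that
  proof (induction rule: rtranclp_induct)
    case (step T U)
    have TU: "T \<in> csimp d N L" "U \<in> csimp d N L" "d \<le> card (T \<inter> U)" using step.hyps by (auto simp: cadj_def)
    have fTU: "finite T" "finite U" using TU csimpD by blast+
    have "card {x\<in>T \<inter> U. \<kappa> x = u} \<le> card {x\<in>T. \<kappa> x = u}" for u using fTU by (intro card_mono) auto
    moreover have "card {x\<in>T \<inter> U. \<kappa> x = u} \<le> card {x\<in>U. \<kappa> x = u}" for u using fTU by (intro card_mono) auto
    ultimately have "can (T \<inter> U) \<subseteq> can T \<inter> can U" unfolding can_def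
      by (intro Int_greatest lab_mono) (simp_all only: le_fun_def simp_thms)
    moreover have "finite (can T)" unfolding can_def using card_lab_fibres(2)[OF fTU(1)] .
    ultimately have "card (can (T \<inter> U)) \<le> card (can T \<inter> can U)" by (intro card_mono) auto
    moreover have "card (can (T \<inter> U)) = card (T \<inter> U)" unfolding can_def using fTU by (intro card_lab_fibres) auto
    ultimately have "cadj d ?N ?M (can T) (can U)" unfolding cadj_def using TU can_simp by auto
    then show ?case using step.IH by auto
  qed auto
  have can_touch: "can S \<inter> A' \<times> UNIV \<noteq> {}" if "S \<in> csimp d N L" "x \<in> S" "\<kappa> x \<in> A'" for S A' x
  proof -
    have "finite {y\<in>S. \<kappa> y = \<kappa> x}" using csimpD(2)[OF that(1)] by auto
    then have "0 < card {y\<in>S. \<kappa> y = \<kappa> x}" using that(2) by (auto simp: card_gt_0_iff)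
    then have "(\<kappa> x, 0) \<in> can S" unfolding can_def lab_def by auto
    then show ?thesis using that by auto
  qed
  obtain S T where ST: "S \<in> csimp d N L" "T \<in> csimp d N L" "S \<inter> A \<noteq> {}" "T \<inter> B \<noteq> {}" "conn d N L S T"
    using cl unfolding clink_def by auto
  obtain x where x: "x \<in> S" "x \<in> A" using ST by auto
  obtain y where y: "y \<in> T" "y \<in> B" using ST by auto
  have "can S \<inter> A' \<times> UNIV \<noteq> {}" using can_touch[OF ST(1) x(1)] AB(1)[of x] x csimpD(1)[OF ST(1)] by auto
  moreover have "can T \<inter> B' \<times> UNIV \<noteq> {}" using can_touch[OF ST(2) y(1)] AB(2)[of y] y csimpD(1)[OF ST(2)] by auto
  ultimately show ?thesis unfolding clink_def using can_simp[OF ST(1)] can_simp[OF ST(2)] can_conn[OF ST(5)] by blast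
qed

text \<open>Enumerating the points of each cell maps labels injectively to points, so
  \<open>clink_image\<close> carries the chain over.\<close>

lemma clink_refine:
  assumes fin: "\<And>u. finite {x\<in>L. \<kappa> x = u}"
    and N: "\<And>x y. x \<in> L \<Longrightarrow> y \<in> L \<Longrightarrow> N' (\<kappa> x) (\<kappa> y) \<Longrightarrow> N x y"
    and AB: "\<And>x. x \<in> L \<Longrightarrow> \<kappa> x \<in> A' \<Longrightarrow> x \<in> A" "\<And>x. x \<in> L \<Longrightarrow> \<kappa> x \<in> B' \<Longrightarrow> x \<in> B"
    and cl: "clink d (\<lambda>p q. N' (fst p) (fst q)) (lab (counts K \<kappa> L)) (A' \<times> UNIV) (B' \<times> UNIV)"
  shows "clink d N L A B"
proof -
  define F where "F u = {x\<in>L. \<kappa> x = u}" for u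
  have "\<exists>f. bij_betw f {..<card (F u)} (F u)" for u
    using ex_bij_betw_nat_finite[OF fin[of u]] unfolding F_def atLeast0LessThan by auto
  then obtain f where f: "\<And>u. bij_betw (f u) {..<card (F u)} (F u)" by metis
  have fF: "f u i \<in> L \<and> \<kappa> (f u i) = u" if "(u, i) \<in> lab (counts K \<kappa> L)" for u i
  proof -
    have "i < card (F u)" using that unfolding lab_def counts_def F_def by auto
    then have "f u i \<in> F u" using f[of u] by (auto simp: bij_betw_def)
    then show ?thesis unfolding F_def by auto
  qed
  show ?thesis
  proof (rule clink_image[where f = "\<lambda>(u, i). f u i", OF _ _ _ _ _ cl])
    show "inj_on (\<lambda>(u, i). f u i) (lab (counts K \<kappa> L))"
    proof (rule inj_onI, clarify)
      fix u i v j assume a: "(u, i) \<in> lab (counts K \<kappa> L)" "(v, j) \<in> lab (counts K \<kappa> L)" "f u i = f v j"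
      have uv: "u = v" using fF[OF a(1)] fF[OF a(2)] a(3) by auto
      have "i < card (F u)" "j < card (F u)" using a uv unfolding lab_def counts_def F_def by auto
      then show "u = v \<and> i = j" using a(3) uv f[of u] by (auto simp: bij_betw_def inj_on_def)
    qed
  qed (use fF N AB in \<open>auto\<close>)
qed

subsection \<open>Cells\<close>

definition cidx :: "real \<Rightarrow> real^'n \<Rightarrow> real^'n" where
  "cidx s x = (\<chi> i. of_int \<lfloor>x $ i / s\<rfloor>)"

lemma cidx_lat: "cidx s x \<in> lat"
  unfolding cidx_def lat_def by simp

lemma cidx_close:
  fixes x y :: "real^'n"
  assumes "0 < s"
  shows "norm ((x - y) - s *\<^sub>R (cidx s x - cidx s y)) \<le> s * sqrt CARD('n)"
proof -
  define z where "z = (x - y) - s *\<^sub>R (cidx s x - cidx s y)"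
  have "\<bar>z $ i\<bar> \<le> s" for i
  proof -
    define a b where "a = x $ i / s" and "b = y $ i / s"
    have "z $ i = s * ((a - \<lfloor>a\<rfloor>) - (b - \<lfloor>b\<rfloor>))"
      unfolding z_def cidx_def a_def b_def using assms by (simp add: algebra_simps)
    moreover have "\<bar>(a - \<lfloor>a\<rfloor>) - (b - \<lfloor>b\<rfloor>)\<bar> \<le> 1" by linarith
    ultimately show ?thesis using assms by (simp add: abs_mult mult_left_le)
  qed
  then have "(z $ i)\<^sup>2 \<le> s\<^sup>2" for i using assms by (metis abs_le_square_iff abs_of_pos)
  then have "(\<Sum>i\<in>UNIV. (z $ i)\<^sup>2) \<le> (\<Sum>i\<in>(UNIV :: 'n set). s\<^sup>2)" by (intro sum_mono)
  then have "sqrt (\<Sum>i\<in>UNIV. (z $ i)\<^sup>2) \<le> sqrt (CARD('n) * s\<^sup>2)" by simp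
  also have "\<dots> = s * sqrt CARD('n)" using assms by (simp add: real_sqrt_mult)
  finally show ?thesis unfolding z_def[symmetric] norm_vec_def L2_set_def by simp
qed

lemma cidx_dist:
  fixes x y :: "real^'n"
  assumes "0 < s"
  shows "dist x y \<le> s * (dist (cidx s x) (cidx s y) + sqrt CARD('n))"
    "s * dist (cidx s x) (cidx s y) \<le> dist x y + s * sqrt CARD('n)"
proof -
  have e: "norm (s *\<^sub>R (cidx s x - cidx s y)) = s * dist (cidx s x) (cidx s y)"
    using assms by (simp add: dist_norm)
  have "norm (x - y) \<le> norm (s *\<^sub>R (cidx s x - cidx s y)) + norm ((x - y) - s *\<^sub>R (cidx s x - cidx s y))"
    using norm_triangle_ineq[of "s *\<^sub>R (cidx s x - cidx s y)" "(x - y) - s *\<^sub>R (cidx s x - cidx s y)"] by simp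
  then show "dist x y \<le> s * (dist (cidx s x) (cidx s y) + sqrt CARD('n))"
    using cidx_close[OF assms, of x y] unfolding e by (simp add: dist_norm algebra_simps)
  have "norm (s *\<^sub>R (cidx s x - cidx s y)) \<le> norm (x - y) + norm ((x - y) - s *\<^sub>R (cidx s x - cidx s y))"
    using norm_triangle_ineq4[of "x - y" "(x - y) - s *\<^sub>R (cidx s x - cidx s y)"] by simp
  then show "s * dist (cidx s x) (cidx s y) \<le> dist x y + s * sqrt CARD('n)"
    using cidx_close[OF assms, of x y] unfolding e by (simp add: dist_norm)
qed

lemma cidx_0: "cidx s 0 = 0"
  unfolding cidx_def by (simp add: vec_eq_iff)

lemma cidx_norm:
  fixes x :: "real^'n"
  assumes "0 < s"
  shows "norm x \<le> s * (norm (cidx s x) + sqrt CARD('n))"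
    "s * norm (cidx s x) \<le> norm x + s * sqrt CARD('n)"
  using cidx_dist[OF assms, of x 0] by (simp_all add: cidx_0)

definition cell :: "real \<Rightarrow> real^'n \<Rightarrow> (real^'n) set" where
  "cell s u = {x. cidx s x = u}"

lemma cell_eq:
  assumes "0 < s" "u \<in> lat"
  shows "cell s u = {x. \<forall>i. s * u $ i \<le> x $ i \<and> x $ i < s * (u $ i + 1)}"
proof -
  have "cidx s x = u \<longleftrightarrow> (\<forall>i. s * u $ i \<le> x $ i \<and> x $ i < s * (u $ i + 1))" for x
  proof -
    have "of_int \<lfloor>x $ i / s\<rfloor> = u $ i \<longleftrightarrow> s * u $ i \<le> x $ i \<and> x $ i < s * (u $ i + 1)" for i
    proof -
      obtain k where k: "u $ i = of_int k" using assms(2) unfolding lat_def by (auto elim!: Ints_cases)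
      have "\<lfloor>x $ i / s\<rfloor> = k \<longleftrightarrow> of_int k \<le> x $ i / s \<and> x $ i / s < of_int k + 1" by linarith
      then show ?thesis unfolding k using assms(1) by (simp add: field_simps)
    qed
    then show ?thesis unfolding cidx_def vec_eq_iff by simp
  qed
  then show ?thesis unfolding cell_def by auto
qed

lemma cell_disjoint: "u \<noteq> v \<Longrightarrow> cell s u \<inter> cell s v = {}"
  unfolding cell_def by auto

lemma cell_bounded:
  fixes u :: "real^'n"
  assumes "0 < s"
  shows "bounded (cell s u)"
proof -
  have "norm x \<le> s * (norm u + sqrt CARD('n))" if "x \<in> cell s u" for x
    using cidx_norm(1)[OF assms, of x] that unfolding cell_def by simp
  then show ?thesis unfolding bounded_iff by blast
qed

lemma cell_measurable [measurable]:
  assumes "0 < s" "u \<in> lat"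
  shows "cell s u \<in> sets borel"
proof -
  have "(\<lambda>x::real^'a. x $ i) \<in> borel_measurable borel" for i
    by (intro borel_measurable_continuous_onI continuous_on_component continuous_on_id)
  then have "{x \<in> space borel. \<forall>i::'a. s * u $ i \<le> x $ i \<and> x $ i < s * (u $ i + 1)} \<in> sets borel"
    by measurable
  then show ?thesis unfolding cell_eq[OF assms] by simp
qed

lemma cell_volume:
  fixes u :: "real^'n"
  assumes "0 < s" "u \<in> lat"
  shows "measure lborel (cell s u) = s ^ CARD('n)"
proof -
  define a b where "a = s *\<^sub>R u" and "b = s *\<^sub>R u + (\<chi> i. s)"
  have 1: "box a b \<subseteq> cell s u" "cell s u \<subseteq> cbox a b"
    unfolding cell_eq[OF assms] a_def b_def by (auto simp: mem_box_cart algebra_simps less_imp_le)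
  have c: "measure lborel (cbox a b) = s ^ CARD('n)"
  proof -
    have "cbox a b \<noteq> {}" unfolding a_def b_def using assms by (auto simp: interval_ne_empty_cart)
    then have "measure lborel (cbox a b) = (\<Prod>i\<in>UNIV. b $ i - a $ i)" by (simp add: content_cbox_cart)
    then show ?thesis unfolding a_def b_def by simp
  qed
  have m: "measure lborel (box a b) = measure lborel (cbox a b)"
    by (simp add: measure_lborel_box_eq measure_lborel_cbox_eq)
  have "measure lborel (box a b) \<le> measure lborel (cell s u)"
    using 1 cell_measurable[OF assms] emeasure_lborel_cbox_finite[of a b] emeasure_mono[OF 1(2), of lborel]
    by (intro measure_mono_fmeasurable fmeasurableI) (auto intro: le_less_trans)
  moreover have "measure lborel (cell s u) \<le> measure lborel (cbox a b)"
    using 1 cell_measurable[OF assms] by (intro measure_mono_fmeasurable) auto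
  ultimately show ?thesis using c m by linarith
qed

text \<open>The part of \<open>is_PPP\<close> on which measurability rests, kept apart because it
  survives adding the origin (\<open>point_process_insert\<close>), while the Poisson law does
  not.\<close>

definition point_process :: "'a measure \<Rightarrow> ('a \<Rightarrow> (real^'n) set) \<Rightarrow> bool" where
  "point_process M Y \<longleftrightarrow> (\<forall>\<omega>\<in>space M. \<forall>B. bounded B \<longrightarrow> finite (Y \<omega> \<inter> B)) \<and>
     (\<forall>B\<in>sets lborel. bounded B \<longrightarrow> (\<lambda>\<omega>. card (Y \<omega> \<inter> B)) \<in> measurable M (count_space UNIV))"

lemma is_PPP_point_process: "is_PPP M X l \<Longrightarrow> point_process M X"
  unfolding is_PPP_def point_process_def by auto

section \<open>The law of the capped cell counts\<close>

lemma cell_fibre: "{x\<in>L. cidx s x = u} = L \<inter> cell s u"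
  unfolding cell_def by auto

lemma point_process_fibre_finite:
  assumes "point_process M Y" "\<omega> \<in> space M" "0 < s"
  shows "finite {x\<in>Y \<omega>. cidx s x = u}"
  using assms cell_bounded[OF assms(3)] unfolding cell_fibre point_process_def by blast

abbreviation ccounts :: "nat \<Rightarrow> real \<Rightarrow> (real^'n) set \<Rightarrow> (real^'n) set \<Rightarrow> real^'n \<Rightarrow> nat" where
  "ccounts d s V L \<equiv> res V (counts (d + 1) (cidx s) L)"

lemma ccounts_cfg: "ccounts d s V L \<in> cfg (d + 1) V"
  unfolding res_def cfg_def counts_def by auto

lemma ccounts_single_measurable:
  assumes Y: "point_process M Y" and s: "0 < s" and u: "u \<in> lat"
  shows "(\<lambda>\<omega>. counts K (cidx s) (Y \<omega>) u) \<in> measurable M (count_space UNIV)"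
proof -
  have "(\<lambda>\<omega>. card (Y \<omega> \<inter> cell s u)) \<in> measurable M (count_space UNIV)"
    using Y cell_measurable[OF s u] cell_bounded[OF s, of u] unfolding point_process_def sets_lborel by blast
  then show ?thesis unfolding counts_def cell_fibre by measurable
qed

lemma ccounts_event:
  assumes Y: "point_process M Y" and s: "0 < s" and V: "finite V" "V \<subseteq> lat"
  shows "{\<omega>\<in>space M. A (ccounts d s V (Y \<omega>))} \<in> sets M"
proof -
  have 1: "{\<omega>\<in>space M. ccounts d s V (Y \<omega>) = c} \<in> sets M" if c: "c \<in> cfg (d + 1) V" for c
  proof -
    have "{\<omega>\<in>space M. ccounts d s V (Y \<omega>) = c} = {\<omega>\<in>space M. \<forall>u\<in>V. counts (d + 1) (cidx s) (Y \<omega>) u = c u}"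
      using c unfolding res_def cfg_def by (auto simp: fun_eq_iff)
    moreover have "{\<omega>\<in>space M. counts (d + 1) (cidx s) (Y \<omega>) u = c u} \<in> sets M" if "u \<in> V" for u
    proof -
      have "(\<lambda>\<omega>. counts (d + 1) (cidx s) (Y \<omega>) u) -` {c u} \<inter> space M \<in> sets M"
        using ccounts_single_measurable[OF Y s] that V by (intro measurable_sets[where A = "count_space UNIV"]) auto
      then show ?thesis by (simp add: vimage_def Int_def conj_commute)
    qed
    ultimately show ?thesis using V(1) by (simp add: sets.sets_Collect_finite_All')
  qed
  have "{\<omega>\<in>space M. A (ccounts d s V (Y \<omega>))} = (\<Union>c\<in>{c\<in>cfg (d + 1) V. A c}. {\<omega>\<in>space M. ccounts d s V (Y \<omega>) = c})"
    using ccounts_cfg by auto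
  then show ?thesis using finite_cfg[OF V(1), of "d + 1"] 1 by (auto intro!: sets.finite_UN)
qed

lemma PPP_count_prob:
  assumes X: "is_PPP M X l" and l: "0 < l" and s: "0 < s" and u: "u \<in> (lat :: (real^'n) set)" and k: "k \<le> K"
  shows "measure M {\<omega>\<in>space M. counts K (cidx s) (X \<omega>) u = k} = tpw K (l * s ^ CARD('n)) k"
proof -
  interpret prob_space M using X unfolding is_PPP_def by simp
  define C where "C \<omega> = card (X \<omega> \<inter> cell s u)" for \<omega>
  define \<mu> where "\<mu> = l * s ^ CARD('n)"
  have c: "cell s u \<in> sets lborel" "bounded (cell s u)" using cell_measurable[OF s u] cell_bounded[OF s] by auto
  have m: "C \<in> measurable M (count_space UNIV)" using X c unfolding is_PPP_def C_def by blast
  have p: "measure M {\<omega>\<in>space M. C \<omega> = j} = exp (- \<mu>) * \<mu> ^ j / fact j" for j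
    using X c cell_volume[OF s u] unfolding is_PPP_def C_def \<mu>_def by simp
  have ms: "{\<omega>\<in>space M. C \<omega> = j} \<in> sets M" for j
    using measurable_sets[OF m, of "{j}"] by (simp add: vimage_def Int_def conj_commute)
  have e: "counts K (cidx s) (X \<omega>) u = min (C \<omega>) K" for \<omega> unfolding counts_def C_def cell_fibre ..
  show ?thesis
  proof (cases "k < K")
    case True
    then have "{\<omega>\<in>space M. counts K (cidx s) (X \<omega>) u = k} = {\<omega>\<in>space M. C \<omega> = k}" unfolding e by (auto simp: min_def)
    then show ?thesis using p True unfolding tpw_def \<mu>_def by simp
  next
    case False
    then have kK: "k = K" using k by simp
    have "{\<omega>\<in>space M. counts K (cidx s) (X \<omega>) u = k} = space M - (\<Union>j<K. {\<omega>\<in>space M. C \<omega> = j})"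
      unfolding e kK by (auto simp: min_def)
    also have "measure M \<dots> = 1 - measure M (\<Union>j<K. {\<omega>\<in>space M. C \<omega> = j})"
      using ms by (intro prob_compl) auto
    also have "measure M (\<Union>j<K. {\<omega>\<in>space M. C \<omega> = j}) = (\<Sum>j<K. measure M {\<omega>\<in>space M. C \<omega> = j})"
      using ms by (intro finite_measure_finite_Union) (auto simp: disjoint_family_on_def)
    finally show ?thesis unfolding p tpw_def kK \<mu>_def by simp
  qed
qed

lemma PPP_config_prob:
  fixes V :: "(real^'n) set"
  assumes X: "is_PPP M X l" and l: "0 < l" and s: "0 < s" and V: "finite V" "V \<subseteq> lat"
    and c: "c \<in> cfg (d + 1) V"
  shows "measure M {\<omega>\<in>space M. ccounts d s V (X \<omega>) = c} = (\<Prod>v\<in>V. tpw (d + 1) (l * s ^ CARD('n)) (c v))"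
proof -
  interpret prob_space M using X unfolding is_PPP_def by simp
  have e: "{\<omega>\<in>space M. ccounts d s V (X \<omega>) = c} = {\<omega>\<in>space M. \<forall>u\<in>V. counts (d + 1) (cidx s) (X \<omega>) u = c u}"
    using c unfolding res_def cfg_def by (auto simp: fun_eq_iff)
  show ?thesis
  proof (cases "V = {}")
    case True
    then show ?thesis unfolding e by (simp add: prob_space)
  next
    case False
    obtain f where f: "bij_betw f {..<card V} V" using ex_bij_betw_nat_finite[OF V(1)] by (auto simp: atLeast0LessThan)
    define n where "n = card V"
    have n0: "{..<n} \<noteq> {}" unfolding n_def lessThan_empty_iff using V False by auto
    define F where "F i = cell s (f i)" for i
    have fV: "f i \<in> V" if "i < n" for i using f that unfolding n_def bij_betw_def by auto
    have "indep_vars (\<lambda>_. count_space UNIV) (\<lambda>i \<omega>. card (X \<omega> \<inter> F i)) {..<n}"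
    proof -
      have "F i \<in> sets lborel \<and> bounded (F i)" if "i < n" for i
        using cell_measurable[OF s] cell_bounded[OF s] fV[OF that] V unfolding F_def by auto
      moreover have "disjoint_family_on F {..<n}"
        unfolding disjoint_family_on_def F_def
      proof (intro ballI impI)
        fix i j assume "i \<in> {..<n}" "j \<in> {..<n}" "i \<noteq> j"
        then have "f i \<noteq> f j" using f unfolding bij_betw_def n_def inj_on_def by auto
        then show "cell s (f i) \<inter> cell s (f j) = {}" by (rule cell_disjoint)
      qed
      ultimately show ?thesis using X unfolding is_PPP_def by blast
    qed
    then have 1: "prob (\<Inter>i\<in>{..<n}. (\<lambda>\<omega>. card (X \<omega> \<inter> F i)) -` {k. min k (d + 1) = c (f i)} \<inter> space M)
      = (\<Prod>i\<in>{..<n}. prob ((\<lambda>\<omega>. card (X \<omega> \<inter> F i)) -` {k. min k (d + 1) = c (f i)} \<inter> space M))"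
      using n0 by (intro indep_varsD) auto
    have 2: "(\<Inter>i\<in>{..<n}. (\<lambda>\<omega>. card (X \<omega> \<inter> F i)) -` {k. min k (d + 1) = c (f i)} \<inter> space M)
      = {\<omega>\<in>space M. \<forall>u\<in>V. counts (d + 1) (cidx s) (X \<omega>) u = c u}"
    proof -
      have "V = f ` {..<n}" using f unfolding bij_betw_def n_def by simp
      then show ?thesis using n0 unfolding counts_def cell_fibre F_def by auto
    qed
    have 3: "prob ((\<lambda>\<omega>. card (X \<omega> \<inter> F i)) -` {k. min k (d + 1) = c (f i)} \<inter> space M)
      = tpw (d + 1) (l * s ^ CARD('n)) (c (f i))" if "i < n" for i
    proof -
      have "(\<lambda>\<omega>. card (X \<omega> \<inter> F i)) -` {k. min k (d + 1) = c (f i)} \<inter> space M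
        = {\<omega>\<in>space M. counts (d + 1) (cidx s) (X \<omega>) (f i) = c (f i)}"
        unfolding counts_def cell_fibre F_def by auto
      moreover have "f i \<in> lat" "c (f i) \<le> d + 1" using fV[OF that] V c unfolding cfg_def by auto
      ultimately show ?thesis using PPP_count_prob[OF X l s, of "f i" "c (f i)" "d + 1"] by simp
    qed
    have 4: "(\<Prod>i\<in>{..<n}. tpw (d + 1) (l * s ^ CARD('n)) (c (f i))) = (\<Prod>v\<in>V. tpw (d + 1) (l * s ^ CARD('n)) (c v))"
      using f unfolding n_def by (rule prod.reindex_bij_betw)
    show ?thesis unfolding e 2[symmetric] 1 4[symmetric] by (intro prod.cong refl 3) simp
  qed
qed

text \<open>Passage from the process to the finite product model. The right side shows the intensity
  explicitly, so processes on unrelated probability spaces become comparable.\<close>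

lemma PPP_law:
  fixes V :: "(real^'n) set"
  assumes X: "is_PPP M X l" and l: "0 < l" and s: "0 < s" and V: "finite V" "V \<subseteq> lat"
  shows "measure M {\<omega>\<in>space M. A (ccounts d s V (X \<omega>))}
    = pexp (tpw (d + 1) (l * s ^ CARD('n))) (d + 1) V (\<lambda>c. of_bool (A c))"
proof -
  interpret prob_space M using X unfolding is_PPP_def by simp
  note Y = is_PPP_point_process[OF X]
  let ?C = "{c\<in>cfg (d + 1) V. A c}"
  have fC: "finite ?C" using finite_cfg[OF V(1)] by auto
  have "{\<omega>\<in>space M. A (ccounts d s V (X \<omega>))} = (\<Union>c\<in>?C. {\<omega>\<in>space M. ccounts d s V (X \<omega>) = c})"
    using ccounts_cfg by auto
  then have "measure M {\<omega>\<in>space M. A (ccounts d s V (X \<omega>))} = measure M (\<Union>c\<in>?C. {\<omega>\<in>space M. ccounts d s V (X \<omega>) = c})"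
    by simp
  also have "\<dots> = (\<Sum>c\<in>?C. measure M {\<omega>\<in>space M. ccounts d s V (X \<omega>) = c})"
    using fC ccounts_event[OF Y s V, of "\<lambda>c'. c' = _"]
    by (intro finite_measure_finite_Union) (auto simp: disjoint_family_on_def)
  also have "\<dots> = (\<Sum>c\<in>?C. \<Prod>v\<in>V. tpw (d + 1) (l * s ^ CARD('n)) (c v))"
    by (intro sum.cong refl PPP_config_prob[OF X l s V]) auto
  also have "\<dots> = (\<Sum>c\<in>cfg (d + 1) V. (\<Prod>v\<in>V. tpw (d + 1) (l * s ^ CARD('n)) (c v)) * of_bool (A c))"
    using finite_cfg[OF V(1), of "d + 1"] by (intro sum.mono_neutral_cong_left) auto
  finally show ?thesis unfolding pexp_def .
qed

subsection \<open>Comparison with the lattice model\<close>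

abbreviation close :: "real^'n \<Rightarrow> real^'n \<Rightarrow> bool" where
  "close x y \<equiv> dist x y \<le> 1"

lemma simplices_csimp: "simplices d L = csimp d close L"
  unfolding simplices_def csimp_def by simp

lemma near_fun: "near \<rho> = (\<lambda>p q. dist (fst p) (fst q) \<le> \<rho>)"
  unfolding near_def by (intro ext) simp

text \<open>Rounding to cells changes distances by at most one cell diagonal: points within distance
  1 have cells within 1 / s + \<surd>D = \<rho>.\<close>

lemma PPP_to_lattice:
  fixes L :: "(real^'n) set"
  assumes fin: "\<And>u. finite {x\<in>L. cidx s x = u}" and \<rho>: "sqrt CARD('n) < \<rho>" and s: "s = 1 / (\<rho> - sqrt CARD('n))"
    and cl: "clink d close L (cball 0 a) (far 0 t)"
  shows "dlink d \<rho> (counts (d + 1) (cidx s) L) (cball 0 (a / s + sqrt CARD('n))) (far 0 (t / s - sqrt CARD('n)))"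
  unfolding dlink_def near_fun
proof (rule clink_coarsen[OF fin _ _ _ cl])
  have s0: "0 < s" using \<rho> unfolding s by simp
  have s1: "1 / s = \<rho> - sqrt CARD('n)" unfolding s by simp
  show "dist (cidx s x) (cidx s y) \<le> \<rho>" if "close x y" for x y :: "real^'n"
  proof -
    have "s * dist (cidx s x) (cidx s y) \<le> 1 + s * sqrt CARD('n)" using cidx_dist(2)[OF s0, of x y] that by simp
    then have "dist (cidx s x) (cidx s y) \<le> 1 / s + sqrt CARD('n)" using s0 by (simp add: field_simps)
    then show ?thesis using s1 by simp
  qed
  show "cidx s x \<in> cball 0 (a / s + sqrt CARD('n))" if "x \<in> L \<inter> cball 0 a" for x
    using cidx_norm(2)[OF s0, of x] that s0 by (auto simp: field_simps)
  show "cidx s x \<in> far 0 (t / s - sqrt CARD('n))" if "x \<in> L \<inter> far 0 t" for x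
    using cidx_norm(1)[OF s0, of x] that s0 by (auto simp: field_simps far_def)
qed

text \<open>The opposite rounding: points in cells within \<rho> are within distance s (\<rho> +
  \<surd>D) = 1.\<close>

lemma lattice_to_PPP:
  fixes L :: "(real^'n) set"
  assumes fin: "\<And>u. finite {x\<in>L. cidx s x = u}" and \<rho>: "0 < \<rho>" and s: "s = 1 / (\<rho> + sqrt CARD('n))"
    and cl: "dlink d \<rho> (counts (d + 1) (cidx s) L) (cball 0 a) (far 0 t)"
  shows "clink d close L (cball 0 (s * (a + sqrt CARD('n)))) (far 0 (s * (t - sqrt CARD('n))))"
proof (rule clink_refine[OF fin _ _ _ cl[unfolded dlink_def near_fun]])
  have s0: "0 < s" using \<rho> unfolding s by (simp add: add_pos_nonneg)
  have s1: "s * (\<rho> + sqrt CARD('n)) = 1" using \<rho> unfolding s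
    by (metis add_pos_nonneg less_numeral_extra(3) nonzero_eq_divide_eq of_nat_0_le_iff real_sqrt_ge_zero)
  show "close x y" if "dist (cidx s x) (cidx s y) \<le> \<rho>" for x y :: "real^'n"
  proof -
    have "dist x y \<le> s * (dist (cidx s x) (cidx s y) + sqrt CARD('n))" by (rule cidx_dist(1)[OF s0])
    also have "\<dots> \<le> s * (\<rho> + sqrt CARD('n))" using that s0 by (intro mult_left_mono) auto
    finally show ?thesis using s1 by simp
  qed
  show "x \<in> cball 0 (s * (a + sqrt CARD('n)))" if "cidx s x \<in> cball 0 a" for x :: "real^'n"
    using order_trans[OF cidx_norm(1)[OF s0, of x] mult_left_mono[of "norm (cidx s x) + sqrt CARD('n)" "a + sqrt CARD('n)" s]] that s0
    by simp
  show "x \<in> far 0 (s * (t - sqrt CARD('n)))" if "cidx s x \<in> far 0 t" for x :: "real^'n"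
  proof -
    have "s * t \<le> s * norm (cidx s x)" using that s0 by (intro mult_left_mono) (auto simp: far_def)
    then show ?thesis using cidx_norm(2)[OF s0, of x] by (simp add: far_def algebra_simps)
  qed
qed

subsection \<open>Adjacency through convex hulls\<close>

text \<open>The unit ball around each vertex contains all vertices, hence the hull; so the unit ball
  around any point of the hull contains all vertices, hence the hull.\<close>

lemma hull_close:
  fixes S :: "(real^'n) set"
  assumes "\<And>x y. x \<in> S \<Longrightarrow> y \<in> S \<Longrightarrow> dist x y \<le> 1" "x \<in> convex hull S" "y \<in> convex hull S"
  shows "dist x y \<le> (1::real)"
proof -
  have 1: "convex hull S \<subseteq> cball z 1" if "z \<in> S" for z
    using assms(1) that by (intro hull_minimal) auto
  have "S \<subseteq> cball x 1"
  proof
    fix z assume "z \<in> S"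
    then have "x \<in> cball z 1" using 1 assms(2) by blast
    then show "z \<in> cball x 1" by (simp add: dist_commute)
  qed
  then have "convex hull S \<subseteq> cball x 1" by (intro hull_minimal) auto
  then show ?thesis using assms(3) by auto
qed

text \<open>Faces with equal convex hulls but different vertices span a clique, within which one simplex can be
  transformed into the other. Hence no general position is needed here.\<close>
lemma adjacent_conn:
  assumes "S \<in> csimp d close L" "T \<in> csimp d close L" "adjacent d S T"
  shows "conn d close L S T"
proof -
  obtain F G where FG: "F \<subseteq> S" "G \<subseteq> T" "card F = d" "card G = d" "convex hull F = convex hull G"
    using assms(3) unfolding adjacent_def by auto
  note SD = csimpD[OF assms(1)] and TD = csimpD[OF assms(2)]
  have fin: "finite F" "finite G" using finite_subset[OF FG(1) SD(2)] finite_subset[OF FG(2) TD(2)] by auto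
  show ?thesis
  proof (cases "F = G")
    case True
    then have "F \<subseteq> S \<inter> T" using FG by auto
    then have "d \<le> card (S \<inter> T)" using FG(3) SD(2) by (metis card_mono finite_Int)
    then show ?thesis using assms unfolding cadj_def by auto
  next
    case False
    obtain g where g: "g \<in> G" "g \<notin> F" using False FG fin by (metis card_subset_eq subsetI)
    obtain f where f: "f \<in> F" "f \<notin> G" using False FG fin by (metis card_subset_eq subsetI)
    define U where "U = F \<union> G"
    have U: "U \<subseteq> L" using FG SD TD unfolding U_def by auto
    have "F \<subseteq> convex hull F" "G \<subseteq> convex hull F" using hull_subset[of F convex] hull_subset[of G convex] FG(5) by auto
    then have "U \<subseteq> convex hull S" using hull_mono[OF FG(1), of convex] unfolding U_def by blast
    then have cl: "close x y" if "x \<in> U" "y \<in> U" for x y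
      using hull_close[of S x y] SD(4) that by auto
    have S': "insert g F \<in> csimp d close L" and T': "insert f G \<in> csimp d close L"
      using f g FG fin U cl unfolding csimp_def U_def by auto
    have "conn d close L (insert g F) (insert f G)"
      using f g FG fin U cl unfolding U_def by (intro conn_in_clique[of "F \<union> G"]) auto
    moreover have "cadj d close L S (insert g F)"
    proof -
      have "F \<subseteq> S \<inter> insert g F" using FG by auto
      then have "d \<le> card (S \<inter> insert g F)" using FG(3) SD(2) by (metis card_mono finite_Int)
      then show ?thesis using assms S' unfolding cadj_def by auto
    qed
    moreover have "cadj d close L (insert f G) T"
    proof -
      have "G \<subseteq> insert f G \<inter> T" using FG by auto
      then have "d \<le> card (insert f G \<inter> T)" using FG(4) TD(2) by (metis card_mono finite_Int)
      then show ?thesis using assms T' unfolding cadj_def by auto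
    qed
    ultimately show ?thesis by (meson converse_rtranclp_into_rtranclp rtranclp.rtrancl_into_rtrancl)
  qed
qed

lemma cadj_adjacent: "cadj d N L S T \<Longrightarrow> adjacent d S T"
  unfolding cadj_def adjacent_def using obtain_subset_with_card_n[of d "S \<inter> T"]
  by (metis le_inf_iff)

lemma path_conn:
  assumes "\<And>i. i \<le> n \<Longrightarrow> \<sigma> i \<in> csimp d close L" "\<And>i. i < n \<Longrightarrow> adjacent d (\<sigma> i) (\<sigma> (Suc i))" "i \<le> n"
  shows "conn d close L (\<sigma> 0) (\<sigma> i)"
  using assms(3)
proof (induction i)
  case (Suc i)
  then have "conn d close L (\<sigma> i) (\<sigma> (Suc i))" using assms by (intro adjacent_conn) auto
  then show ?case using Suc by (auto intro: rtranclp_trans)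
qed auto

subsection \<open>Reaching a distance\<close>

lemma reach_imp_conn:
  assumes "reach d r L" "0 \<le> r"
  obtains S T x where "S \<in> csimp d close (insert 0 L)" "0 \<in> S" "conn d close (insert 0 L) S T" "x \<in> T" "r < norm x"
proof -
  obtain \<sigma> n where \<sigma>: "\<And>i. i \<le> n \<Longrightarrow> \<sigma> i \<in> csimp d close (insert 0 L)" "0 \<in> \<sigma> 0"
    "\<And>i. i < n \<Longrightarrow> adjacent d (\<sigma> i) (\<sigma> (Suc i))" "convex hull (\<sigma> n) - cball 0 r \<noteq> {}"
    using assms(1) unfolding reach_def simplices_csimp by blast
  have "\<not> \<sigma> n \<subseteq> cball 0 r" using \<sigma>(4) hull_minimal[of "\<sigma> n" "cball 0 r" convex] by auto
  then obtain x where "x \<in> \<sigma> n" "r < norm x" by (auto simp: subset_iff not_le)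
  then show ?thesis using that[of "\<sigma> 0" "\<sigma> n" x] \<sigma> path_conn[of n \<sigma> d "insert 0 L" n] by auto
qed

lemma conn_imp_reach:
  assumes "S \<in> csimp d close (insert 0 L)" "0 \<in> S" "conn d close (insert 0 L) S T" "x \<in> T" "r < norm x"
  shows "reach d r L"
proof -
  obtain n where "(cadj d close (insert 0 L) ^^ n) S T" using assms(3) rtranclp_imp_relpowp by metis
  then obtain f where f: "f 0 = S" "f n = T" "\<And>i. i < n \<Longrightarrow> cadj d close (insert 0 L) (f i) (f (Suc i))"
    unfolding relpowp_fun_conv by auto
  have "f i \<in> csimp d close (insert 0 L)" if "i \<le> n" for i
    using f assms(1) that by (cases i) (auto simp: cadj_def)
  moreover have "x \<in> convex hull (f n) - cball 0 r" using assms f hull_inc[of x T convex] by auto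
  ultimately show ?thesis unfolding reach_def simplices_csimp
    using f assms(2) cadj_adjacent by (intro exI[of _ f] exI[of _ n]) blast
qed

text \<open>Cut the chain behind its last simplex containing 0. The next simplex avoids 0 but shares
  a vertex with it, and this vertex is within distance 1 of 0. There is a next one, since the final
  simplex has a vertex farther than r \<ge> 1 from 0.\<close>

lemma reach_imp_clink:
  assumes d: "1 \<le> d" and "reach d r L" "1 \<le> r"
  shows "clink d close L (cball 0 1) (far 0 r)"
proof -
  obtain S T x where S: "S \<in> csimp d close (insert 0 L)" "0 \<in> S" "conn d close (insert 0 L) S T" "x \<in> T" "r < norm x"
    by (rule reach_imp_conn[OF assms(2)]) (use assms(3) in auto)
  have "0 \<in> T \<or> (\<exists>S'. S' \<in> csimp d close L \<and> S' \<inter> cball 0 1 \<noteq> {} \<and> conn d close L S' T)"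
    using S(3)
  proof (induction rule: rtranclp_induct)
    case (step T U)
    have TU: "T \<in> csimp d close (insert 0 L)" "U \<in> csimp d close (insert 0 L)" "d \<le> card (T \<inter> U)"
      using step.hyps(2) by (auto simp: cadj_def)
    obtain w where w: "w \<in> T" "w \<in> U" using cadj_common[OF step.hyps(2) d] .
    show ?case
    proof (cases "0 \<in> U")
      case False
      then have UL: "U \<in> csimp d close L" using csimpD(1)[OF TU(2)] by (intro csimp_restrict[OF TU(2)]) auto
      show ?thesis
      proof (cases "0 \<in> T")
        case True
        then have "w \<in> cball 0 1" using csimpD(4)[OF TU(1), of 0 w] w by simp
        then show ?thesis using UL w by blast
      next
        case F: False
        then have TL: "T \<in> csimp d close L" using csimpD(1)[OF TU(1)] by (intro csimp_restrict[OF TU(1)]) auto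
        obtain S' where S': "S' \<in> csimp d close L" "S' \<inter> cball 0 1 \<noteq> {}" "conn d close L S' T" using F step.IH by auto
        have "cadj d close L T U" using TL UL TU by (simp add: cadj_def)
        then show ?thesis using S' by (meson rtranclp.rtrancl_into_rtrancl)
      qed
    qed auto
  qed (use S in auto)
  moreover have "0 \<notin> T"
  proof
    assume "0 \<in> T"
    from csimpD(4)[OF conn_csimp[OF S(3,1)] this S(4)] have "dist 0 x \<le> 1" .
    then show False using S(5) assms(3) by simp
  qed
  ultimately obtain S' where S': "S' \<in> csimp d close L" "S' \<inter> cball 0 1 \<noteq> {}" "conn d close L S' T" by auto
  have "T \<inter> far 0 r \<noteq> {}" using S(4,5) unfolding far_def by (auto simp: disjoint_iff)
  then show ?thesis unfolding clink_def using S' conn_csimp[OF S'(3,1)] by blast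
qed

subsection \<open>Infinite paths\<close>

definition fpath :: "nat \<Rightarrow> (real^'n) set \<Rightarrow> real \<Rightarrow> nat \<Rightarrow> (nat \<Rightarrow> (real^'n) set) \<Rightarrow> bool" where
  "fpath d L K n \<sigma> \<longleftrightarrow> (\<forall>i\<le>n. \<sigma> i \<in> simplices d L) \<and> inj_on (\<lambda>i. convex hull (\<sigma> i)) {..n} \<and>
     (\<forall>i<n. adjacent d (\<sigma> i) (\<sigma> (Suc i))) \<and> \<sigma> 0 \<inter> cball 0 K \<noteq> {}"

lemma fpath_mono: "fpath d L K n \<sigma> \<Longrightarrow> m \<le> n \<Longrightarrow> fpath d L K m \<sigma>"
  unfolding fpath_def by (auto intro: inj_on_subset)

lemma fpath_cong: "(\<And>i. i \<le> n \<Longrightarrow> \<sigma> i = \<tau> i) \<Longrightarrow> fpath d L K n \<sigma> \<longleftrightarrow> fpath d L K n \<tau>"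
  unfolding fpath_def by (intro conj_cong) (auto simp: inj_on_def)

text \<open>If every candidate failed at some stage, all of the finitely many would fail at the
  largest of these stages. This is the selection step in the compactness argument for infinite
  paths.\<close>

lemma pigeonhole_antimono:
  assumes "finite A" "\<And>m. \<exists>a\<in>A. R (m::nat) a" "\<And>m n a. R n a \<Longrightarrow> m \<le> n \<Longrightarrow> R m a"
  shows "\<exists>a\<in>A. \<forall>m. R m a"
proof (rule ccontr)
  assume "\<not> ?thesis"
  then obtain g where g: "\<And>a. a \<in> A \<Longrightarrow> \<not> R (g a) a" by metis
  obtain a where a: "a \<in> A" "R (Max (insert 0 (g ` A))) a" using assms(2) by blast
  have "g a \<le> Max (insert 0 (g ` A))" using a assms(1) by (intro Max_ge) auto
  then show False using assms(3)[OF a(2)] g[OF a(1)] by blast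
qed

lemma simplices_near_finite:
  assumes fin: "\<And>B. bounded B \<Longrightarrow> finite (L \<inter> B)"
  shows "finite {T \<in> simplices d L. T \<inter> cball 0 K \<noteq> {}}"
proof -
  have "T \<subseteq> L \<inter> cball 0 (K + 1)" if T: "T \<in> simplices d L" "T \<inter> cball 0 K \<noteq> {}" for T
  proof
    fix x assume x: "x \<in> T"
    obtain y where y: "y \<in> T" "norm y \<le> K" using T(2) by auto
    have "dist x y \<le> 1" using csimpD(4)[OF T(1)[unfolded simplices_csimp] x y(1)] .
    then have "norm x \<le> K + 1" using y norm_triangle_sub[of x y] by (simp add: dist_norm)
    then show "x \<in> L \<inter> cball 0 (K + 1)" using x csimpD(1)[OF T(1)[unfolded simplices_csimp]] by auto
  qed
  then have "{T \<in> simplices d L. T \<inter> cball 0 K \<noteq> {}} \<subseteq> Pow (L \<inter> cball 0 (K + 1))" by auto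
  then show ?thesis by (rule finite_subset) (intro finite_Pow_iff[THEN iffD2] fin bounded_cball)
qed

lemma adjacent_finite:
  assumes fin: "\<And>B. bounded B \<Longrightarrow> finite (L \<inter> B)" and d: "1 \<le> d" and S: "S \<in> simplices d L"
  shows "finite {T \<in> simplices d L. adjacent d S T}"
proof -
  note SD = csimpD[OF S[unfolded simplices_csimp]]
  obtain R where "\<forall>x\<in>S. norm x \<le> R" using SD(2) finite_imp_bounded[of S] unfolding bounded_iff by blast
  then have R: "S \<subseteq> cball 0 R" by auto
  have "T \<inter> cball 0 (R + 1) \<noteq> {}" if T: "T \<in> simplices d L" "adjacent d S T" for T
  proof -
    note TD = csimpD[OF T(1)[unfolded simplices_csimp]]
    obtain F G where FG: "F \<subseteq> S" "G \<subseteq> T" "card F = d" "card G = d" "convex hull F = convex hull G"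
      using T(2) unfolding adjacent_def by auto
    have "F \<noteq> {}" using FG(3) d by auto
    then obtain p where p: "p \<in> F" by auto
    obtain y where y: "y \<in> T" using TD(5) by auto
    have "p \<in> convex hull T" using FG(5) hull_inc[OF p, of convex] hull_mono[OF FG(2), of convex] by auto
    moreover have "y \<in> convex hull T" using hull_inc[OF y] .
    ultimately have "dist y p \<le> 1" using hull_close[of T y p] TD(4) by auto
    moreover have "norm p \<le> R" using p FG(1) R by auto
    ultimately have "norm y \<le> R + 1" using norm_triangle_sub[of y p] by (simp add: dist_norm)
    then show ?thesis using y by auto
  qed
  then have "{T \<in> simplices d L. adjacent d S T} \<subseteq> {T \<in> simplices d L. T \<inter> cball 0 (R + 1) \<noteq> {}}" by auto
  then show ?thesis using simplices_near_finite[OF fin] finite_subset by blast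
qed

text \<open>Koenig's lemma: a simplex has finitely many neighbours (\<open>adjacent_finite\<close>),
  so paths of every length from one ball yield an infinite path. The infinite path is thereby traded
  for countable quantifiers and finite paths, which makes percolation an event.\<close>

lemma face_perc_iff:
  assumes fin: "\<And>B. bounded B \<Longrightarrow> finite (L \<inter> B)" and d: "1 \<le> d"
  shows "face_perc d L \<longleftrightarrow> (\<exists>K::nat. \<forall>n. \<exists>\<sigma>. fpath d L K n \<sigma>)"
proof
  assume "face_perc d L"
  then obtain \<sigma> where \<sigma>: "\<And>i. \<sigma> i \<in> simplices d L" "inj (\<lambda>i. convex hull (\<sigma> i))"
    "\<And>i. adjacent d (\<sigma> i) (\<sigma> (Suc i))" unfolding face_perc_def by auto
  obtain x where x: "x \<in> \<sigma> 0" using csimpD(5)[OF \<sigma>(1)[unfolded simplices_csimp]] by blast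
  obtain K :: nat where "norm x \<le> K" using real_arch_simple by blast
  then have "fpath d L K n \<sigma>" for n
    unfolding fpath_def using \<sigma> x by (auto intro: inj_on_subset)
  then show "\<exists>K::nat. \<forall>n. \<exists>\<sigma>. fpath d L K n \<sigma>" by blast
next
  assume "\<exists>K::nat. \<forall>n. \<exists>\<sigma>. fpath d L K n \<sigma>"
  then obtain K :: nat where K: "\<And>n. \<exists>\<sigma>. fpath d L K n \<sigma>" by blast
  \<comment> \<open>The first \<open>n + 1\<close> simplices of \<open>\<sigma>\<close> extend to
    paths of every length.\<close>
  define P where "P n \<sigma> \<longleftrightarrow> (\<forall>m. \<exists>\<tau>. fpath d L K (n + m) \<tau> \<and> (\<forall>i\<le>n. \<tau> i = \<sigma> i))" for n \<sigma>
  have Pf: "fpath d L K n \<sigma>" if P: "P n \<sigma>" for n \<sigma>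
  proof -
    obtain \<tau> where "fpath d L K (n + 0) \<tau>" "\<forall>i\<le>n. \<tau> i = \<sigma> i" using P unfolding P_def by blast
    then show ?thesis using fpath_cong[of n \<tau> \<sigma>] by simp
  qed
  have "\<exists>f. \<forall>n. P n (f n) \<and> (\<forall>i\<le>n. f (Suc n) i = f n i)"
  proof (rule dependent_nat_choice)
    have "\<exists>S\<in>{T \<in> simplices d L. T \<inter> cball 0 K \<noteq> {}}. \<forall>m. \<exists>\<tau>. fpath d L K m \<tau> \<and> \<tau> 0 = S"
    proof (rule pigeonhole_antimono[OF simplices_near_finite[OF fin]])
      fix m obtain \<tau> where \<tau>: "fpath d L K m \<tau>" using K by blast
      then have "\<tau> 0 \<in> {T \<in> simplices d L. T \<inter> cball 0 K \<noteq> {}}" unfolding fpath_def by auto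
      then show "\<exists>S\<in>{T \<in> simplices d L. T \<inter> cball 0 K \<noteq> {}}. \<exists>\<tau>. fpath d L K m \<tau> \<and> \<tau> 0 = S"
        using \<tau> by blast
    qed (auto intro: fpath_mono)
    then obtain S where "\<forall>m. \<exists>\<tau>. fpath d L K m \<tau> \<and> \<tau> 0 = S" by blast
    then show "\<exists>\<sigma>. P 0 \<sigma>" unfolding P_def by (intro exI[of _ "\<lambda>_. S"]) auto
  next
    fix \<sigma> n assume P: "P n \<sigma>"
    have "\<exists>S\<in>{T \<in> simplices d L. adjacent d (\<sigma> n) T}. \<forall>m. \<exists>\<tau>. fpath d L K (Suc n + m) \<tau> \<and> (\<forall>i\<le>n. \<tau> i = \<sigma> i) \<and> \<tau> (Suc n) = S"
    proof (rule pigeonhole_antimono)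
      have "\<sigma> n \<in> simplices d L" using Pf[OF P] unfolding fpath_def by auto
      then show "finite {T \<in> simplices d L. adjacent d (\<sigma> n) T}" using adjacent_finite[of L d "\<sigma> n"] fin d by blast
      fix m
      obtain \<tau> where \<tau>: "fpath d L K (n + Suc m) \<tau>" "\<forall>i\<le>n. \<tau> i = \<sigma> i" using P unfolding P_def by blast
      have "\<tau> (Suc n) \<in> simplices d L" "adjacent d (\<tau> n) (\<tau> (Suc n))" using \<tau>(1) unfolding fpath_def by auto
      then show "\<exists>S\<in>{T \<in> simplices d L. adjacent d (\<sigma> n) T}. \<exists>\<tau>. fpath d L K (Suc n + m) \<tau> \<and> (\<forall>i\<le>n. \<tau> i = \<sigma> i) \<and> \<tau> (Suc n) = S"
        using \<tau> by (intro bexI[of _ "\<tau> (Suc n)"] exI[of _ \<tau>]) auto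
    next
      fix m k S
      assume "\<exists>\<tau>. fpath d L K (Suc n + k) \<tau> \<and> (\<forall>i\<le>n. \<tau> i = \<sigma> i) \<and> \<tau> (Suc n) = S" "m \<le> k"
      then show "\<exists>\<tau>. fpath d L K (Suc n + m) \<tau> \<and> (\<forall>i\<le>n. \<tau> i = \<sigma> i) \<and> \<tau> (Suc n) = S"
        using fpath_mono[of d L K "Suc n + k" _ "Suc n + m"] by auto
    qed
    then obtain S where S: "\<And>m. \<exists>\<tau>. fpath d L K (Suc n + m) \<tau> \<and> (\<forall>i\<le>n. \<tau> i = \<sigma> i) \<and> \<tau> (Suc n) = S" by blast
    have "P (Suc n) (\<sigma>(Suc n := S))" unfolding P_def
    proof
      fix m obtain \<tau> where "fpath d L K (Suc n + m) \<tau>" "\<forall>i\<le>n. \<tau> i = \<sigma> i" "\<tau> (Suc n) = S" using S by blast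
      then show "\<exists>\<tau>. fpath d L K (Suc n + m) \<tau> \<and> (\<forall>i\<le>Suc n. \<tau> i = (\<sigma>(Suc n := S)) i)"
        by (intro exI[of _ \<tau>]) (auto simp: le_Suc_eq)
    qed
    then show "\<exists>\<tau>. P (Suc n) \<tau> \<and> (\<forall>i\<le>n. \<tau> i = \<sigma> i)" by (intro exI[of _ "\<sigma>(Suc n := S)"]) auto
  qed
  then obtain f where f: "\<And>n. P n (f n)" "\<And>n i. i \<le> n \<Longrightarrow> f (Suc n) i = f n i" by blast
  define \<sigma> where "\<sigma> i = f i i" for i
  have fi: "f n i = \<sigma> i" if "i \<le> n" for n i
    using that by (induction n rule: dec_induct) (auto simp: \<sigma>_def f(2))
  have \<sigma>: "fpath d L K n \<sigma>" for n using Pf[OF f(1)[of n]] fpath_cong[of n "f n" \<sigma>] fi by simp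
  show "face_perc d L" unfolding face_perc_def
  proof (intro exI[of _ \<sigma>] conjI allI)
    show "\<sigma> i \<in> simplices d L" for i using \<sigma>[of i] unfolding fpath_def by auto
    show "adjacent d (\<sigma> i) (\<sigma> (Suc i))" for i using \<sigma>[of "Suc i"] unfolding fpath_def by auto
    show "inj (\<lambda>i. convex hull (\<sigma> i))"
    proof (rule injI)
      fix i j assume "convex hull (\<sigma> i) = convex hull (\<sigma> j)"
      then show "i = j" using \<sigma>[of "max i j"] unfolding fpath_def inj_on_def by auto
    qed
  qed
qed

lemma face_perc_imp_clink:
  assumes fin: "\<And>B. bounded B \<Longrightarrow> finite (L \<inter> B)" and "face_perc d L"
  shows "\<exists>K::nat. \<forall>t. clink d close L (cball 0 K) (far 0 t)"
proof -
  obtain \<sigma> where \<sigma>: "\<And>i. \<sigma> i \<in> csimp d close L" "inj (\<lambda>i. convex hull (\<sigma> i))"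
    "\<And>i. adjacent d (\<sigma> i) (\<sigma> (Suc i))" using assms(2) unfolding face_perc_def simplices_csimp by auto
  obtain x where x: "x \<in> \<sigma> 0" using csimpD(5)[OF \<sigma>(1)] by blast
  obtain K :: nat where K: "norm x \<le> K" using real_arch_simple by blast
  have "clink d close L (cball 0 K) (far 0 t)" for t
  proof -
    have "\<exists>i. \<sigma> i \<inter> far 0 t \<noteq> {}"
    proof (rule ccontr)
      assume "\<not> ?thesis"
      then have "range \<sigma> \<subseteq> Pow (L \<inter> cball 0 t)"
        using csimpD(1)[OF \<sigma>(1)] unfolding far_def by (force simp: disjoint_iff)
      then have "finite (range \<sigma>)" by (rule finite_subset) (intro finite_Pow_iff[THEN iffD2] fin bounded_cball)
      moreover have "inj \<sigma>" using \<sigma>(2) by (auto simp: inj_def)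
      ultimately show False using range_inj_infinite by blast
    qed
    then obtain i where "\<sigma> i \<inter> far 0 t \<noteq> {}" by blast
    moreover have "conn d close L (\<sigma> 0) (\<sigma> i)" using \<sigma> by (intro path_conn[of i]) auto
    moreover have "\<sigma> 0 \<inter> cball 0 K \<noteq> {}" using x K by auto
    ultimately show ?thesis unfolding clink_def using \<sigma>(1) by blast
  qed
  then show ?thesis by blast
qed

lemma relpowp_shortest_inj:
  assumes "(R ^^ m) x y" "\<And>k. (R ^^ k) x y \<Longrightarrow> m \<le> k"
  obtains f where "f 0 = x" "f m = y" "\<And>i. i < m \<Longrightarrow> R (f i) (f (Suc i))" "inj_on f {..m}"
proof -
  obtain f where f: "f 0 = x" "f m = y" "\<And>i. i < m \<Longrightarrow> R (f i) (f (Suc i))"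
    using assms(1) unfolding relpowp_fun_conv by auto
  have "f i \<noteq> f j" if ij: "i < j" "j \<le> m" for i j
  proof
    assume e: "f i = f j"
    have sub: "(R ^^ (b - a)) (f a) (f b)" if "a \<le> b" "b \<le> m" for a b
      unfolding relpowp_fun_conv using f that by (intro exI[of _ "\<lambda>k. f (a + k)"]) auto
    have "(R ^^ ((i - 0) + (m - j))) x y"
      using sub[of 0 i] sub[of j m] f(1,2) e ij unfolding relpowp_add by auto
    then have "m \<le> i + (m - j)" using assms(2) by fastforce
    then show False using ij by auto
  qed
  then have "inj_on f {..m}" unfolding inj_on_def by (metis atMost_iff linorder_neqE_nat)
  then show ?thesis using that f by blast
qed

text \<open>A shortest chain repeats no simplex, and \<open>gen\<close> turns distinct simplices
  into distinct hulls. Each step moves outwards by at most 1, so distance \<open>K + n + 2\<close>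
  cannot be reached in fewer than \<open>n\<close> steps.\<close>

lemma clink_imp_fpath:
  assumes d: "1 \<le> d" and gen: "\<And>S T. S \<in> simplices d L \<Longrightarrow> T \<in> simplices d L \<Longrightarrow> convex hull S = convex hull T \<Longrightarrow> S = T"
    and cl: "clink d close L (cball 0 K) (far 0 (K + n + 2))"
  shows "\<exists>\<sigma>. fpath d L K n \<sigma>"
proof -
  obtain S T where ST: "S \<in> csimp d close L" "T \<in> csimp d close L" "S \<inter> cball 0 K \<noteq> {}"
    "T \<inter> far 0 (K + n + 2) \<noteq> {}" "conn d close L S T" using cl unfolding clink_def by blast
  let ?R = "cadj d close L"
  obtain m0 where m0: "(?R ^^ m0) S T" using ST(5) rtranclp_imp_relpowp by metis
  define m where "m = (LEAST m. (?R ^^ m) S T)"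
  have "(?R ^^ m) S T" unfolding m_def by (rule LeastI[of "\<lambda>m. (?R ^^ m) S T" m0]) (rule m0)
  then obtain f where f: "f 0 = S" "f m = T" "\<And>i. i < m \<Longrightarrow> ?R (f i) (f (Suc i))" "inj_on f {..m}"
  proof (rule relpowp_shortest_inj)
    show "m \<le> k" if "(?R ^^ k) S T" for k unfolding m_def by (rule Least_le) (rule that)
  qed blast
  have fs: "f i \<in> csimp d close L" if "i \<le> m" for i using f ST(1) that by (cases i) (auto simp: cadj_def)
  have bd: "norm x \<le> K + 1 + i" if "i \<le> m" "x \<in> f i" for i x
    using that
  proof (induction i arbitrary: x)
    case 0
    obtain y where "y \<in> S" "norm y \<le> K" using ST(3) by auto
    moreover have "dist x y \<le> 1" using csimpD(4)[OF ST(1)] 0 f(1) calculation by auto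
    ultimately show ?case using norm_triangle_sub[of x y] by (simp add: dist_norm)
  next
    case (Suc i)
    obtain w where w: "w \<in> f i" "w \<in> f (Suc i)" using cadj_common[OF f(3) d] Suc.prems by (metis Suc_le_eq)
    have "norm w \<le> K + 1 + i" using Suc w by auto
    moreover have "dist x w \<le> 1" using csimpD(4)[OF fs[OF Suc.prems(1)]] Suc.prems w by auto
    ultimately show ?case using norm_triangle_sub[of x w] by (simp add: dist_norm)
  qed
  obtain x where x: "x \<in> T" "K + n + 2 \<le> norm x" using ST(4) unfolding far_def by auto
  then have "K + n + 2 \<le> K + 1 + m" using bd[of m x] f(2) by auto
  then have nm: "n \<le> m" by simp
  have "inj_on (\<lambda>i. convex hull (f i)) {..n}"
  proof (rule inj_onI)
    fix i j assume ij: "i \<in> {..n}" "j \<in> {..n}" "convex hull (f i) = convex hull (f j)"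
    then have "f i = f j" using gen[of "f i" "f j"] fs nm unfolding simplices_csimp by auto
    then show "i = j" using f(4) ij nm unfolding inj_on_def by auto
  qed
  then have "fpath d L K n f"
    unfolding fpath_def simplices_csimp using fs f nm ST(3) cadj_adjacent[OF f(3)] by auto
  then show ?thesis by blast
qed

subsection \<open>Measurability\<close>

lemma pred_Bex:
  assumes "countable X" "\<And>i. i \<in> X \<Longrightarrow> Measurable.pred M (P i)"
  shows "Measurable.pred M (\<lambda>x. \<exists>i\<in>X. P i x)"
proof -
  have "(\<Union>i\<in>X. {x\<in>space M. P i x}) \<in> sets M"
    using assms by (intro sets.countable_UN') (auto simp: pred_def)
  also have "(\<Union>i\<in>X. {x\<in>space M. P i x}) = {x\<in>space M. \<exists>i\<in>X. P i x}" by auto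
  finally show ?thesis by (simp add: pred_def)
qed

lemma pred_Ball:
  assumes "countable X" "\<And>i. i \<in> X \<Longrightarrow> Measurable.pred M (P i)"
  shows "Measurable.pred M (\<lambda>x. \<forall>i\<in>X. P i x)"
proof -
  have "Measurable.pred M (\<lambda>x. \<not> (\<exists>i\<in>X. \<not> P i x))"
    using assms by (intro pred_intros_logic(2) pred_Bex)
  then show ?thesis by simp
qed

section \<open>A measurable enumeration of the points\<close>

lemma countable_lat: "countable (lat :: (real^'n) set)"
proof -
  have "lat \<subseteq> range (\<lambda>f :: 'n \<Rightarrow> int. (\<chi> i. of_int (f i)) :: real^'n)"
  proof
    fix x :: "real^'n" assume x: "x \<in> lat"
    then have "x = (\<chi> i. of_int \<lfloor>x $ i\<rfloor>)" unfolding lat_def by (auto simp: vec_eq_iff)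
    then show "x \<in> range (\<lambda>f :: 'n \<Rightarrow> int. (\<chi> i. of_int (f i)) :: real^'n)" by (intro image_eqI[where x = "\<lambda>i. \<lfloor>x $ i\<rfloor>"]) auto
  qed
  then show ?thesis by (rule countable_subset) (intro countable_image countableI_type)
qed

text \<open>The pair \<open>j\<close> indexes a point by a mesh 1 / (N + 1) and a cell of it in
  which the point is alone. There are countably many such pairs, and every point of a locally finite
  set has one (\<open>pt_surj\<close>), so quantifiers over points become countable ones.\<close>

definition single :: "(real^'n) set \<Rightarrow> nat \<times> (real^'n) \<Rightarrow> bool" where
  "single L j \<longleftrightarrow> card (L \<inter> cell (1 / (real (fst j) + 1)) (snd j)) = 1"

definition pt :: "(real^'n) set \<Rightarrow> nat \<times> (real^'n) \<Rightarrow> real^'n" where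
  "pt L j = (if single L j then the_elem (L \<inter> cell (1 / (real (fst j) + 1)) (snd j)) else 0)"

lemma pt_mem:
  assumes "single L j"
  shows "L \<inter> cell (1 / (real (fst j) + 1)) (snd j) = {pt L j}" "pt L j \<in> L"
proof -
  obtain z where z: "L \<inter> cell (1 / (real (fst j) + 1)) (snd j) = {z}"
    using assms unfolding single_def by (rule card_1_singletonE)
  then have "pt L j = z" using assms unfolding pt_def by simp
  then show "L \<inter> cell (1 / (real (fst j) + 1)) (snd j) = {pt L j}" using z by simp
  then show "pt L j \<in> L" by auto
qed

text \<open>A point of a locally finite set has positive distance to the others; once the cell
  diagonal is smaller, the point is alone. Holding for all fine meshes, the statement allows
  finitely many points to be indexed at one common mesh.\<close>

lemma pt_eventually:
  fixes L :: "(real^'n) set"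
  assumes fin: "\<And>B. bounded B \<Longrightarrow> finite (L \<inter> B)" and x: "x \<in> L"
  shows "\<exists>N0. \<forall>N\<ge>N0. single L (N, cidx (1 / (real N + 1)) x) \<and> pt L (N, cidx (1 / (real N + 1)) x) = x"
proof -
  obtain e where e: "0 < e" "\<And>y. y \<in> L \<inter> cball x 1 \<Longrightarrow> y \<noteq> x \<Longrightarrow> e \<le> dist x y"
    using finite_set_avoid[OF fin[OF bounded_cball[of x 1]], of x] by auto
  define m where "m = min e 1"
  have m: "0 < m" unfolding m_def using e by auto
  obtain N0 :: nat where N0: "sqrt CARD('n) / m < N0" using reals_Archimedean2 by blast
  have "single L (N, cidx (1 / (real N + 1)) x) \<and> pt L (N, cidx (1 / (real N + 1)) x) = x" if "N0 \<le> N" for N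
  proof -
    define s where "s = 1 / (real N + 1)"
    have s: "0 < s" unfolding s_def by simp
    have "sqrt CARD('n) / m < N" using N0 that by linarith
    then have "sqrt CARD('n) < m * (real N + 1)" using m by (simp add: field_simps)
    then have sm: "s * sqrt CARD('n) < m" unfolding s_def by (simp add: field_simps)
    have "y = x" if y: "y \<in> L" "cidx s y = cidx s x" for y
    proof (rule ccontr)
      assume "y \<noteq> x"
      have "dist x y \<le> s * sqrt CARD('n)" using cidx_dist(1)[OF s, of x y] y by simp
      then have "dist x y < m" using sm by simp
      then show False using e(2)[of y] y \<open>y \<noteq> x\<close> unfolding m_def by auto
    qed
    then have c: "L \<inter> cell s (cidx s x) = {x}" using x unfolding cell_def by auto
    then have 1: "single L (N, cidx s x)" unfolding single_def s_def by simp
    moreover from pt_mem(1)[OF 1] have "pt L (N, cidx s x) = x"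
      using c unfolding s_def by simp
    ultimately show ?thesis unfolding s_def by blast
  qed
  then show ?thesis by blast
qed

lemma pt_surj:
  fixes L :: "(real^'n) set"
  assumes "\<And>B. bounded B \<Longrightarrow> finite (L \<inter> B)" "x \<in> L"
  shows "\<exists>j\<in>UNIV \<times> lat. single L j \<and> pt L j = x"
proof -
  obtain N0 where "\<forall>N\<ge>N0. single L (N, cidx (1 / (real N + 1)) x) \<and> pt L (N, cidx (1 / (real N + 1)) x) = x"
    using pt_eventually[OF assms] by blast
  then show ?thesis using cidx_lat by (intro bexI[of _ "(N0, cidx (1 / (real N0 + 1)) x)"]) auto
qed

lemma single_pred:
  fixes Y :: "'a \<Rightarrow> (real^'n) set"
  assumes Y: "point_process M Y" and j: "j \<in> UNIV \<times> lat"
  shows "Measurable.pred M (\<lambda>\<omega>. single (Y \<omega>) j)"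
proof -
  let ?C = "cell (1 / (real (fst j) + 1)) (snd j)"
  have "?C \<in> sets lborel" "bounded ?C" using j by (auto intro!: cell_measurable cell_bounded)
  then have "(\<lambda>\<omega>. card (Y \<omega> \<inter> ?C)) \<in> measurable M (count_space UNIV)" using Y unfolding point_process_def by blast
  then show ?thesis unfolding single_def by measurable
qed

lemma pt_measurable:
  fixes Y :: "'a \<Rightarrow> (real^'n) set"
  assumes Y: "point_process M Y" and j: "j \<in> UNIV \<times> lat"
  shows "(\<lambda>\<omega>. pt (Y \<omega>) j) \<in> borel_measurable M"
proof (rule measurableI)
  fix B :: "(real^'n) set" assume B: "B \<in> sets borel"
  let ?C = "cell (1 / (real (fst j) + 1)) (snd j)"
  have C: "?C \<in> sets lborel" "bounded ?C" using j by (auto intro!: cell_measurable cell_bounded)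
  have BC: "?C \<inter> B \<in> sets lborel" "bounded (?C \<inter> B)" using C B by auto
  have m: "(\<lambda>\<omega>. card (Y \<omega> \<inter> (?C \<inter> B))) \<in> measurable M (count_space UNIV)"
    using Y BC unfolding point_process_def by blast
  have q: "Measurable.pred M (\<lambda>\<omega>. single (Y \<omega>) j)" by (rule single_pred[OF Y j])
  have "pt (Y \<omega>) j \<in> B \<longleftrightarrow> (single (Y \<omega>) j \<and> card (Y \<omega> \<inter> (?C \<inter> B)) = 1) \<or> (\<not> single (Y \<omega>) j \<and> 0 \<in> B)" for \<omega>
  proof (cases "single (Y \<omega>) j")
    case True
    have "Y \<omega> \<inter> (?C \<inter> B) = {pt (Y \<omega>) j} \<inter> B"
      using pt_mem(1)[OF True] by blast
    then show ?thesis using True by (cases "pt (Y \<omega>) j \<in> B") auto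
  qed (auto simp: pt_def)
  then have "(\<lambda>\<omega>. pt (Y \<omega>) j) -` B \<inter> space M = {\<omega>\<in>space M. (single (Y \<omega>) j \<and> card (Y \<omega> \<inter> (?C \<inter> B)) = 1) \<or> (\<not> single (Y \<omega>) j \<and> 0 \<in> B)}"
    by auto
  also have "\<dots> \<in> sets M" using m q by measurable
  finally show "(\<lambda>\<omega>. pt (Y \<omega>) j) -` B \<inter> space M \<in> sets M" .
qed auto

text \<open>Used with a countable \<open>D\<close>, which makes membership in a convex hull an event.\<close>
lemma in_hull_iff:
  fixes x :: "'b::euclidean_space"
  assumes "finite G" "G \<noteq> {}" and D: "\<And>U :: 'b set. open U \<Longrightarrow> U \<noteq> {} \<Longrightarrow> \<exists>v\<in>D. v \<in> U"
  shows "x \<in> convex hull G \<longleftrightarrow> (\<forall>v\<in>D. \<exists>y\<in>G. v \<bullet> x \<le> v \<bullet> y)"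
proof
  assume x: "x \<in> convex hull G"
  show "\<forall>v\<in>D. \<exists>y\<in>G. v \<bullet> x \<le> v \<bullet> y"
  proof (intro ballI, rule ccontr)
    fix v assume "\<not> (\<exists>y\<in>G. v \<bullet> x \<le> v \<bullet> y)"
    then have "G \<subseteq> {y. v \<bullet> y < v \<bullet> x}" by auto
    then have "convex hull G \<subseteq> {y. v \<bullet> y < v \<bullet> x}" by (intro hull_minimal convex_halfspace_lt)
    then show False using x by auto
  qed
next
  assume *: "\<forall>v\<in>D. \<exists>y\<in>G. v \<bullet> x \<le> v \<bullet> y"
  show "x \<in> convex hull G"
  proof (rule ccontr)
    assume x: "x \<notin> convex hull G"
    have "closed (convex hull G)" using assms(1) by (intro compact_imp_closed compact_convex_hull finite_imp_compact)
    then obtain a b where ab: "a \<bullet> x < b" "\<And>y. y \<in> convex hull G \<Longrightarrow> b < a \<bullet> y"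
      using separating_hyperplane_closed_point[of "convex hull G" x] x convex_convex_hull by metis
    define U where "U = (\<Inter>y\<in>G. {v. v \<bullet> y < v \<bullet> x})"
    have "- a \<in> U" unfolding U_def using ab hull_inc[of _ G convex] by force
    moreover have "open U" unfolding U_def using assms(1)
      by (intro open_INT ballI open_Collect_less continuous_intros)
    ultimately obtain v where "v \<in> D" "v \<in> U" using D[of U] by auto
    then show False using * unfolding U_def by force
  qed
qed

lemma in_hull_pred:
  fixes a :: "'a \<Rightarrow> real^'n"
  assumes "a \<in> borel_measurable M" "\<And>j. j \<in> G \<Longrightarrow> y j \<in> borel_measurable M" "finite G"
  shows "Measurable.pred M (\<lambda>\<omega>. a \<omega> \<in> convex hull ((\<lambda>j. y j \<omega>) ` G))"
proof (cases "G = {}")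
  case False
  obtain D :: "(real^'n) set" where D: "countable D" "\<And>U. open U \<Longrightarrow> U \<noteq> {} \<Longrightarrow> \<exists>v\<in>D. v \<in> U"
    using countable_dense_setE by blast
  have eq: "a \<omega> \<in> convex hull ((\<lambda>j. y j \<omega>) ` G) \<longleftrightarrow> (\<forall>v\<in>D. \<exists>j\<in>G. v \<bullet> a \<omega> \<le> v \<bullet> y j \<omega>)" for \<omega>
    using in_hull_iff[of "(\<lambda>j. y j \<omega>) ` G" D "a \<omega>"] assms(3) False D(2) by auto
  have 1: "Measurable.pred M (\<lambda>\<omega>. v \<bullet> a \<omega> \<le> v \<bullet> y j \<omega>)" if "j \<in> G" for v j
    using assms(1) assms(2)[OF that] by measurable
  show ?thesis unfolding eq
    by (intro pred_Ball D(1) pred_Bex countable_finite assms(3) 1)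
qed auto

lemma hull_eq_pred:
  fixes y :: "'j \<Rightarrow> 'a \<Rightarrow> real^'n"
  assumes "\<And>j. j \<in> F \<union> G \<Longrightarrow> y j \<in> borel_measurable M" "finite F" "finite G"
  shows "Measurable.pred M (\<lambda>\<omega>. convex hull ((\<lambda>j. y j \<omega>) ` F) = convex hull ((\<lambda>j. y j \<omega>) ` G))"
proof -
  have eq: "convex hull ((\<lambda>j. y j \<omega>) ` F) = convex hull ((\<lambda>j. y j \<omega>) ` G) \<longleftrightarrow>
    (\<forall>j\<in>F. y j \<omega> \<in> convex hull ((\<lambda>j. y j \<omega>) ` G)) \<and> (\<forall>j\<in>G. y j \<omega> \<in> convex hull ((\<lambda>j. y j \<omega>) ` F))" for \<omega>
  proof
    assume R: "(\<forall>j\<in>F. y j \<omega> \<in> convex hull ((\<lambda>j. y j \<omega>) ` G)) \<and> (\<forall>j\<in>G. y j \<omega> \<in> convex hull ((\<lambda>j. y j \<omega>) ` F))"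
    show "convex hull ((\<lambda>j. y j \<omega>) ` F) = convex hull ((\<lambda>j. y j \<omega>) ` G)"
      using R by (intro equalityI hull_minimal convex_convex_hull) auto
  next
    assume e: "convex hull ((\<lambda>j. y j \<omega>) ` F) = convex hull ((\<lambda>j. y j \<omega>) ` G)"
    show "(\<forall>j\<in>F. y j \<omega> \<in> convex hull ((\<lambda>j. y j \<omega>) ` G)) \<and> (\<forall>j\<in>G. y j \<omega> \<in> convex hull ((\<lambda>j. y j \<omega>) ` F))"
      using e by (metis hull_inc image_eqI)
  qed
  have 1: "Measurable.pred M (\<lambda>\<omega>. y j \<omega> \<in> convex hull ((\<lambda>j. y j \<omega>) ` G))" if "j \<in> F" for j
    using assms that by (intro in_hull_pred) auto
  have 2: "Measurable.pred M (\<lambda>\<omega>. y j \<omega> \<in> convex hull ((\<lambda>j. y j \<omega>) ` F))" if "j \<in> G" for j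
    using assms that by (intro in_hull_pred) auto
  show ?thesis unfolding eq
    by (intro pred_intros_logic(3) pred_Ball countable_finite assms 1 2)
qed

lemma adjacent_image:
  assumes "inj_on p J" "inj_on p J'"
  shows "adjacent d (p ` J) (p ` J') \<longleftrightarrow>
    (\<exists>F\<in>{F. F \<subseteq> J \<and> card F = d}. \<exists>G\<in>{G. G \<subseteq> J' \<and> card G = d}. convex hull (p ` F) = convex hull (p ` G))"
proof
  assume "adjacent d (p ` J) (p ` J')"
  then obtain F G where FG: "F \<subseteq> p ` J" "G \<subseteq> p ` J'" "card F = d" "card G = d" "convex hull F = convex hull G"
    unfolding adjacent_def by auto
  obtain F' where F': "F' \<subseteq> J" "F = p ` F'" using FG(1) by (auto simp: subset_image_iff)
  obtain G' where G': "G' \<subseteq> J'" "G = p ` G'" using FG(2) by (auto simp: subset_image_iff)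
  have "card F' = d" "card G' = d" using FG F' G' assms card_image inj_on_subset by metis+
  then show "\<exists>F\<in>{F. F \<subseteq> J \<and> card F = d}. \<exists>G\<in>{G. G \<subseteq> J' \<and> card G = d}. convex hull (p ` F) = convex hull (p ` G)"
    using FG F' G' by blast
next
  assume "\<exists>F\<in>{F. F \<subseteq> J \<and> card F = d}. \<exists>G\<in>{G. G \<subseteq> J' \<and> card G = d}. convex hull (p ` F) = convex hull (p ` G)"
  then obtain F G where FG: "F \<subseteq> J" "card F = d" "G \<subseteq> J'" "card G = d" "convex hull (p ` F) = convex hull (p ` G)" by auto
  then have "card (p ` F) = d" "card (p ` G) = d" using assms card_image inj_on_subset by metis+
  then show "adjacent d (p ` J) (p ` J')" unfolding adjacent_def using FG by (intro exI[of _ "p ` F"] exI[of _ "p ` G"]) auto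
qed

text \<open>The flag \<open>h\<close> asks for distinct hulls. It is on for percolation and off for
  \<open>reach\<close>, so that one measurability proof covers both.\<close>

definition spath :: "bool \<Rightarrow> nat \<Rightarrow> (real^'n) set \<Rightarrow> (real^'n) set \<Rightarrow> (real^'n) set \<Rightarrow> nat \<Rightarrow> (nat \<Rightarrow> (real^'n) set) \<Rightarrow> bool" where
  "spath h d L A B n \<sigma> \<longleftrightarrow> (\<forall>i\<le>n. \<sigma> i \<in> simplices d L) \<and> (\<forall>i<n. adjacent d (\<sigma> i) (\<sigma> (Suc i))) \<and>
     (h \<longrightarrow> inj_on (\<lambda>i. convex hull (\<sigma> i)) {..n}) \<and> \<sigma> 0 \<inter> A \<noteq> {} \<and> \<sigma> n \<inter> B \<noteq> {}"

text \<open>A path of fixed length is given by a list of finite index sets, of which there are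
  countably many. For a fixed list, being a path is a finite combination of conditions on the
  measurable points \<open>pt\<close>; equality of hulls is measurable by
  \<open>hull_eq_pred\<close>.\<close>

lemma spath_pred:
  fixes Y :: "'a \<Rightarrow> (real^'n) set"
  assumes Y: "point_process M Y" and AB: "A \<in> sets borel" "B \<in> sets borel"
  shows "Measurable.pred M (\<lambda>\<omega>. \<exists>\<sigma>. spath h d (Y \<omega>) A B n \<sigma>)"
proof -
  define JJ where "JJ = {J. finite J \<and> J \<subseteq> (UNIV \<times> lat :: (nat \<times> (real^'n)) set) \<and> card J = d + 1}"
  define p where "p j \<omega> = pt (Y \<omega>) j" for j \<omega>
  define ok where "ok J \<omega> \<longleftrightarrow> (\<forall>j\<in>J. single (Y \<omega>) j) \<and> (\<forall>i\<in>J. \<forall>j\<in>J. i \<noteq> j \<longrightarrow> p i \<omega> \<noteq> p j \<omega>) \<and> (\<forall>i\<in>J. \<forall>j\<in>J. close (p i \<omega>) (p j \<omega>))" for J \<omega>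
  define adj where "adj J J' \<omega> \<longleftrightarrow> (\<exists>F\<in>{F. F \<subseteq> J \<and> card F = d}. \<exists>G\<in>{G. G \<subseteq> J' \<and> card G = d}.
      convex hull ((\<lambda>j. p j \<omega>) ` F) = convex hull ((\<lambda>j. p j \<omega>) ` G))" for J J' \<omega>
  define heq where "heq J J' \<omega> \<longleftrightarrow> convex hull ((\<lambda>j. p j \<omega>) ` J) = convex hull ((\<lambda>j. p j \<omega>) ` J')" for J J' \<omega>
  define Q where "Q Js \<omega> \<longleftrightarrow> (\<forall>i\<in>{..n}. ok (Js ! i) \<omega>) \<and> (\<forall>i\<in>{..<n}. adj (Js ! i) (Js ! Suc i) \<omega>) \<and>
    (h \<longrightarrow> (\<forall>i\<in>{..n}. \<forall>j\<in>{..n}. i \<noteq> j \<longrightarrow> \<not> heq (Js ! i) (Js ! j) \<omega>)) \<and>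
    (\<exists>j\<in>Js ! 0. p j \<omega> \<in> A) \<and> (\<exists>j\<in>Js ! n. p j \<omega> \<in> B)" for Js \<omega>
  define LL where "LL = {Js \<in> lists JJ. length Js = n + 1}"
  have "countable (UNIV \<times> lat :: (nat \<times> (real^'n)) set)" using countable_lat by auto
  then have "countable JJ" unfolding JJ_def
    by (intro countable_subset[OF _ countable_Collect_finite_subset]) auto
  then have cLL: "countable LL" unfolding LL_def by (intro countable_subset[OF _ countable_lists]) auto
  have pm: "p j \<in> borel_measurable M" if "j \<in> UNIV \<times> lat" for j unfolding p_def by (rule pt_measurable[OF Y that])
  have okm: "Measurable.pred M (ok J)" if J: "J \<in> JJ" for J
  proof -
    have f: "countable J" using J unfolding JJ_def by (auto intro: countable_finite)
    have m: "p i \<in> borel_measurable M" if "i \<in> J" for i using pm J that unfolding JJ_def by auto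
    have 1: "Measurable.pred M (\<lambda>\<omega>. single (Y \<omega>) j)" if "j \<in> J" for j using single_pred[OF Y] J that unfolding JJ_def by auto
    have 2: "Measurable.pred M (\<lambda>\<omega>. i \<noteq> j \<longrightarrow> p i \<omega> \<noteq> p j \<omega>)" if "i \<in> J" "j \<in> J" for i j
      using m[OF that(1)] m[OF that(2)] by measurable
    have 3: "Measurable.pred M (\<lambda>\<omega>. close (p i \<omega>) (p j \<omega>))" if "i \<in> J" "j \<in> J" for i j
      using m[OF that(1)] m[OF that(2)] by measurable
    show ?thesis unfolding ok_def
      by (intro pred_intros_logic(3) pred_Ball f 1 2 3)
  qed
  have hm: "Measurable.pred M (\<lambda>\<omega>. convex hull ((\<lambda>j. p j \<omega>) ` F) = convex hull ((\<lambda>j. p j \<omega>) ` G))"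
    if "F \<subseteq> J" "G \<subseteq> J'" "J \<in> JJ" "J' \<in> JJ" for F G J J'
    using that pm unfolding JJ_def by (intro hull_eq_pred) (auto intro: finite_subset)
  have adjm: "Measurable.pred M (adj J J')" if J: "J \<in> JJ" "J' \<in> JJ" for J J'
  proof -
    have c: "countable {F. F \<subseteq> K \<and> card F = d}" if "K \<in> JJ" for K
    proof -
      have "finite (Pow K)" using that unfolding JJ_def by auto
      then have "finite {F. F \<subseteq> K \<and> card F = d}" by (rule rev_finite_subset) auto
      then show ?thesis by (rule countable_finite)
    qed
    have "Measurable.pred M (\<lambda>\<omega>. convex hull ((\<lambda>j. p j \<omega>) ` F) = convex hull ((\<lambda>j. p j \<omega>) ` G))"
      if "F \<in> {F. F \<subseteq> J \<and> card F = d}" "G \<in> {F. F \<subseteq> J' \<and> card F = d}" for F G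
      using that by (intro hm[OF _ _ J]) auto
    then show ?thesis unfolding adj_def by (intro pred_Bex c J)
  qed
  have Qm: "Measurable.pred M (Q Js)" if Js: "Js \<in> LL" for Js
  proof -
    have J: "Js ! i \<in> JJ" if "i \<le> n" for i using Js that unfolding LL_def by (auto simp: in_lists_conv_set)
    have m: "p j \<in> borel_measurable M" if "j \<in> Js ! i" "i \<le> n" for i j using pm J[OF that(2)] that(1) unfolding JJ_def by auto
    have cJ: "countable (Js ! i)" if "i \<le> n" for i using J[OF that] unfolding JJ_def by (auto intro: countable_finite)
    have 1: "Measurable.pred M (\<lambda>\<omega>. p j \<omega> \<in> C)" if "j \<in> Js ! i" "i \<le> n" "C \<in> sets borel" for i j C
      using m[OF that(1,2)] that(3) by measurable
    have 2: "Measurable.pred M (\<lambda>\<omega>. \<exists>j\<in>Js ! i. p j \<omega> \<in> C)" if "i \<le> n" "C \<in> sets borel" for i C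
      using that by (intro pred_Bex cJ 1) auto
    have 3: "Measurable.pred M (\<lambda>\<omega>. i \<noteq> j \<longrightarrow> \<not> heq (Js ! i) (Js ! j) \<omega>)" if "i \<le> n" "j \<le> n" for i j
      using hm[OF subset_refl subset_refl J[OF that(1)] J[OF that(2)]] unfolding heq_def by measurable
    have 5: "Measurable.pred M (\<lambda>\<omega>. \<forall>i\<in>{..n}. \<forall>j\<in>{..n}. i \<noteq> j \<longrightarrow> \<not> heq (Js ! i) (Js ! j) \<omega>)"
      by (intro pred_Ball countable_finite 3) auto
    have 4: "Measurable.pred M (\<lambda>\<omega>. h \<longrightarrow> (\<forall>i\<in>{..n}. \<forall>j\<in>{..n}. i \<noteq> j \<longrightarrow> \<not> heq (Js ! i) (Js ! j) \<omega>))"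
    proof (cases h)
      case True
      show ?thesis using 5 by (simp only: True simp_thms)
    qed simp
    have 6: "Measurable.pred M (\<lambda>\<omega>. \<forall>i\<in>{..n}. ok (Js ! i) \<omega>)"
      by (intro pred_Ball countable_finite okm J) auto
    have 7: "Measurable.pred M (\<lambda>\<omega>. \<forall>i\<in>{..<n}. adj (Js ! i) (Js ! Suc i) \<omega>)"
      by (intro pred_Ball countable_finite adjm J) auto
    show ?thesis unfolding Q_def
      by (intro pred_intros_logic(3) 6 7 4 2[OF _ AB(1)] 2[OF _ AB(2)]) auto
  qed
  have eq: "(\<exists>\<sigma>. spath h d (Y \<omega>) A B n \<sigma>) \<longleftrightarrow> (\<exists>Js\<in>LL. Q Js \<omega>)" if \<omega>: "\<omega> \<in> space M" for \<omega>
  proof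
    define q where "q j = p j \<omega>" for j
    have ok: "inj_on q J \<and> q ` J \<in> simplices d (Y \<omega>)" if "ok J \<omega>" "J \<in> JJ" for J
    proof -
      have i: "inj_on q J" using that(1) unfolding ok_def q_def inj_on_def by blast
      have "q ` J \<subseteq> Y \<omega>" using that(1) pt_mem(2) unfolding ok_def q_def p_def by auto
      then show ?thesis using i that card_image[OF i] unfolding simplices_def JJ_def ok_def q_def by auto
    qed
    {
      assume "\<exists>\<sigma>. spath h d (Y \<omega>) A B n \<sigma>"
      then obtain \<sigma> where \<sigma>: "spath h d (Y \<omega>) A B n \<sigma>" by blast
      have fin: "finite (Y \<omega> \<inter> B)" if "bounded B" for B using Y \<omega> that unfolding point_process_def by auto
      have "\<forall>x\<in>Y \<omega>. \<exists>j\<in>UNIV \<times> lat. single (Y \<omega>) j \<and> q j = x" unfolding q_def p_def using pt_surj[OF fin] by blast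
      then obtain g where g: "\<And>x. x \<in> Y \<omega> \<Longrightarrow> g x \<in> UNIV \<times> lat \<and> single (Y \<omega>) (g x) \<and> q (g x) = x" by metis
      define Js where "Js = map (\<lambda>i. g ` \<sigma> i) [0..<n + 1]"
      have Jn: "Js ! i = g ` \<sigma> i" if "i \<le> n" for i unfolding Js_def using that by (simp del: upt_Suc)
      have s: "\<sigma> i \<in> simplices d (Y \<omega>)" if "i \<le> n" for i using \<sigma> that unfolding spath_def by auto
      have gi: "g ` \<sigma> i \<in> JJ \<and> q ` (g ` \<sigma> i) = \<sigma> i \<and> ok (g ` \<sigma> i) \<omega> \<and> inj_on q (g ` \<sigma> i)" if i: "i \<le> n" for i
      proof -
        have S: "\<sigma> i \<subseteq> Y \<omega>" "finite (\<sigma> i)" "card (\<sigma> i) = d + 1" "\<And>x y. x \<in> \<sigma> i \<Longrightarrow> y \<in> \<sigma> i \<Longrightarrow> close x y"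
          using s[OF i] unfolding simplices_def by auto
        have "inj_on g (\<sigma> i)" by (rule inj_on_inverseI[of _ q]) (use g S(1) in auto)
        then have "card (g ` \<sigma> i) = d + 1" using S(3) card_image by metis
        moreover have "g ` \<sigma> i \<subseteq> UNIV \<times> lat" using g S(1) by blast
        moreover have qg: "q ` (g ` \<sigma> i) = \<sigma> i" 
        proof -
          have "(\<lambda>x. q (g x)) ` \<sigma> i = (\<lambda>x. x) ` \<sigma> i" using g S(1) by (intro image_cong) auto
          then show ?thesis by (simp add: image_image)
        qed
        moreover have "inj_on q (g ` \<sigma> i)" by (rule inj_on_inverseI[of _ g]) (use g S(1) in auto)
        ultimately have 1: "g ` \<sigma> i \<in> JJ" "q ` (g ` \<sigma> i) = \<sigma> i" "inj_on q (g ` \<sigma> i)" using S(2) unfolding JJ_def by auto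
        have "ok (g ` \<sigma> i) \<omega>" unfolding ok_def q_def[symmetric]
        proof (intro conjI ballI impI)
          fix j assume "j \<in> g ` \<sigma> i" then show "single (Y \<omega>) j" using g S(1) by auto
        next
          fix j k assume "j \<in> g ` \<sigma> i" "k \<in> g ` \<sigma> i" "j \<noteq> k" then show "q j \<noteq> q k" using 1(3) unfolding inj_on_def by blast
        next
          fix j k assume "j \<in> g ` \<sigma> i" "k \<in> g ` \<sigma> i" then show "close (q j) (q k)" using S(4) 1(2) by blast
        qed
        then show ?thesis using 1 by auto
      qed
      have "Js \<in> LL" unfolding LL_def using gi unfolding Js_def by (auto simp: in_lists_conv_set)
      moreover have "Q Js \<omega>" unfolding Q_def
      proof (intro conjI ballI impI)
        show "ok (Js ! i) \<omega>" if "i \<in> {..n}" for i using gi Jn that by simp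
        show "adj (Js ! i) (Js ! Suc i) \<omega>" if i: "i \<in> {..<n}" for i
        proof -
          have a: "adjacent d (q ` (g ` \<sigma> i)) (q ` (g ` \<sigma> (Suc i)))"
            using gi[of i] gi[of "Suc i"] i \<sigma> unfolding spath_def by auto
          have "inj_on q (g ` \<sigma> i)" "inj_on q (g ` \<sigma> (Suc i))" using gi[of i] gi[of "Suc i"] i by auto
          from a[unfolded adjacent_image[OF this]] have "adj (g ` \<sigma> i) (g ` \<sigma> (Suc i)) \<omega>"
            unfolding adj_def q_def .
          then show ?thesis using Jn[of i] Jn[of "Suc i"] i by simp
        qed
        show "\<not> heq (Js ! i) (Js ! j) \<omega>" if hh: h and ij: "i \<in> {..n}" "j \<in> {..n}" "i \<noteq> j" for i j
        proof -
          have "convex hull (\<sigma> i) \<noteq> convex hull (\<sigma> j)" using \<sigma> hh ij unfolding spath_def inj_on_def by blast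
          then have "convex hull (q ` (g ` \<sigma> i)) \<noteq> convex hull (q ` (g ` \<sigma> j))" using gi[of i] gi[of j] ij by simp
          then show ?thesis unfolding heq_def q_def using Jn[of i] Jn[of j] ij by simp
        qed
        obtain x where x: "x \<in> \<sigma> 0" "x \<in> A" using \<sigma> unfolding spath_def by auto
        have "q (g x) = x" using g s[of 0] x unfolding simplices_def by auto
        moreover have "g x \<in> Js ! 0" using x Jn[of 0] by simp
        ultimately show "\<exists>j\<in>Js ! 0. p j \<omega> \<in> A" using x(2) unfolding q_def by (intro bexI[of _ "g x"]) simp_all
        obtain y where y: "y \<in> \<sigma> n" "y \<in> B" using \<sigma> unfolding spath_def by auto
        have "q (g y) = y" using g s[of n] y unfolding simplices_def by auto
        moreover have "g y \<in> Js ! n" using y Jn[of n] by simp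
        ultimately show "\<exists>j\<in>Js ! n. p j \<omega> \<in> B" using y(2) unfolding q_def by (intro bexI[of _ "g y"]) simp_all
      qed
      ultimately show "\<exists>Js\<in>LL. Q Js \<omega>" by blast
    next
      assume "\<exists>Js\<in>LL. Q Js \<omega>"
      then obtain Js where Js: "Js \<in> LL" "Q Js \<omega>" by blast
      have J: "Js ! i \<in> JJ" if "i \<le> n" for i using Js(1) that unfolding LL_def by (auto simp: in_lists_conv_set)
      have oki: "ok (Js ! i) \<omega>" if "i \<le> n" for i using Js(2) that unfolding Q_def by auto
      have "spath h d (Y \<omega>) A B n (\<lambda>i. q ` (Js ! i))" unfolding spath_def
      proof (intro conjI allI impI)
        show "q ` (Js ! i) \<in> simplices d (Y \<omega>)" if "i \<le> n" for i using ok[OF oki[OF that] J[OF that]] by auto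
        show "adjacent d (q ` (Js ! i)) (q ` (Js ! Suc i))" if i: "i < n" for i
        proof -
          have "i \<le> n" "Suc i \<le> n" using i by auto
          then have "inj_on q (Js ! i)" "inj_on q (Js ! Suc i)" using ok oki J by blast+
          moreover have "adj (Js ! i) (Js ! Suc i) \<omega>" using Js(2) i unfolding Q_def by blast
          ultimately show ?thesis unfolding adj_def q_def[symmetric] by (simp only: adjacent_image)
        qed
        show "inj_on (\<lambda>i. convex hull (q ` (Js ! i))) {..n}" if h
          using Js(2) that unfolding Q_def heq_def q_def inj_on_def by blast
        show "q ` (Js ! 0) \<inter> A \<noteq> {}" "q ` (Js ! n) \<inter> B \<noteq> {}" using Js(2) unfolding Q_def q_def by auto
      qed
      then show "\<exists>\<sigma>. spath h d (Y \<omega>) A B n \<sigma>" by blast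
    }
  qed
  have m: "Measurable.pred M (\<lambda>\<omega>. \<exists>Js\<in>LL. Q Js \<omega>)"
    by (intro pred_Bex cLL Qm)
  have e: "{\<omega>\<in>space M. \<exists>\<sigma>. spath h d (Y \<omega>) A B n \<sigma>} = {\<omega>\<in>space M. \<exists>Js\<in>LL. Q Js \<omega>}"
    using eq by (intro Collect_cong conj_cong refl)
  show ?thesis using m unfolding pred_def e .
qed

lemma point_process_finite: "point_process M Y \<Longrightarrow> \<omega> \<in> space M \<Longrightarrow> bounded B \<Longrightarrow> finite (Y \<omega> \<inter> B)"
  unfolding point_process_def by blast

lemma face_perc_event:
  fixes Y :: "'a \<Rightarrow> (real^'n) set"
  assumes Y: "point_process M Y" and d: "1 \<le> d"
  shows "{\<omega>\<in>space M. face_perc d (Y \<omega>)} \<in> sets M"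
proof -
  have 1: "Measurable.pred M (\<lambda>\<omega>. \<exists>\<sigma>. spath True d (Y \<omega>) (cball 0 (real K)) UNIV n \<sigma>)" for K n :: nat
    by (rule spath_pred[OF Y]) auto
  have "Measurable.pred M (\<lambda>\<omega>. \<exists>K::nat. \<forall>n. \<exists>\<sigma>. spath True d (Y \<omega>) (cball 0 (real K)) UNIV n \<sigma>)"
    by (intro pred_intros_countable 1)
  then have "{\<omega>\<in>space M. \<exists>K::nat. \<forall>n. \<exists>\<sigma>. spath True d (Y \<omega>) (cball 0 (real K)) UNIV n \<sigma>} \<in> sets M" by (simp add: pred_def)
  also have "{\<omega>\<in>space M. \<exists>K::nat. \<forall>n. \<exists>\<sigma>. spath True d (Y \<omega>) (cball 0 (real K)) UNIV n \<sigma>} = {\<omega>\<in>space M. face_perc d (Y \<omega>)}"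
  proof (intro Collect_cong conj_cong refl)
    fix \<omega> assume \<omega>: "\<omega> \<in> space M"
    have "spath True d (Y \<omega>) (cball 0 (real K)) UNIV n \<sigma> = fpath d (Y \<omega>) (real K) n \<sigma>" for K n \<sigma>
      unfolding spath_def fpath_def using csimpD(5)[of "\<sigma> n" d close "Y \<omega>"] by (auto simp: simplices_csimp)
    then show "(\<exists>K::nat. \<forall>n. \<exists>\<sigma>. spath True d (Y \<omega>) (cball 0 (real K)) UNIV n \<sigma>) = face_perc d (Y \<omega>)"
      using face_perc_iff[of "Y \<omega>" d] point_process_finite[OF Y \<omega>] d by simp
  qed
  finally show ?thesis .
qed

lemma point_process_insert:
  fixes Y :: "'a \<Rightarrow> (real^'n) set"
  assumes Y: "point_process M Y"
  shows "point_process M (\<lambda>\<omega>. insert x (Y \<omega>))"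
  unfolding point_process_def
proof (intro conjI ballI allI impI)
  fix \<omega> and B :: "(real^'n) set" assume "\<omega> \<in> space M" "bounded B"
  then have "finite (insert x (Y \<omega> \<inter> B))" using point_process_finite[OF Y] by simp
  then show "finite (insert x (Y \<omega>) \<inter> B)" by (rule rev_finite_subset) auto
next
  fix B :: "(real^'n) set" assume B: "B \<in> sets lborel" "bounded B"
  have B': "B - {x} \<in> sets lborel" "bounded (B - {x})" using B by (auto intro: bounded_subset)
  have eq: "card (insert x (Y \<omega>) \<inter> B) = card (Y \<omega> \<inter> (B - {x})) + of_bool (x \<in> B)" if "\<omega> \<in> space M" for \<omega>
  proof (cases "x \<in> B")
    case True
    then have "insert x (Y \<omega>) \<inter> B = insert x (Y \<omega> \<inter> (B - {x}))" by auto
    moreover have "finite (Y \<omega> \<inter> (B - {x}))" using point_process_finite[OF Y that B'(2)] .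
    ultimately show ?thesis using True by simp
  next
    case False
    then have "insert x (Y \<omega>) \<inter> B = Y \<omega> \<inter> (B - {x})" by auto
    then show ?thesis using False by simp
  qed
  have "(\<lambda>\<omega>. card (Y \<omega> \<inter> (B - {x}))) \<in> measurable M (count_space UNIV)"
    using Y B' unfolding point_process_def by blast
  then have "(\<lambda>\<omega>. card (Y \<omega> \<inter> (B - {x})) + of_bool (x \<in> B)) \<in> measurable M (count_space UNIV)" by measurable
  then show "(\<lambda>\<omega>. card (insert x (Y \<omega>) \<inter> B)) \<in> measurable M (count_space UNIV)"
    using eq by (subst measurable_cong) auto
qed

lemma reach_event:
  fixes Y :: "'a \<Rightarrow> (real^'n) set"
  assumes Y: "point_process M Y"
  shows "{\<omega>\<in>space M. reach d r (Y \<omega>)} \<in> sets M"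
proof -
  let ?Z = "\<lambda>\<omega>. insert 0 (Y \<omega>)"
  have 1: "Measurable.pred M (\<lambda>\<omega>. \<exists>\<sigma>. spath False d (?Z \<omega>) {0} (- cball 0 r) n \<sigma>)" for n
    by (rule spath_pred[OF point_process_insert[OF Y]]) auto
  have "Measurable.pred M (\<lambda>\<omega>. \<exists>n. \<exists>\<sigma>. spath False d (?Z \<omega>) {0} (- cball 0 r) n \<sigma>)"
    by (intro pred_intros_countable 1)
  then have "{\<omega>\<in>space M. \<exists>n. \<exists>\<sigma>. spath False d (?Z \<omega>) {0} (- cball 0 r) n \<sigma>} \<in> sets M" by (simp add: pred_def)
  also have "{\<omega>\<in>space M. \<exists>n. \<exists>\<sigma>. spath False d (?Z \<omega>) {0} (- cball 0 r) n \<sigma>} = {\<omega>\<in>space M. reach d r (Y \<omega>)}"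
  proof (intro Collect_cong conj_cong refl)
    fix \<omega>
    have h: "convex hull S - cball 0 r \<noteq> {} \<longleftrightarrow> S \<inter> (- cball 0 r) \<noteq> {}" for S :: "(real^'n) set"
      using hull_minimal[of S "cball 0 r" convex] hull_subset[of S convex] by auto
    show "(\<exists>n. \<exists>\<sigma>. spath False d (?Z \<omega>) {0} (- cball 0 r) n \<sigma>) = reach d r (Y \<omega>)"
    proof
      assume "\<exists>n. \<exists>\<sigma>. spath False d (?Z \<omega>) {0} (- cball 0 r) n \<sigma>"
      then obtain n \<sigma> where "spath False d (?Z \<omega>) {0} (- cball 0 r) n \<sigma>" by blast
      then show "reach d r (Y \<omega>)" unfolding reach_def spath_def h by (intro exI[of _ \<sigma>] exI[of _ n]) simp
    next
      assume "reach d r (Y \<omega>)"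
      then obtain n \<sigma> where "(\<forall>i\<le>n. \<sigma> i \<in> simplices d (?Z \<omega>)) \<and> 0 \<in> \<sigma> 0 \<and>
        (\<forall>i<n. adjacent d (\<sigma> i) (\<sigma> (Suc i))) \<and> (convex hull (\<sigma> n)) - cball 0 r \<noteq> {}"
        unfolding reach_def by blast
      then have "spath False d (?Z \<omega>) {0} (- cball 0 r) n \<sigma>" unfolding spath_def h by simp
      then show "\<exists>n. \<exists>\<sigma>. spath False d (?Z \<omega>) {0} (- cball 0 r) n \<sigma>" by blast
    qed
  qed
  finally show ?thesis .
qed

subsection \<open>General position\<close>

definition degenerate :: "nat \<Rightarrow> (real^'n) set \<Rightarrow> bool" where
  "degenerate d L \<longleftrightarrow> (\<exists>x S. x \<in> L \<and> S \<subseteq> L \<and> finite S \<and> card S = d \<and> x \<notin> S \<and> x \<in> convex hull S)"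

text \<open>Without degeneracy every vertex is an extreme point of the hull, so the hull determines
  its vertices.\<close>

lemma hull_inj:
  assumes "\<not> degenerate d L" "S \<in> simplices d L" "T \<in> simplices d L" "convex hull S = convex hull T"
  shows "S = T"
proof -
  have *: "S \<subseteq> T" if ST: "S \<in> simplices d L" "T \<in> simplices d L" "convex hull S = convex hull T" for S T
  proof (rule ccontr)
    assume "\<not> S \<subseteq> T"
    then obtain x where x: "x \<in> S" "x \<notin> T" by auto
    have "x \<notin> convex hull (S - {x})"
    proof
      assume "x \<in> convex hull (S - {x})"
      moreover have "card (S - {x}) = d" "finite (S - {x})" using x ST(1) unfolding simplices_def by auto
      moreover have "S - {x} \<subseteq> L" "x \<in> L" using x ST(1) unfolding simplices_def by auto
      ultimately have "degenerate d L" unfolding degenerate_def by (intro exI[of _ x] exI[of _ "S - {x}"]) simp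
      then show False using assms(1) by simp
    qed
    then have "x extreme_point_of (convex hull S)"
      using x ST(1) extreme_point_of_convex_hull_insert[of "S - {x}" x] unfolding simplices_def by (simp add: insert_absorb)
    then have "x extreme_point_of (convex hull T)" using ST(3) by simp
    then have "x \<in> T" by (rule extreme_point_of_convex_hull)
    then show False using x by simp
  qed
  show ?thesis using *[OF assms(2-4)] *[OF assms(3,2) assms(4)[symmetric]] by auto
qed

text \<open>At most D points span an affine subspace of dimension less than D.\<close>

lemma hull_negligible:
  fixes S :: "(real^'n) set"
  assumes "finite S" "card S \<le> CARD('n)"
  shows "convex hull S \<in> null_sets lborel"
proof (cases "S = {}")
  case False
  then obtain a where a: "a \<in> S" by auto
  define B where "B = (\<lambda>x. x - a) ` (S - {a})"
  have "dim B \<le> card B" unfolding B_def using assms by (intro dim_le_card') auto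
  also have "\<dots> \<le> card (S - {a})" unfolding B_def using assms by (intro card_image_le) auto
  also have "\<dots> < CARD('n)" using assms a card_Diff1_less[OF assms(1) a] by linarith
  finally have "dim (span B) < DIM(real^'n)" by (simp add: dim_span)
  then have n: "negligible (span B)" by (rule negligible_lowdim)
  have "convex hull S \<subseteq> (\<lambda>x. a + x) ` span B"
  proof (rule hull_minimal)
    show "convex ((\<lambda>x. a + x) ` span B)" by (intro convex_translation subspace_imp_convex subspace_span)
    show "S \<subseteq> (\<lambda>x. a + x) ` span B"
    proof
      fix x assume x: "x \<in> S"
      have "x - a \<in> span B"
      proof (cases "x = a")
        case True then show ?thesis by (simp add: span_zero)
      next
        case False then show ?thesis using x unfolding B_def by (intro span_base) auto
      qed
      then show "x \<in> (\<lambda>x. a + x) ` span B" by (intro image_eqI[of _ _ "x - a"]) auto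
    qed
  qed
  then have "negligible (convex hull S)" using n negligible_translation negligible_subset by blast
  moreover have "convex hull S \<in> sets lborel"
    using assms(1) by (simp add: borel_compact compact_convex_hull finite_imp_compact)
  ultimately show ?thesis using negligible_iff_null_sets null_sets_completion_iff by blast
qed auto

lemma PPP_null_miss:
  assumes X: "is_PPP M X l" and B: "B \<in> null_sets lborel" "bounded B"
  shows "measure M {\<omega>\<in>space M. card (X \<omega> \<inter> B) = 1} = 0"
proof -
  have "measure lborel B = 0" using B by (simp add: measure_eq_0_null_sets)
  moreover have "measure M {\<omega>\<in>space M. card (X \<omega> \<inter> B) = 1} = exp (- l * measure lborel B) * (l * measure lborel B) ^ 1 / fact 1"
    using X B unfolding is_PPP_def by blast
  ultimately show ?thesis by simp
qed

text \<open>Expresses the position of an isolated point through the counts in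
  \<open>C \<inter> B\<close> and \<open>C - B\<close> alone. The last case is the default value 0
  of \<open>pt\<close>, taken when the cell does not hold exactly one point.\<close>

lemma pt_in_iff:
  fixes L :: "(real^'n) set"
  assumes "finite (L \<inter> C)" "C = cell (1 / (real N + 1)) u"
  shows "pt L (N, u) \<in> B \<longleftrightarrow>
    (card (L \<inter> (C \<inter> B)) + card (L \<inter> (C - B)) = 1 \<and> card (L \<inter> (C \<inter> B)) = 1) \<or>
    (card (L \<inter> (C \<inter> B)) + card (L \<inter> (C - B)) \<noteq> 1 \<and> 0 \<in> B)"
proof -
  have "L \<inter> C = (L \<inter> (C \<inter> B)) \<union> (L \<inter> (C - B))" by auto
  then have "card (L \<inter> C) = card (L \<inter> (C \<inter> B)) + card (L \<inter> (C - B))"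
  proof -
    have "finite (L \<inter> (C \<inter> B))" "finite (L \<inter> (C - B))" by (rule finite_subset[OF _ assms(1)], blast)+
    moreover have "(L \<inter> (C \<inter> B)) \<inter> (L \<inter> (C - B)) = {}" by blast
    ultimately have "card ((L \<inter> (C \<inter> B)) \<union> (L \<inter> (C - B))) = card (L \<inter> (C \<inter> B)) + card (L \<inter> (C - B))" by (rule card_Un_disjoint)
    then show ?thesis using \<open>L \<inter> C = (L \<inter> (C \<inter> B)) \<union> (L \<inter> (C - B))\<close> by (simp only:)
  qed
  then have s: "single L (N, u) \<longleftrightarrow> card (L \<inter> (C \<inter> B)) + card (L \<inter> (C - B)) = 1"
    unfolding single_def assms(2) by simp
  show ?thesis
  proof (cases "single L (N, u)")
    case True
    have "L \<inter> C = {pt L (N, u)}" using pt_mem(1)[OF True] assms(2) by simp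
    then have "L \<inter> (C \<inter> B) = {pt L (N, u)} \<inter> B" by blast
    then show ?thesis using True s by (cases "pt L (N, u) \<in> B") auto
  next
    case False
    then have "pt L (N, u) = 0" by (simp add: pt_def)
    then show ?thesis using False s by simp
  qed
qed

lemma pred_nat2:
  fixes f g :: "'a \<Rightarrow> nat"
  assumes "f \<in> measurable M (count_space UNIV)" "g \<in> measurable M (count_space UNIV)"
  shows "Measurable.pred M (\<lambda>x. Q (f x) (g x))"
proof -
  have 1: "Measurable.pred M (\<lambda>x. f x = a)" "Measurable.pred M (\<lambda>x. g x = a)" for a
    using assms by measurable
  have "Measurable.pred M (\<lambda>x. \<exists>a. \<exists>b. (f x = a \<and> g x = b) \<and> Q a b)"
    by (intro pred_intros_countable pred_intros_logic(3) 1) simp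
  then show ?thesis by simp
qed

text \<open>\<open>is_PPP\<close> provides independence for counts in disjoint sets. Splitting each
  cell into its part in the target set and the rest gives 2 m disjoint sets; their counts, grouped
  in pairs, decide by \<open>pt_in_iff\<close> whether the points lie in the targets.\<close>

lemma PPP_pt_indep:
  fixes X :: "'a \<Rightarrow> (real^'n) set"
  assumes X: "is_PPP M X l" and W: "W \<subseteq> lat"
  shows "prob_space.indep_vars M (\<lambda>_. borel) (\<lambda>u \<omega>. pt (X \<omega>) (N, u)) W"
proof -
  interpret prob_space M using X unfolding is_PPP_def by simp
  note Y = is_PPP_point_process[OF X]
  define C where "C u = cell (1 / (real N + 1)) u" for u :: "real^'n"
  have C: "C u \<in> sets borel" "bounded (C u)" if "u \<in> W" for u
    using that W unfolding C_def by (auto intro!: cell_measurable cell_bounded)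
  have rv: "random_variable borel (\<lambda>\<omega>. pt (X \<omega>) (N, u))" if "u \<in> W" for u
    using that W by (intro pt_measurable[OF Y]) auto
  have "indep_sets (\<lambda>u. {(\<lambda>\<omega>. pt (X \<omega>) (N, u)) -` A \<inter> space M |A. A \<in> sets borel}) W"
  proof (rule indep_setsI)
    show "{(\<lambda>\<omega>. pt (X \<omega>) (N, u)) -` A \<inter> space M |A. A \<in> sets borel} \<subseteq> events" if "u \<in> W" for u
      using rv[OF that] by (auto intro: measurable_sets)
    fix A J assume J: "J \<noteq> {}" "J \<subseteq> W" "finite J"
      and A: "\<forall>j\<in>J. A j \<in> {(\<lambda>\<omega>. pt (X \<omega>) (N, j)) -` A \<inter> space M |A. A \<in> sets borel}"
    then obtain B where B: "\<And>j. j \<in> J \<Longrightarrow> B j \<in> sets borel \<and> A j = (\<lambda>\<omega>. pt (X \<omega>) (N, j)) -` B j \<inter> space M"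
      by (auto simp: bchoice_iff) metis
    obtain f where f: "bij_betw f {..<card J} J" using ex_bij_betw_nat_finite[OF J(3)] by (auto simp: atLeast0LessThan)
    define m where "m = card J"
    have m: "{..<m} \<noteq> {}" unfolding m_def lessThan_empty_iff using J by auto
    have fJ: "f i \<in> J" if "i < m" for i using f that unfolding m_def bij_betw_def by auto
    have finj: "f i \<noteq> f j" if "i < m" "j < m" "i \<noteq> j" for i j using f that unfolding m_def bij_betw_def inj_on_def by auto
    \<comment> \<open>Even indices are the parts inside the target sets, odd ones the
      remainders.\<close>
    define G where "G k = (if even k then C (f (k div 2)) \<inter> B (f (k div 2)) else C (f (k div 2)) - B (f (k div 2)))" for k
    have GC: "G k \<subseteq> C (f (k div 2))" for k unfolding G_def by auto
    have G: "G k \<in> sets lborel \<and> bounded (G k)" if "k < 2 * m" for k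
    proof -
      have "f (k div 2) \<in> J" using that by (intro fJ) auto
      then have "C (f (k div 2)) \<in> sets borel" "bounded (C (f (k div 2)))" "B (f (k div 2)) \<in> sets borel"
        using C J(2) B by auto
      then show ?thesis using bounded_subset[OF _ GC] unfolding G_def by auto
    qed
    have dG: "disjoint_family_on G {..<2 * m}"
      unfolding disjoint_family_on_def
    proof (intro ballI impI)
      fix k k' assume k: "k \<in> {..<2 * m}" "k' \<in> {..<2 * m}" "k \<noteq> k'"
      show "G k \<inter> G k' = {}"
      proof (cases "k div 2 = k' div 2")
        case True
        then have "even k \<noteq> even k'" using k(3) by (metis div_mult_mod_eq odd_iff_mod_2_eq_one parity_cases)
        then show ?thesis unfolding G_def using True by auto
      next
        case False
        then have "f (k div 2) \<noteq> f (k' div 2)" using k by (intro finj) auto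
        then have "C (f (k div 2)) \<inter> C (f (k' div 2)) = {}" unfolding C_def by (rule cell_disjoint)
        then show ?thesis using GC by blast
      qed
    qed
    define n where "n k \<omega> = card (X \<omega> \<inter> G k)" for k \<omega>
    have ind: "indep_vars (\<lambda>_. count_space UNIV) n {..<2 * m}"
      using X G dG unfolding is_PPP_def n_def by blast
    define K where "K i = {2 * i, 2 * i + 1}" for i :: nat
    have ind2: "indep_vars (\<lambda>i. PiM (K i) (\<lambda>_. count_space UNIV)) (\<lambda>i \<omega>. restrict (\<lambda>k. n k \<omega>) (K i)) {..<m}"
    proof (rule indep_vars_restrict[OF ind])
      show "K i \<subseteq> {..<2 * m}" if "i \<in> {..<m}" for i using that unfolding K_def by auto
      show "disjoint_family_on K {..<m}" unfolding disjoint_family_on_def K_def by auto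
    qed
    define T where "T i a b \<longleftrightarrow> (a + b = 1 \<and> a = 1) \<or> (a + b \<noteq> 1 \<and> 0 \<in> B (f i))" for i and a b :: nat
    define E where "E i = {h \<in> space (PiM (K i) (\<lambda>_. count_space UNIV)). T i (h (2 * i)) (h (2 * i + 1))}" for i
    have E: "E i \<in> sets (PiM (K i) (\<lambda>_. count_space UNIV))" for i
    proof -
      have 1: "(\<lambda>h. h k) \<in> measurable (PiM (K i) (\<lambda>_. count_space (UNIV::nat set))) (count_space UNIV)" if "k \<in> K i" for k
        using that by (rule measurable_component_singleton)
      have "(\<lambda>h. h (2 * i)) \<in> measurable (PiM (K i) (\<lambda>_. count_space (UNIV::nat set))) (count_space UNIV)"
        "(\<lambda>h. h (2 * i + 1)) \<in> measurable (PiM (K i) (\<lambda>_. count_space (UNIV::nat set))) (count_space UNIV)"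
        by (rule 1, simp add: K_def)+
      then have "Measurable.pred (PiM (K i) (\<lambda>_. count_space (UNIV::nat set))) (\<lambda>h. T i (h (2 * i)) (h (2 * i + 1)))"
        by (rule pred_nat2)
      then show ?thesis unfolding E_def by (simp add: pred_def)
    qed
    have AE: "(\<lambda>\<omega>. restrict (\<lambda>k. n k \<omega>) (K i)) -` E i \<inter> space M = A (f i)" if i: "i < m" for i
    proof -
      have "restrict (\<lambda>k. n k \<omega>) (K i) \<in> E i \<longleftrightarrow> pt (X \<omega>) (N, f i) \<in> B (f i)" if "\<omega> \<in> space M" for \<omega>
      proof -
        have "bounded (C (f i))" using C(2) fJ[OF i] J(2) by auto
        then have "finite (X \<omega> \<inter> C (f i))" using point_process_finite[OF Y that] by auto
        from pt_in_iff[OF this C_def, of "B (f i)"]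
        show ?thesis unfolding E_def T_def n_def G_def K_def by (simp add: space_PiM)
      qed
      then show ?thesis using B[OF fJ[OF i]] by auto
    qed
    have "prob (\<Inter>i\<in>{..<m}. (\<lambda>\<omega>. restrict (\<lambda>k. n k \<omega>) (K i)) -` E i \<inter> space M)
      = (\<Prod>i\<in>{..<m}. prob ((\<lambda>\<omega>. restrict (\<lambda>k. n k \<omega>) (K i)) -` E i \<inter> space M))"
      by (rule indep_varsD[OF ind2 m]) (auto simp: E)
    moreover have "(\<Inter>i\<in>{..<m}. (\<lambda>\<omega>. restrict (\<lambda>k. n k \<omega>) (K i)) -` E i \<inter> space M) = (\<Inter>j\<in>J. A j)"
    proof -
      have "J = f ` {..<m}" using f unfolding bij_betw_def m_def by simp
      then show ?thesis using AE by simp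
    qed
    moreover have "(\<Prod>i\<in>{..<m}. prob ((\<lambda>\<omega>. restrict (\<lambda>k. n k \<omega>) (K i)) -` E i \<inter> space M)) = (\<Prod>i\<in>{..<m}. prob (A (f i)))"
      using AE by (intro prod.cong) auto
    moreover have "(\<Prod>i\<in>{..<m}. prob (A (f i))) = (\<Prod>j\<in>J. prob (A j))"
      using f unfolding m_def by (rule prod.reindex_bij_betw)
    ultimately show "prob (\<Inter>j\<in>J. A j) = (\<Prod>j\<in>J. prob (A j))" by simp
  qed
  then show ?thesis unfolding indep_vars_def2 using rv by simp
qed

text \<open>Fix the points in the cells \<open>U\<close>: their hull is a null set, and the point in
  cell \<open>u\<close>, which is independent of them, lies in a given null set with probability 0.
  Integration over the fixed points (Fubini) gives the claim.\<close>

lemma PPP_in_hull_null: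
  fixes X :: "'a \<Rightarrow> (real^'n) set"
  assumes X: "is_PPP M X l" and U: "finite U" "U \<subseteq> lat" "card U \<le> CARD('n)" and u: "u \<in> lat" "u \<notin> U"
  shows "measure M {\<omega>\<in>space M. single (X \<omega>) (N, u) \<and> pt (X \<omega>) (N, u) \<in> convex hull ((\<lambda>v. pt (X \<omega>) (N, v)) ` U)} = 0"
proof -
  interpret prob_space M using X unfolding is_PPP_def by simp
  note Y = is_PPP_point_process[OF X]
  define C where "C = cell (1 / (real N + 1)) u"
  have C: "C \<in> sets borel" "bounded C" using u unfolding C_def by (auto intro!: cell_measurable cell_bounded)
  define p where "p v \<omega> = pt (X \<omega>) (N, v)" for v \<omega>
  have pm: "p v \<in> borel_measurable M" if "v \<in> lat" for v using that unfolding p_def by (intro pt_measurable[OF Y]) auto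
  define S where "S = PiM U (\<lambda>_. borel :: (real^'n) measure)"
  define T where "T = PiM {u} (\<lambda>_. borel :: (real^'n) measure)"
  define Z where "Z \<omega> = restrict (\<lambda>v. p v \<omega>) U" for \<omega>
  define a where "a \<omega> = restrict (\<lambda>v. p v \<omega>) {u}" for \<omega>
  have "indep_vars (\<lambda>_. borel) p (insert u U)" unfolding p_def using U u by (intro PPP_pt_indep[OF X]) auto
  then have "indep_var S Z T a" unfolding S_def T_def Z_def a_def by (rule indep_var_restrict) (use u in auto)
  then have rv: "Z \<in> measurable M S" "a \<in> measurable M T" and d: "distr M S Z \<Otimes>\<^sub>M distr M T a = distr M (S \<Otimes>\<^sub>M T) (\<lambda>\<omega>. (Z \<omega>, a \<omega>))"
    unfolding indep_var_distribution_eq by auto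
  \<comment> \<open>Leaving out 0 excludes the default value of \<open>pt\<close>; a genuine point
    at 0 is covered by the null event for \<open>{0}\<close> below.\<close>
  define P where "P zh \<longleftrightarrow> snd zh u \<in> C - {0} \<and> snd zh u \<in> convex hull ((\<lambda>v. fst zh v) ` U)" for zh :: "((real^'n) \<Rightarrow> (real^'n)) \<times> ((real^'n) \<Rightarrow> (real^'n))"
  have m1: "(\<lambda>zh. snd zh u) \<in> borel_measurable (S \<Otimes>\<^sub>M T)"
    by (rule measurable_compose[OF measurable_snd]) (auto simp: T_def intro!: measurable_component_singleton)
  have m2: "(\<lambda>zh. fst zh v) \<in> borel_measurable (S \<Otimes>\<^sub>M T)" if "v \<in> U" for v
    by (rule measurable_compose[OF measurable_fst]) (use that in \<open>auto simp: S_def intro!: measurable_component_singleton\<close>)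
  have C0: "C - {0} \<in> sets borel" using C by auto
  have Pm: "Measurable.pred (S \<Otimes>\<^sub>M T) P"
    unfolding P_def by (intro pred_intros_logic(3) pred_sets2[OF C0 m1] in_hull_pred m1 m2 U(1))
  define A where "A = {zh\<in>space (S \<Otimes>\<^sub>M T). P zh}"
  have A: "A \<in> sets (S \<Otimes>\<^sub>M T)" unfolding A_def using Pm by (simp add: pred_def)
  interpret T: prob_space "distr M T a" by (rule prob_space_distr[OF rv(2)])
  have slice: "emeasure (distr M T a) (Pair z -` A) = 0" for z
  proof -
    define B where "B = C \<inter> (convex hull (z ` U)) - {0}"
    have hn: "convex hull (z ` U) \<in> null_sets lborel"
      using U by (intro hull_negligible) (auto intro: order_trans[OF card_image_le])
    then have Bn: "B \<in> null_sets lborel" unfolding B_def using C by (intro null_sets_subset[OF hn]) auto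
    have Bb: "bounded B" using C(2) unfolding B_def by (auto intro: bounded_subset)
    have sub: "a -` (Pair z -` A) \<inter> space M \<subseteq> {\<omega>\<in>space M. card (X \<omega> \<inter> B) = 1}"
    proof
      fix \<omega> assume w: "\<omega> \<in> a -` (Pair z -` A) \<inter> space M"
      then have "P (z, a \<omega>)" unfolding A_def by auto
      then have pB: "p u \<omega> \<in> B" "p u \<omega> \<noteq> 0" unfolding P_def a_def B_def by auto
      then have s: "single (X \<omega>) (N, u)" unfolding p_def pt_def by (auto split: if_splits)
      have "X \<omega> \<inter> C = {p u \<omega>}" using pt_mem(1)[OF s] unfolding C_def p_def by simp
      moreover have "X \<omega> \<inter> B = (X \<omega> \<inter> C) \<inter> B" unfolding B_def by auto
      ultimately have "X \<omega> \<inter> B = {p u \<omega>}" using pB(1) by auto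
      then show "\<omega> \<in> {\<omega>\<in>space M. card (X \<omega> \<inter> B) = 1}" using w by simp
    qed
    have ev: "{\<omega>\<in>space M. card (X \<omega> \<inter> B) = 1} \<in> sets M"
    proof -
      have "(\<lambda>\<omega>. card (X \<omega> \<inter> B)) \<in> measurable M (count_space UNIV)"
        using Y Bn Bb unfolding point_process_def by blast
      from measurable_sets[OF this, of "{1}"] show ?thesis by (simp add: vimage_def Int_def conj_commute)
    qed
    have "Pair z -` A \<in> sets T" using A by (rule sets_Pair1)
    then have "emeasure (distr M T a) (Pair z -` A) = emeasure M (a -` (Pair z -` A) \<inter> space M)"
      by (rule emeasure_distr[OF rv(2)])
    also have "\<dots> \<le> emeasure M {\<omega>\<in>space M. card (X \<omega> \<inter> B) = 1}" by (rule emeasure_mono[OF sub ev])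
    also have "\<dots> = 0" using PPP_null_miss[OF X Bn Bb] by (simp add: emeasure_eq_measure)
    finally show ?thesis by simp
  qed
  have "emeasure (distr M (S \<Otimes>\<^sub>M T) (\<lambda>\<omega>. (Z \<omega>, a \<omega>))) A = (\<integral>\<^sup>+ z. emeasure (distr M T a) (Pair z -` A) \<partial>distr M S Z)"
    unfolding d[symmetric] using A by (intro T.emeasure_pair_measure_alt) (simp cong: sets_pair_measure_cong)
  also have "\<dots> = 0" unfolding slice by simp
  finally have 1: "emeasure M ((\<lambda>\<omega>. (Z \<omega>, a \<omega>)) -` A \<inter> space M) = 0"
    using A rv by (simp add: emeasure_distr)
  have z: "{0 :: real^'n} \<in> null_sets lborel" "bounded {0 :: real^'n}" by auto
  have ev0: "{\<omega>\<in>space M. card (X \<omega> \<inter> {0}) = 1} \<in> sets M"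
  proof -
    have "(\<lambda>\<omega>. card (X \<omega> \<inter> {0})) \<in> measurable M (count_space UNIV)"
      using Y z unfolding point_process_def by blast
    from measurable_sets[OF this, of "{1}"] show ?thesis by (simp add: vimage_def Int_def conj_commute)
  qed
  have evA: "(\<lambda>\<omega>. (Z \<omega>, a \<omega>)) -` A \<inter> space M \<in> sets M"
    using A rv by (intro measurable_sets[OF _ A]) auto
  have "{\<omega>\<in>space M. single (X \<omega>) (N, u) \<and> pt (X \<omega>) (N, u) \<in> convex hull ((\<lambda>v. pt (X \<omega>) (N, v)) ` U)}
    \<subseteq> ((\<lambda>\<omega>. (Z \<omega>, a \<omega>)) -` A \<inter> space M) \<union> {\<omega>\<in>space M. card (X \<omega> \<inter> {0}) = 1}"
  proof
    fix \<omega> assume "\<omega> \<in> {\<omega>\<in>space M. single (X \<omega>) (N, u) \<and> pt (X \<omega>) (N, u) \<in> convex hull ((\<lambda>v. pt (X \<omega>) (N, v)) ` U)}"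
    then have w: "\<omega> \<in> space M" "single (X \<omega>) (N, u)" "p u \<omega> \<in> convex hull ((\<lambda>v. p v \<omega>) ` U)" unfolding p_def by auto
    have pc: "p u \<omega> \<in> C" "p u \<omega> \<in> X \<omega>" using pt_mem[OF w(2)] unfolding C_def p_def by auto
    show "\<omega> \<in> ((\<lambda>\<omega>. (Z \<omega>, a \<omega>)) -` A \<inter> space M) \<union> {\<omega>\<in>space M. card (X \<omega> \<inter> {0}) = 1}"
    proof (cases "p u \<omega> = 0")
      case True
      then have "X \<omega> \<inter> {0} = {0}" using pc by auto
      then show ?thesis using w(1) by simp
    next
      case False
      have "(Z \<omega>, a \<omega>) \<in> space (S \<Otimes>\<^sub>M T)"
        using measurable_space[OF rv(1) w(1)] measurable_space[OF rv(2) w(1)] by (simp add: space_pair_measure)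
      moreover have "P (Z \<omega>, a \<omega>)" unfolding P_def Z_def a_def using w(3) pc False by simp
      ultimately show ?thesis using w(1) unfolding A_def by simp
    qed
  qed
  then have "measure M {\<omega>\<in>space M. single (X \<omega>) (N, u) \<and> pt (X \<omega>) (N, u) \<in> convex hull ((\<lambda>v. pt (X \<omega>) (N, v)) ` U)}
    \<le> measure M (((\<lambda>\<omega>. (Z \<omega>, a \<omega>)) -` A \<inter> space M) \<union> {\<omega>\<in>space M. card (X \<omega> \<inter> {0}) = 1})"
    using ev0 evA by (intro finite_measure_mono) auto
  also have "\<dots> \<le> measure M ((\<lambda>\<omega>. (Z \<omega>, a \<omega>)) -` A \<inter> space M) + measure M {\<omega>\<in>space M. card (X \<omega> \<inter> {0}) = 1}"
    using ev0 evA by (intro measure_Un_le) auto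
  also have "\<dots> = 0" using 1 PPP_null_miss[OF X z] by (simp add: measure_def)
  finally show ?thesis by (simp add: measure_le_0_iff)
qed

text \<open>A degenerate configuration is detected at any mesh that isolates \<open>x\<close> and
  all points of \<open>S\<close>, so countably many events cover it. They are null because a hull of
  at most D points is.\<close>

lemma PPP_generic:
  fixes X :: "'a \<Rightarrow> (real^'n) set"
  assumes X: "is_PPP M X l" and d: "d \<le> CARD('n)"
  obtains A where "A \<in> null_sets M" "\<And>\<omega>. \<omega> \<in> space M - A \<Longrightarrow> \<not> degenerate d (X \<omega>)"
proof -
  interpret prob_space M using X unfolding is_PPP_def by simp
  note Y = is_PPP_point_process[OF X]
  define I where "I = {(N :: nat, u, U). u \<in> (lat :: (real^'n) set) \<and> finite U \<and> U \<subseteq> lat \<and> card U = d \<and> u \<notin> U}"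
  define A where "A = (\<lambda>(N, u, U). {\<omega>\<in>space M. single (X \<omega>) (N, u) \<and> pt (X \<omega>) (N, u) \<in> convex hull ((\<lambda>v. pt (X \<omega>) (N, v)) ` U)})"
  have "I \<subseteq> UNIV \<times> lat \<times> {U. finite U \<and> U \<subseteq> lat}" unfolding I_def by auto
  moreover have "countable ((UNIV :: nat set) \<times> (lat :: (real^'n) set) \<times> {U. finite U \<and> U \<subseteq> (lat :: (real^'n) set)})"
    by (intro countable_SIGMA countableI_type countable_lat countable_Collect_finite_subset)
  ultimately have cI: "countable I" by (rule countable_subset)
  have "A i \<in> null_sets M" if i: "i \<in> I" for i
  proof -
    obtain N u U where iN: "i = (N, u, U)" by (cases i) auto
    then have h: "u \<in> lat" "finite U" "U \<subseteq> lat" "card U \<le> CARD('n)" "u \<notin> U" using i d unfolding I_def by auto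
    have "A i \<in> sets M"
    proof -
      have p: "(\<lambda>\<omega>. pt (X \<omega>) (N, v)) \<in> borel_measurable M" if "v \<in> lat" for v using that by (intro pt_measurable[OF Y]) auto
      have "Measurable.pred M (\<lambda>\<omega>. pt (X \<omega>) (N, u) \<in> convex hull ((\<lambda>v. pt (X \<omega>) (N, v)) ` U))"
        using h p by (intro in_hull_pred) auto
      moreover have "Measurable.pred M (\<lambda>\<omega>. single (X \<omega>) (N, u))" using h by (intro single_pred[OF Y]) auto
      ultimately have "Measurable.pred M (\<lambda>\<omega>. single (X \<omega>) (N, u) \<and> pt (X \<omega>) (N, u) \<in> convex hull ((\<lambda>v. pt (X \<omega>) (N, v)) ` U))"
        by (intro pred_intros_logic(3))
      then show ?thesis unfolding A_def iN by (simp add: pred_def)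
    qed
    moreover have "measure M (A i) = 0" unfolding A_def iN using PPP_in_hull_null[OF X h(2-4,1,5)] by simp
    ultimately show ?thesis by (auto simp: null_sets_def emeasure_eq_measure)
  qed
  then have null: "(\<Union>i\<in>I. A i) \<in> null_sets M" by (rule null_sets_UN'[OF cI])
  show ?thesis
  proof (rule that[OF null])
    fix \<omega> assume w: "\<omega> \<in> space M - (\<Union>i\<in>I. A i)"
    show "\<not> degenerate d (X \<omega>)"
    proof
      assume "degenerate d (X \<omega>)"
      then obtain x S where xS: "x \<in> X \<omega>" "S \<subseteq> X \<omega>" "finite S" "card S = d" "x \<notin> S" "x \<in> convex hull S"
        unfolding degenerate_def by blast
      have fin: "finite (X \<omega> \<inter> B)" if "bounded B" for B using point_process_finite[OF Y _ that] w by auto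
      have "\<forall>y\<in>insert x S. \<exists>N0. \<forall>N\<ge>N0. single (X \<omega>) (N, cidx (1 / (real N + 1)) y) \<and> pt (X \<omega>) (N, cidx (1 / (real N + 1)) y) = y"
        using pt_eventually[of "X \<omega>"] fin xS(1,2) by blast
      then obtain N0 where N0: "\<And>y N. y \<in> insert x S \<Longrightarrow> N0 y \<le> N \<Longrightarrow>
        single (X \<omega>) (N, cidx (1 / (real N + 1)) y) \<and> pt (X \<omega>) (N, cidx (1 / (real N + 1)) y) = y" by metis
      define N where "N = Max (N0 ` insert x S)"
      have "N0 y \<le> N" if "y \<in> insert x S" for y unfolding N_def using that xS(3) by (intro Max_ge) auto
      then have NN: "single (X \<omega>) (N, cidx (1 / (real N + 1)) y)" "pt (X \<omega>) (N, cidx (1 / (real N + 1)) y) = y" if "y \<in> insert x S" for y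
        using N0 that by blast+
      define g where "g y = cidx (1 / (real N + 1)) y" for y :: "real^'n"
      have inj: "inj_on g (insert x S)"
        by (rule inj_on_inverseI[of _ "\<lambda>v. pt (X \<omega>) (N, v)"]) (use NN g_def in auto)
      have "g x \<notin> g ` S"
      proof
        assume "g x \<in> g ` S"
        then obtain y where "y \<in> S" "g x = g y" by auto
        then show False using inj xS(5) unfolding inj_on_def by auto
      qed
      moreover have "card (g ` S) = d" using card_image[OF inj_on_subset[OF inj]] xS(4) by auto
      ultimately have iI: "(N, g x, g ` S) \<in> I" unfolding I_def using xS(3) cidx_lat unfolding g_def by auto
      have "(\<lambda>v. pt (X \<omega>) (N, v)) ` g ` S = S"
      proof -
        have "(\<lambda>y. pt (X \<omega>) (N, g y)) ` S = (\<lambda>y. y) ` S" using NN unfolding g_def by (intro image_cong) auto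
        then show ?thesis by (simp add: image_image)
      qed
      then have "\<omega> \<in> A (N, g x, g ` S)" unfolding A_def using w xS(6) NN[of x] unfolding g_def by simp
      then show False using w iI by blast
    qed
  qed
qed

subsection \<open>Regions with many points\<close>

definition full :: "nat \<Rightarrow> real \<Rightarrow> (real^'n) set \<Rightarrow> real^'n \<Rightarrow> bool" where
  "full d h L u \<longleftrightarrow> counts (d + 1) (cidx h) L u = d + 1"

text \<open>The circumradius of a simplex of diameter 1 about its barycentre is at most \<open>d / (d + 1)\<close>; a fine
  mesh leaves room for a whole cell around the barycentre within distance 1 of all vertices.\<close>
definition fine_mesh :: "'n::finite itself \<Rightarrow> nat \<Rightarrow> real \<Rightarrow> bool" where
  "fine_mesh D d h \<longleftrightarrow> 0 < h \<and> 4 * (real d + 1) * (h * sqrt CARD('n)) \<le> 1"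

lemma fine_mesh_bounds:
  assumes "fine_mesh TYPE('n::finite) d h"
  shows "0 < h" "2 * (h * sqrt CARD('n)) \<le> 1" "real d / (real d + 1) + h * sqrt CARD('n) \<le> 1"
proof -
  define x where "x = h * sqrt CARD('n)"
  have x: "0 \<le> x" "4 * (real d + 1) * x \<le> 1" using assms unfolding fine_mesh_def x_def by auto
  show "0 < h" using assms unfolding fine_mesh_def by simp
  have "4 * x \<le> 4 * (real d + 1) * x" using x(1) by (simp add: algebra_simps)
  then show "2 * (h * sqrt CARD('n)) \<le> 1" using x unfolding x_def by simp
  have "0 \<le> (real d + 1) * x" using x(1) by simp
  then have "x * (real d + 1) \<le> 1" using x(2) by (simp add: algebra_simps)
  then have "x \<le> 1 / (real d + 1)" by (subst pos_le_divide_eq) auto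
  moreover have "real d / (real d + 1) + 1 / (real d + 1) = 1" by (simp add: add_divide_distrib[symmetric])
  ultimately show "real d / (real d + 1) + h * sqrt CARD('n) \<le> 1" unfolding x_def[symmetric] by linarith
qed

lemma full_simplex:
  assumes "fine_mesh TYPE('n::finite) d h" "full d h L (u :: real^'n)"
  obtains S where "S \<in> csimp d close L" "S \<subseteq> cell h u"
proof -
  have "d + 1 \<le> card {x\<in>L. cidx h x = u}" using assms(2) unfolding full_def counts_def by simp
  then obtain S where S: "S \<subseteq> {x\<in>L. cidx h x = u}" "card S = d + 1" "finite S"
    by (meson obtain_subset_with_card_n)
  have "close x y" if "x \<in> S" "y \<in> S" for x y
  proof -
    have "cidx h x = cidx h y" using that S by auto
    then have "dist x y \<le> h * sqrt CARD('n)" using cidx_dist(1)[of h x y] fine_mesh_bounds[OF assms(1)] by simp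
    then show ?thesis using fine_mesh_bounds[OF assms(1)] by simp
  qed
  then have "S \<in> csimp d close L" using S unfolding csimp_def by auto
  moreover have "S \<subseteq> cell h u" using S unfolding cell_def by auto
  ultimately show ?thesis using that by blast
qed

lemma conn_neighbour_cells:
  assumes h: "fine_mesh TYPE('n::finite) d h" and u: "dist u (v :: real^'n) \<le> sqrt CARD('n)"
    and S: "S \<in> csimp d close L" "S \<subseteq> cell h u" and T: "T \<in> csimp d close L" "T \<subseteq> cell h v"
  shows "conn d close L S T"
proof (rule conn_in_clique[of "S \<union> T"])
  fix x y assume xy: "x \<in> S \<union> T" "y \<in> S \<union> T"
  have "x \<in> cell h u \<union> cell h v" "y \<in> cell h u \<union> cell h v" using xy S T by auto
  then have "dist (cidx h x) (cidx h y) \<le> sqrt CARD('n)"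
    using u unfolding cell_def by (auto simp: dist_commute)
  then have "h * (dist (cidx h x) (cidx h y) + sqrt CARD('n)) \<le> h * (2 * sqrt CARD('n))"
    using fine_mesh_bounds(1)[OF h] by (intro mult_left_mono) auto
  then show "close x y" using cidx_dist(1)[OF fine_mesh_bounds(1)[OF h], of x y] fine_mesh_bounds(2)[OF h] by linarith
qed (use csimpD[OF S(1)] csimpD[OF T(1)] in auto)

definition cell_step :: "nat \<Rightarrow> real \<Rightarrow> (real^'n) set \<Rightarrow> real^'n \<Rightarrow> real^'n \<Rightarrow> bool" where
  "cell_step d h L u v \<longleftrightarrow> full d h L u \<and> full d h L v \<and> dist u v \<le> sqrt CARD('n)"

lemma conn_cell_chain:
  assumes h: "fine_mesh TYPE('n::finite) d h" and uv: "(cell_step d h L)\<^sup>*\<^sup>* u (v :: real^'n)"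
    and S: "S \<in> csimp d close L" "S \<subseteq> cell h u" and T: "T \<in> csimp d close L" "T \<subseteq> cell h v"
  shows "conn d close L S T"
  using uv T
proof (induction arbitrary: T rule: rtranclp_induct)
  case base
  then show ?case using conn_neighbour_cells[OF h _ S, of u T] by simp
next
  case (step v w)
  have f: "full d h L v" "dist v w \<le> sqrt CARD('n)" using step.hyps(2) unfolding cell_step_def by auto
  obtain R where R: "R \<in> csimp d close L" "R \<subseteq> cell h v" using full_simplex[OF h f(1)] .
  have "conn d close L S R" using step.IH R by blast
  moreover have "conn d close L R T" using conn_neighbour_cells[OF h f(2) R step.prems] .
  ultimately show ?case by (rule rtranclp_trans)
qed

text \<open>Move all nonzero coordinates one unit towards 0 at once: the step has length at most
  \<surd>D, the norm does not increase, and the sum of the absolute values decreases.\<close>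

lemma cell_chain_to_0:
  assumes "\<And>u. u \<in> lat \<Longrightarrow> norm u \<le> r \<Longrightarrow> full d h L u" "u \<in> lat" "norm u \<le> r"
  shows "(cell_step d h L)\<^sup>*\<^sup>* u (0 :: real^'n)"
  using assms(2,3)
proof (induction "nat (\<Sum>i\<in>UNIV. \<lfloor>\<bar>u $ i\<bar>\<rfloor>)" arbitrary: u rule: less_induct)
  case less
  show ?case
  proof (cases "u = 0")
    case False
    define v where "v = (\<chi> i. u $ i - sgn (u $ i))"
    have ui: "u $ i \<in> \<int>" for i using less.prems(1) unfolding lat_def by auto
    have vl: "v \<in> lat" using ui unfolding lat_def v_def by (auto simp: sgn_if)
    have v1: "\<bar>v $ i\<bar> = (if u $ i = 0 then 0 else \<bar>u $ i\<bar> - 1)" for i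
    proof -
      obtain k where k: "u $ i = of_int k" using ui[of i] by (auto elim: Ints_cases)
      have "real_of_int k \<ge> 1" if "k > 0" using that by linarith
      moreover have "real_of_int k \<le> -1" if "k < 0" using that by linarith
      ultimately show ?thesis unfolding v_def using k by (auto simp: sgn_if)
    qed
    have vle: "\<bar>v $ i\<bar> \<le> \<bar>u $ i\<bar>" for i unfolding v1 by auto
    have nv: "norm v \<le> r" using norm_le_componentwise_cart[of v u] vle less.prems(2) by simp
    have uv: "dist u v \<le> sqrt CARD('n)"
    proof -
      have "norm (u - v) \<le> sqrt (\<Sum>i\<in>(UNIV :: 'n set). 1)"
        unfolding norm_vec_def L2_set_def v_def by (intro real_sqrt_le_mono sum_mono) (simp add: sgn_if)
      then show ?thesis by (simp add: dist_norm)
    qed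
    obtain j where j: "u $ j \<noteq> 0" using False by (auto simp: vec_eq_iff)
    have "\<lfloor>\<bar>v $ j\<bar>\<rfloor> < \<lfloor>\<bar>u $ j\<bar>\<rfloor>" using v1[of j] j by simp
    moreover have "\<lfloor>\<bar>v $ i\<bar>\<rfloor> \<le> \<lfloor>\<bar>u $ i\<bar>\<rfloor>" for i using vle by (intro floor_mono)
    ultimately have "(\<Sum>i\<in>UNIV. \<lfloor>\<bar>v $ i\<bar>\<rfloor>) < (\<Sum>i\<in>UNIV. \<lfloor>\<bar>u $ i\<bar>\<rfloor>)" by (intro sum_strict_mono_ex1) auto
    moreover have "0 \<le> (\<Sum>i\<in>UNIV. \<lfloor>\<bar>v $ i\<bar>\<rfloor>)" by (intro sum_nonneg) simp
    ultimately have "(cell_step d h L)\<^sup>*\<^sup>* v 0" using vl nv by (intro less.hyps) auto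
    moreover have "cell_step d h L u v" unfolding cell_step_def using assms(1) less.prems vl nv uv by simp
    ultimately show ?thesis by (meson converse_rtranclp_into_rtranclp)
  qed auto
qed

text \<open>Exchange a vertex of \<open>S\<close> for the origin, which lies in the same cell and
  thus close to the other vertices.\<close>

lemma conn_origin_cell:
  assumes h: "fine_mesh TYPE('n::finite) d h" and S: "S \<in> csimp d close L" "S \<subseteq> cell h (0 :: real^'n)"
  obtains S0 where "S0 \<in> csimp d close (insert 0 L)" "0 \<in> S0" "conn d close (insert 0 L) S0 S"
proof -
  note SD = csimpD[OF S(1)]
  have "d \<le> card (S - {0})" using SD by (cases "0 \<in> S") auto
  then obtain F where F: "F \<subseteq> S - {0}" "card F = d" "finite F" by (meson obtain_subset_with_card_n)
  have z: "0 \<in> cell h (0::real^'n)" unfolding cell_def by (simp add: cidx_0)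
  have cl: "close x y" if "x \<in> cell h 0" "y \<in> cell h 0" for x y :: "real^'n"
  proof -
    have "dist x y \<le> h * sqrt CARD('n)" using cidx_dist(1)[of h x y] fine_mesh_bounds[OF h] that unfolding cell_def by simp
    then show ?thesis using fine_mesh_bounds[OF h] by simp
  qed
  have sub: "insert 0 F \<subseteq> cell h 0" using F S z by auto
  have c: "card (insert 0 F) = d + 1" using F by (subst card_insert_disjoint) auto
  have S0: "insert 0 F \<in> csimp d close (insert 0 L)"
    unfolding csimp_def
  proof (intro CollectI conjI ballI)
    show "insert 0 F \<subseteq> insert 0 L" using F(1) SD(1) by auto
    show "close x y" if "x \<in> insert 0 F" "y \<in> insert 0 F" for x y using that sub by (intro cl) auto
  qed (use F c in auto)
  have "F \<subseteq> insert 0 F \<inter> S" using F by auto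
  then have "card F \<le> card (insert 0 F \<inter> S)" using F(3) by (intro card_mono) auto
  then have "d \<le> card (insert 0 F \<inter> S)" using F(2) by simp
  then have "cadj d close (insert 0 L) (insert 0 F) S"
    unfolding cadj_def using S0 csimp_mono[OF subset_insertI S(1)] by simp
  then show ?thesis by (intro that[of "insert 0 F"] S0 r_into_rtranclp) auto
qed

lemma conn_barycentre_cell:
  fixes L :: "(real^'n) set"
  assumes h: "fine_mesh TYPE('n) d h" and T: "T \<in> csimp d close L" "x0 \<in> T" "norm x0 \<le> a"
  obtains u where "u \<in> lat" "h * norm u \<le> a + 1 + h * sqrt CARD('n)"
    "\<And>S. S \<in> csimp d close L \<Longrightarrow> S \<subseteq> cell h u \<Longrightarrow> conn d close L S T"
proof -
  note TD = csimpD[OF T(1)] and h0 = fine_mesh_bounds[OF h]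
  define b where "b = (1 / (real d + 1)) *\<^sub>R (\<Sum>z\<in>T. z)"
  have xb: "dist x b \<le> real d / (real d + 1)" if x: "x \<in> T" for x
  proof -
    have "(\<Sum>z\<in>T. x) = (real d + 1) *\<^sub>R x" by (simp only: sum_constant_scaleR TD(3) of_nat_add of_nat_1)
    then have "x - b = (1 / (real d + 1)) *\<^sub>R (\<Sum>z\<in>T. x - z)"
      unfolding b_def by (simp add: sum_subtractf scaleR_right_diff_distrib del: sum_constant)
    then have "norm (x - b) = (1 / (real d + 1)) * norm (\<Sum>z\<in>T. x - z)" by simp
    \<comment> \<open>The summand of \<open>x\<close> itself vanishes, leaving \<open>d\<close>
      vectors of length at most 1, divided by \<open>d + 1\<close>.\<close>
    also have "(\<Sum>z\<in>T. x - z) = (\<Sum>z\<in>T - {x}. x - z)" using TD(2) x by (subst sum.remove[of T x]) auto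
    finally have n: "norm (x - b) = norm (\<Sum>z\<in>T - {x}. x - z) / (real d + 1)" by simp
    have "norm (\<Sum>z\<in>T - {x}. x - z) \<le> (\<Sum>z\<in>T - {x}. norm (x - z))" by (rule norm_sum)
    also have "\<dots> \<le> (\<Sum>z\<in>T - {x}. 1)" using TD(4)[OF x] by (intro sum_mono) (auto simp: dist_norm)
    also have "\<dots> = real d" using TD(2,3) x by simp
    finally have "norm (x - b) \<le> real d / (real d + 1)" unfolding n by (intro divide_right_mono) auto
    then show ?thesis by (simp add: dist_norm)
  qed
  have bn: "norm b \<le> a + 1"
  proof -
    have "real d / (real d + 1) \<le> 1" by simp
    then have "dist x0 b \<le> 1" using xb[OF T(2)] by linarith
    then show ?thesis using norm_triangle_sub[of b x0] T(3) by (simp add: dist_norm norm_minus_commute)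
  qed
  show ?thesis
  proof (rule that[of "cidx h b"])
    show "cidx h b \<in> lat" by (rule cidx_lat)
    show "h * norm (cidx h b) \<le> a + 1 + h * sqrt CARD('n)" using cidx_norm(2)[OF h0(1), of b] bn by linarith
    fix S assume S: "S \<in> csimp d close L" "S \<subseteq> cell h (cidx h b)"
    note SD = csimpD[OF S(1)]
    have yb: "dist y b \<le> h * sqrt CARD('n)" if "y \<in> S" for y
      using cidx_dist(1)[OF h0(1), of y b] that S(2) unfolding cell_def by auto
    have xy: "close x y" if "x \<in> T" "y \<in> S" for x y
      using dist_triangle2[of x y b] xb[OF that(1)] yb[OF that(2)] h0(3) by linarith
    show "conn d close L S T"
    proof (rule conn_in_clique[of "S \<union> T"])
      fix x y assume "x \<in> S \<union> T" "y \<in> S \<union> T"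
      then consider "x \<in> S" "y \<in> S" | "x \<in> S" "y \<in> T" | "x \<in> T" "y \<in> S" | "x \<in> T" "y \<in> T" by blast
      then show "close x y"
      proof cases
        case 2
        then show ?thesis using xy[of y x] by (simp add: dist_commute)
      qed (fact SD(4) xy TD(4))+
    qed (use SD TD in auto)
  qed
qed

text \<open>The first simplex of the link is connected to a full cell around its barycentre, and
  full cells lead from there to the origin. The radius in \<open>f\<close> allows for the start
  radius \<open>a\<close>, a barycentre within 1 of the starting vertex, and the rounding to a
  cell.\<close>

lemma reach_if_full:
  fixes L :: "(real^'n) set"
  assumes h: "fine_mesh TYPE('n) d h"
    and f: "\<And>u. u \<in> lat \<Longrightarrow> h * norm u \<le> a + 1 + h * sqrt CARD('n) \<Longrightarrow> full d h L u"
    and a: "0 \<le> a" and cl: "clink d close L (cball 0 a) (far 0 t)" and r: "r < t"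
  shows "reach d r L"
proof -
  obtain S T where ST: "S \<in> csimp d close L" "T \<in> csimp d close L" "S \<inter> cball 0 a \<noteq> {}" "T \<inter> far 0 t \<noteq> {}" "conn d close L S T"
    using cl unfolding clink_def by blast
  obtain x0 where x0: "x0 \<in> S" "norm x0 \<le> a" using ST(3) by auto
  obtain u where u: "u \<in> lat" "h * norm u \<le> a + 1 + h * sqrt CARD('n)"
    "\<And>R. R \<in> csimp d close L \<Longrightarrow> R \<subseteq> cell h u \<Longrightarrow> conn d close L R S"
    using conn_barycentre_cell[OF h ST(1) x0] by blast
  have h0: "0 < h" by (rule fine_mesh_bounds[OF h])
  define r0 where "r0 = (a + 1 + h * sqrt CARD('n)) / h"
  have r0: "norm v \<le> r0 \<longleftrightarrow> h * norm v \<le> a + 1 + h * sqrt CARD('n)" for v :: "real^'n"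
    unfolding r0_def using h0 by (simp add: field_simps)
  have ch: "(cell_step d h L)\<^sup>*\<^sup>* u 0" using f u r0 by (intro cell_chain_to_0[of r0]) auto
  obtain R where R: "R \<in> csimp d close L" "R \<subseteq> cell h u" using full_simplex[OF h f[OF u(1,2)]] .
  have "full d h L 0" using f[of 0] a h0 by (simp add: lat_def)
  then obtain Q where Q: "Q \<in> csimp d close L" "Q \<subseteq> cell h 0" using full_simplex[OF h] by blast
  obtain S0 where S0: "S0 \<in> csimp d close (insert 0 L)" "0 \<in> S0" "conn d close (insert 0 L) S0 Q"
    using conn_origin_cell[OF h Q] .
  have "conn d close L Q R" using conn_sym[OF conn_cell_chain[OF h ch R Q]] .
  also have "conn d close L R S" by (rule u(3)[OF R])
  also note ST(5)
  finally have "conn d close (insert 0 L) Q T" by (rule conn_mono[OF subset_insertI])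
  with S0(3) have c: "conn d close (insert 0 L) S0 T" by (rule rtranclp_trans)
  obtain x where "x \<in> T" "t \<le> norm x" using ST(4) unfolding far_def by auto
  then show ?thesis using conn_imp_reach[OF S0(1,2) c, of x r] r by simp
qed

lemma reach_if_all_full:
  fixes L :: "(real^'n) set"
  assumes h: "fine_mesh TYPE('n) d h" and f: "\<And>u. u \<in> lat \<Longrightarrow> norm u \<le> r0 \<Longrightarrow> full d h L u"
    and v: "(v :: real^'n) \<in> lat" "norm v \<le> r0" "r < h * (norm v - sqrt CARD('n))"
  shows "reach d r L"
proof -
  have h0: "0 < h" by (rule fine_mesh_bounds[OF h])
  have ch: "(cell_step d h L)\<^sup>*\<^sup>* v 0" by (rule cell_chain_to_0[OF f v(1,2)])
  obtain R where R: "R \<in> csimp d close L" "R \<subseteq> cell h v" using full_simplex[OF h f[OF v(1,2)]] .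
  have "full d h L 0" using f[of 0] v(2) norm_ge_zero[of v] by (simp add: lat_def)
  then obtain Q where Q: "Q \<in> csimp d close L" "Q \<subseteq> cell h 0" using full_simplex[OF h] by blast
  obtain S0 where S0: "S0 \<in> csimp d close (insert 0 L)" "0 \<in> S0" "conn d close (insert 0 L) S0 Q"
    using conn_origin_cell[OF h Q] .
  have "conn d close (insert 0 L) Q R"
    by (rule conn_mono[OF subset_insertI conn_sym[OF conn_cell_chain[OF h ch R Q]]])
  with S0(3) have c: "conn d close (insert 0 L) S0 R" by (rule rtranclp_trans)
  obtain x where x: "x \<in> R" using csimpD(5)[OF R(1)] by blast
  then have "cidx h x = v" using R(2) unfolding cell_def by auto
  then have "h * norm v \<le> norm x + h * sqrt CARD('n)" using cidx_norm(2)[OF h0, of x] by simp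
  then have "r < norm x" using v(3) by (simp add: algebra_simps)
  then show ?thesis using conn_imp_reach[OF S0(1,2) c x] by simp
qed

text \<open>Outside a null set distinct simplices have distinct hulls, so long chains yield long
  paths (\<open>clink_imp_fpath\<close>) and \<open>face_perc_iff\<close> applies.\<close>

lemma face_perc_pos:
  fixes X :: "'a \<Rightarrow> (real^'n) set"
  assumes X: "is_PPP M X l" and d: "1 \<le> d" "d \<le> CARD('n)" and E: "E \<in> sets M" "0 < measure M E"
    and cl: "\<And>\<omega> t. \<omega> \<in> E \<Longrightarrow> clink d close (X \<omega>) (cball 0 K) (far 0 t)"
  shows "0 < measure M {\<omega>\<in>space M. face_perc d (X \<omega>)}"
proof -
  interpret prob_space M using X unfolding is_PPP_def by simp
  note Y = is_PPP_point_process[OF X]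
  obtain A where A: "A \<in> null_sets M" "\<And>\<omega>. \<omega> \<in> space M - A \<Longrightarrow> \<not> degenerate d (X \<omega>)"
    using PPP_generic[OF X d(2)] by blast
  obtain K' :: nat where K': "K \<le> K'" using real_arch_simple by blast
  have "E - A \<subseteq> {\<omega>\<in>space M. face_perc d (X \<omega>)}"
  proof
    fix \<omega> assume w: "\<omega> \<in> E - A"
    then have ws: "\<omega> \<in> space M" using sets.sets_into_space[OF E(1)] by auto
    have "\<exists>\<sigma>. fpath d (X \<omega>) (real K') n \<sigma>" for n
    proof (rule clink_imp_fpath[OF d(1)])
      show "S = T" if "S \<in> simplices d (X \<omega>)" "T \<in> simplices d (X \<omega>)" "convex hull S = convex hull T" for S T
        using hull_inj[OF _ that] A(2) ws w by blast
      show "clink d close (X \<omega>) (cball 0 (real K')) (far 0 (real K' + real n + 2))"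
        using cl[of \<omega>] w K' by (intro clink_mono[OF order_refl _ order_refl cl]) auto
    qed
    then show "\<omega> \<in> {\<omega>\<in>space M. face_perc d (X \<omega>)}"
      using face_perc_iff[of "X \<omega>" d] point_process_finite[OF Y ws] d(1) ws by auto
  qed
  then have "measure M (E - A) \<le> measure M {\<omega>\<in>space M. face_perc d (X \<omega>)}"
    using face_perc_event[OF Y d(1)] by (intro finite_measure_mono)
  moreover have "measure M (E - A) = measure M E" using A(1) E(1) by (intro measure_Diff_null_set) auto
  ultimately show ?thesis using E(2) by linarith
qed

lemma full_prob:
  fixes X :: "'a \<Rightarrow> (real^'n) set"
  assumes X: "is_PPP M X l" and l: "0 < l" and h: "0 < h" and V: "finite V" "V \<subseteq> lat"
  shows "{\<omega>\<in>space M. \<forall>u\<in>V. full d h (X \<omega>) u} \<in> sets M"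
    "measure M {\<omega>\<in>space M. \<forall>u\<in>V. full d h (X \<omega>) u} = tpw (d + 1) (l * h ^ CARD('n)) (d + 1) ^ card V"
proof -
  define c where "c u = (if u \<in> V then d + 1 else 0)" for u :: "real^'n"
  have c: "c \<in> cfg (d + 1) V" unfolding cfg_def c_def by auto
  have e: "{\<omega>\<in>space M. \<forall>u\<in>V. full d h (X \<omega>) u} = {\<omega>\<in>space M. ccounts d h V (X \<omega>) = c}"
    unfolding full_def res_def c_def by (auto simp: fun_eq_iff)
  show "{\<omega>\<in>space M. \<forall>u\<in>V. full d h (X \<omega>) u} \<in> sets M"
    unfolding e by (rule ccounts_event[OF is_PPP_point_process[OF X] h V])
  show "measure M {\<omega>\<in>space M. \<forall>u\<in>V. full d h (X \<omega>) u} = tpw (d + 1) (l * h ^ CARD('n)) (d + 1) ^ card V"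
    unfolding e PPP_config_prob[OF X l h V c] c_def by (simp cong: prod.cong)
qed

lemma tpw_top_pos:
  assumes "0 < \<mu>"
  shows "0 < tpw K \<mu> K"
proof -
  have "(\<Sum>j<Suc K. exp (- \<mu>) * \<mu> ^ j / fact j) \<le> 1" using assms by (intro poisson_sum_le_1) auto
  moreover have "0 < exp (- \<mu>) * \<mu> ^ K / fact K" using assms by simp
  ultimately show ?thesis unfolding tpw_def by simp
qed

subsection \<open>Percolation at high intensity\<close>

definition nine :: "(nat \<times> nat) set" where "nine = {..<3} \<times> {..<3}"

definition sub :: "nat \<times> nat \<Rightarrow> nat \<times> nat \<Rightarrow> nat \<times> nat" where
  "sub p s = (3 * fst p + fst s, 3 * snd p + snd s)"

text \<open>Renormalisation: at most one of the nine sub-blocks of a good block is bad. If a block is bad with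
  probability at most \<open>b\<close>, the next scale gives \<open>81 b\<^sup>2\<close>, while the three pairs of facing sub-blocks of two
  adjacent good blocks cannot all be spoiled.\<close>
primrec good :: "(nat \<times> nat \<Rightarrow> bool) \<Rightarrow> nat \<Rightarrow> nat \<times> nat \<Rightarrow> bool" where
  "good F 0 p = F p"
| "good F (Suc k) p = (\<exists>q\<in>nine. \<forall>s\<in>nine - {q}. good F k (sub p s))"

text \<open>The good base cells of \<open>p\<close> whose enclosing blocks at all levels up to
  \<open>k\<close> are good. Other good base cells may be cut off inside a bad sub-block.\<close>

primrec desc :: "(nat \<times> nat \<Rightarrow> bool) \<Rightarrow> nat \<Rightarrow> nat \<times> nat \<Rightarrow> nat \<times> nat \<Rightarrow> bool" where
  "desc F 0 p x = (F p \<and> x = p)"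
| "desc F (Suc k) p x = (good F (Suc k) p \<and> (\<exists>s\<in>nine. desc F k (sub p s) x))"

definition adj :: "nat \<times> nat \<Rightarrow> nat \<times> nat \<Rightarrow> bool" where
  "adj p q \<longleftrightarrow> fst p = fst q \<and> (snd q = snd p + 1 \<or> snd p = snd q + 1)
     \<or> snd p = snd q \<and> (fst q = fst p + 1 \<or> fst p = fst q + 1)"

definition bstep :: "(nat \<times> nat \<Rightarrow> bool) \<Rightarrow> nat \<times> nat \<Rightarrow> nat \<times> nat \<Rightarrow> bool" where
  "bstep H p q \<longleftrightarrow> adj p q \<and> H p \<and> H q"

lemma bstep_sym: "(bstep H)\<^sup>*\<^sup>* p q \<Longrightarrow> (bstep H)\<^sup>*\<^sup>* q p"
proof (rule sympD[OF symp_rtranclp])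
  show "symp (bstep H)" unfolding bstep_def adj_def by (rule sympI) auto
qed

lemma bstep_map:
  assumes "(bstep H)\<^sup>*\<^sup>* p q" "\<And>p q. bstep H p q \<Longrightarrow> R (f p) (f q)"
  shows "R\<^sup>*\<^sup>* (f p) (f q)"
  using assms(1) by (induction rule: rtranclp_induct) (auto intro: rtranclp.rtrancl_into_rtrancl assms(2))

lemma line3:
  assumes H: "\<And>j. j < 3 \<Longrightarrow> H (f j)" and f: "\<And>j. adj (f j) (f (Suc j))" and jk: "j < 3" "k < (3::nat)"
  shows "(bstep H)\<^sup>*\<^sup>* (f j) (f k)"
proof -
  have s: "bstep H (f 0) (f 1)" "bstep H (f 1) (f 2)"
    using H[of 0] H[of 1] H[of 2] f[of 0] f[of 1] unfolding bstep_def by (auto simp: numeral_2_eq_2)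
  have m: "(bstep H)\<^sup>*\<^sup>* (f j) (f 1)" if "j < 3" for j
  proof -
    have "j = 0 \<or> j = 1 \<or> j = 2" using that by auto
    then show ?thesis using s bstep_sym[OF r_into_rtranclp[of "bstep H" "f 1" "f 2"]] by auto
  qed
  show ?thesis using m[OF jk(1)] bstep_sym[OF m[OF jk(2)]] by (rule rtranclp_trans)
qed

text \<open>A row and a column that avoid \<open>q\<close> meet in a hub. A cell outside the row of
  \<open>q\<close> runs along its own row and then the chosen column, a cell outside the column of
  \<open>q\<close> symmetrically. If \<open>q\<close> itself satisfies \<open>H\<close>, then all
  nine cells do.\<close>

lemma grid3:
  assumes q: "q \<in> nine" and H: "\<And>s. s \<in> nine - {q} \<Longrightarrow> H s"
    and st: "s \<in> nine" "t \<in> nine" "H s" "H t"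
  shows "(bstep H)\<^sup>*\<^sup>* s t"
proof -
  obtain i0 j0 where q0: "q = (i0, j0)" by (cases q)
  have two: "\<exists>r::nat. r < 3 \<and> r \<noteq> m" for m
  proof (cases "m = 0")
    case True then show ?thesis by (intro exI[of _ 1]) auto
  next
    case False then show ?thesis by (intro exI[of _ 0]) auto
  qed
  obtain i1 where i1: "i1 < 3" "i1 \<noteq> i0" using two by blast
  obtain j1 where j1: "j1 < 3" "j1 \<noteq> j0" using two by blast
  have row: "(bstep H)\<^sup>*\<^sup>* (i, j) (i, k)" if "i < 3" "i \<noteq> i0" "j < 3" "k < 3" for i j k
    by (rule line3[where f = "\<lambda>j. (i, j)"]) (use that H q0 in \<open>auto simp: nine_def adj_def\<close>)
  have col: "(bstep H)\<^sup>*\<^sup>* (i, j) (k, j)" if "j < 3" "j \<noteq> j0" "i < 3" "k < 3" for i j k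
    by (rule line3[where f = "\<lambda>i. (i, j)"]) (use that H q0 in \<open>auto simp: nine_def adj_def\<close>)
  have hub: "(bstep H)\<^sup>*\<^sup>* s (i1, j1)" if s: "s \<in> nine" "H s" for s
  proof -
    obtain i j where ij: "s = (i, j)" "i < 3" "j < 3" using s unfolding nine_def by (cases s) auto
    consider "i \<noteq> i0" | "j \<noteq> j0" | "s = q" using ij q0 by auto
    then show ?thesis
    proof cases
      case 1
      then show ?thesis using row[of i j j1] col[of j1 i i1] ij i1 j1 by (auto intro: rtranclp_trans)
    next
      case 2
      then show ?thesis using col[of j i i1] row[of i1 j j1] ij i1 j1 by (auto intro: rtranclp_trans)
    next
      case 3
      then have "H u" if "u \<in> nine" for u using H s that by (cases "u = q") auto
      then have "(bstep H)\<^sup>*\<^sup>* (i, j) (i, j1)" "(bstep H)\<^sup>*\<^sup>* (i, j1) (i1, j1)"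
        using ij i1 j1 line3[where f = "\<lambda>j. (i, j)", of H j j1] line3[where f = "\<lambda>i. (i, j1)", of H i i1]
        by (auto simp: nine_def adj_def)
      then show ?thesis using ij by (auto intro: rtranclp_trans)
    qed
  qed
  show ?thesis using hub[OF st(1,3)] bstep_sym[OF hub[OF st(2,4)]] by (rule rtranclp_trans)
qed

lemma good_sub_connected:
  assumes "good F (Suc k) p" "s \<in> nine" "t \<in> nine" "good F k (sub p s)" "good F k (sub p t)"
  shows "(bstep (good F k))\<^sup>*\<^sup>* (sub p s) (sub p t)"
proof -
  obtain q where q: "q \<in> nine" "\<And>s. s \<in> nine - {q} \<Longrightarrow> good F k (sub p s)" using assms(1) by auto
  have "(bstep (\<lambda>s. good F k (sub p s)))\<^sup>*\<^sup>* s t"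
    by (rule grid3[OF q(1)]) (use q(2) assms in auto)
  then show ?thesis by (rule bstep_map) (auto simp: bstep_def adj_def sub_def)
qed

lemma good_adj_link:
  assumes "bstep (good F (Suc k)) p q"
  obtains s t where "s \<in> nine" "t \<in> nine" "bstep (good F k) (sub p s) (sub q t)"
proof -
  have three: "\<exists>r::nat. r < 3 \<and> r \<noteq> m \<and> r \<noteq> n" for m n
  proof -
    have "\<not> {..<3} \<subseteq> {m, n}"
    proof
      assume "{..<3} \<subseteq> {m, n}"
      then have "card {..<3::nat} \<le> card {m, n}" by (intro card_mono) auto
      then show False using card_insert_le_m1[of 2 "{n}" m] by simp
    qed
    then show ?thesis by auto
  qed
  obtain x where x: "x \<in> nine" "\<And>s. s \<in> nine \<Longrightarrow> s \<noteq> x \<Longrightarrow> good F k (sub p s)" using assms unfolding bstep_def by auto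
  obtain y where y: "y \<in> nine" "\<And>s. s \<in> nine \<Longrightarrow> s \<noteq> y \<Longrightarrow> good F k (sub q s)" using assms unfolding bstep_def by auto
  obtain i where i: "i < 3" "i \<noteq> fst x" "i \<noteq> fst y" using three by blast
  obtain j where j: "j < 3" "j \<noteq> snd x" "j \<noteq> snd y" using three by blast
  have n: "(i, a) \<in> nine" "(a, j) \<in> nine" if "a < 3" for a using i j that unfolding nine_def by auto
  have gi: "good F k (sub p (i, a))" "good F k (sub q (i, a))" if "a < 3" for a
  proof -
    have "(i, a) \<noteq> x" "(i, a) \<noteq> y" using i by (cases x, simp, cases y, simp)
    then show "good F k (sub p (i, a))" "good F k (sub q (i, a))"
      using x(2)[OF n(1)[OF that]] y(2)[OF n(1)[OF that]] by blast+
  qed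
  have gj: "good F k (sub p (a, j))" "good F k (sub q (a, j))" if "a < 3" for a
  proof -
    have "(a, j) \<noteq> x" "(a, j) \<noteq> y" using j by (cases x, simp, cases y, simp)
    then show "good F k (sub p (a, j))" "good F k (sub q (a, j))"
      using x(2)[OF n(2)[OF that]] y(2)[OF n(2)[OF that]] by blast+
  qed
  have "adj p q" using assms unfolding bstep_def by simp
  then consider "fst p = fst q" "snd q = snd p + 1" | "fst p = fst q" "snd p = snd q + 1"
    | "snd p = snd q" "fst q = fst p + 1" | "snd p = snd q" "fst p = fst q + 1" unfolding adj_def by auto
  then show ?thesis
  proof cases
    case 1
    then have "adj (sub p (i, 2)) (sub q (i, 0))" by (auto simp: adj_def sub_def)
    then show ?thesis using n gi by (intro that[of "(i, 2)" "(i, 0)"]) (simp_all add: bstep_def)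
  next
    case 2
    then have "adj (sub p (i, 0)) (sub q (i, 2))" by (auto simp: adj_def sub_def)
    then show ?thesis using n gi by (intro that[of "(i, 0)" "(i, 2)"]) (simp_all add: bstep_def)
  next
    case 3
    then have "adj (sub p (2, j)) (sub q (0, j))" by (auto simp: adj_def sub_def)
    then show ?thesis using n gj by (intro that[of "(2, j)" "(0, j)"]) (simp_all add: bstep_def)
  next
    case 4
    then have "adj (sub p (0, j)) (sub q (2, j))" by (auto simp: adj_def sub_def)
    then show ?thesis using n gj by (intro that[of "(0, j)" "(2, j)"]) (simp_all add: bstep_def)
  qed
qed

lemma good_refine_chain:
  assumes "(bstep (good F (Suc k)))\<^sup>*\<^sup>* p q" "good F (Suc k) p" "s \<in> nine" "good F k (sub p s)"
    and "t \<in> nine" "good F k (sub q t)"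
  shows "(bstep (good F k))\<^sup>*\<^sup>* (sub p s) (sub q t)"
  using assms(1,5,6)
proof (induction arbitrary: t rule: rtranclp_induct)
  case base
  then show ?case using good_sub_connected[OF assms(2,3) _ assms(4)] by blast
next
  case (step q r)
  obtain u v where uv: "u \<in> nine" "v \<in> nine" "bstep (good F k) (sub q u) (sub r v)"
    using good_adj_link[OF step.hyps(2)] .
  have g: "good F k (sub q u)" "good F k (sub r v)" "good F (Suc k) r"
    using uv(3) step.hyps(2) unfolding bstep_def by auto
  have "(bstep (good F k))\<^sup>*\<^sup>* (sub p s) (sub q u)" by (rule step.IH[OF uv(1) g(1)])
  also have "(bstep (good F k))\<^sup>*\<^sup>* (sub q u) (sub r v)" using uv(3) by (rule r_into_rtranclp)
  also have "(bstep (good F k))\<^sup>*\<^sup>* (sub r v) (sub r t)"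
    by (rule good_sub_connected[OF g(3) uv(2) step.prems(1) g(2) step.prems(2)])
  finally show ?case .
qed

lemma desc_good: "desc F k p x \<Longrightarrow> good F k p"
  by (cases k) auto

text \<open>Descend level by level: a chain of good blocks refines to a chain of good sub-blocks
  (\<open>good_refine_chain\<close>) until single cells remain.\<close>

lemma desc_connected:
  assumes "(bstep (good F k))\<^sup>*\<^sup>* p q" "desc F k p x" "desc F k q y"
  shows "(bstep F)\<^sup>*\<^sup>* x y"
  using assms
proof (induction k arbitrary: p q)
  case 0
  have "good F 0 = F" by (rule ext) simp
  then show ?case using 0 by simp
next
  case (Suc k)
  obtain s t where st: "s \<in> nine" "desc F k (sub p s) x" "t \<in> nine" "desc F k (sub q t) y"
    using Suc.prems(2,3) by auto
  have "good F (Suc k) p" by (rule desc_good[OF Suc.prems(2)])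
  then have "(bstep (good F k))\<^sup>*\<^sup>* (sub p s) (sub q t)"
    by (rule good_refine_chain[OF Suc.prems(1) _ st(1) desc_good[OF st(2)] st(3) desc_good[OF st(4)]])
  then show ?case by (rule Suc.IH[OF _ st(2,4)])
qed

lemma good_desc:
  assumes "good F k p"
  shows "\<exists>x. desc F k p x \<and> 3 ^ k * fst p \<le> fst x"
  using assms
proof (induction k arbitrary: p)
  case (Suc k)
  obtain q where q: "q \<in> nine" "\<forall>s\<in>nine - {q}. good F k (sub p s)" using Suc.prems by auto
  have "\<exists>s. s \<in> nine - {q}"
  proof (cases "q = (0, 0)")
    case True
    then show ?thesis by (intro exI[of _ "(0, 1)"]) (auto simp: nine_def)
  next
    case False
    then show ?thesis by (intro exI[of _ "(0, 0)"]) (auto simp: nine_def)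
  qed
  then obtain s where s: "s \<in> nine" "good F k (sub p s)" using q by blast
  obtain x where x: "desc F k (sub p s) x" "3 ^ k * fst (sub p s) \<le> fst x" using Suc.IH[OF s(2)] by blast
  have "3 ^ Suc k * fst p \<le> 3 ^ k * fst (sub p s)" unfolding sub_def by (simp add: algebra_simps)
  then have "3 ^ Suc k * fst p \<le> fst x" using x(2) by linarith
  moreover have "desc F (Suc k) p x" using x(1) s Suc.prems by (subst desc.simps(2)) blast
  ultimately show ?case by blast
qed simp

text \<open>Goodness of the origin block at all levels makes the origin one of its descendants. A
  good sub-block with first index 2 in the block of level \<open>k + 1\<close> contains a descendant
  with first coordinate at least \<open>2 * 3 ^ k\<close>.\<close>

lemma good_origin_far:
  assumes "\<And>j. j \<le> Suc k \<Longrightarrow> good F j (0, 0)"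
  obtains x where "(bstep F)\<^sup>*\<^sup>* (0, 0) x" "k \<le> fst x"
proof -
  have o: "desc F j (0, 0) (0, 0)" if "j \<le> Suc k" for j
    using that
  proof (induction j)
    case 0
    then show ?case using assms[of 0] by simp
  next
    case (Suc j)
    have "sub (0, 0) (0, 0) = (0, 0)" "(0, 0) \<in> nine" unfolding sub_def nine_def by auto
    then show ?case using Suc assms[OF Suc.prems] by (metis desc.simps(2) Suc_leD)
  qed
  obtain q where q: "q \<in> nine" "\<forall>s\<in>nine - {q}. good F k (sub (0, 0) s)" using assms[of "Suc k"] by auto
  obtain s where s: "s \<in> nine" "fst s = 2" "s \<noteq> q"
  proof (cases "q = (2, 0)")
    case True
    then show ?thesis using that[of "(2, 1)"] by (auto simp: nine_def)
  next
    case False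
    then show ?thesis using that[of "(2, 0)"] by (auto simp: nine_def)
  qed
  obtain x where x: "desc F k (sub (0, 0) s) x" "3 ^ k * fst (sub (0, 0) s) \<le> fst x"
    using good_desc[of F k "sub (0, 0) s"] q(2) s by blast
  have "desc F (Suc k) (0, 0) x" using x(1) s(1) assms[of "Suc k"] by (metis desc.simps(2) order_refl)
  then have "(bstep F)\<^sup>*\<^sup>* (0, 0) x" by (rule desc_connected[OF rtranclp.rtrancl_refl o[OF order_refl]])
  moreover have "k \<le> fst x"
  proof -
    have "k < 3 ^ k" by (induction k) auto
    also have "(3::nat) ^ k \<le> 3 ^ k * fst (sub (0, 0) s)" using s(2) unfolding sub_def by simp
    finally show ?thesis using x(2) by linarith
  qed
  ultimately show ?thesis using that by blast
qed

section \<open>The probability of bad blocks\<close>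

definition block :: "nat \<Rightarrow> nat \<times> nat \<Rightarrow> (nat \<times> nat) set" where
  "block k p = {x. fst x div 3 ^ k = fst p \<and> snd x div 3 ^ k = snd p}"

lemma block_0: "block 0 p = {p}"
  unfolding block_def by (auto simp: prod_eq_iff)

lemma block_disjoint: "p \<noteq> q \<Longrightarrow> block k p \<inter> block k q = {}"
  unfolding block_def by (auto simp: prod_eq_iff)

lemma block_sub: "s \<in> nine \<Longrightarrow> block k (sub p s) \<subseteq> block (Suc k) p"
proof
  fix x assume s: "s \<in> nine" and x: "x \<in> block k (sub p s)"
  have "fst x div 3 ^ Suc k = (3 * fst p + fst s) div 3" "snd x div 3 ^ Suc k = (3 * snd p + snd s) div 3"
    using x unfolding block_def sub_def power_Suc2 div_mult2_eq by auto
  then show "x \<in> block (Suc k) p" using s unfolding block_def nine_def by auto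
qed

lemma finite_block: "finite (block k p)"
proof (rule finite_subset)
  show "block k p \<subseteq> {..<3 ^ k * Suc (fst p)} \<times> {..<3 ^ k * Suc (snd p)}"
  proof
    fix x assume "x \<in> block k p"
    then have "fst x div 3 ^ k = fst p" "snd x div 3 ^ k = snd p" unfolding block_def by auto
    then have "fst x < 3 ^ k * Suc (fst p)" "snd x < 3 ^ k * Suc (snd p)"
      using dividend_less_times_div[of "3 ^ k" "fst x"] dividend_less_times_div[of "3 ^ k" "snd x"] by simp_all
    then show "x \<in> {..<3 ^ k * Suc (fst p)} \<times> {..<3 ^ k * Suc (snd p)}" by (simp add: mem_Times_iff)
  qed
qed simp

lemma block_origin_mono:
  assumes "j \<le> k"
  shows "block j (0, 0) \<subseteq> block k (0, 0)"
  using assms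
proof (induction rule: dec_induct)
  case (step k)
  have "block k (sub (0, 0) (0, 0)) \<subseteq> block (Suc k) (0, 0)" by (rule block_sub) (simp add: nine_def)
  then show ?case using step.IH by (simp add: sub_def)
qed simp

lemma good_cong: "(\<And>x. x \<in> block k p \<Longrightarrow> F x = G x) \<Longrightarrow> good F k p = good G k p"
proof (induction k arbitrary: p)
  case 0
  then show ?case by (simp add: block_0)
next
  case (Suc k)
  have "good F k (sub p s) = good G k (sub p s)" if "s \<in> nine" for s
    by (rule Suc.IH) (use Suc.prems block_sub[OF that] in blast)
  then show ?case by simp
qed

context weights
begin

text \<open>A bad block has two distinct bad sub-blocks; these occupy disjoint sets of cells and are
  independent, and there are 72 ordered pairs. For b = (1/81) (1/4)^(k+1) the factor 81 b is at most
  1/4, so the bound gains 1/4 per level; it starts at 1/324.\<close>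

lemma bad_prob:
  fixes e :: "nat \<times> nat \<Rightarrow> 'v"
  assumes e: "inj e" and w: "1 - w K \<le> 1 / 324"
  shows "E (e ` block k p) (\<lambda>c. of_bool (\<not> good (\<lambda>x. c (e x) = K) k p)) \<le> 1 / 81 * (1 / 4) ^ Suc k"
proof (induction k arbitrary: p)
  case 0
  have "E (e ` block 0 p) (\<lambda>c. of_bool (\<not> good (\<lambda>x. c (e x) = K) 0 p)) = (\<Sum>k\<le>K. w k * of_bool (k \<noteq> K))"
    by (simp add: block_0 pexp_insert pexp_empty)
  also have "\<dots> = (\<Sum>k\<le>K. w k) - w K"
    by (subst sum.remove[of "{..K}" K], simp, simp, subst sum.remove[of "{..K}" K w]) (auto intro!: sum.cong)
  finally show ?case using w w_sum by simp
next
  case (Suc k)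
  define \<epsilon> where "\<epsilon> = (1 / 81 :: real) * (1 / 4) ^ Suc k"
  define V where "V = e ` block (Suc k) p"
  define b where "b s c = (of_bool (\<not> good (\<lambda>x. c (e x) = K) k (sub p s)) :: real)" for s c
  have V: "finite V" unfolding V_def using finite_block by simp
  have indep: "b s (c(v := n)) = b s c" if "v \<notin> e ` block k (sub p s)" for s c v n
  proof -
    have "good (\<lambda>x. (c(v := n)) (e x) = K) k (sub p s) = good (\<lambda>x. c (e x) = K) k (sub p s)"
      by (rule good_cong) (use that in auto)
    then show ?thesis unfolding b_def by simp
  qed
  have b1: "E V (b s) \<le> \<epsilon>" "0 \<le> E V (b s)" if s: "s \<in> nine" for s
  proof -
    have "E V (b s) = E (e ` block k (sub p s)) (b s)"
    proof (rule E_superset[OF V])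
      show "e ` block k (sub p s) \<subseteq> V" unfolding V_def by (intro image_mono block_sub s)
    qed (rule indep, blast)
    also have "\<dots> \<le> \<epsilon>" unfolding b_def \<epsilon>_def by (rule Suc.IH)
    finally show "E V (b s) \<le> \<epsilon>" .
    show "0 \<le> E V (b s)" by (rule E_nonneg) (simp add: b_def)
  qed
  have b2: "E V (\<lambda>c. b s c * b t c) \<le> \<epsilon> * \<epsilon>" if st: "s \<in> nine" "t \<in> nine - {s}" for s t
  proof -
    let ?A = "e ` block k (sub p s)" and ?B = "V - e ` block k (sub p s)"
    have A: "?A \<subseteq> V" unfolding V_def using block_sub[OF st(1)] by blast
    have "sub p s \<noteq> sub p t" using st unfolding sub_def by (auto simp: prod_eq_iff)
    then have dis: "?A \<inter> e ` block k (sub p t) = {}"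
      using block_disjoint e by (simp add: image_Int[symmetric])
    have "E (?A \<union> ?B) (\<lambda>c. b s c * b t c) = E (?A \<union> ?B) (b s) * E (?A \<union> ?B) (b t)"
    proof (rule E_Times)
      show "b s (c(v := n)) = b s c" if "v \<in> ?B" for c v n using that by (intro indep) blast
      show "b t (c(v := n)) = b t c" if "v \<in> ?A" for c v n using that dis by (intro indep) blast
    qed (use V A in \<open>auto intro: finite_subset\<close>)
    moreover have "?A \<union> ?B = V" using A by auto
    ultimately have "E V (\<lambda>c. b s c * b t c) = E V (b s) * E V (b t)" by simp
    then show ?thesis using b1[of s] b1[of t] st by (auto intro!: mult_mono)
  qed
  have c9: "card nine = 9" "finite nine" unfolding nine_def by auto
  have "E V (\<lambda>c. of_bool (\<not> good (\<lambda>x. c (e x) = K) (Suc k) p)) \<le> E V (\<lambda>c. \<Sum>s\<in>nine. \<Sum>t\<in>nine - {s}. b s c * b t c)"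
  proof (rule E_mono)
    fix c
    have nn: "0 \<le> (\<Sum>t\<in>nine - {s}. b s c * b t c)" for s by (intro sum_nonneg) (simp add: b_def)
    show "of_bool (\<not> good (\<lambda>x. c (e x) = K) (Suc k) p) \<le> (\<Sum>s\<in>nine. \<Sum>t\<in>nine - {s}. b s c * b t c)"
    proof (cases "good (\<lambda>x. c (e x) = K) (Suc k) p")
      case False
      then have ex: "\<exists>s\<in>nine - {q}. \<not> good (\<lambda>x. c (e x) = K) k (sub p s)" if "q \<in> nine" for q
        using that by auto
      have "(0, 0) \<in> nine" unfolding nine_def by simp
      then obtain s where s: "s \<in> nine" "\<not> good (\<lambda>x. c (e x) = K) k (sub p s)" using ex by blast
      obtain t where t: "t \<in> nine - {s}" "\<not> good (\<lambda>x. c (e x) = K) k (sub p t)" using ex[OF s(1)] by blast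
      have "1 = b s c * b t c" using s t unfolding b_def by simp
      also have "\<dots> \<le> (\<Sum>t\<in>nine - {s}. b s c * b t c)" using c9 t by (intro member_le_sum) (auto simp: b_def)
      also have "\<dots> \<le> (\<Sum>s\<in>nine. \<Sum>t\<in>nine - {s}. b s c * b t c)"
        using c9 s nn by (intro member_le_sum[of s nine "\<lambda>s. \<Sum>t\<in>nine - {s}. b s c * b t c"]) auto
      finally show ?thesis using False by simp
    qed (auto intro!: sum_nonneg nn)
  qed
  also have "\<dots> = (\<Sum>s\<in>nine. \<Sum>t\<in>nine - {s}. E V (\<lambda>c. b s c * b t c))" by (simp only: pexp_sum)
  also have "\<dots> \<le> (\<Sum>s\<in>nine. \<Sum>t\<in>nine - {s}. \<epsilon> * \<epsilon>)" using b2 by (intro sum_mono) auto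
  also have "\<dots> = (\<Sum>s\<in>nine. 8 * (\<epsilon> * \<epsilon>))" using c9 by (intro sum.cong) auto
  also have "\<dots> = 72 * (\<epsilon> * \<epsilon>)" using c9 by simp
  also have "\<dots> \<le> 81 * \<epsilon> * \<epsilon>" by simp
  also have "\<dots> = (1 / 4) ^ Suc k * \<epsilon>" unfolding \<epsilon>_def by simp
  also have "\<dots> \<le> (1 / 4) * \<epsilon>"
    using power_le_one[of "1/4 :: real" k] by (intro mult_right_mono) (auto simp: \<epsilon>_def)
  also have "\<dots> = 1 / 81 * (1 / 4) ^ Suc (Suc k)" unfolding \<epsilon>_def by simp
  finally show ?case unfolding V_def .
qed

text \<open>A union bound over the levels with a geometric series. It is uniform in
  \<open>N\<close>, so that all levels can be good simultaneously in the limit.\<close>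

lemma all_good_prob:
  fixes e :: "nat \<times> nat \<Rightarrow> 'v"
  assumes e: "inj e" and w: "1 - w K \<le> 1 / 324"
  shows "1 / 2 \<le> E (e ` block N (0, 0)) (\<lambda>c. of_bool (\<forall>j\<le>N. good (\<lambda>x. c (e x) = K) j (0, 0)))"
proof -
  define V where "V = e ` block N (0, 0)"
  define b where "b j c = (of_bool (\<not> good (\<lambda>x. c (e x) = K) j (0, 0)) :: real)" for j c
  have V: "finite V" unfolding V_def using finite_block by simp
  have bj: "E V (b j) \<le> 1 / 81 * (1 / 4) ^ Suc j" if j: "j \<le> N" for j
  proof -
    have "b j (c(v := n)) = b j c" if "v \<notin> e ` block j (0, 0)" for c v n
    proof -
      have "good (\<lambda>x. (c(v := n)) (e x) = K) j (0, 0) = good (\<lambda>x. c (e x) = K) j (0, 0)"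
        by (rule good_cong) (use that in auto)
      then show ?thesis unfolding b_def by simp
    qed
    then have "E V (b j) = E (e ` block j (0, 0)) (b j)"
      using block_origin_mono[OF j] by (intro E_superset[OF V]) (auto simp: V_def)
    also have "\<dots> \<le> 1 / 81 * (1 / 4) ^ Suc j" unfolding b_def by (rule bad_prob[OF e w])
    finally show ?thesis .
  qed
  have "(\<Sum>j\<le>N. E V (b j)) \<le> (\<Sum>j\<le>N. 1 / 81 * (1 / 4) ^ Suc j)" using bj by (intro sum_mono) auto
  also have "\<dots> \<le> (\<Sum>j\<le>N. (1 / 4 * (1/4) ^ j))"
    by (intro sum_mono) simp
  also have "\<dots> \<le> 1 / 2"
  proof -
    have "(\<Sum>j\<le>N. (1 / 4 * (1 / 4) ^ j)) = 1 / 4 * (\<Sum>j\<le>N. (1 / 4 :: real) ^ j)" by (simp only: sum_distrib_left)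
    also have "(\<Sum>j\<le>N. (1 / 4 :: real) ^ j) \<le> 4 / 3"
    proof -
      define S where "S = (\<Sum>j\<le>N. (1 / 4 :: real) ^ j)"
      have "(1 - 1 / 4) * S = 1 - (1 / 4) ^ Suc N" unfolding S_def by (rule sum_gp_basic)
      moreover have "(0::real) \<le> (1 / 4) ^ Suc N" by (rule zero_le_power) simp
      ultimately have "(1 - 1 / 4) * S \<le> 1" by linarith
      then have "S \<le> 4 / 3" by simp
      then show ?thesis unfolding S_def .
    qed
    finally show ?thesis by simp
  qed
  finally have s: "(\<Sum>j\<le>N. E V (b j)) \<le> 1 / 2" .
  have "E V (\<lambda>c. 1 - (\<Sum>j\<le>N. b j c)) \<le> E V (\<lambda>c. of_bool (\<forall>j\<le>N. good (\<lambda>x. c (e x) = K) j (0, 0)))"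
  proof (rule E_mono)
    fix c
    have nn: "0 \<le> (\<Sum>j\<le>N. b j c)" by (intro sum_nonneg) (simp add: b_def)
    show "1 - (\<Sum>j\<le>N. b j c) \<le> of_bool (\<forall>j\<le>N. good (\<lambda>x. c (e x) = K) j (0, 0))"
    proof (cases "\<forall>j\<le>N. good (\<lambda>x. c (e x) = K) j (0, 0)")
      case False
      then obtain j where j: "j \<le> N" "\<not> good (\<lambda>x. c (e x) = K) j (0, 0)" by blast
      have "1 = b j c" using j unfolding b_def by simp
      also have "\<dots> \<le> (\<Sum>j\<le>N. b j c)" using j by (intro member_le_sum) (auto simp: b_def)
      finally show ?thesis using False by simp
    qed (use nn in simp)
  qed
  moreover have "E V (\<lambda>c. 1 - (\<Sum>j\<le>N. b j c)) = 1 - (\<Sum>j\<le>N. E V (b j))"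
    by (simp only: pexp_diff pexp_sum E_const[OF V])
  ultimately show ?thesis using s unfolding V_def by linarith
qed

end

section \<open>Percolation in a coordinate plane of cells\<close>

definition plane :: "'n::finite \<Rightarrow> 'n \<Rightarrow> nat \<times> nat \<Rightarrow> real^'n" where
  "plane i j p = real (fst p) *\<^sub>R axis i 1 + real (snd p) *\<^sub>R axis j 1"

lemma plane_nth: "i \<noteq> j \<Longrightarrow> plane i j p $ i = real (fst p)" "i \<noteq> j \<Longrightarrow> plane i j p $ j = real (snd p)"
  unfolding plane_def by (auto simp: axis_def)

lemma plane_inj: "i \<noteq> j \<Longrightarrow> inj (plane i j)"
  by (rule injI) (metis plane_nth prod_eq_iff of_nat_eq_iff)

lemma plane_lat: "plane i j p \<in> lat"
  unfolding plane_def lat_def by (auto simp: axis_def)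

lemma plane_adj: "adj p q \<Longrightarrow> dist (plane i j p) (plane i j q) \<le> 1"
proof -
  assume "adj p q"
  then have "plane i j p - plane i j q \<in> {axis i 1, - axis i 1, axis j 1, - axis j 1}"
    unfolding adj_def plane_def by (auto simp: algebra_simps)
  then show ?thesis by (auto simp: dist_norm)
qed

text \<open>The mean count per cell is chosen so large that a cell fails to be full with probability
  at most 1/324, the starting value in \<open>bad_prob\<close>. The two axes of the plane exist
  because D \<ge> 2, and chains of full cells carry chains of simplices
  (\<open>conn_cell_chain\<close>).\<close>

lemma exists_percolation:
  fixes M :: "real \<Rightarrow> 'a measure" and X :: "real \<Rightarrow> 'a \<Rightarrow> (real^'n) set"
  assumes D: "2 \<le> CARD('n)" and d: "1 \<le> d" "d \<le> CARD('n)" and X: "\<And>l. 0 < l \<Longrightarrow> is_PPP (M l) (X l) l"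
  obtains l where "0 < l" "0 < measure (M l) {\<omega>\<in>space (M l). face_perc d (X l \<omega>)}"
proof -
  define h where "h = 1 / (4 * (real d + 1) * sqrt CARD('n))"
  have h: "fine_mesh TYPE('n) d h" unfolding fine_mesh_def h_def using D by simp
  note h0 = fine_mesh_bounds(1)[OF h]
  have "\<exists>\<mu>>0. 1 - tpw (d + 1) \<mu> (d + 1) \<le> 1 / 324"
  proof -
    have "((\<lambda>\<mu>::real. \<Sum>j<d + 1. exp (- \<mu>) * \<mu> ^ j / fact j) \<longlongrightarrow> (\<Sum>j<d + 1. 0)) at_top"
    proof (rule tendsto_sum)
      fix j
      have "((\<lambda>\<mu>::real. \<mu> ^ j / exp \<mu> * (1 / fact j)) \<longlongrightarrow> 0 * (1 / fact j)) at_top"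
        by (intro tendsto_mult tendsto_power_div_exp_0 tendsto_const)
      then show "((\<lambda>\<mu>::real. exp (- \<mu>) * \<mu> ^ j / fact j) \<longlongrightarrow> 0) at_top"
        by (simp add: exp_minus field_simps)
    qed
    then have "eventually (\<lambda>\<mu>::real. (\<Sum>j<d + 1. exp (- \<mu>) * \<mu> ^ j / fact j) < 1 / 324) at_top"
      by (rule order_tendstoD) simp
    then have "eventually (\<lambda>\<mu>::real. (\<Sum>j<d + 1. exp (- \<mu>) * \<mu> ^ j / fact j) < 1 / 324 \<and> 0 < \<mu>) at_top"
      using eventually_gt_at_top by (rule eventually_conj)
    then obtain \<mu> :: real where "(\<Sum>j<d + 1. exp (- \<mu>) * \<mu> ^ j / fact j) < 1 / 324" "0 < \<mu>"
      by (metis (mono_tags, lifting) eventually_happens' trivial_limit_at_top_linorder)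
    then show ?thesis by (intro exI[of _ \<mu>]) (simp add: tpw_def)
  qed
  then obtain \<mu> where \<mu>: "0 < \<mu>" "1 - tpw (d + 1) \<mu> (d + 1) \<le> 1 / 324" by blast
  define l where "l = \<mu> / h ^ CARD('n)"
  have l: "0 < l" "l * h ^ CARD('n) = \<mu>" unfolding l_def using \<mu> h0 by auto
  interpret prob_space "M l" using X[OF l(1)] unfolding is_PPP_def by simp
  interpret W: weights "tpw (d + 1) \<mu>" "d + 1" using weights_tpw \<mu>(1) by simp
  note Y = is_PPP_point_process[OF X[OF l(1)]]
  obtain i j :: 'n where ij: "i \<noteq> j" using D card_le_Suc0_iff_eq[of "UNIV :: 'n set"] by force
  define e where "e = plane i j"
  have e: "inj e" unfolding e_def by (rule plane_inj[OF ij])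
  define V where "V N = e ` block N (0, 0)" for N
  have V: "finite (V N)" "V N \<subseteq> lat" for N unfolding V_def e_def using finite_block plane_lat by auto
  define A where "A N = {\<omega>\<in>space (M l). \<forall>k\<le>N. good (\<lambda>x. full d h (X l \<omega>) (e x)) k (0, 0)}" for N
  have A_eq: "A N = {\<omega>\<in>space (M l). (\<lambda>c. \<forall>k\<le>N. good (\<lambda>x. c (e x) = d + 1) k (0, 0)) (ccounts d h (V N) (X l \<omega>))}" for N
  proof -
    have "good (\<lambda>x. full d h (X l \<omega>) (e x)) k (0, 0) = good (\<lambda>x. ccounts d h (V N) (X l \<omega>) (e x) = d + 1) k (0, 0)"
      if "k \<le> N" for k \<omega>
    proof (rule good_cong)
      fix x assume "x \<in> block k (0, 0)"
      then have "e x \<in> V N" unfolding V_def using block_origin_mono[OF that] by blast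
      then show "full d h (X l \<omega>) (e x) = (ccounts d h (V N) (X l \<omega>) (e x) = d + 1)"
        unfolding full_def res_def by simp
    qed
    then show ?thesis unfolding A_def by auto
  qed
  have As: "A N \<in> sets (M l)" for N unfolding A_eq by (rule ccounts_event[OF Y h0 V])
  have Ap: "1 / 2 \<le> prob (A N)" for N
  proof -
    have "prob (A N) = W.E (V N) (\<lambda>c. of_bool (\<forall>k\<le>N. good (\<lambda>x. c (e x) = d + 1) k (0, 0)))"
      unfolding A_eq l(2)[symmetric] by (rule PPP_law[OF X[OF l(1)] l(1) h0 V])
    moreover have "1 / 2 \<le> W.E (V N) (\<lambda>c. of_bool (\<forall>k\<le>N. good (\<lambda>x. c (e x) = d + 1) k (0, 0)))"
      unfolding V_def by (rule W.all_good_prob[OF e \<mu>(2)])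
    ultimately show ?thesis by (simp only:)
  qed
  have "(\<lambda>N. prob (A N)) \<longlonglongrightarrow> prob (\<Inter>N. A N)"
  proof (rule finite_Lim_measure_decseq)
    show "range A \<subseteq> events" using As by blast
    show "decseq A" unfolding decseq_def A_def by fastforce
  qed
  then have p: "1 / 2 \<le> prob (\<Inter>N. A N)" by (rule LIMSEQ_le_const) (use Ap in blast)
  have "0 < measure (M l) {\<omega>\<in>space (M l). face_perc d (X l \<omega>)}"
  proof (rule face_perc_pos[OF X[OF l(1)] d])
    show "(\<Inter>N. A N) \<in> events" using As by auto
    show "0 < prob (\<Inter>N. A N)" using p by linarith
    fix \<omega> t assume w: "\<omega> \<in> (\<Inter>N. A N)"
    define F where "F x = full d h (X l \<omega>) (e x)" for x
    have g: "good F k (0, 0)" for k using w unfolding A_def F_def by auto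
    obtain k :: nat where k: "t / h + sqrt CARD('n) \<le> real k" using real_arch_simple by blast
    obtain x where x: "(bstep F)\<^sup>*\<^sup>* (0, 0) x" "k \<le> fst x" using good_origin_far[of k F] g by blast
    have D1: "1 \<le> sqrt CARD('n)" using D by simp
    have "(cell_step d h (X l \<omega>))\<^sup>*\<^sup>* (e (0, 0)) (e x)"
    proof (rule bstep_map[OF x(1)])
      fix p q assume pq: "bstep F p q"
      then have "dist (e p) (e q) \<le> sqrt CARD('n)"
        unfolding bstep_def e_def by (intro order_trans[OF plane_adj D1]) simp
      then show "cell_step d h (X l \<omega>) (e p) (e q)" using pq unfolding bstep_def cell_step_def F_def by simp
    qed
    moreover have e0: "e (0, 0) = 0" unfolding e_def plane_def by simp
    ultimately have ch: "(cell_step d h (X l \<omega>))\<^sup>*\<^sup>* 0 (e x)" by simp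
    have f0: "full d h (X l \<omega>) 0" using g[of 0] e0 unfolding F_def by simp
    have "full d h (X l \<omega>) (e x)" using ch f0 by (cases rule: rtranclp.cases) (auto simp: cell_step_def)
    then obtain T where T: "T \<in> csimp d close (X l \<omega>)" "T \<subseteq> cell h (e x)" using full_simplex[OF h] by blast
    obtain S where S: "S \<in> csimp d close (X l \<omega>)" "S \<subseteq> cell h (0 :: real^'n)" using full_simplex[OF h f0] .
    have c: "conn d close (X l \<omega>) S T" by (rule conn_cell_chain[OF h ch S T])
    obtain s where s: "s \<in> S" using csimpD(5)[OF S(1)] by blast
    then have "cidx h s = 0" using S(2) unfolding cell_def by auto
    then have s1: "norm s \<le> h * sqrt CARD('n)" using cidx_norm(1)[OF h0, of s] by simp
    obtain y where y: "y \<in> T" using csimpD(5)[OF T(1)] by blast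
    then have "cidx h y = e x" using T(2) unfolding cell_def by auto
    moreover have "h * norm (cidx h y) \<le> norm y + h * sqrt CARD('n)" by (rule cidx_norm(2)[OF h0])
    moreover have "real (fst x) \<le> norm (e x)"
      using component_le_norm_cart[of "e x" i] plane_nth(1)[OF ij, of x] unfolding e_def by simp
    then have "h * (t / h + sqrt CARD('n)) \<le> h * norm (e x)" using k x(2) h0 by (intro mult_left_mono) auto
    ultimately have "t \<le> norm y" using h0 by (simp add: algebra_simps)
    then have "T \<inter> far 0 t \<noteq> {}" using y unfolding far_def by auto
    moreover have "S \<inter> cball 0 (h * sqrt CARD('n)) \<noteq> {}" using s s1 by auto
    ultimately show "clink d close (X l \<omega>) (cball 0 (h * sqrt CARD('n))) (far 0 t)"
      unfolding clink_def using S(1) T(1) c by blast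
  qed
  then show ?thesis using that l(1) by blast
qed

subsection \<open>The Poisson process between two lattice models\<close>

text \<open>A vertex of the first simplex inside the ball becomes the new centre; by the triangle
  inequality, sites at distance \<open>R + t\<close> from 0 are at distance at least
  \<open>t\<close> from it.\<close>

lemma dlink_cover:
  assumes c: "c \<in> cfg K V" and cl: "dlink d \<rho> c (cball 0 R) (far 0 (R + t))" and \<rho>: "0 \<le> \<rho>"
  shows "\<exists>v\<in>V \<inter> cball (0 :: real^'n) R. dlink d \<rho> c (cball v (2 * \<rho>)) (far v t)"
proof -
  obtain S T v i where ST: "S \<in> csimp d (near \<rho>) (lab c)" "T \<in> csimp d (near \<rho>) (lab c)" "(v, i) \<in> S" "v \<in> cball 0 R"
    "T \<inter> far 0 (R + t) \<times> UNIV \<noteq> {}" "conn d (near \<rho>) (lab c) S T"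
    using cl unfolding dlink_def clink_def by blast
  have "i < c v" using csimpD(1)[OF ST(1)] ST(3) unfolding lab_def by blast
  then have v: "v \<in> V" using c unfolding cfg_def by (metis (mono_tags, lifting) mem_Collect_eq not_less_zero)
  have "far 0 (R + t) \<subseteq> far v t"
  proof
    fix x assume x: "x \<in> far (0 :: real^'n) (R + t)"
    then show "x \<in> far v t" using ST(4) dist_triangle[of 0 x v] unfolding far_def by simp
  qed
  then have "T \<inter> far v t \<times> UNIV \<noteq> {}" using ST(5) by blast
  moreover have "S \<inter> cball v (2 * \<rho>) \<times> UNIV \<noteq> {}" using ST(3) \<rho> by (auto intro!: exI[of _ v])
  ultimately have "dlink d \<rho> c (cball v (2 * \<rho>)) (far v t)"
    unfolding dlink_def clink_def using ST(1,2,6) by blast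
  then show ?thesis using v ST(4) by blast
qed

lemma counts_off_lat: "u \<notin> lat \<Longrightarrow> counts K (cidx s) L u = 0"
proof -
  assume "u \<notin> lat"
  then have "{x \<in> L. cidx s x = u} = {}" using cidx_lat by blast
  then show ?thesis unfolding counts_def by (simp only: card.empty min_0L)
qed

lemma res_counts_lat: "res B (counts K (cidx s) L) = res (lat \<inter> B) (counts K (cidx s) L)"
  unfolding res_def by (auto simp: fun_eq_iff counts_off_lat)

text \<open>The cardinality is a union bound over starting cells. The conclusion is about a cover
  \<open>G\<close>, an event of finitely many counts, so that measurability of the chain event
  itself does not have to be discussed.\<close>

lemma clink_prob_upper:
  fixes X :: "'a \<Rightarrow> (real^'n) set"
  assumes X: "is_PPP M X l" and l: "0 < l" and d: "1 \<le> d" and \<rho>: "1 \<le> \<rho>" "sqrt CARD('n) < \<rho>"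
    and s: "s = 1 / (\<rho> - sqrt CARD('n))" and a: "0 \<le> a" and n: "3 \<le> n"
  obtains G where "G \<in> sets M"
    "{\<omega>\<in>space M. clink d close (X \<omega>) (cball 0 a) (far 0 (a + s * (2 * sqrt CARD('n) + n * \<rho>)))} \<subseteq> G"
    "measure M G \<le> card (lat \<inter> cball (0 :: real^'n) (a / s + sqrt CARD('n))) * arm TYPE('n) d \<rho> n (l * s ^ CARD('n))"
proof -
  note Y = is_PPP_point_process[OF X]
  define R where "R = a / s + sqrt CARD('n)"
  define T where "T = R + n * \<rho>"
  define V where "V = (lat \<inter> cball 0 (T + \<rho>) :: (real^'n) set)"
  define \<mu> where "\<mu> = l * s ^ CARD('n)"
  have s0: "0 < s" unfolding s using \<rho> by simp
  have R0: "0 \<le> R" unfolding R_def using a s0 by simp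
  have RT: "R \<le> T" "0 \<le> T + \<rho>" unfolding T_def using R0 \<rho> by auto
  have V: "finite V" "V \<subseteq> lat" unfolding V_def using finite_lat_card(1)[OF RT(2)] by auto
  have \<mu>: "0 \<le> \<mu>" unfolding \<mu>_def using l s0 by simp
  interpret weights "tpw (d + 1) \<mu>" "d + 1" by (rule weights_tpw[OF \<mu>])
  define A where "A c = dlink d \<rho> c (cball 0 R) (far 0 T)" for c :: "real^'n \<Rightarrow> nat"
  define G where "G = {\<omega>\<in>space M. A (ccounts d s V (X \<omega>))}"
  have "G \<in> sets M" unfolding G_def by (rule ccounts_event[OF Y s0 V])
  moreover have "{\<omega>\<in>space M. clink d close (X \<omega>) (cball 0 a) (far 0 (a + s * (2 * sqrt CARD('n) + n * \<rho>)))} \<subseteq> G"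
  proof
    fix \<omega> assume w: "\<omega> \<in> {\<omega>\<in>space M. clink d close (X \<omega>) (cball 0 a) (far 0 (a + s * (2 * sqrt CARD('n) + n * \<rho>)))}"
    have t: "(a + s * (2 * sqrt CARD('n) + n * \<rho>)) / s - sqrt CARD('n) = T"
      unfolding T_def R_def using s0 by (simp add: field_simps)
    have "dlink d \<rho> (counts (d + 1) (cidx s) (X \<omega>)) (cball 0 R) (far 0 T)"
      using PPP_to_lattice[OF point_process_fibre_finite[OF Y _ s0] \<rho>(2) s, of \<omega> d a "a + s * (2 * sqrt CARD('n) + n * \<rho>)"] w
      unfolding R_def[symmetric] t by simp
    then have "dlink d \<rho> (res (cball 0 (T + \<rho>)) (counts (d + 1) (cidx s) (X \<omega>))) (cball 0 R) (far 0 T)"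
      by (rule dlink_local[OF d subset_cball[OF RT(1)]])
    then show "\<omega> \<in> G" using w unfolding G_def A_def V_def by (simp add: res_counts_lat[of "cball 0 (T + \<rho>)"])
  qed
  moreover have "measure M G \<le> card (lat \<inter> cball (0 :: real^'n) R) * arm TYPE('n) d \<rho> n \<mu>"
  proof -
    define W where "W = (lat \<inter> cball 0 R :: (real^'n) set)"
    have W: "finite W" unfolding W_def by (rule finite_lat_card(1)[OF R0])
    have "measure M G = E V (\<lambda>c. of_bool (A c))"
      unfolding G_def \<mu>_def by (rule PPP_law[OF X l s0 V])
    also have "\<dots> \<le> E V (\<lambda>c. \<Sum>v\<in>W. of_bool (dlink d \<rho> c (cball v (2 * \<rho>)) (far v (n * \<rho>))))"
    proof (rule E_mono)
      fix c assume c: "c \<in> cfg (d + 1) V"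
      show "of_bool (A c) \<le> (\<Sum>v\<in>W. of_bool (dlink d \<rho> c (cball v (2 * \<rho>)) (far v (n * \<rho>))) :: real)"
      proof (cases "A c")
        case True
        then obtain v where v: "v \<in> W" "dlink d \<rho> c (cball v (2 * \<rho>)) (far v (n * \<rho>))"
          using dlink_cover[OF c, of d \<rho> R "n * \<rho>"] \<rho>(1) V(2) unfolding A_def T_def W_def by auto
        have "(1::real) = of_bool (dlink d \<rho> c (cball v (2 * \<rho>)) (far v (n * \<rho>)))" using v by simp
        also have "\<dots> \<le> (\<Sum>v\<in>W. of_bool (dlink d \<rho> c (cball v (2 * \<rho>)) (far v (n * \<rho>))) :: real)"
          using v(1) W by (intro member_le_sum[of v W "\<lambda>v. of_bool (dlink d \<rho> c (cball v (2 * \<rho>)) (far v (n * \<rho>)))"]) auto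
        finally show ?thesis using True by simp
      qed (simp add: sum_nonneg)
    qed
    also have "\<dots> = (\<Sum>v\<in>W. E V (\<lambda>c. of_bool (dlink d \<rho> c (cball v (2 * \<rho>)) (far v (n * \<rho>)))))" by (rule pexp_sum)
    also have "\<dots> \<le> (\<Sum>v\<in>W. arm TYPE('n) d \<rho> n \<mu>)"
      by (intro sum_mono link_prob_le_arm[OF d \<rho>(1) \<mu> V _ n]) (simp add: W_def)
    finally show ?thesis unfolding W_def by simp
  qed
  ultimately show ?thesis using that unfolding R_def \<mu>_def by blast
qed

text \<open>A percolating configuration has a ball from which chains lead arbitrarily far. For each
  ball this is contained in events of exponentially small probability, whose intersection is null,
  and countably many balls suffice.\<close>

lemma no_perc_if_arm_decays:
  fixes X :: "'a \<Rightarrow> (real^'n) set"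
  assumes X: "is_PPP M X l" and l: "0 < l" and d: "1 \<le> d" and \<rho>: "1 \<le> \<rho>" "sqrt CARD('n) < \<rho>"
    and s: "s = 1 / (\<rho> - sqrt CARD('n))" and dec: "0 < \<alpha>" "\<And>n. 3 \<le> n \<Longrightarrow> arm TYPE('n) d \<rho> n (l * s ^ CARD('n)) \<le> exp (- \<alpha> * n)"
  shows "measure M {\<omega>\<in>space M. face_perc d (X \<omega>)} = 0"
proof -
  interpret prob_space M using X unfolding is_PPP_def by simp
  note Y = is_PPP_point_process[OF X]
  define C where "C a n = {\<omega>\<in>space M. clink d close (X \<omega>) (cball 0 a) (far 0 (a + s * (2 * sqrt CARD('n) + real n * \<rho>)))}" for a n
  define N where "N a = real (card (lat \<inter> cball (0 :: real^'n) (a / s + sqrt CARD('n))))" for a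
  have "\<exists>G. G \<in> sets M \<and> C a (n + 3) \<subseteq> G \<and> prob G \<le> N a * exp (- \<alpha> * real (n + 3))" if a: "0 \<le> a" for a and n :: nat
  proof -
    obtain G where G: "G \<in> sets M" "C a (n + 3) \<subseteq> G"
      "prob G \<le> N a * arm TYPE('n) d \<rho> (n + 3) (l * s ^ CARD('n))"
      using clink_prob_upper[OF X l d \<rho> s a, of "n + 3"] unfolding C_def N_def by auto
    have "N a * arm TYPE('n) d \<rho> (n + 3) (l * s ^ CARD('n)) \<le> N a * exp (- \<alpha> * real (n + 3))"
      using dec(2)[of "n + 3"] by (intro mult_left_mono) (auto simp: N_def)
    then show ?thesis using G by (intro exI[of _ G]) auto
  qed
  then obtain G where G: "\<And>a n. 0 \<le> a \<Longrightarrow> G a n \<in> sets M \<and> C a (n + 3) \<subseteq> G a n \<and> prob (G a n) \<le> N a * exp (- \<alpha> * real (n + 3))"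
    by metis
  have null: "(\<Inter>n. G a n) \<in> null_sets M" if a: "0 \<le> a" for a
  proof -
    have s: "(\<Inter>n. G a n) \<in> sets M" using G[OF a] by auto
    have "prob (\<Inter>n. G a n) \<le> N a * exp (- \<alpha> * real (n + 3))" for n :: nat
    proof -
      have "prob (\<Inter>n. G a n) \<le> prob (G a n)" using G[OF a] by (intro finite_measure_mono) auto
      then show ?thesis using G[OF a, of n] by linarith
    qed
    moreover have "(\<lambda>n. N a * exp (- \<alpha> * real (n + 3))) \<longlonglongrightarrow> 0" using dec(1) by real_asymp
    ultimately have "prob (\<Inter>n. G a n) \<le> 0" by (intro LIMSEQ_le_const[of _ 0] exI allI impI)
    then have "prob (\<Inter>n. G a n) = 0" using measure_nonneg[of M "\<Inter>n. G a n"] by linarith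
    then show ?thesis using s by (simp add: null_sets_def emeasure_eq_measure)
  qed
  have "{\<omega>\<in>space M. face_perc d (X \<omega>)} \<subseteq> (\<Union>K::nat. \<Inter>n. G (real K) n)"
  proof
    fix \<omega> assume w: "\<omega> \<in> {\<omega>\<in>space M. face_perc d (X \<omega>)}"
    then obtain K :: nat where K: "\<And>t. clink d close (X \<omega>) (cball 0 (real K)) (far 0 t)"
      using face_perc_imp_clink[OF point_process_finite[OF Y]] by blast
    then have "\<omega> \<in> C (real K) (n + 3)" for n using w unfolding C_def by simp
    then have "\<omega> \<in> G (real K) n" for n using G[of "real K" n] by auto
    then show "\<omega> \<in> (\<Union>K::nat. \<Inter>n. G (real K) n)" by blast
  qed
  moreover have "(\<Union>K::nat. \<Inter>n. G (real K) n) \<in> null_sets M" using null by (intro null_sets_UN) simp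
  ultimately have "{\<omega>\<in>space M. face_perc d (X \<omega>)} \<in> null_sets M"
    using face_perc_event[OF Y d] by (rule null_sets_subset[rotated 2])
  then show ?thesis by (simp add: null_sets_def measure_def)
qed

lemma lattice_link_prob:
  fixes X :: "'a \<Rightarrow> (real^'n) set"
  assumes X: "is_PPP M X l" and l: "0 < l" and d: "1 \<le> d" and \<rho>: "0 < \<rho>" and s: "0 < s" and n: "3 \<le> n"
  defines "E \<equiv> {\<omega>\<in>space M. dlink d \<rho> (counts (d + 1) (cidx s) (X \<omega>)) (cball 0 (2 * \<rho>)) (far 0 (n * \<rho>))}"
  shows "E \<in> sets M" "measure M E = arm TYPE('n) d \<rho> n (l * s ^ CARD('n))"
proof -
  define V where "V = (win \<rho> n :: (real^'n) set)"
  have V: "finite V" "V \<subseteq> lat" unfolding V_def using \<rho> by (auto intro!: finite_lat_card)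
  have sub: "cball 0 (2 * \<rho>) \<subseteq> cball (0 :: real^'n) (n * \<rho>)" using n \<rho> by (intro subset_cball mult_right_mono) auto
  have e: "E = {\<omega>\<in>space M. dlink d \<rho> (ccounts d s V (X \<omega>)) (cball 0 (2 * \<rho>)) (far 0 (n * \<rho>))}"
    unfolding E_def V_def
    using dlink_local[OF d sub] dlink_mono[OF res_le order_refl order_refl]
    by (simp only: res_counts_lat[of "cball 0 (n * \<rho> + \<rho>)", symmetric]) blast
  show "E \<in> sets M" unfolding e by (rule ccounts_event[OF is_PPP_point_process[OF X] s V])
  have "measure M E = pexp (tpw (d + 1) (l * s ^ CARD('n))) (d + 1) V (\<lambda>c. of_bool (dlink d \<rho> c (cball 0 (2 * \<rho>)) (far 0 (n * \<rho>))))"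
    unfolding e by (rule PPP_law[OF X l s V])
  then show "measure M E = arm TYPE('n) d \<rho> n (l * s ^ CARD('n))"
    using n unfolding arm_def hit_def V_def by simp
qed

text \<open>The lattice events decrease in \<open>n\<close>, so their intersection keeps probability
  at least \<open>c\<close>; on it chains from one fixed ball reach every distance.\<close>

lemma perc_if_arm_bounded_below:
  fixes X :: "'a \<Rightarrow> (real^'n) set"
  assumes X: "is_PPP M X l" and l: "0 < l" and d: "1 \<le> d" "d \<le> CARD('n)" and \<rho>: "0 < \<rho>"
    and s: "s = 1 / (\<rho> + sqrt CARD('n))" and c: "0 < c" "\<And>n. c \<le> arm TYPE('n) d \<rho> n (l * s ^ CARD('n))"
  shows "0 < measure M {\<omega>\<in>space M. face_perc d (X \<omega>)}"
proof -
  interpret prob_space M using X unfolding is_PPP_def by simp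
  note Y = is_PPP_point_process[OF X]
  have s0: "0 < s" unfolding s using \<rho> by (simp add: add_pos_nonneg)
  define A where "A n = {\<omega>\<in>space M. dlink d \<rho> (counts (d + 1) (cidx s) (X \<omega>)) (cball 0 (2 * \<rho>)) (far 0 (real n * \<rho>))}" for n
  have A: "A (n + 3) \<in> sets M" "c \<le> prob (A (n + 3))" for n
    using lattice_link_prob[OF X l d(1) \<rho> s0, of "n + 3"] c(2)[of "n + 3"] unfolding A_def by auto
  have "decseq (\<lambda>n. A (n + 3))"
  proof (rule decseq_SucI)
    fix n
    have "far 0 (real (Suc n + 3) * \<rho>) \<subseteq> far (0 :: real^'n) (real (n + 3) * \<rho>)"
      unfolding far_def using \<rho> by (auto simp: algebra_simps)
    then show "A (Suc n + 3) \<subseteq> A (n + 3)" unfolding A_def using dlink_mono[OF order_refl order_refl] by blast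
  qed
  then have "(\<lambda>n. prob (A (n + 3))) \<longlonglongrightarrow> prob (\<Inter>n. A (n + 3))" using A by (intro finite_Lim_measure_decseq) auto
  then have p: "c \<le> prob (\<Inter>n. A (n + 3))" using A(2) by (intro LIMSEQ_le_const) auto
  show ?thesis
  proof (rule face_perc_pos[OF X d])
    show "(\<Inter>n. A (n + 3)) \<in> events" using A(1) by auto
    show "0 < prob (\<Inter>n. A (n + 3))" using p c(1) by linarith
    fix \<omega> t assume w: "\<omega> \<in> (\<Inter>n. A (n + 3))"
    then have ws: "\<omega> \<in> space M" unfolding A_def by auto
    obtain n :: nat where n: "(t / s + sqrt CARD('n)) / \<rho> \<le> real n" using real_arch_simple by blast
    have "dlink d \<rho> (counts (d + 1) (cidx s) (X \<omega>)) (cball 0 (2 * \<rho>)) (far 0 (real (n + 3) * \<rho>))"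
      using w unfolding A_def by blast
    then have 1: "clink d close (X \<omega>) (cball 0 (s * (2 * \<rho> + sqrt CARD('n)))) (far 0 (s * (real (n + 3) * \<rho> - sqrt CARD('n))))"
      by (rule lattice_to_PPP[OF point_process_fibre_finite[OF Y ws s0] \<rho> s])
    have "t / s + sqrt CARD('n) \<le> real n * \<rho>" using n \<rho> by (simp add: field_simps)
    then have "t / s + sqrt CARD('n) \<le> real (n + 3) * \<rho>" using \<rho> by (simp add: algebra_simps)
    then have "t / s \<le> real (n + 3) * \<rho> - sqrt CARD('n)" by linarith
    then have "t \<le> s * (real (n + 3) * \<rho> - sqrt CARD('n))" using s0 by (simp add: pos_divide_le_eq mult.commute)
    then have "far 0 (s * (real (n + 3) * \<rho> - sqrt CARD('n))) \<subseteq> far (0 :: real^'n) t" unfolding far_def by auto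
    then show "clink d close (X \<omega>) (cball 0 (s * (2 * \<rho> + sqrt CARD('n)))) (far 0 t)"
      using 1 by (rule clink_mono[OF order_refl order_refl])
  qed
qed

section \<open>Nested meshes and the connection to the origin\<close>

lemma cidx_nested:
  assumes "0 < m"
  shows "cidx h x = cidx (real m) (cidx (h / real m) x)"
proof -
  have "\<lfloor>y / real m\<rfloor> = \<lfloor>real_of_int \<lfloor>y\<rfloor> / real m\<rfloor>" for y :: real
  proof (rule order_antisym)
    have "real_of_int (\<lfloor>y / real m\<rfloor> * int m) \<le> y"
      using mult_right_mono[OF of_int_floor_le[of "y / real m"], of "real m"] assms by simp
    then have "\<lfloor>y / real m\<rfloor> * int m \<le> \<lfloor>y\<rfloor>" by (simp only: le_floor_iff)
    then have "real_of_int (\<lfloor>y / real m\<rfloor> * int m) \<le> real_of_int \<lfloor>y\<rfloor>" by (simp only: of_int_le_iff)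
    then show "\<lfloor>y / real m\<rfloor> \<le> \<lfloor>real_of_int \<lfloor>y\<rfloor> / real m\<rfloor>"
      using assms by (simp add: le_floor_iff field_simps)
    show "\<lfloor>real_of_int \<lfloor>y\<rfloor> / real m\<rfloor> \<le> \<lfloor>y / real m\<rfloor>"
      using assms by (intro floor_mono divide_right_mono) auto
  qed
  from this[of "x $ i / h * real m" for i] show ?thesis unfolding cidx_def using assms by (simp add: field_simps)
qed

text \<open>Capping each fine count at \<open>d + 1\<close> does not change whether the sum reaches
  \<open>d + 1\<close>. Fullness of coarse cells thus becomes an increasing event of the same fine
  counts that carry the arm event.\<close>

lemma full_iff_fine_counts:
  fixes L :: "(real^'n) set"
  assumes m: "0 < m" and fin: "\<And>v. finite {x\<in>L. cidx (h / real m) x = v}"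
    and W: "finite W" "\<And>v. v \<in> lat \<Longrightarrow> cidx (real m) v = u \<Longrightarrow> v \<in> W"
  shows "full d h L u \<longleftrightarrow> d + 1 \<le> (\<Sum>v | v \<in> W \<and> cidx (real m) v = u. res W (counts (d + 1) (cidx (h / real m)) L) v)"
proof -
  define F where "F v = {x\<in>L. cidx (h / real m) x = v}" for v
  define U where "U = {v \<in> W. cidx (real m) v = u}"
  have U: "finite U" unfolding U_def using W(1) by simp
  have "{x\<in>L. cidx h x = u} = (\<Union>v\<in>U. F v)"
    unfolding U_def F_def cidx_nested[OF m, of h] using W(2) cidx_lat by auto
  moreover have "card (\<Union>v\<in>U. F v) = (\<Sum>v\<in>U. card (F v))"
    by (rule card_UN_disjoint[OF U]) (use fin in \<open>auto simp: F_def\<close>)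
  ultimately have c: "card {x\<in>L. cidx h x = u} = (\<Sum>v\<in>U. card (F v))" by simp
  have r: "(\<Sum>v\<in>U. res W (counts (d + 1) (cidx (h / real m)) L) v) = (\<Sum>v\<in>U. min (card (F v)) (d + 1))"
    by (intro sum.cong) (auto simp: res_def U_def counts_def F_def)
  have "d + 1 \<le> (\<Sum>v\<in>U. card (F v)) \<longleftrightarrow> d + 1 \<le> (\<Sum>v\<in>U. min (card (F v)) (d + 1))"
  proof (cases "\<exists>v\<in>U. d + 1 \<le> card (F v)")
    case True
    then obtain v where v: "v \<in> U" "d + 1 \<le> card (F v)" by blast
    have "card (F v) \<le> (\<Sum>v\<in>U. card (F v))" using v U by (intro member_le_sum) auto
    moreover have "min (card (F v)) (d + 1) \<le> (\<Sum>v\<in>U. min (card (F v)) (d + 1))"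
      using v U by (intro member_le_sum[of v U "\<lambda>v. min (card (F v)) (d + 1)"]) auto
    ultimately show ?thesis using v by simp
  next
    case False
    then have "(\<Sum>v\<in>U. min (card (F v)) (d + 1)) = (\<Sum>v\<in>U. card (F v))" by (intro sum.cong) auto
    then show ?thesis by simp
  qed
  then show ?thesis unfolding full_def counts_def[of "d + 1" "cidx h"] c r[unfolded U_def] U_def by auto
qed

text \<open>The Harris inequality requires both events on one product space, so the mesh
  \<open>h / m\<close> of the arms subdivides the mesh \<open>h\<close> of the full cells; this
  prescribes \<rho> through h / m = 1 / (\<rho> + \<surd>D). The radius 3 is the start radius 2 of
  the link plus 1 for the barycentre.\<close>

lemma reach_prob_lower:
  fixes X :: "'a \<Rightarrow> (real^'n) set"
  assumes X: "is_PPP M X l" and l: "0 < l" and d: "1 \<le> d" and h: "fine_mesh TYPE('n) d h" and m: "0 < m"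
    and \<rho>: "\<rho> = real m / h - sqrt CARD('n)" "0 < \<rho>" and n: "3 \<le> n" and r: "r < h / m * (n * \<rho> - sqrt CARD('n))"
  shows "tpw (d + 1) (l * h ^ CARD('n)) (d + 1) ^ card {u \<in> lat. h * norm (u :: real^'n) \<le> 3 + h * sqrt CARD('n)}
    * arm TYPE('n) d \<rho> n (l * (h / m) ^ CARD('n)) \<le> theta M X d r"
proof -
  interpret prob_space M using X unfolding is_PPP_def by simp
  note Y = is_PPP_point_process[OF X] and h0 = fine_mesh_bounds(1)[OF h]
  define s where "s = h / real m"
  define U where "U = {u \<in> lat. h * norm (u :: real^'n) \<le> 3 + h * sqrt CARD('n)}"
  define r0 where "r0 = 3 / h + sqrt CARD('n)"
  have s0: "0 < s" unfolding s_def using h0 m by simp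
  have s1: "s = 1 / (\<rho> + sqrt CARD('n))" unfolding s_def \<rho>(1) by simp
  have Ur: "U \<subseteq> lat \<inter> cball 0 r0"
  proof
    fix u assume "u \<in> U"
    moreover have "h * r0 = 3 + h * sqrt CARD('n)" unfolding r0_def using h0 by (simp add: distrib_left)
    ultimately have "u \<in> lat" "h * norm u \<le> h * r0" unfolding U_def by auto
    then show "u \<in> lat \<inter> cball 0 r0" using h0 by simp
  qed
  have r00: "0 \<le> r0" unfolding r0_def using h0 by simp
  have U: "finite U" "U \<subseteq> lat" using finite_subset[OF Ur] finite_lat_card(1)[OF r00] unfolding U_def by auto
  \<comment> \<open>Large enough for the arm event and for all fine cells inside the coarse cells of
    \<open>U\<close>.\<close>
  define w where "w = max (n * \<rho> + \<rho>) (real m * (r0 + sqrt CARD('n)))"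
  define W where "W = (lat \<inter> cball 0 w :: (real^'n) set)"
  have w0: "0 \<le> w" unfolding w_def using \<rho>(2) by (intro max.coboundedI1) simp
  have W: "finite W" "W \<subseteq> lat" unfolding W_def using finite_lat_card(1)[OF w0] by auto
  have fib: "v \<in> W" if "v \<in> lat" "cidx (real m) v = u" "u \<in> U" for u v
  proof -
    have "norm v \<le> real m * (norm u + sqrt CARD('n))" using cidx_norm(1)[of "real m" v] m that(2) by simp
    also have "\<dots> \<le> real m * (r0 + sqrt CARD('n))" using Ur that(3) by (intro mult_left_mono add_right_mono) auto
    finally show ?thesis using that(1) unfolding W_def w_def by simp
  qed
  define \<mu> where "\<mu> = l * s ^ CARD('n)"
  have \<mu>: "0 \<le> \<mu>" unfolding \<mu>_def using l s0 by simp
  interpret W: weights "tpw (d + 1) \<mu>" "d + 1" by (rule weights_tpw[OF \<mu>])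
  define A where "A c \<longleftrightarrow> (\<forall>u\<in>U. d + 1 \<le> (\<Sum>v | v \<in> W \<and> cidx (real m) v = u. c v))" for c :: "real^'n \<Rightarrow> nat"
  define B where "B c = dlink d \<rho> c (cball 0 (2 * \<rho>)) (far 0 (n * \<rho>))" for c :: "real^'n \<Rightarrow> nat"
  have mA: "mono (\<lambda>c. of_bool (A c) :: real)"
  proof (rule monoI)
    fix c c' :: "real^'n \<Rightarrow> nat" assume c: "c \<le> c'"
    have "A c'" if "A c"
      unfolding A_def
    proof
      fix u assume "u \<in> U"
      then have "d + 1 \<le> (\<Sum>v | v \<in> W \<and> cidx (real m) v = u. c v)" using that unfolding A_def by blast
      also have "\<dots> \<le> (\<Sum>v | v \<in> W \<and> cidx (real m) v = u. c' v)" using c by (intro sum_mono) (simp add: le_fun_def)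
      finally show "d + 1 \<le> (\<Sum>v | v \<in> W \<and> cidx (real m) v = u. c' v)" .
    qed
    then show "of_bool (A c) \<le> (of_bool (A c') :: real)" by auto
  qed
  have hB: "hit d \<rho> n c = of_bool (B c)" for c unfolding hit_def B_def ..
  have mB: "mono (\<lambda>c. of_bool (B c) :: real)" 
  proof -
    have "hit d \<rho> n = (\<lambda>c. of_bool (B c))" by (rule ext) (rule hB)
    moreover have "mono (hit d \<rho> n :: (real^'n \<Rightarrow> nat) \<Rightarrow> real)" by (rule mono_hit)
    ultimately show ?thesis by (simp only:)
  qed
  have full: "(\<forall>u\<in>U. full d h (X \<omega>) u) \<longleftrightarrow> A (ccounts d s W (X \<omega>))" if "\<omega> \<in> space M" for \<omega>
    unfolding A_def s_def
    by (intro ball_cong refl full_iff_fine_counts[OF m point_process_fibre_finite[OF Y that s0, unfolded s_def] W(1)] fib)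
  have "tpw (d + 1) (l * h ^ CARD('n)) (d + 1) ^ card U = prob {\<omega>\<in>space M. \<forall>u\<in>U. full d h (X \<omega>) u}"
    by (rule full_prob(2)[OF X l h0 U, symmetric])
  also have "\<dots> = prob {\<omega>\<in>space M. A (ccounts d s W (X \<omega>))}"
    by (rule arg_cong[where f = prob]) (use full in blast)
  also have "\<dots> = W.E W (\<lambda>c. of_bool (A c))" unfolding \<mu>_def by (rule PPP_law[OF X l s0 W])
  finally have pA: "tpw (d + 1) (l * h ^ CARD('n)) (d + 1) ^ card U = W.E W (\<lambda>c. of_bool (A c))" .
  have "arm TYPE('n) d \<rho> n \<mu> = W.E (win \<rho> n) (\<lambda>c. of_bool (B c))" using n unfolding arm_def hB[abs_def] by simp
  also have "\<dots> \<le> W.E W (\<lambda>c. of_bool (B c))"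
    by (rule W.E_superset_mono[OF W(1) _ mB]) (auto simp: W_def w_def)
  finally have pB: "arm TYPE('n) d \<rho> n \<mu> \<le> W.E W (\<lambda>c. of_bool (B c))" .
  have "tpw (d + 1) (l * h ^ CARD('n)) (d + 1) ^ card U * arm TYPE('n) d \<rho> n \<mu>
      \<le> W.E W (\<lambda>c. of_bool (A c)) * W.E W (\<lambda>c. of_bool (B c))"
    unfolding pA by (intro mult_left_mono pB W.E_nonneg) simp
  also have "\<dots> \<le> W.E W (\<lambda>c. of_bool (A c) * of_bool (B c))" by (rule W.harris[OF W(1) mA mB])
  also have "\<dots> = W.E W (\<lambda>c. of_bool (A c \<and> B c))" by (rule arg_cong[where f = "W.E W"]) auto
  also have "\<dots> = prob {\<omega>\<in>space M. A (ccounts d s W (X \<omega>)) \<and> B (ccounts d s W (X \<omega>))}"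
    unfolding \<mu>_def by (rule PPP_law[OF X l s0 W, symmetric])
  also have "\<dots> \<le> theta M X d r"
    unfolding theta_def
  proof (rule finite_measure_mono[OF _ reach_event[OF Y]], clarify)
    fix \<omega> assume ws: "\<omega> \<in> space M" and a: "A (ccounts d s W (X \<omega>))" and b: "B (ccounts d s W (X \<omega>))"
    have "dlink d \<rho> (counts (d + 1) (cidx s) (X \<omega>)) (cball 0 (2 * \<rho>)) (far 0 (n * \<rho>))"
      using b unfolding B_def by (rule dlink_mono[OF res_le order_refl order_refl])
    then have 1: "clink d close (X \<omega>) (cball 0 (s * (2 * \<rho> + sqrt CARD('n)))) (far 0 (s * (n * \<rho> - sqrt CARD('n))))"
      by (rule lattice_to_PPP[OF point_process_fibre_finite[OF Y ws s0] \<rho>(2) s1])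
    have "s * (2 * \<rho> + sqrt CARD('n)) \<le> s * (2 * (\<rho> + sqrt CARD('n)))" using s0 by (intro mult_left_mono) auto
    also have "\<dots> = 2 * (s * (\<rho> + sqrt CARD('n)))" by (rule mult.left_commute)
    also have "s * (\<rho> + sqrt CARD('n)) = 1"
      using add_pos_nonneg[OF \<rho>(2), of "sqrt CARD('n)"] unfolding s1 by simp
    finally have "cball 0 (s * (2 * \<rho> + sqrt CARD('n))) \<subseteq> cball (0 :: real^'n) 2" by (intro subset_cball) simp
    then have 2: "clink d close (X \<omega>) (cball 0 2) (far 0 (s * (n * \<rho> - sqrt CARD('n))))"
      using 1 by (rule clink_mono[OF order_refl _ order_refl])
    show "reach d r (X \<omega>)"
    proof (rule reach_if_full[OF h _ _ 2])
      fix u :: "real^'n" assume "u \<in> lat" "h * norm u \<le> 2 + 1 + h * sqrt CARD('n)"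
      then show "full d h (X \<omega>) u" using full[OF ws] a unfolding U_def by auto
    qed (use r in \<open>auto simp: s_def\<close>)
  qed
  finally show ?thesis unfolding U_def \<mu>_def s_def .
qed

text \<open>All cells of a large ball are full with positive probability. Positivity matters for the
  decay rate, because the real logarithm cannot express minus infinity at 0.\<close>

lemma theta_pos:
  fixes X :: "'a \<Rightarrow> (real^'n) set"
  assumes X: "is_PPP M X l" and l: "0 < l"
  shows "0 < theta M X d r"
proof -
  interpret prob_space M using X unfolding is_PPP_def by simp
  define h where "h = 1 / (4 * (real d + 1) * sqrt CARD('n))"
  have h: "fine_mesh TYPE('n) d h" unfolding fine_mesh_def h_def by simp
  note h0 = fine_mesh_bounds(1)[OF h]
  obtain k :: nat where k: "r / h + sqrt CARD('n) < real k" using reals_Archimedean2 by blast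
  obtain i :: 'n where True by simp
  define v where "v = real k *\<^sub>R (axis i 1 :: real^'n)"
  have "norm (axis i 1 :: real^'n) = 1" by (intro norm_Basis) simp
  then have v: "v \<in> lat" "norm v = real k" unfolding v_def lat_def by (auto simp: axis_def[of i])
  define V where "V = (lat \<inter> cball 0 (real k) :: (real^'n) set)"
  have V: "finite V" "V \<subseteq> lat" unfolding V_def by (auto intro!: finite_lat_card)
  have "0 < tpw (d + 1) (l * h ^ CARD('n)) (d + 1) ^ card V" using l h0 by (intro zero_less_power tpw_top_pos) simp
  also have "\<dots> = prob {\<omega>\<in>space M. \<forall>u\<in>V. full d h (X \<omega>) u}" by (rule full_prob(2)[OF X l h0 V, symmetric])
  also have "\<dots> \<le> theta M X d r"
    unfolding theta_def
  proof (rule finite_measure_mono[OF _ reach_event[OF is_PPP_point_process[OF X]]], clarify)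
    fix \<omega> assume f: "\<forall>u\<in>V. full d h (X \<omega>) u"
    have "r / h < norm v - sqrt CARD('n)" using k v(2) by simp
    then have "r < h * (norm v - sqrt CARD('n))" using h0 by (simp add: pos_divide_less_eq mult.commute)
    then show "reach d r (X \<omega>)" using f v by (intro reach_if_all_full[OF h _ v(1), of "real k"]) (auto simp: V_def)
  qed
  finally show ?thesis .
qed

subsection \<open>The critical intensity\<close>

lemma ratio_limits:
  fixes a :: real and m :: nat
  shows "((\<lambda>\<rho>. (\<rho> / (\<rho> - a)) ^ m) \<longlongrightarrow> 1) at_top" "((\<lambda>\<rho>. (\<rho> / (\<rho> + a)) ^ m) \<longlongrightarrow> 1) at_top"
    "((\<lambda>\<rho>. ((\<rho> + a) / (\<rho> - a)) ^ m) \<longlongrightarrow> 1) at_top"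
proof -
  have "((\<lambda>\<rho>. \<rho> / (\<rho> - a)) \<longlongrightarrow> 1) at_top" "((\<lambda>\<rho>. \<rho> / (\<rho> + a)) \<longlongrightarrow> 1) at_top"
    "((\<lambda>\<rho>. (\<rho> + a) / (\<rho> - a)) \<longlongrightarrow> 1) at_top" by real_asymp+
  from this[THEN tendsto_power[where n = m]] show "((\<lambda>\<rho>. (\<rho> / (\<rho> - a)) ^ m) \<longlongrightarrow> 1) at_top"
    "((\<lambda>\<rho>. (\<rho> / (\<rho> + a)) ^ m) \<longlongrightarrow> 1) at_top" "((\<lambda>\<rho>. ((\<rho> + a) / (\<rho> - a)) ^ m) \<longlongrightarrow> 1) at_top"
    by simp_all
qed

lemma Limsup_neg_if_exp_decay:
  fixes f :: "real \<Rightarrow> real"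
  assumes pos: "\<And>r. 0 < f r" and C: "0 < C" and \<kappa>: "0 < \<kappa>" and le: "\<And>r. t \<le> r \<Longrightarrow> f r \<le> C * exp (- \<kappa> * r)"
  shows "Limsup at_top (\<lambda>r. ereal (ln (f r) / r)) < 0"
proof -
  define R where "R = max (max 1 t) (2 * ln C / \<kappa>)"
  have "ln (f r) / r \<le> - \<kappa> / 2" if r: "R \<le> r" for r
  proof -
    have r1: "1 \<le> r" "t \<le> r" "2 * ln C / \<kappa> \<le> r" using r unfolding R_def by auto
    have "ln (f r) \<le> ln (C * exp (- \<kappa> * r))" using le[OF r1(2)] pos C by (subst ln_le_cancel_iff) auto
    also have "\<dots> = ln C - \<kappa> * r" using C by (simp add: ln_mult)
    also have "\<dots> \<le> (- \<kappa> / 2) * r" using r1(3) \<kappa> by (simp add: field_simps)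
    finally show ?thesis using r1(1) by (simp add: pos_divide_le_eq)
  qed
  then have "eventually (\<lambda>r. ereal (ln (f r) / r) \<le> ereal (- \<kappa> / 2)) at_top"
    unfolding eventually_at_top_linorder by (intro exI[of _ R]) auto
  then have "Limsup at_top (\<lambda>r. ereal (ln (f r) / r)) \<le> ereal (- \<kappa> / 2)" by (rule Limsup_bounded)
  also have "\<dots> < 0" using \<kappa> by simp
  finally show ?thesis .
qed

text \<open>\<open>Lim\<close> denotes the limit if there is one; antitonicity and the lower bound
  make \<open>f\<close> converge to its infimum.\<close>

lemma antimono_Lim_ge:
  fixes f :: "real \<Rightarrow> real"
  assumes anti: "\<And>r r'. r \<le> r' \<Longrightarrow> f r' \<le> f r" and c: "\<And>r. c \<le> f r"
  shows "c \<le> Lim at_top f"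
proof -
  have bdd: "bdd_below (range f)" using c by (auto simp: bdd_below_def)
  have "(f \<longlongrightarrow> Inf (range f)) at_top"
  proof (rule order_tendstoI)
    fix a assume "a < Inf (range f)"
    then show "eventually (\<lambda>x. a < f x) at_top"
      using cInf_lower[OF _ bdd] by (intro always_eventually allI) (metis order_less_le_trans rangeI)
  next
    fix a assume "Inf (range f) < a"
    then obtain r where "f r < a" using cInf_lessD[of "range f" a] by auto
    then show "eventually (\<lambda>x. f x < a) at_top"
      unfolding eventually_at_top_linorder using anti by (meson order_le_less_trans)
  qed
  then have "Lim at_top f = Inf (range f)" by (intro tendsto_Lim) auto
  then show ?thesis using c by (auto intro!: cInf_greatest)
qed

lemma theta_antimono:
  fixes X :: "'a \<Rightarrow> (real^'n) set"
  assumes X: "is_PPP M X l" and r: "r \<le> r'"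
  shows "theta M X d r' \<le> theta M X d r"
proof -
  interpret prob_space M using X unfolding is_PPP_def by simp
  have "reach d r L" if "reach d r' L" for L :: "(real^'n) set"
  proof -
    have "C - cball 0 r \<noteq> {}" if "C - cball 0 r' \<noteq> {}" for C :: "(real^'n) set"
      using that subset_cball[OF r, of 0] by blast
    then show ?thesis using \<open>reach d r' L\<close> unfolding reach_def by meson
  qed
  then show ?thesis unfolding theta_def
    by (intro finite_measure_mono reach_event[OF is_PPP_point_process[OF X]]) auto
qed

lemma tpw_top_mono:
  assumes "0 \<le> \<mu>" "\<mu> \<le> \<nu>"
  shows "tpw (d + 1) \<mu> (d + 1) \<le> tpw (d + 1) \<nu> (d + 1)"
proof -
  have "(\<lambda>\<mu>::real. 1 - (\<Sum>j\<le>d. exp (- \<mu>) * \<mu> ^ j / fact j)) \<mu> \<le> (\<lambda>\<mu>::real. 1 - (\<Sum>j\<le>d. exp (- \<mu>) * \<mu> ^ j / fact j)) \<nu>"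
  proof (rule DERIV_nonneg_imp_nondecreasing[OF assms(2)])
    fix x assume "\<mu> \<le> x" "x \<le> \<nu>"
    then have "0 \<le> exp (- x) * x ^ d / fact d" using assms by simp
    then show "\<exists>y. ((\<lambda>\<mu>::real. 1 - (\<Sum>j\<le>d. exp (- \<mu>) * \<mu> ^ j / fact j)) has_real_derivative y) (at x) \<and> 0 \<le> y"
      using poisson_tail_deriv[of d x] by blast
  qed
  then show ?thesis by (simp add: tpw_def lessThan_Suc_atMost)
qed

lemma slope_pos: "0 < b \<Longrightarrow> 0 < slope TYPE('n::finite) b"
  unfolding slope_def by simp

section \<open>The lattice thresholds and the critical intensity\<close>

locale percolation =
  fixes M :: "real \<Rightarrow> 'a measure" and X :: "real \<Rightarrow> 'a \<Rightarrow> (real^'n) set" and d :: nat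
  assumes dim: "2 \<le> CARD('n)" and d: "1 \<le> d" "d \<le> CARD('n)" and PPP: "\<And>l. 0 < l \<Longrightarrow> is_PPP (M l) (X l) l"
begin

definition perc :: "real set" where
  "perc = {l. 0 < l \<and> 0 < measure (M l) {\<omega>\<in>space (M l). face_perc d (X l \<omega>)}}"

abbreviation lf :: real where "lf \<equiv> lambda_face M X d"

lemma lf_eq: "lf = Inf perc"
  unfolding perc_def lambda_face_def ..

text \<open>The infimum of the empty set would be an arbitrary number.\<close>

lemma perc_nonempty: "perc \<noteq> {}"
  using exists_percolation[OF dim d PPP] unfolding perc_def by blast

lemma lf_le: "l \<in> perc \<Longrightarrow> lf \<le> l"
  unfolding lf_eq by (rule cInf_lower) (auto simp: perc_def bdd_below_def intro: less_imp_le)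

text \<open>The conclusion of \<open>arm_threshold\<close> as a predicate. The parameter
  \<open>x\<close> is the mean number of points in \<rho>^D cells, which tends to the intensity as
  \<rho> grows for either choice of the mesh.\<close>

definition threshold :: "real \<Rightarrow> real \<Rightarrow> real \<Rightarrow> bool" where
  "threshold \<rho> b \<beta> \<longleftrightarrow> 0 \<le> \<beta> \<and> \<beta> \<le> b
    \<and> (\<forall>x. 0 < x \<and> x < \<beta> \<longrightarrow> (\<exists>\<alpha>>0. \<forall>n\<ge>3. arm TYPE('n) d \<rho> n (x / \<rho> ^ CARD('n)) \<le> exp (- \<alpha> * n)))
    \<and> (\<forall>x m. \<beta> < x \<and> x \<le> b \<longrightarrow> slope TYPE('n) b * (x - \<beta>) \<le> arm TYPE('n) d \<rho> m (x / \<rho> ^ CARD('n)))"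

lemma threshold_exists:
  assumes "1 \<le> \<rho>" "0 < b" "b \<le> \<rho> ^ CARD('n)"
  obtains \<beta> where "threshold \<rho> b \<beta>"
  using arm_threshold[OF d(1) assms] unfolding threshold_def by metis

lemma scale_upper:
  assumes "0 < (\<rho>::real)"
  shows "l * (1 / (\<rho> - a)) ^ m = (l * (\<rho> / (\<rho> - a)) ^ m) / \<rho> ^ m"
  using assms by (simp add: power_divide)

text \<open>Otherwise the arms would decay exponentially in the lattice model that contains the
  complex, and \<open>l\<close> would not percolate.\<close>

lemma threshold_le:
  assumes \<rho>: "1 \<le> \<rho>" "sqrt CARD('n) < \<rho>" and \<beta>: "threshold \<rho> b \<beta>" and l: "l \<in> perc"
  shows "\<beta> \<le> l * (\<rho> / (\<rho> - sqrt CARD('n))) ^ CARD('n)"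
proof (rule ccontr)
  let ?x = "l * (\<rho> / (\<rho> - sqrt CARD('n))) ^ CARD('n)"
  assume "\<not> \<beta> \<le> ?x"
  moreover have l0: "0 < l" using l unfolding perc_def by simp
  then have "0 < ?x" using \<rho> by simp
  ultimately obtain \<alpha> where \<alpha>: "0 < \<alpha>" "\<And>n. 3 \<le> n \<Longrightarrow> arm TYPE('n) d \<rho> n (?x / \<rho> ^ CARD('n)) \<le> exp (- \<alpha> * n)"
    using \<beta> unfolding threshold_def by (metis not_le)
  have e: "l * (1 / (\<rho> - sqrt CARD('n))) ^ CARD('n) = ?x / \<rho> ^ CARD('n)" using \<rho>(1) by (intro scale_upper) simp
  have "measure (M l) {\<omega>\<in>space (M l). face_perc d (X l \<omega>)} = 0"
  proof (rule no_perc_if_arm_decays[OF PPP[OF l0] l0 d(1) \<rho> refl \<alpha>(1)])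
    show "arm TYPE('n) d \<rho> n (l * (1 / (\<rho> - sqrt CARD('n))) ^ CARD('n)) \<le> exp (- \<alpha> * n)" if "3 \<le> n" for n
      unfolding e by (rule \<alpha>(2)[OF that])
  qed
  then show False using l unfolding perc_def by simp
qed

lemma perc_if_above_threshold:
  assumes \<rho>: "1 \<le> \<rho>" and \<beta>: "threshold \<rho> b \<beta>" and l: "0 < l"
    and x: "x = l * (\<rho> / (\<rho> + sqrt CARD('n))) ^ CARD('n)" "\<beta> < x" "x \<le> b"
  shows "l \<in> perc"
proof -
  have "0 < \<beta> + b" "0 \<le> \<beta>" using \<beta> x unfolding threshold_def by auto
  then have b: "0 < b" using x by linarith
  have c: "0 < slope TYPE('n) b * (x - \<beta>)" using slope_pos[where 'n = 'n, OF b] x(2) by simp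
  have e: "l * (1 / (\<rho> + sqrt CARD('n))) ^ CARD('n) = x / \<rho> ^ CARD('n)"
    using \<rho> unfolding x(1) by (simp add: power_divide)
  have "slope TYPE('n) b * (x - \<beta>) \<le> arm TYPE('n) d \<rho> n (l * (1 / (\<rho> + sqrt CARD('n))) ^ CARD('n))" for n
    unfolding e using \<beta> x(2,3) unfolding threshold_def by blast
  then have "0 < measure (M l) {\<omega>\<in>space (M l). face_perc d (X l \<omega>)}"
    using \<rho> by (intro perc_if_arm_bounded_below[OF PPP[OF l] l d _ refl c]) auto
  then show ?thesis using l unfolding perc_def by simp
qed

text \<open>The value of \<open>b\<close> is so small that \<open>arm_le\<close> bounds arms at
  \<open>b\<close> by 1/200, while \<open>slope\<close> is at least 1 / (72 b). A threshold below b
  / 2 would force an arm probability of at least 1/144 at \<open>b\<close>. So the threshold is at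
  least b / 2, and \<open>threshold_le\<close> carries this over to \<open>lf\<close>.\<close>

lemma lf_pos: "0 < lf"
proof -
  define a where "a = sqrt CARD('n)"
  define \<rho> where "\<rho> = 2 * a + 1"
  define b where "b = 1 / (200 * 5 ^ CARD('n) :: real)"
  have a: "0 \<le> a" unfolding a_def by simp
  have \<rho>: "1 \<le> \<rho>" "sqrt CARD('n) < \<rho>" using a unfolding \<rho>_def a_def by linarith+
  have b0: "0 < b" unfolding b_def by simp
  have "1 \<le> 200 * (5::real) ^ CARD('n)" using one_le_power[of "5::real" "CARD('n)"] by linarith
  then have "b \<le> 1" unfolding b_def by simp
  also have "1 \<le> \<rho> ^ CARD('n)" using \<rho>(1) by (rule one_le_power)
  finally obtain \<beta> where \<beta>: "threshold \<rho> b \<beta>" using threshold_exists[OF \<rho>(1) b0] by blast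
  have "b / 2 \<le> \<beta>"
  proof (rule ccontr)
    assume n: "\<not> b / 2 \<le> \<beta>"
    have "slope TYPE('n) b * (b - \<beta>) \<le> arm TYPE('n) d \<rho> 3 (b / \<rho> ^ CARD('n))"
      using \<beta> n b0 unfolding threshold_def by simp
    also have "\<dots> \<le> 1 - exp (- (5 ^ CARD('n) * (b / \<rho> ^ CARD('n) * \<rho> ^ CARD('n))))"
      using b0 \<rho>(1) by (intro arm_le[OF d(1) \<rho>(1)]) auto
    also have "5 ^ CARD('n) * (b / \<rho> ^ CARD('n) * \<rho> ^ CARD('n)) = 1 / 200" using \<rho>(1) unfolding b_def by simp
    also have "1 - exp (- (1 / 200 :: real)) \<le> 1 / 200" using exp_ge_add_one_self[of "- (1 / 200) :: real"] by simp
    finally have 1: "slope TYPE('n) b * (b - \<beta>) \<le> 1 / 200" .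
    have "slope TYPE('n) b = exp (- (1 / 200)) / (36 * b)" unfolding slope_def b_def by simp
    moreover have "(1 / 2 :: real) \<le> exp (- (1 / 200))" using exp_ge_add_one_self[of "- (1 / 200) :: real"] by simp
    then have "1 / 2 / (36 * b) \<le> exp (- (1 / 200)) / (36 * b)" using b0 by (intro divide_right_mono) auto
    ultimately have "1 / 2 / (36 * b) \<le> slope TYPE('n) b" by linarith
    then have "1 / 2 / (36 * b) * (b / 2) \<le> slope TYPE('n) b * (b - \<beta>)" using n b0 slope_pos[where 'n = 'n, OF b0] by (intro mult_mono) auto
    then show False using 1 b0 by simp
  qed
  have "b / 2 / (\<rho> / (\<rho> - a)) ^ CARD('n) \<le> l" if l: "l \<in> perc" for l
  proof -
    have "b / 2 \<le> l * (\<rho> / (\<rho> - a)) ^ CARD('n)"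
      using threshold_le[OF \<rho> \<beta> l] \<open>b / 2 \<le> \<beta>\<close> unfolding a_def by linarith
    moreover have "0 < (\<rho> / (\<rho> - a)) ^ CARD('n)" using \<rho> unfolding a_def by simp
    ultimately show ?thesis by (simp add: pos_divide_le_eq)
  qed
  then have "b / 2 / (\<rho> / (\<rho> - a)) ^ CARD('n) \<le> lf" unfolding lf_eq using perc_nonempty by (intro cInf_greatest) auto
  moreover have "0 < b / 2 / (\<rho> / (\<rho> - a)) ^ CARD('n)" using b0 \<rho> unfolding a_def by simp
  ultimately show ?thesis by linarith
qed

text \<open>Put \<open>l2\<close> between \<open>l\<close> and \<open>lf\<close>, and take \<rho> so
  large that \<open>l\<close> in the larger lattice model is still below \<open>l2\<close> in the
  smaller one (\<open>x < x'\<close>). A threshold of at most \<open>x\<close> would make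
  \<open>l2\<close> percolate, which is impossible below \<open>lf\<close>. So \<open>x\<close> is
  below the threshold and the arms at \<open>l\<close> decay.\<close>

lemma subcritical_decay:
  assumes l: "0 < l" "l < lf"
  shows "Limsup at_top (\<lambda>r. ereal (ln (theta (M l) (X l) d r) / r)) < 0"
proof -
  define a where "a = sqrt CARD('n)"
  define l2 where "l2 = (l + lf) / 2"
  have l2: "l < l2" "l2 < lf" unfolding l2_def using l by auto
  have "((\<lambda>\<rho>. l * ((\<rho> + a) / (\<rho> - a)) ^ CARD('n)) \<longlongrightarrow> l * 1) at_top" by (intro tendsto_mult tendsto_const ratio_limits)
  then have "eventually (\<lambda>\<rho>. l * ((\<rho> + a) / (\<rho> - a)) ^ CARD('n) < l2) at_top" using l2 by (intro order_tendstoD) auto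
  then have "eventually (\<lambda>\<rho>. l * ((\<rho> + a) / (\<rho> - a)) ^ CARD('n) < l2 \<and> max (a + 1) (lf + 1) \<le> \<rho>) at_top"
    using eventually_ge_at_top by (rule eventually_conj)
  then obtain \<rho> where \<rho>1: "l * ((\<rho> + a) / (\<rho> - a)) ^ CARD('n) < l2" "max (a + 1) (lf + 1) \<le> \<rho>"
    unfolding eventually_at_top_linorder by blast
  have a0: "0 \<le> a" unfolding a_def by simp
  have r: "a + 1 \<le> \<rho>" "lf + 1 \<le> \<rho>" using \<rho>1(2) by simp_all
  have \<rho>: "1 \<le> \<rho>" "sqrt CARD('n) < \<rho>" "lf \<le> \<rho>" using r a0 lf_pos unfolding a_def by linarith+
  have \<rho>p: "\<rho> \<le> \<rho> ^ CARD('n)" using \<rho>(1) dim by (intro self_le_power) auto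
  obtain \<beta> where \<beta>: "threshold \<rho> lf \<beta>" using threshold_exists[OF \<rho>(1) lf_pos] \<rho>(3) \<rho>p by (meson order_trans)
  define x where "x = l * (\<rho> / (\<rho> - a)) ^ CARD('n)"
  define x' where "x' = l2 * (\<rho> / (\<rho> + a)) ^ CARD('n)"
  have x0: "0 < x" unfolding x_def a_def using l \<rho> by simp
  have "x < x'"
  proof -
    have "(\<rho> + a) / (\<rho> - a) * (\<rho> / (\<rho> + a)) = \<rho> / (\<rho> - a)" using \<rho> a0 by (simp add: add_pos_nonneg)
    then have "x = l * ((\<rho> + a) / (\<rho> - a)) ^ CARD('n) * (\<rho> / (\<rho> + a)) ^ CARD('n)"
      unfolding x_def by (simp only: mult.assoc power_mult_distrib[symmetric])
    also have "\<dots> < l2 * (\<rho> / (\<rho> + a)) ^ CARD('n)" using \<rho> a0 by (intro mult_strict_right_mono \<rho>1) (simp add: add_pos_nonneg)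
    finally show ?thesis unfolding x'_def .
  qed
  have "(\<rho> / (\<rho> + a)) ^ CARD('n) \<le> 1" using \<rho> a0 by (intro power_le_one) (auto simp: divide_le_eq_1)
  then have "x' \<le> l2" unfolding x'_def using l l2 by (intro mult_left_le) auto
  have "x < \<beta>"
  proof (rule ccontr)
    assume "\<not> x < \<beta>"
    then have "\<beta> < x'" using \<open>x < x'\<close> by linarith
    moreover have "x' \<le> lf" using \<open>x' \<le> l2\<close> l2 by linarith
    ultimately have "l2 \<in> perc" using perc_if_above_threshold[OF \<rho>(1) \<beta>, of l2 x'] l l2 unfolding x'_def a_def by simp
    then show False using lf_le l2 by fastforce
  qed
  then obtain \<alpha> where \<alpha>: "0 < \<alpha>" "\<And>n. 3 \<le> n \<Longrightarrow> arm TYPE('n) d \<rho> n (x / \<rho> ^ CARD('n)) \<le> exp (- \<alpha> * n)"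
    using \<beta> x0 unfolding threshold_def by metis
  define s where "s = 1 / (\<rho> - a)"
  have s0: "0 < s" unfolding s_def a_def using \<rho> by simp
  have ls: "l * s ^ CARD('n) = x / \<rho> ^ CARD('n)" unfolding s_def x_def using \<rho>(1) by (simp add: scale_upper)
  define N where "N = real (card (lat \<inter> cball (0 :: real^'n) (1 / s + a))) + 1"
  define A where "A = 1 + s * (2 * a)"
  define B where "B = s * \<rho>"
  have B: "0 < B" unfolding B_def using s0 \<rho> by simp
  have A: "1 \<le> A" unfolding A_def using s0 a0 by simp
  interpret prob_space "M l" using PPP[OF l(1)] unfolding is_PPP_def by simp
  show ?thesis
  proof (rule Limsup_neg_if_exp_decay[where C = "N * exp (\<alpha> * (A / B + 1))" and \<kappa> = "\<alpha> / B" and t = "A + 4 * B"])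
    show "0 < theta (M l) (X l) d r" for r by (rule theta_pos[OF PPP[OF l(1)] l(1)])
    show "0 < N * exp (\<alpha> * (A / B + 1))" unfolding N_def by simp
    show "0 < \<alpha> / B" using \<alpha>(1) B by simp
    fix r assume r: "A + 4 * B \<le> r"
    \<comment> \<open>The number of steps of length \<open>B\<close> that fit between
      \<open>A\<close> and \<open>r\<close>. The bound on \<open>r\<close> gives
      \<open>3 \<le> n\<close>, from where on \<open>arm\<close> is a crossing probability.\<close>
    define n where "n = nat \<lfloor>(r - A) / B\<rfloor>"
    have q: "4 \<le> (r - A) / B" using r B by (simp add: le_divide_eq)
    then have n: "real n \<le> (r - A) / B" "(r - A) / B - 1 \<le> real n" "3 \<le> n" unfolding n_def by linarith+
    obtain G where G: "G \<in> events"
      "{\<omega>\<in>space (M l). clink d close (X l \<omega>) (cball 0 1) (far 0 (1 + s * (2 * a + real n * \<rho>)))} \<subseteq> G"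
      "prob G \<le> card (lat \<inter> cball (0 :: real^'n) (1 / s + a)) * arm TYPE('n) d \<rho> n (l * s ^ CARD('n))"
      using clink_prob_upper[OF PPP[OF l(1)] l(1) d(1) \<rho>(1,2) s_def[unfolded a_def] zero_le_one n(3)] unfolding a_def by blast
    have "1 + s * (2 * a + real n * \<rho>) = A + B * real n" unfolding A_def B_def by (simp add: algebra_simps)
    also have "\<dots> \<le> r" using n(1) B by (simp add: le_divide_eq mult.commute)
    finally have t: "far 0 r \<subseteq> far (0 :: real^'n) (1 + s * (2 * a + real n * \<rho>))" unfolding far_def by auto
    have r1: "1 \<le> r" using r A B by linarith
    have "theta (M l) (X l) d r \<le> prob G"
      unfolding theta_def
    proof (rule finite_measure_mono[OF subset_trans[OF _ G(2)] G(1)], clarify)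
      fix \<omega> assume "reach d r (X l \<omega>)"
      then have "clink d close (X l \<omega>) (cball 0 1) (far 0 r)" by (rule reach_imp_clink[OF d(1) _ r1])
      then show "clink d close (X l \<omega>) (cball 0 1) (far 0 (1 + s * (2 * a + real n * \<rho>)))"
        by (rule clink_mono[OF order_refl order_refl t])
    qed
    also have "\<dots> \<le> N * arm TYPE('n) d \<rho> n (l * s ^ CARD('n))"
    proof -
      have "0 \<le> arm TYPE('n) d \<rho> n (l * s ^ CARD('n))" using l s0 by (intro arm_bounds[OF d(1) \<rho>(1)]) auto
      then show ?thesis using G(3) unfolding N_def by (simp add: algebra_simps)
    qed
    also have "\<dots> \<le> N * exp (- \<alpha> * n)" unfolding ls by (intro mult_left_mono \<alpha>(2) n(3)) (simp add: N_def)
    also have "\<dots> \<le> N * exp (\<alpha> * (A / B + 1) + - (\<alpha> / B) * r)"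
    proof -
      have "\<alpha> * ((r - A) / B - 1) \<le> \<alpha> * real n" using n(2) \<alpha>(1) by (intro mult_left_mono) auto
      then have "- \<alpha> * n \<le> \<alpha> * (A / B + 1) + - (\<alpha> / B) * r" by (simp add: diff_divide_distrib algebra_simps)
      then show ?thesis by (intro mult_left_mono) (auto simp: N_def)
    qed
    finally show "theta (M l) (X l) d r \<le> N * exp (\<alpha> * (A / B + 1)) * exp (- (\<alpha> / B) * r)"
      by (simp only: exp_add mult.assoc)
  qed
qed

text \<open>For a percolating l' < l the threshold is at most l' up to a factor tending to 1, so in
  the limit the arms at \<open>l\<close> are at least \<open>slope\<close> times l - l'; then l'
  runs down to \<open>lf\<close>. The probability of full cells is taken at \<open>lf\<close>
  instead of \<open>l\<close> to make the prefactor constant.\<close>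

lemma theta_lower:
  assumes h: "fine_mesh TYPE('n) d h" and l: "lf < l" "l \<le> lf + 1"
  shows "tpw (d + 1) (lf * h ^ CARD('n)) (d + 1) ^ card {u \<in> lat. h * norm (u :: real^'n) \<le> 3 + h * sqrt CARD('n)}
    * slope TYPE('n) (lf + 1) * (l - lf) \<le> theta (M l) (X l) d r"
proof -
  define a where "a = sqrt CARD('n)"
  define b where "b = lf + 1"
  define U where "U = {u \<in> lat. h * norm (u :: real^'n) \<le> 3 + h * sqrt CARD('n)}"
  define p where "p = tpw (d + 1) (lf * h ^ CARD('n)) (d + 1) ^ card U"
  define q where "q = tpw (d + 1) (l * h ^ CARD('n)) (d + 1) ^ card U"
  note h0 = fine_mesh_bounds(1)[OF h]
  have l0: "0 < l" using l lf_pos by linarith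
  have a0: "0 \<le> a" unfolding a_def by simp
  have b0: "0 < b" unfolding b_def using lf_pos by simp
  have tp: "0 < tpw (d + 1) (lf * h ^ CARD('n)) (d + 1)" using lf_pos h0 by (intro tpw_top_pos) simp
  have pq: "p \<le> q"
    unfolding p_def q_def using tp lf_pos h0 l by (intro power_mono tpw_top_mono mult_right_mono) auto
  have p0: "0 \<le> p" "0 \<le> q" using tp pq unfolding p_def by (auto intro: order_trans[rotated])
  have sl: "0 < slope TYPE('n) b" by (rule slope_pos[OF b0])
  have main: "p * slope TYPE('n) b * (l - l') \<le> theta (M l) (X l) d r" if l': "l' \<in> perc" "l' < l" for l'
  proof -
    define f where "f \<rho> = p * slope TYPE('n) b * (l * (\<rho> / (\<rho> + a)) ^ CARD('n) - l' * (\<rho> / (\<rho> - a)) ^ CARD('n))" for \<rho> :: real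
    have "(f \<longlongrightarrow> p * slope TYPE('n) b * (l * 1 - l' * 1)) at_top"
      unfolding f_def by (intro tendsto_intros ratio_limits)
    \<comment> \<open>\<rho> runs through the values \<open>real m / h - a\<close>, for which the
      fine mesh subdivides \<open>h\<close>.\<close>
    moreover have "filterlim (\<lambda>m. real m / h - a) at_top sequentially" using h0 by real_asymp
    ultimately have lim: "(\<lambda>m. f (real m / h - a)) \<longlonglongrightarrow> p * slope TYPE('n) b * (l - l')"
      using filterlim_compose by fastforce
    have "f (real m / h - a) \<le> theta (M l) (X l) d r" if m: "h * (max (a + 1) b + a + 1) \<le> real m" for m
    proof -
      define \<rho> where "\<rho> = real m / h - a"
      have "max (a + 1) b + a + 1 \<le> real m / h" using m h0 by (simp add: le_divide_eq mult.commute)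
      then have \<rho>: "1 \<le> \<rho>" "sqrt CARD('n) < \<rho>" "b \<le> \<rho>" using a0 max.cobounded1[of "a + 1" b] max.cobounded2[of b "a + 1"] unfolding \<rho>_def a_def by linarith+
      have m0: "0 < m" using \<rho> a0 unfolding \<rho>_def by (cases m) auto
      have "\<rho> \<le> \<rho> ^ CARD('n)" using \<rho>(1) dim by (intro self_le_power) auto
      then obtain \<beta> where \<beta>: "threshold \<rho> b \<beta>" using threshold_exists[OF \<rho>(1) b0] \<rho>(3) by (meson order_trans)
      define x where "x = l * (\<rho> / (\<rho> + a)) ^ CARD('n)"
      have \<beta>l: "\<beta> \<le> l' * (\<rho> / (\<rho> - a)) ^ CARD('n)" unfolding a_def by (rule threshold_le[OF \<rho>(1,2) \<beta> l'(1)])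
      have "(\<rho> / (\<rho> + a)) ^ CARD('n) \<le> 1" using \<rho> a0 by (intro power_le_one) (auto simp: divide_le_eq_1)
      then have "x \<le> l" unfolding x_def using l0 by (intro mult_left_le) auto
      then have xb: "x \<le> b" using l unfolding b_def by linarith
      \<comment> \<open>Makes the arm long enough for the resulting chain to leave the ball of
        radius \<open>r\<close>.\<close>
      obtain k :: nat where k: "(r / (h / m) + a) / \<rho> < real k" using reals_Archimedean2 by blast
      define n where "n = k + 3"
      have "(r / (h / m) + a) / \<rho> < real n" using k unfolding n_def by simp
      then have "r / (h / m) < real n * \<rho> - a" using \<rho>(1) by (simp add: pos_divide_less_eq algebra_simps)
      then have rn: "r < h / m * (n * \<rho> - a)" using h0 m0 by (subst (asm) pos_divide_less_eq) (simp_all add: mult.commute)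
      have hm: "h / m = 1 / (\<rho> + a)" unfolding \<rho>_def by simp
      have lx: "l * (h / m) ^ CARD('n) = x / \<rho> ^ CARD('n)" unfolding hm x_def using \<rho>(1) by (simp add: power_divide)
      have "f \<rho> \<le> p * slope TYPE('n) b * (x - \<beta>)"
        unfolding f_def x_def[symmetric] using \<beta>l p0 sl by (intro mult_left_mono) auto
      also have "\<dots> \<le> p * arm TYPE('n) d \<rho> n (x / \<rho> ^ CARD('n))"
      proof (cases "\<beta> < x")
        case True
        then show ?thesis using \<beta> xb p0 unfolding threshold_def by (simp add: mult.assoc mult_left_mono)
      next
        case False
        have "0 \<le> x / \<rho> ^ CARD('n)" using \<rho> a0 l0 unfolding x_def by (simp add: add_pos_nonneg)
        then have "0 \<le> p * arm TYPE('n) d \<rho> n (x / \<rho> ^ CARD('n))"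
          using p0 by (intro mult_nonneg_nonneg arm_bounds[OF d(1) \<rho>(1)]) auto
        moreover have "p * slope TYPE('n) b * (x - \<beta>) \<le> 0" using False p0 sl by (intro mult_nonneg_nonpos) auto
        ultimately show ?thesis by linarith
      qed
      also have "\<dots> \<le> q * arm TYPE('n) d \<rho> n (l * (h / m) ^ CARD('n))"
        unfolding lx using pq \<rho> a0 l0
        by (intro mult_right_mono arm_bounds[OF d(1) \<rho>(1)]) (simp_all add: x_def add_pos_nonneg)
      also have "\<dots> \<le> theta (M l) (X l) d r"
        unfolding q_def U_def
        by (rule reach_prob_lower[OF PPP[OF l0] l0 d(1) h m0 \<rho>_def[unfolded a_def]]) (use \<rho> rn in \<open>auto simp: n_def a_def\<close>)
      finally show ?thesis unfolding \<rho>_def .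
    qed
    moreover obtain m0 :: nat where "h * (max (a + 1) b + a + 1) \<le> real m0" using real_arch_simple by blast
    ultimately have "\<forall>m\<ge>m0. f (real m / h - a) \<le> theta (M l) (X l) d r" by (meson of_nat_mono order_trans)
    then show ?thesis by (intro LIMSEQ_le_const2[OF lim]) auto
  qed
  have "p * slope TYPE('n) b * (l - lf) \<le> theta (M l) (X l) d r"
  proof (rule ccontr)
    assume n: "\<not> ?thesis"
    define c where "c = p * slope TYPE('n) b"
    have c0: "0 < c" using tp sl unfolding c_def p_def by simp
    have "lf < l - theta (M l) (X l) d r / c" using n c0 unfolding c_def[symmetric] by (simp add: field_simps)
    then obtain l' where l': "l' \<in> perc" "l' < l - theta (M l) (X l) d r / c"
      using cInf_lessD[OF perc_nonempty] unfolding lf_eq by blast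
    have "0 < theta (M l) (X l) d r / c" using theta_pos[OF PPP[OF l0] l0] c0 by simp
    then have "c * (l - l') \<le> theta (M l) (X l) d r" using main[OF l'(1)] l'(2) unfolding c_def by simp
    then show False using l'(2) c0 by (simp add: field_simps)
  qed
  then show ?thesis unfolding p_def U_def b_def .
qed

lemma supercritical_linear:
  "0 < Liminf (at_right lf) (\<lambda>l. ereal (theta_inf M X d l / (l - lf)))"
proof -
  define h where "h = 1 / (4 * (real d + 1) * sqrt CARD('n))"
  have h: "fine_mesh TYPE('n) d h" unfolding fine_mesh_def h_def by simp
  note h0 = fine_mesh_bounds(1)[OF h]
  define c where "c = tpw (d + 1) (lf * h ^ CARD('n)) (d + 1) ^ card {u \<in> lat. h * norm (u :: real^'n) \<le> 3 + h * sqrt CARD('n)}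
    * slope TYPE('n) (lf + 1)"
  have c: "0 < c"
    unfolding c_def using lf_pos h0 by (intro mult_pos_pos zero_less_power tpw_top_pos slope_pos) auto
  have "c \<le> theta_inf M X d l / (l - lf)" if l: "lf < l" "l < lf + 1" for l
  proof -
    have l0: "0 < l" using l lf_pos by linarith
    have "c * (l - lf) \<le> theta_inf M X d l"
      unfolding theta_inf_def
    proof (rule antimono_Lim_ge)
      show "theta (M l) (X l) d r' \<le> theta (M l) (X l) d r" if "r \<le> r'" for r r' by (rule theta_antimono[OF PPP[OF l0] that])
      show "c * (l - lf) \<le> theta (M l) (X l) d r" for r unfolding c_def using theta_lower[OF h, of l r] l by simp
    qed
    then show ?thesis using l by (simp add: pos_le_divide_eq)
  qed
  then have "eventually (\<lambda>l. ereal c \<le> ereal (theta_inf M X d l / (l - lf))) (at_right lf)"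
    unfolding eventually_at_right_field by (intro exI[of _ "lf + 1"]) auto
  then have "ereal c \<le> Liminf (at_right lf) (\<lambda>l. ereal (theta_inf M X d l / (l - lf)))" by (rule Liminf_bounded)
  then show ?thesis using c by (metis ereal_less(2) order_less_le_trans)
qed

end

theorem theorem1:
  fixes M :: "real \<Rightarrow> 'a measure" and X :: "real \<Rightarrow> 'a \<Rightarrow> (real^'n) set" and d :: nat
  assumes "CARD('n) \<ge> 2" and "1 \<le> d" and "d \<le> CARD('n)"
    and "\<forall>l>0. is_PPP (M l) (X l) l"
  shows "(\<forall>l. 0 < l \<and> l < lambda_face M X d \<longrightarrow>
            Limsup at_top (\<lambda>r::real. ereal (ln (theta (M l) (X l) d r) / r)) < 0)
       \<and> Liminf (at_right (lambda_face M X d))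
            (\<lambda>l. ereal (theta_inf M X d l / (l - lambda_face M X d))) > 0"
proof -
  interpret percolation M X d by unfold_locales (use assms in auto)
  show ?thesis using subcritical_decay supercritical_linear by blast
qed

end
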